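(* Let $\mathcal{M}$ be a semi-finite von Neumann algebra with a distinguished faithful, normal, semi-finite trace $\tau$. Let $E$ be an order-continuous symmetric quasi-Banach function space on $\mathbb{R}^+$ that is $\alpha$-convex with constant $1$ for some $0<\alpha\le 1$, and suppose that $E$ satisfies a lower $q$-estimate with constant $1$ for some $q\ge\alpha$. Let $\{x_n\}_{n=1}^\infty$ be a bounded sequence in $E(\mathcal{M},\tau)$. Then there exist a subsequence $\{x_{n_k}\}_{k=1}^\infty$ of $\{x_n\}_{n=1}^\infty$, bounded sequences $\{\varphi_k\}_{k=1}^\infty$ and $\{\zeta_k\}_{k=1}^\infty$ in $E(\mathcal{M},\tau)$, and a mutually disjoint sequence of projections $\{e_k\}_{k=1}^\infty$ in $\mathcal{M}$ such that: (i) $x_{n_k}=\varphi_k+\zeta_k$ for all $k\ge1$; (ii) $\{\varphi_k:k\ge1\}$ is $E$-equi-integrable and $e_k\varphi_ke_k=0$ for all $k\ge1$; (iii) $e_k\zeta_ke_k=\zeta_k$ for all $k\ge1$.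
   Context: $\mathcal{M}$ acts on a Hilbert space $H$. A closed densely defined operator $x$ affiliated with $\mathcal{M}$ is $\tau$-measurable if for every $\epsilon>0$ there is a projection $p\in\mathcal{M}$ with $p(H)\subseteq \operatorname{dom}(x)$, $\tau(\mathbf{1}-p)<\epsilon$ and $xp\in\mathcal{M}$; $\widetilde{\mathcal{M}}$ is the $*$-algebra of all $\tau$-measurable operators (strong sum, strong product, adjoint). For $x\in\widetilde{\mathcal{M}}$ and $t\ge0$, $\mu_t(x)=\inf\{s\ge 0:\tau(e^{|x|}(s,\infty))\le t\}$, where $e^{|x|}$ is the spectral measure of $|x|$; $\mu(x)$ denotes the function $t\mapsto\mu_t(x)$. $\mathbb{R}^+=[0,\infty)$ carries Lebesgue measure $m$ and $L^0(\mathbb{R}^+,m)$ is the space of (classes of) measurable functions. A symmetric quasi-Banach function space $E$ on $\mathbb{R}^+$ is a quasi-Banach lattice of measurable functions that is an order ideal in $L^0(\mathbb{R}^+,m)$, is rearrangement invariant (if $f\in E$ and $g\in L^0(\mathbb{R}^+,m)$ have the same decreasing rearrangement of absolute values, then $g\in E$ and $\|g\|_E=\|f\|_E$), and contains all finitely supported simple functions. $E$ is order-continuous if $\|f_\beta\|_E\to0$ whenever $f_\beta\downarrow 0$ is a downward directed net in $E$. $E$ is $\alpha$-convex with constant $1$ if $\|(\sum_i|f_i|^\alpha)^{1/\alpha}\|_E\le(\sum_i\|f_i\|_E^\alpha)^{1/\alpha}$ for all finite families in $E$. $E$ satisfies a lower $q$-estimate with constant $1$ if $(\sum\|f_n\|_E^q)^{1/q}\le\|\sum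 f_n\|_E$ for all finite sequences of mutually disjoint elements of $E$. $E(\mathcal{M},\tau)=\{x\in\widetilde{\mathcal{M}}:\mu(x)\in E\}$ with $\|x\|_{E(\mathcal{M},\tau)}=\|\mu(x)\|_E$. Projections are self-adjoint; mutually disjoint projections are pairwise orthogonal ones ($e_ke_l=0$ for $k\neq l$); $e_n\downarrow_n 0$ means that the sequence is decreasing with infimum $0$. A bounded subset $K$ of $E(\mathcal{M},\tau)$ is $E$-equi-integrable if $\lim_{n\to\infty}\sup_{x\in K}\|e_nxe_n\|_{E(\mathcal{M},\tau)}=0$ for every decreasing sequence $\{e_n\}_{n=1}^\infty$ of projections in $\mathcal{M}$ with $e_n\downarrow_n0$. *)

theory Defs
  imports "HOL-Analysis.Analysis"
begin

section \<open>Complex Hilbert spaces and bounded operators\<close>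

text \<open>The inner product is linear in the first and conjugate-linear in the second argument.\<close>

class complex_hilbert_space = banach +
  fixes scaleC :: "complex \<Rightarrow> 'a \<Rightarrow> 'a" (infixr "*\<^sub>C" 75)
    and cinner :: "'a \<Rightarrow> 'a \<Rightarrow> complex"
  assumes scaleC_add_right: "c *\<^sub>C (x + y) = c *\<^sub>C x + c *\<^sub>C y"
    and scaleC_add_left: "(c + d) *\<^sub>C x = c *\<^sub>C x + d *\<^sub>C x"
    and scaleC_scaleC: "c *\<^sub>C d *\<^sub>C x = (c * d) *\<^sub>C x"
    and scaleC_of_real: "complex_of_real r *\<^sub>C x = r *\<^sub>R x"
    and cinner_commute: "cinner x y = cnj (cinner y x)"
    and cinner_add_left: "cinner (x + y) z = cinner x z + cinner y z"
    and cinner_scaleC_left: "cinner (c *\<^sub>C x) y = c * cinner x y"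
    and cinner_self: "cinner x x = complex_of_real ((norm x)\<^sup>2)"

instantiation complex :: complex_hilbert_space
begin

definition "c *\<^sub>C x = c * (x :: complex)"
definition "cinner x y = x * cnj (y :: complex)"

instance
proof
  fix x :: complex
  show "cinner x x = complex_of_real ((norm x)\<^sup>2)"
    using complex_norm_square[of x] by (simp add: cinner_complex_def)
qed (simp_all add: scaleC_complex_def cinner_complex_def algebra_simps scaleR_conv_of_real)

end

definition bounded_clinear :: "('h::complex_hilbert_space \<Rightarrow> 'h) \<Rightarrow> bool" where
  "bounded_clinear T \<longleftrightarrow> bounded_linear T \<and> (\<forall>c x. T (c *\<^sub>C x) = c *\<^sub>C T x)"

definition badjoint :: "('h::complex_hilbert_space \<Rightarrow> 'h) \<Rightarrow> 'h \<Rightarrow> 'h" where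
  "badjoint T = (THE S. \<forall>x y. cinner (T x) y = cinner x (S y))"

text \<open>Over the complex numbers this already forces \<open>T\<close> to be self-adjoint.\<close>

definition positive_op :: "('h::complex_hilbert_space \<Rightarrow> 'h) \<Rightarrow> bool" where
  "positive_op T \<longleftrightarrow> (\<forall>x. cinner (T x) x \<in> \<real>\<^sub>\<ge>\<^sub>0)"

definition op_le :: "('h::complex_hilbert_space \<Rightarrow> 'h) \<Rightarrow> ('h \<Rightarrow> 'h) \<Rightarrow> bool" where
  "op_le S T \<longleftrightarrow> positive_op (\<lambda>x. T x - S x)"

definition projection_op :: "('h::complex_hilbert_space \<Rightarrow> 'h) \<Rightarrow> bool" where
  "projection_op p \<longleftrightarrow> bounded_clinear p \<and> p \<circ> p = p \<and> badjoint p = p"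

definition unitary_op :: "('h::complex_hilbert_space \<Rightarrow> 'h) \<Rightarrow> bool" where
  "unitary_op u \<longleftrightarrow> bounded_clinear u \<and> badjoint u \<circ> u = id \<and> u \<circ> badjoint u = id"

section \<open>Von Neumann algebras and traces\<close>

definition commutant :: "('h::complex_hilbert_space \<Rightarrow> 'h) set \<Rightarrow> ('h \<Rightarrow> 'h) set" where
  "commutant \<S> = {T. bounded_clinear T \<and> (\<forall>S\<in>\<S>. T \<circ> S = S \<circ> T)}"

text \<open>The bicommutant condition makes \<open>\<M>\<close> a unital subalgebra of the bounded operators.\<close>

definition von_neumann_algebra :: "('h::complex_hilbert_space \<Rightarrow> 'h) set \<Rightarrow> bool" where
  "von_neumann_algebra \<M> \<longleftrightarrow>
     (\<forall>T\<in>\<M>. bounded_clinear T \<and> badjoint T \<in> \<M>) \<and> commutant (commutant \<M>) = \<M>"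

definition positive_cone :: "('h::complex_hilbert_space \<Rightarrow> 'h) set \<Rightarrow> ('h \<Rightarrow> 'h) set" where
  "positive_cone \<M> = {T\<in>\<M>. positive_op T}"

text \<open>A trace is a function on the positive cone; the values of \<open>\<tau>\<close> elsewhere play no role.
  Increasing nets are rendered as upward directed sets.\<close>

definition trace_on :: "('h::complex_hilbert_space \<Rightarrow> 'h) set \<Rightarrow> (('h \<Rightarrow> 'h) \<Rightarrow> ennreal) \<Rightarrow> bool" where
  "trace_on \<M> \<tau> \<longleftrightarrow>
     (\<forall>S\<in>positive_cone \<M>. \<forall>T\<in>positive_cone \<M>. \<tau> (\<lambda>x. S x + T x) = \<tau> S + \<tau> T) \<and>
     (\<forall>T\<in>positive_cone \<M>. \<forall>r\<ge>0. \<tau> (\<lambda>x. r *\<^sub>R T x) = ennreal r * \<tau> T) \<and>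
     (\<forall>T\<in>\<M>. \<tau> (badjoint T \<circ> T) = \<tau> (T \<circ> badjoint T))"

definition faithful_trace ::
    "('h::complex_hilbert_space \<Rightarrow> 'h) set \<Rightarrow> (('h \<Rightarrow> 'h) \<Rightarrow> ennreal) \<Rightarrow> bool" where
  "faithful_trace \<M> \<tau> \<longleftrightarrow> (\<forall>T\<in>positive_cone \<M>. \<tau> T = 0 \<longrightarrow> T = (\<lambda>x. 0))"

definition normal_trace ::
    "('h::complex_hilbert_space \<Rightarrow> 'h) set \<Rightarrow> (('h \<Rightarrow> 'h) \<Rightarrow> ennreal) \<Rightarrow> bool" where
  "normal_trace \<M> \<tau> \<longleftrightarrow>
     (\<forall>D T. D \<subseteq> positive_cone \<M> \<and> D \<noteq> {} \<and>
        (\<forall>R\<in>D. \<forall>S\<in>D. \<exists>U\<in>D. op_le R U \<and> op_le S U) \<and>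
        T \<in> positive_cone \<M> \<and> (\<forall>S\<in>D. op_le S T) \<and>
        (\<forall>U\<in>positive_cone \<M>. (\<forall>S\<in>D. op_le S U) \<longrightarrow> op_le T U)
        \<longrightarrow> \<tau> T = (SUP S\<in>D. \<tau> S))"

definition semifinite_trace ::
    "('h::complex_hilbert_space \<Rightarrow> 'h) set \<Rightarrow> (('h \<Rightarrow> 'h) \<Rightarrow> ennreal) \<Rightarrow> bool" where
  "semifinite_trace \<M> \<tau> \<longleftrightarrow>
     (\<forall>T\<in>positive_cone \<M>. T \<noteq> (\<lambda>x. 0) \<longrightarrow>
        (\<exists>S\<in>positive_cone \<M>. S \<noteq> (\<lambda>x. 0) \<and> op_le S T \<and> \<tau> S < \<infinity>))"

section \<open>Unbounded operators and spectral measures\<close>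

text \<open>Possibly unbounded operators are represented by their graphs, so that operators with
  the same domain and action are equal. The plain product \<open>A B\<close> is \<open>B O A\<close>.\<close>

type_synonym 'h operator = "('h \<times> 'h) set"

definition graph :: "('h \<Rightarrow> 'h) \<Rightarrow> 'h operator" where
  "graph T = {(x, T x) | x. True}"

definition linear_operator :: "'h::complex_hilbert_space operator \<Rightarrow> bool" where
  "linear_operator A \<longleftrightarrow> single_valued A \<and> (0, 0) \<in> A \<and>
     (\<forall>x y x' y'. (x, y) \<in> A \<and> (x', y') \<in> A \<longrightarrow> (x + x', y + y') \<in> A) \<and>
     (\<forall>c x y. (x, y) \<in> A \<longrightarrow> (c *\<^sub>C x, c *\<^sub>C y) \<in> A)"

definition closed_densely_defined :: "'h::complex_hilbert_space operator \<Rightarrow> bool" where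
  "closed_densely_defined A \<longleftrightarrow> linear_operator A \<and> closed A \<and> closure (Domain A) = UNIV"

definition op_adjoint :: "'h::complex_hilbert_space operator \<Rightarrow> 'h operator" where
  "op_adjoint A = {(u, v). \<forall>(x, y)\<in>A. cinner y u = cinner x v}"

definition positive_selfadjoint :: "'h::complex_hilbert_space operator \<Rightarrow> bool" where
  "positive_selfadjoint A \<longleftrightarrow> closed_densely_defined A \<and> op_adjoint A = A \<and>
     (\<forall>(x, y)\<in>A. cinner y x \<in> \<real>\<^sub>\<ge>\<^sub>0)"

definition op_abs :: "'h::complex_hilbert_space operator \<Rightarrow> 'h operator" where
  "op_abs A = (THE B. positive_selfadjoint B \<and> B O B = A O op_adjoint A)"

definition projection_valued_measure ::
    "(real set \<Rightarrow> 'h::complex_hilbert_space \<Rightarrow> 'h) \<Rightarrow> bool" where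
  "projection_valued_measure P \<longleftrightarrow>
     (\<forall>B\<in>sets borel. projection_op (P B)) \<and> P UNIV = id \<and>
     (\<forall>B\<in>sets borel. \<forall>C\<in>sets borel. P (B \<inter> C) = P B \<circ> P C) \<and>
     (\<forall>F :: nat \<Rightarrow> real set. range F \<subseteq> sets borel \<and> disjoint_family F \<longrightarrow>
        (\<forall>h. (\<lambda>n. P (F n) h) sums P (\<Union>n. F n) h))"

definition scalar_measure ::
    "(real set \<Rightarrow> 'h::complex_hilbert_space \<Rightarrow> 'h) \<Rightarrow> 'h \<Rightarrow> real measure" where
  "scalar_measure P h = measure_of UNIV (sets borel) (\<lambda>B. ennreal (Re (cinner (P B h) h)))"

text \<open>\<open>A = \<integral>\<lambda> dP(\<lambda>)\<close> for a self-adjoint \<open>A\<close>: equality of domains and of quadratic forms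
  (the latter determines \<open>A\<close> on its domain by polarization).\<close>

definition spectral_resolution ::
    "'h::complex_hilbert_space operator \<Rightarrow> (real set \<Rightarrow> 'h \<Rightarrow> 'h) \<Rightarrow> bool" where
  "spectral_resolution A P \<longleftrightarrow> projection_valued_measure P \<and>
     Domain A = {h. (\<integral>\<^sup>+ l. ennreal (l\<^sup>2) \<partial>scalar_measure P h) < \<infinity>} \<and>
     (\<forall>(h, k)\<in>A. cinner k h = complex_of_real (\<integral>l. l \<partial>scalar_measure P h))"

text \<open>By the spectral theorem the choice exists and is unique on Borel sets.\<close>

definition spectral_measure ::
    "'h::complex_hilbert_space operator \<Rightarrow> real set \<Rightarrow> 'h \<Rightarrow> 'h" where
  "spectral_measure A = (SOME P. spectral_resolution A P)"

section \<open>Measurable operators\<close>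

definition affiliated :: "('h::complex_hilbert_space \<Rightarrow> 'h) set \<Rightarrow> 'h operator \<Rightarrow> bool" where
  "affiliated \<M> x \<longleftrightarrow> (\<forall>u\<in>commutant \<M>. unitary_op u \<longrightarrow> x O graph u = graph u O x)"

definition measurable_operators ::
    "('h::complex_hilbert_space \<Rightarrow> 'h) set \<Rightarrow> (('h \<Rightarrow> 'h) \<Rightarrow> ennreal) \<Rightarrow> 'h operator set" where
  "measurable_operators \<M> \<tau> =
     {x. closed_densely_defined x \<and> affiliated \<M> x \<and>
        (\<forall>\<epsilon>>0. \<exists>p\<in>\<M>. projection_op p \<and> range p \<subseteq> Domain x \<and>
           \<tau> (\<lambda>h. h - p h) < ennreal \<epsilon> \<and> (\<exists>T\<in>\<M>. graph p O x = graph T))}"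

definition strong_sum :: "'h::complex_hilbert_space operator \<Rightarrow> 'h operator \<Rightarrow> 'h operator" where
  "strong_sum x y = closure {(h, a + b) | h a b. (h, a) \<in> x \<and> (h, b) \<in> y}"

definition strong_prod :: "'h::complex_hilbert_space operator \<Rightarrow> 'h operator \<Rightarrow> 'h operator" where
  "strong_prod x y = closure (y O x)"

definition compress :: "('h::complex_hilbert_space \<Rightarrow> 'h) \<Rightarrow> 'h operator \<Rightarrow> 'h operator" where
  "compress e x = strong_prod (strong_prod (graph e) x) (graph e)"

text \<open>The value at \<open>t = 0\<close> is infinite when \<open>x\<close> is unbounded, hence the type \<^typ>\<open>ennreal\<close>.\<close>

definition singular_value ::
    "(('h::complex_hilbert_space \<Rightarrow> 'h) \<Rightarrow> ennreal) \<Rightarrow> 'h operator \<Rightarrow> real \<Rightarrow> ennreal" where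
  "singular_value \<tau> x t =
     Inf {ennreal s | s. 0 \<le> s \<and> \<tau> (spectral_measure (op_abs x) {s<..}) \<le> ennreal t}"

section \<open>Symmetric function spaces on the half-line\<close>

abbreviation half_line :: "real measure" where
  "half_line \<equiv> lebesgue_on {0..}"

text \<open>Infinite values occur for functions such as the identity, whose rearrangement is
  constantly infinite.\<close>

definition decreasing_rearrangement :: "(real \<Rightarrow> real) \<Rightarrow> real \<Rightarrow> ennreal" where
  "decreasing_rearrangement f t =
     Inf {ennreal s | s. 0 \<le> s \<and> emeasure half_line {u\<in>{0..}. s < \<bar>f u\<bar>} \<le> ennreal t}"

text \<open>Classes modulo null sets are rendered by a set \<open>E\<close> of functions and a quasi-norm \<open>N\<close>,
  both invariant under almost everywhere equality by the axiom \<open>ideal\<close>; the values of the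
  functions on the negative half-line and those of \<open>N\<close> outside \<open>E\<close> play no role.\<close>

locale symmetric_quasi_banach_function_space =
  fixes E :: "(real \<Rightarrow> real) set" and N :: "(real \<Rightarrow> real) \<Rightarrow> real"
  assumes measurable: "f \<in> E \<Longrightarrow> f \<in> borel_measurable half_line"
    and zero: "(\<lambda>t. 0) \<in> E"
    and add: "f \<in> E \<Longrightarrow> g \<in> E \<Longrightarrow> (\<lambda>t. f t + g t) \<in> E"
    and scale: "f \<in> E \<Longrightarrow> (\<lambda>t. c * f t) \<in> E"
    and norm_nonneg: "f \<in> E \<Longrightarrow> 0 \<le> N f"
    and norm_eq_0: "f \<in> E \<Longrightarrow> N f = 0 \<longleftrightarrow> (AE t in half_line. f t = 0)"
    and norm_scale: "f \<in> E \<Longrightarrow> N (\<lambda>t. c * f t) = \<bar>c\<bar> * N f"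
    and quasi_triangle: "\<exists>C. \<forall>f\<in>E. \<forall>g\<in>E. N (\<lambda>t. f t + g t) \<le> C * (N f + N g)"
    and ideal: "f \<in> E \<Longrightarrow> g \<in> borel_measurable half_line \<Longrightarrow>
        (AE t in half_line. \<bar>g t\<bar> \<le> \<bar>f t\<bar>) \<Longrightarrow> g \<in> E \<and> N g \<le> N f"
    and complete: "(\<And>n::nat. F n \<in> E) \<Longrightarrow>
        (\<forall>\<epsilon>>0. \<exists>n0. \<forall>m\<ge>n0. \<forall>n\<ge>n0. N (\<lambda>t. F m t - F n t) < \<epsilon>) \<Longrightarrow>
        \<exists>f\<in>E. (\<lambda>n. N (\<lambda>t. F n t - f t)) \<longlonglongrightarrow> 0"
    and symmetric: "f \<in> E \<Longrightarrow> g \<in> borel_measurable half_line \<Longrightarrow>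
        (\<forall>t\<ge>0. decreasing_rearrangement g t = decreasing_rearrangement f t) \<Longrightarrow>
        g \<in> E \<and> N g = N f"
    and simple: "simple_function half_line f \<Longrightarrow>
        emeasure half_line {t\<in>{0..}. f t \<noteq> 0} < \<infinity> \<Longrightarrow> f \<in> E"

text \<open>Decreasing nets are rendered as downward directed sets.\<close>

definition order_continuous :: "(real \<Rightarrow> real) set \<Rightarrow> ((real \<Rightarrow> real) \<Rightarrow> real) \<Rightarrow> bool" where
  "order_continuous E N \<longleftrightarrow>
     (\<forall>D. D \<subseteq> E \<and> D \<noteq> {} \<and>
        (\<forall>f\<in>D. \<forall>g\<in>D. \<exists>h\<in>D. (AE t in half_line. h t \<le> f t) \<and> (AE t in half_line. h t \<le> g t)) \<and>
        (\<forall>f\<in>D. AE t in half_line. 0 \<le> f t) \<and>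
        (\<forall>g\<in>E. (\<forall>f\<in>D. AE t in half_line. g t \<le> f t) \<longrightarrow> (AE t in half_line. g t \<le> 0))
        \<longrightarrow> (\<forall>\<epsilon>>0. \<exists>f\<in>D. \<forall>g\<in>D. (AE t in half_line. g t \<le> f t) \<longrightarrow> N g < \<epsilon>))"

definition convex_const_1 ::
    "real \<Rightarrow> (real \<Rightarrow> real) set \<Rightarrow> ((real \<Rightarrow> real) \<Rightarrow> real) \<Rightarrow> bool" where
  "convex_const_1 \<alpha> E N \<longleftrightarrow>
     (\<forall>(n::nat) f. (\<forall>i<n. f i \<in> E) \<longrightarrow>
        N (\<lambda>t. (\<Sum>i<n. \<bar>f i t\<bar> powr \<alpha>) powr (1 / \<alpha>)) \<le> (\<Sum>i<n. N (f i) powr \<alpha>) powr (1 / \<alpha>))"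

definition lower_estimate_const_1 ::
    "real \<Rightarrow> (real \<Rightarrow> real) set \<Rightarrow> ((real \<Rightarrow> real) \<Rightarrow> real) \<Rightarrow> bool" where
  "lower_estimate_const_1 q E N \<longleftrightarrow>
     (\<forall>(n::nat) f. (\<forall>i<n. f i \<in> E) \<and>
        (\<forall>i<n. \<forall>j<n. i \<noteq> j \<longrightarrow> (AE t in half_line. f i t = 0 \<or> f j t = 0)) \<longrightarrow>
        (\<Sum>i<n. N (f i) powr q) powr (1 / q) \<le> N (\<lambda>t. \<Sum>i<n. f i t))"

section \<open>Noncommutative symmetric spaces\<close>

text \<open>For a measurable operator, \<open>enn2real\<close> alters the singular value function at most
  at the single point \<open>t = 0\<close>.\<close>

definition nc_space ::
    "('h::complex_hilbert_space \<Rightarrow> 'h) set \<Rightarrow> (('h \<Rightarrow> 'h) \<Rightarrow> ennreal) \<Rightarrow> (real \<Rightarrow> real) set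
      \<Rightarrow> 'h operator set" where
  "nc_space \<M> \<tau> E = {x \<in> measurable_operators \<M> \<tau>. (\<lambda>t. enn2real (singular_value \<tau> x t)) \<in> E}"

definition nc_norm ::
    "(('h::complex_hilbert_space \<Rightarrow> 'h) \<Rightarrow> ennreal) \<Rightarrow> ((real \<Rightarrow> real) \<Rightarrow> real)
      \<Rightarrow> 'h operator \<Rightarrow> real" where
  "nc_norm \<tau> N x = N (\<lambda>t. enn2real (singular_value \<tau> x t))"

definition nc_bounded ::
    "('h::complex_hilbert_space \<Rightarrow> 'h) set \<Rightarrow> (('h \<Rightarrow> 'h) \<Rightarrow> ennreal) \<Rightarrow> (real \<Rightarrow> real) set
      \<Rightarrow> ((real \<Rightarrow> real) \<Rightarrow> real) \<Rightarrow> 'h operator set \<Rightarrow> bool" where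
  "nc_bounded \<M> \<tau> E N K \<longleftrightarrow> K \<subseteq> nc_space \<M> \<tau> E \<and> (\<exists>C. \<forall>x\<in>K. nc_norm \<tau> N x \<le> C)"

definition decreasing_to_zero ::
    "('h::complex_hilbert_space \<Rightarrow> 'h) set \<Rightarrow> (nat \<Rightarrow> 'h \<Rightarrow> 'h) \<Rightarrow> bool" where
  "decreasing_to_zero \<M> e \<longleftrightarrow>
     (\<forall>n. e n \<in> \<M> \<and> projection_op (e n)) \<and> (\<forall>n. op_le (e (Suc n)) (e n)) \<and>
     (\<forall>p\<in>\<M>. projection_op p \<and> (\<forall>n. op_le p (e n)) \<longrightarrow> p = (\<lambda>h. 0))"

definition equi_integrable ::
    "('h::complex_hilbert_space \<Rightarrow> 'h) set \<Rightarrow> (('h \<Rightarrow> 'h) \<Rightarrow> ennreal) \<Rightarrow> (real \<Rightarrow> real) set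
      \<Rightarrow> ((real \<Rightarrow> real) \<Rightarrow> real) \<Rightarrow> 'h operator set \<Rightarrow> bool" where
  "equi_integrable \<M> \<tau> E N K \<longleftrightarrow> nc_bounded \<M> \<tau> E N K \<and>
     (\<forall>e. decreasing_to_zero \<M> e \<longrightarrow>
        (\<lambda>n. SUP x\<in>K. ennreal (nc_norm \<tau> N (compress (e n) x))) \<longlonglongrightarrow> 0)"

end

theory Submission
  imports Defs "HOL-Library.Diagonal_Subsequence"
begin

text \<open>A closed operator \<open>X\<close> is handled through the orthogonal projection onto its graph, which yields
  bounded \<open>S\<close>, \<open>C\<close>, \<open>V\<close> with \<open>X = {(S g, V g)}\<close> and \<open>|X| = {(S g, C g)}\<close>, and hence the spectral projections
  of \<open>|X|\<close>. Singular values are estimated by projections of small cotrace on which an operator is bounded,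
  and smallness in the quasi-norm by a function in \<open>E\<close> dominating such bounds.

  A diagonal argument gives a subsequence and cut-off levels such that neither the mass of the singular value
  functions between a fixed level and the moving one, nor the squared trace norms of the middle spectral parts
  on \<open>c' - c\<close>, for projections \<open>c \<le> c'\<close> of finite trace, can stay away from \<open>0\<close>: the lower estimate turns a
  loss of mass into a decrease of a bounded quantity. Off the corners \<open>e\<^sub>k x e\<^sub>k\<close>, where \<open>e\<^sub>k\<close> lies between
  consecutive projections of this kind, the operators are then equi-integrable, and each corner is removed
  as \<open>\<zeta>\<^sub>k\<close>.\<close>


section \<open>Hilbert space\<close>

text \<open>A direct lower estimate for operators is out of reach: \<open>x c\<close> and
  \<open>x (1 - c)\<close> do not have disjoint singular value functions. The scalar estimate is
  therefore applied only to pieces of one singular value function, and on the bounded middle parts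
  the squared trace norm takes its place, being additive along orthogonal projections; Chebyshev's
  inequality leads back to singular values. Equi-integrability concerns two-sided compressions of
  operators that need not be self-adjoint, so left and right supports are controlled separately. The
  corners must be exactly orthogonal and exactly removed, which plain differences of projections do
  not give; these are first shrunk by projections of small trace, and the trace of what is discarded
  is chosen with the head of the singular value function in view. The analysis takes place on
  operators truncated at a level where that head has norm at most \<open>1 / (n + 1)\<close>; the
  unbounded heads return only as an error term. Since singular values of a sum are evaluated at half
  the argument and \<open>N\<close> is a quasi-norm, every addition costs the factor
  \<open>2 * qc * qc\<close>.\<close>

lemma cinner_zero_left [simp]: "cinner 0 y = 0"
  using cinner_add_left[of 0 0 y] by simp

lemma cinner_add_right: "cinner x (y + z) = cinner x y + cinner x z"
  by (metis cinner_add_left cinner_commute complex_cnj_add)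

lemma cinner_zero_right [simp]: "cinner x 0 = 0"
  using cinner_add_right[of x 0 0] by simp

lemma cinner_scaleC_right: "cinner x (c *\<^sub>C y) = cnj c * cinner x y"
  by (metis cinner_scaleC_left cinner_commute complex_cnj_mult)

lemma cinner_scaleR_left: "cinner (r *\<^sub>R x) y = of_real r * cinner x y"
  by (metis scaleC_of_real cinner_scaleC_left)

lemma cinner_scaleR_right: "cinner x (r *\<^sub>R y) = of_real r * cinner x y"
  by (metis scaleC_of_real cinner_scaleC_right complex_cnj_complex_of_real)

lemma cinner_minus_left: "cinner (- x) y = - cinner x y"
  using cinner_scaleR_left[of "-1" x y] by simp

lemma cinner_minus_right: "cinner x (- y) = - cinner x y"
  using cinner_scaleR_right[of x "-1" y] by simp

lemma cinner_diff_left: "cinner (x - y) z = cinner x z - cinner y z"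
  using cinner_add_left[of x "-y" z] by (simp add: cinner_minus_left)

lemma cinner_diff_right: "cinner x (y - z) = cinner x y - cinner x z"
  using cinner_add_right[of x y "-z"] by (simp add: cinner_minus_right)

lemmas cinner_simps = cinner_add_left cinner_add_right cinner_diff_left cinner_diff_right
  cinner_minus_left cinner_minus_right cinner_scaleC_left cinner_scaleC_right
  cinner_scaleR_left cinner_scaleR_right

lemma scaleC_zero_right [simp]: "c *\<^sub>C (0::'a::complex_hilbert_space) = 0"
  using scaleC_add_right[of c 0 "0::'a"] by simp

lemma scaleC_zero_left [simp]: "0 *\<^sub>C (x::'a::complex_hilbert_space) = 0"
  using scaleC_of_real[of 0 x] by simp

lemma scaleC_one [simp]: "1 *\<^sub>C (x::'a::complex_hilbert_space) = x"
  using scaleC_of_real[of 1 x] by simp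

lemma scaleC_minus_one: "(-1) *\<^sub>C (x::'a::complex_hilbert_space) = - x"
  using scaleC_of_real[of "-1" x] by simp

lemma scaleC_minus_right: "c *\<^sub>C (- x::'a::complex_hilbert_space) = - (c *\<^sub>C x)"
  using scaleC_add_right[of c x "- x"] by (simp add: eq_neg_iff_add_eq_0 add.commute)

lemma scaleC_diff_right: "c *\<^sub>C (x - y::'a::complex_hilbert_space) = c *\<^sub>C x - c *\<^sub>C y"
  using scaleC_add_right[of c x "- y"] by (simp add: scaleC_minus_right)

lemma cinner_self_Re: "Re (cinner x x) = (norm x)\<^sup>2"
  by (simp add: cinner_self)

lemma norm_eq_sqrt_cinner: "(norm x)\<^sup>2 = Re (cinner x x)"
  by (simp add: cinner_self)

lemma Re_cinner_commute: "Re (cinner x y) = Re (cinner y x)"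
  using arg_cong[OF cinner_commute[of x y], of Re] by simp

lemma cinner_eq_0_commute: "cinner x y = 0 \<longleftrightarrow> cinner y x = 0"
  by (metis cinner_commute complex_cnj_zero_iff)

lemma norm_add_sq: "(norm (x + y))\<^sup>2 = (norm x)\<^sup>2 + (norm y)\<^sup>2 + 2 * Re (cinner x y)"
  for x :: "'a::complex_hilbert_space"
  using Re_cinner_commute[of x y] by (simp add: norm_eq_sqrt_cinner cinner_simps)

lemma norm_diff_sq: "(norm (x - y))\<^sup>2 = (norm x)\<^sup>2 + (norm y)\<^sup>2 - 2 * Re (cinner x y)"
  for x :: "'a::complex_hilbert_space"
  using Re_cinner_commute[of x y] by (simp add: norm_eq_sqrt_cinner cinner_simps)

lemma pythagoras: "cinner x y = 0 \<Longrightarrow> (norm (x + y))\<^sup>2 = (norm x)\<^sup>2 + (norm y)\<^sup>2"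
  for x :: "'a::complex_hilbert_space"
  by (simp add: norm_add_sq)

lemma norm_scaleC: "norm (c *\<^sub>C x) = cmod c * norm x" for x :: "'a::complex_hilbert_space"
proof -
  have "cinner (c *\<^sub>C x) (c *\<^sub>C x) = (c * cnj c) * cinner x x"
    by (simp add: cinner_scaleC_left cinner_scaleC_right mult.assoc)
  also have "\<dots> = of_real ((cmod c * norm x)\<^sup>2)"
    by (simp add: cinner_self power_mult_distrib flip: complex_norm_square)
  finally have "cinner (c *\<^sub>C x) (c *\<^sub>C x) = of_real ((cmod c * norm x)\<^sup>2)" .
  then have "(norm (c *\<^sub>C x))\<^sup>2 = (cmod c * norm x)\<^sup>2"
    by (simp only: cinner_self of_real_eq_iff)
  then show ?thesis by (simp add: power2_eq_iff_nonneg)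
qed

text \<open>The subtracted vector is the component of \<open>x\<close> along \<open>y\<close>. The
  identity serves both the Cauchy-Schwarz inequality and the variational step of the projection
  theorem.\<close>

lemma norm_diff_component_sq:
  fixes x y :: "'a::complex_hilbert_space"
  assumes "y \<noteq> 0"
  shows "(norm (x - (cinner x y / of_real ((norm y)\<^sup>2)) *\<^sub>C y))\<^sup>2 = (norm x)\<^sup>2 - (cmod (cinner x y))\<^sup>2 / (norm y)\<^sup>2"
proof -
  let ?c = "cinner x y / of_real ((norm y)\<^sup>2)"
  have "cinner x (?c *\<^sub>C y) = (cinner x y * cnj (cinner x y)) / of_real ((norm y)\<^sup>2)"
    by (simp add: cinner_scaleC_right)
  also have "\<dots> = of_real ((cmod (cinner x y))\<^sup>2 / (norm y)\<^sup>2)"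
    by (simp only: complex_norm_square[symmetric] of_real_divide)
  finally have "Re (cinner x (?c *\<^sub>C y)) = (cmod (cinner x y))\<^sup>2 / (norm y)\<^sup>2" by simp
  moreover have "norm (?c *\<^sub>C y) = cmod (cinner x y) / norm y"
    using assms by (simp add: norm_scaleC norm_divide norm_power power2_eq_square norm_mult)
  ultimately show ?thesis by (simp add: norm_diff_sq power_divide)
qed

lemma cauchy_schwarz: "cmod (cinner x y) \<le> norm x * norm y"
proof (cases "y = 0")
  case False
  have "0 \<le> (norm x)\<^sup>2 - (cmod (cinner x y))\<^sup>2 / (norm y)\<^sup>2"
    by (metis False norm_diff_component_sq zero_le_power2)
  then have "(cmod (cinner x y))\<^sup>2 \<le> (norm x * norm y)\<^sup>2"
    using False by (simp add: field_simps power_mult_distrib)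
  then show ?thesis by (auto intro: power2_le_imp_le)
qed simp

lemma bounded_bilinear_cinner: "bounded_bilinear cinner"
proof
  show "\<exists>K. \<forall>a b. norm (cinner a b) \<le> norm a * norm b * K"
    by (intro exI[of _ 1] allI) (simp add: cauchy_schwarz)
qed (simp_all add: cinner_simps scaleR_conv_of_real)

lemmas tendsto_cinner = bounded_bilinear.tendsto[OF bounded_bilinear_cinner]

lemma bounded_linear_scaleC: "bounded_linear ((*\<^sub>C) c)"
  by (rule bounded_linear_intro[of _ "cmod c"])
     (simp_all add: scaleC_add_right norm_scaleC scaleC_scaleC scaleC_of_real[symmetric] mult.commute)

lemmas tendsto_scaleC = bounded_linear.tendsto[OF bounded_linear_scaleC]

lemma cinner_ext: "(\<And>z. cinner x z = cinner y z) \<Longrightarrow> x = y"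
  for x :: "'a::complex_hilbert_space"
  using norm_eq_sqrt_cinner[of "x - y"] cinner_diff_left[of x y "x - y"] by simp

lemma cinner_ext_right: "(\<And>z. cinner z x = cinner z y) \<Longrightarrow> x = y"
  for x :: "'a::complex_hilbert_space"
  by (rule cinner_ext) (metis cinner_commute)

section \<open>Closed subspaces and the projection theorem\<close>

definition csubspace :: "'a::complex_hilbert_space set \<Rightarrow> bool" where
  "csubspace S \<longleftrightarrow> 0 \<in> S \<and> (\<forall>x\<in>S. \<forall>y\<in>S. x + y \<in> S) \<and> (\<forall>c. \<forall>x\<in>S. c *\<^sub>C x \<in> S)"

lemma csubspace_0: "csubspace S \<Longrightarrow> 0 \<in> S"
  and csubspace_add: "csubspace S \<Longrightarrow> x \<in> S \<Longrightarrow> y \<in> S \<Longrightarrow> x + y \<in> S"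
  and csubspace_scaleC: "csubspace S \<Longrightarrow> x \<in> S \<Longrightarrow> c *\<^sub>C x \<in> S"
  by (auto simp: csubspace_def)

lemma csubspace_minus: "csubspace S \<Longrightarrow> x \<in> S \<Longrightarrow> - x \<in> S"
  by (metis csubspace_scaleC scaleC_minus_one)

lemma csubspace_diff: "csubspace S \<Longrightarrow> x \<in> S \<Longrightarrow> y \<in> S \<Longrightarrow> x - y \<in> S"
  by (metis csubspace_add csubspace_minus diff_conv_add_uminus)

lemma csubspace_scaleR: "csubspace S \<Longrightarrow> x \<in> S \<Longrightarrow> r *\<^sub>R x \<in> S"
  by (metis csubspace_scaleC scaleC_of_real)

lemma csubspace_closure: assumes "csubspace S" shows "csubspace (closure S)"
  unfolding csubspace_def
proof (intro conjI ballI allI)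
  show "0 \<in> closure S" using assms closure_subset csubspace_0 by blast
  fix x assume "x \<in> closure S"
  then obtain f where f: "\<And>n. f n \<in> S" "f \<longlonglongrightarrow> x" using closure_sequential by metis
  show "c *\<^sub>C x \<in> closure S" for c
    using f assms by (auto simp: closure_sequential csubspace_def intro!: exI[of _ "\<lambda>n. c *\<^sub>C f n"] tendsto_scaleC)
  fix y assume "y \<in> closure S"
  then obtain g where g: "\<And>n. g n \<in> S" "g \<longlonglongrightarrow> y" using closure_sequential by metis
  show "x + y \<in> closure S"
    using f g assms by (auto simp: closure_sequential csubspace_def intro!: exI[of _ "\<lambda>n. f n + g n"] tendsto_add)
qed

lemma parallelogram: "(norm (x - y))\<^sup>2 = 2 * (norm x)\<^sup>2 + 2 * (norm y)\<^sup>2 - 4 * (norm ((1/2) *\<^sub>R (x + y)))\<^sup>2"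
  for x :: "'a::complex_hilbert_space"
  by (simp add: norm_diff_sq norm_add_sq power_divide field_simps cinner_scaleR_left cinner_scaleR_right)

text \<open>A sequence minimizing the distance to \<open>h\<close> is Cauchy by the parallelogram
  law. Its limit leaves an orthogonal remainder, since removing a component along \<open>b\<close>
  would otherwise shorten the distance.\<close>

lemma orthogonal_decomposition:
  fixes S :: "'a::complex_hilbert_space set"
  assumes S: "csubspace S" "closed S"
  shows "\<exists>a\<in>S. \<forall>b\<in>S. cinner (h - a) b = 0"
proof -
  define I where "I = (\<lambda>a. (norm (h - a))\<^sup>2) ` S"
  define d where "d = Inf I"
  have ne: "I \<noteq> {}" using S csubspace_0 by (auto simp: I_def)
  have bd: "bdd_below I" by (auto simp: I_def intro!: bdd_belowI[of _ 0])
  have lower: "d \<le> (norm (h - a))\<^sup>2" if "a \<in> S" for a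
    unfolding d_def using bd that by (intro cInf_lower) (auto simp: I_def)
  have "\<exists>a\<in>S. (norm (h - a))\<^sup>2 < d + inverse (real (Suc n))" for n
  proof -
    have "\<exists>z\<in>I. z < d + inverse (real (Suc n))"
      using cInf_lessD[OF ne, of "d + inverse (real (Suc n))"] by (auto simp: d_def)
    then show ?thesis by (auto simp: I_def)
  qed
  then obtain f where fS: "\<And>n. f n \<in> S" and f: "\<And>n. (norm (h - f n))\<^sup>2 < d + inverse (real (Suc n))"
    by metis
  have est: "(norm (f m - f n))\<^sup>2 \<le> 2 * inverse (real (Suc m)) + 2 * inverse (real (Suc n))" for m n
  proof -
    have "h - f n - (h - f m) = f m - f n" by simp
    moreover have "(1/2) *\<^sub>R (h - f n + (h - f m)) = h - (1/2) *\<^sub>R (f n + f m)"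
      by (simp add: algebra_simps flip: scaleR_add_left)
    moreover have "d \<le> (norm (h - (1/2) *\<^sub>R (f n + f m)))\<^sup>2"
      using S fS by (intro lower csubspace_scaleR csubspace_add)
    ultimately show ?thesis
      using parallelogram[of "h - f n" "h - f m"] f[of n] f[of m] by simp
  qed
  have "Cauchy f"
  proof (rule metric_CauchyI)
    fix e :: real assume e: "0 < e"
    obtain N where N: "inverse (real (Suc N)) < e\<^sup>2 / 4"
      using reals_Archimedean[of "e\<^sup>2 / 4"] e by auto
    show "\<exists>M. \<forall>m\<ge>M. \<forall>n\<ge>M. dist (f m) (f n) < e"
    proof (intro exI allI impI)
      fix m n assume "N \<le> m" "N \<le> n"
      then have "inverse (real (Suc m)) \<le> inverse (real (Suc N))" "inverse (real (Suc n)) \<le> inverse (real (Suc N))"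
        by (auto intro!: le_imp_inverse_le)
      then have "(norm (f m - f n))\<^sup>2 < e\<^sup>2" using est[of m n] N by linarith
      then show "dist (f m) (f n) < e" using e by (simp add: dist_norm power_less_imp_less_base)
    qed
  qed
  then obtain a where a: "f \<longlonglongrightarrow> a" using Cauchy_convergent convergent_def by blast
  have aS: "a \<in> S" using S(2) fS a closed_sequentially by blast
  have "(\<lambda>n. (norm (h - f n))\<^sup>2) \<longlonglongrightarrow> (norm (h - a))\<^sup>2" by (intro tendsto_intros a)
  moreover have "(\<lambda>n. d + inverse (real (Suc n))) \<longlonglongrightarrow> d + 0"
    by (intro tendsto_intros LIMSEQ_inverse_real_of_nat)
  ultimately have ad: "(norm (h - a))\<^sup>2 \<le> d"
    using f by (intro LIMSEQ_le[of _ _ _ d]) (auto intro: less_imp_le)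
  have "cinner (h - a) b = 0" if b: "b \<in> S" for b
  proof (cases "b = 0")
    case False
    let ?z = "cinner (h - a) b" and ?c = "cinner (h - a) b / of_real ((norm b)\<^sup>2)"
    have "(norm (h - a))\<^sup>2 \<le> (norm (h - (a + ?c *\<^sub>C b)))\<^sup>2"
      using ad lower[of "a + ?c *\<^sub>C b"] S aS b by (meson csubspace_add csubspace_scaleC order_trans)
    also have "h - (a + ?c *\<^sub>C b) = (h - a) - ?c *\<^sub>C b" by simp
    also have "(norm \<dots>)\<^sup>2 = (norm (h - a))\<^sup>2 - (cmod ?z)\<^sup>2 / (norm b)\<^sup>2"
      by (rule norm_diff_component_sq[OF False])
    finally have "(cmod ?z)\<^sup>2 / (norm b)\<^sup>2 \<le> 0" by simp
    then show ?thesis using False by (simp add: divide_le_0_iff)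
  qed simp
  with aS show ?thesis by blast
qed

section \<open>Bounded operators and adjoints\<close>

lemma bounded_clinearI:
  assumes "\<And>x y. T (x + y) = T x + T y" "\<And>c x. T (c *\<^sub>C x) = c *\<^sub>C T x" "\<And>x. norm (T x) \<le> K * norm x"
  shows "bounded_clinear T"
  unfolding bounded_clinear_def
proof (intro conjI allI)
  show "bounded_linear T"
    by (rule bounded_linear_intro[of _ K]) (use assms scaleC_of_real in \<open>metis mult.commute\<close>)+
qed (rule assms)

lemma bounded_clinear_add: "bounded_clinear T \<Longrightarrow> T (x + y) = T x + T y"
  and bounded_clinear_diff: "bounded_clinear T \<Longrightarrow> T (x - y) = T x - T y"
  and bounded_clinear_minus: "bounded_clinear T \<Longrightarrow> T (- x) = - T x"
  and bounded_clinear_zero: "bounded_clinear T \<Longrightarrow> T 0 = 0"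
  and bounded_clinear_scaleR: "bounded_clinear T \<Longrightarrow> T (r *\<^sub>R x) = r *\<^sub>R T x"
  and bounded_clinear_scaleC: "bounded_clinear T \<Longrightarrow> T (c *\<^sub>C x) = c *\<^sub>C T x"
  by (auto simp: bounded_clinear_def dest: bounded_linear.linear intro: linear_add linear_diff linear_neg linear_0 linear_scale)

lemmas bounded_clinear_simps = bounded_clinear_add bounded_clinear_diff bounded_clinear_minus
  bounded_clinear_zero bounded_clinear_scaleR bounded_clinear_scaleC

lemma bounded_clinear_tendsto: "bounded_clinear T \<Longrightarrow> (f \<longlongrightarrow> a) F \<Longrightarrow> ((\<lambda>x. T (f x)) \<longlongrightarrow> T a) F"
  unfolding bounded_clinear_def by (auto intro: bounded_linear.tendsto)

lemma bounded_clinear_continuous: "bounded_clinear T \<Longrightarrow> continuous_on A T"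
  unfolding bounded_clinear_def by (auto intro: linear_continuous_on)

lemma bounded_clinear_bound: assumes "bounded_clinear T" obtains K where "0 < K" "\<And>x. norm (T x) \<le> K * norm x"
  using assms bounded_linear.pos_bounded[of T] unfolding bounded_clinear_def by (metis mult.commute)

lemma bounded_clinear_id: "bounded_clinear id" "bounded_clinear (\<lambda>h. h)"
  and bounded_clinear_0: "bounded_clinear (\<lambda>h. 0)"
  by (rule bounded_clinearI[of _ 1]; simp)+

lemma bounded_clinear_plus: "bounded_clinear S \<Longrightarrow> bounded_clinear T \<Longrightarrow> bounded_clinear (\<lambda>h. S h + T h)"
  and bounded_clinear_sub: "bounded_clinear S \<Longrightarrow> bounded_clinear T \<Longrightarrow> bounded_clinear (\<lambda>h. S h - T h)"
  by (simp_all add: bounded_clinear_def bounded_linear_add bounded_linear_sub scaleC_add_right scaleC_diff_right)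

lemma bounded_clinear_compose: "bounded_clinear S \<Longrightarrow> bounded_clinear T \<Longrightarrow> bounded_clinear (\<lambda>h. S (T h))"
  and bounded_clinear_comp: "bounded_clinear S \<Longrightarrow> bounded_clinear T \<Longrightarrow> bounded_clinear (S \<circ> T)"
  by (simp_all add: bounded_clinear_def bounded_linear_compose o_def)

lemma bounded_clinear_scale: "bounded_clinear T \<Longrightarrow> bounded_clinear (\<lambda>h. c *\<^sub>C T h)"
  unfolding bounded_clinear_def
  by (auto intro: bounded_linear_compose[OF bounded_linear_scaleC] simp: scaleC_scaleC mult.commute)

lemma bounded_clinear_scale_real: "bounded_clinear T \<Longrightarrow> bounded_clinear (\<lambda>h. r *\<^sub>R T h)"
  using bounded_clinear_scale[of T "of_real r"] by (simp add: scaleC_of_real)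

text \<open>The representing vector is a multiple of \<open>y - a\<close>, where \<open>f y\<close>
  is nonzero and \<open>a\<close> is the nearest point to \<open>y\<close> in the kernel. The
  combination of \<open>x\<close> and \<open>y - a\<close> that lies in the kernel is orthogonal to
  \<open>y - a\<close>, which solves for \<open>f x\<close>.\<close>

lemma riesz:
  fixes f :: "'a::complex_hilbert_space \<Rightarrow> complex"
  assumes add: "\<And>x y. f (x + y) = f x + f y" and sc: "\<And>c x. f (c *\<^sub>C x) = c * f x"
    and bd: "\<And>x. cmod (f x) \<le> K * norm x"
  shows "\<exists>z. \<forall>x. f x = cinner x z"
proof (cases "\<forall>x. f x = 0")
  case False
  then obtain y where y: "f y \<noteq> 0" by blast
  have "bounded_linear f"
    by (rule bounded_linear_intro[of _ K])
       (use add sc bd in \<open>simp_all add: scaleC_of_real[symmetric, where ?'a='a] scaleR_conv_of_real mult.commute\<close>)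
  then have "closed (f -` {0})"
    by (intro closed_vimage) (simp_all add: linear_continuous_on continuous_on_eq_continuous_at linear_continuous_at)
  moreover have "f 0 = 0" using add[of 0 0] by simp
  then have "csubspace (f -` {0})" by (simp add: csubspace_def add sc)
  ultimately obtain a where a: "f a = 0" "\<And>b. f b = 0 \<Longrightarrow> cinner (y - a) b = 0"
    using orthogonal_decomposition[of "f -` {0}" y] by auto
  let ?u = "y - a"
  have fu: "f ?u = f y" using add[of ?u a] a by simp
  then have u0: "?u \<noteq> 0" using y \<open>f 0 = 0\<close> by metis
  have "f x = cinner x ((cnj (f y) / of_real ((norm ?u)\<^sup>2)) *\<^sub>C ?u)" for x
  proof -
    have "f (f y *\<^sub>C x + (- f x) *\<^sub>C ?u) = 0" by (simp only: add sc fu) simp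
    then have "cinner (f y *\<^sub>C x + (- f x) *\<^sub>C ?u) ?u = 0"
      using a(2) cinner_eq_0_commute by blast
    then have "f y * cinner x ?u = f x * of_real ((norm ?u)\<^sup>2)"
      by (simp add: cinner_add_left cinner_scaleC_left cinner_self)
    then show ?thesis using u0 by (simp add: cinner_scaleC_right field_simps)
  qed
  then show ?thesis by blast
qed (auto intro: exI[of _ 0])

lemma adjoint_exists:
  assumes T: "bounded_clinear T"
  shows "\<exists>S. \<forall>x y. cinner (T x) y = cinner x (S y)"
proof -
  obtain K where K: "0 < K" "\<And>x. norm (T x) \<le> K * norm x" using bounded_clinear_bound[OF T] by blast
  have "\<exists>z. \<forall>x. cinner (T x) y = cinner x z" for y
  proof (rule riesz)
    fix x show "cmod (cinner (T x) y) \<le> (K * norm y) * norm x"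
      using cauchy_schwarz[of "T x" y] mult_right_mono[OF K(2)[of x], of "norm y"] by (simp add: mult.commute mult.left_commute)
  qed (simp_all add: bounded_clinear_simps[OF T] cinner_simps)
  then show ?thesis by metis
qed

text \<open>A definite description is evaluated by exhibiting any function with the adjoint
  identity; concrete adjoints are computed this way throughout.\<close>

lemma badjoint_unique:
  assumes S: "\<And>x y. cinner (T x) y = cinner x (S y)"
  shows "badjoint T = S"
  unfolding badjoint_def
proof (rule the_equality)
  fix S' assume S': "\<forall>x y. cinner (T x) y = cinner x (S' y)"
  have "S' y = S y" for y by (rule cinner_ext_right) (metis S S')
  then show "S' = S" by (rule ext)
qed (use S in blast)

lemma cinner_badjoint: assumes "bounded_clinear T" shows "cinner (T x) y = cinner x (badjoint T y)"
  using adjoint_exists[OF assms] badjoint_unique by metis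

lemma cinner_badjoint': assumes "bounded_clinear T" shows "cinner (badjoint T x) y = cinner x (T y)"
  using cinner_badjoint[OF assms] by (metis cinner_commute)

lemma badjoint_norm_bound:
  assumes T: "bounded_clinear T" and c: "\<And>x. norm (T x) \<le> c * norm x"
  shows "norm (badjoint T y) \<le> c * norm y"
proof (cases "badjoint T y = 0")
  case True
  then show ?thesis using c[of y] by (metis norm_ge_zero norm_zero order_trans)
next
  case False
  let ?a = "badjoint T y"
  have "(norm ?a)\<^sup>2 = cmod (cinner (T ?a) y)" by (simp add: cinner_badjoint[OF T] cinner_self norm_power)
  also have "\<dots> \<le> c * norm ?a * norm y"
    using cauchy_schwarz[of "T ?a" y] mult_right_mono[OF c[of ?a], of "norm y"] by simp
  finally have "norm ?a * norm ?a \<le> (c * norm y) * norm ?a" by (simp add: power2_eq_square mult_ac)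
  then show ?thesis using False by simp
qed

lemma bounded_clinear_badjoint: assumes T: "bounded_clinear T" shows "bounded_clinear (badjoint T)"
proof -
  obtain K where K: "\<And>x. norm (T x) \<le> K * norm x" using bounded_clinear_bound[OF T] by blast
  show ?thesis
    by (rule bounded_clinearI[OF _ _ badjoint_norm_bound[OF T K]])
       (rule cinner_ext_right, simp add: cinner_simps flip: cinner_badjoint[OF T])+
qed

lemma badjoint_badjoint: "bounded_clinear T \<Longrightarrow> badjoint (badjoint T) = T"
  by (rule badjoint_unique) (simp add: cinner_badjoint')

text \<open>Bundles boundedness with symmetry, so that proofs can use the identity for the inner
  product without evaluating \<open>badjoint\<close>.\<close>

definition selfadj :: "('h::complex_hilbert_space \<Rightarrow> 'h) \<Rightarrow> bool" where
  "selfadj T \<longleftrightarrow> bounded_clinear T \<and> (\<forall>x y. cinner (T x) y = cinner x (T y))"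

lemma selfadj_clinear: "selfadj T \<Longrightarrow> bounded_clinear T"
  and selfadjD: "selfadj T \<Longrightarrow> cinner (T x) y = cinner x (T y)"
  by (auto simp: selfadj_def)

lemma selfadj_iff: "selfadj T \<longleftrightarrow> bounded_clinear T \<and> badjoint T = T"
  unfolding selfadj_def using badjoint_unique[of T T] cinner_badjoint[of T] by auto

lemma projection_iff: "projection_op p \<longleftrightarrow> selfadj p \<and> p \<circ> p = p"
  by (auto simp: projection_op_def selfadj_iff)

lemma selfadj_Im: "selfadj T \<Longrightarrow> Im (cinner (T x) x) = 0"
  by (metis Reals_cnj_iff cinner_commute complex_is_Real_iff selfadjD)

lemma selfadj_real: "selfadj T \<Longrightarrow> cinner (T x) x = of_real (Re (cinner (T x) x))"
  by (simp add: complex_eq_iff selfadj_Im)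

text \<open>Polarization: testing the difference at \<open>x + y\<close> and at
  \<open>x + i y\<close> yields two equations whose only solution is zero.\<close>

lemma clinear_eq_if_form:
  assumes T: "bounded_clinear T" and S: "bounded_clinear S"
    and eq: "\<And>x. cinner (T x) x = cinner (S x) x"
  shows "T = S"
proof
  fix x
  define D where "D = (\<lambda>h. T h - S h)"
  have D: "bounded_clinear D" unfolding D_def by (rule bounded_clinear_sub[OF T S])
  have z: "cinner (D x) x = 0" for x using eq[of x] by (simp add: D_def cinner_diff_left)
  have "cinner (D x) y = 0" for x y
  proof -
    have 1: "cinner (D x) y + cinner (D y) x = 0"
      using z[of "x + y"] z[of x] z[of y]
      by (simp add: bounded_clinear_add[OF D] cinner_add_left cinner_add_right add.commute)
    have "cinner (D (x + \<i> *\<^sub>C y)) (x + \<i> *\<^sub>C y) = 0" by (rule z)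
    then have "\<i> * cinner (D y) x - \<i> * cinner (D x) y = 0"
      using z[of x] z[of y]
      by (simp add: bounded_clinear_add[OF D] bounded_clinear_scaleC[OF D] cinner_add_left cinner_add_right
          cinner_scaleC_left cinner_scaleC_right)
    then have "cinner (D y) x = cinner (D x) y" by (simp add: algebra_simps)
    with 1 show ?thesis by simp
  qed
  then have "D x = 0" using cinner_ext[of "D x" 0] by simp
  then show "T x = S x" by (simp add: D_def)
qed

section \<open>Projections\<close>

abbreviation perp :: "('h::complex_hilbert_space \<Rightarrow> 'h) \<Rightarrow> 'h \<Rightarrow> 'h" where
  "perp p \<equiv> (\<lambda>h. h - p h)"

lemma proj_clinear: "projection_op p \<Longrightarrow> bounded_clinear p"
  and proj_selfadj: "projection_op p \<Longrightarrow> selfadj p"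
  and proj_cinner: "projection_op p \<Longrightarrow> cinner (p x) y = cinner x (p y)"
  by (auto simp: projection_iff selfadj_def)

lemma proj_idem: "projection_op p \<Longrightarrow> p (p x) = p x"
  by (simp add: projection_op_def fun_eq_iff)

lemma proj_simps: "projection_op p \<Longrightarrow> p (x + y) = p x + p y" "projection_op p \<Longrightarrow> p (x - y) = p x - p y"
  "projection_op p \<Longrightarrow> p 0 = 0" "projection_op p \<Longrightarrow> p (c *\<^sub>C x) = c *\<^sub>C p x" "projection_op p \<Longrightarrow> p (- x) = - p x"
  by (simp_all add: bounded_clinear_simps proj_clinear)

lemma projectionI:
  assumes "bounded_clinear p" "\<And>x. p (p x) = p x" "\<And>x y. cinner (p x) y = cinner x (p y)"
  shows "projection_op p"
  using assms by (auto simp: projection_iff selfadj_def)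

lemma proj_norm_sq: "projection_op p \<Longrightarrow> (norm (p x))\<^sup>2 = Re (cinner (p x) x)"
  by (metis norm_eq_sqrt_cinner proj_cinner proj_idem Re_cinner_commute)

lemma proj_cinner_self: "projection_op p \<Longrightarrow> cinner (p x) x = of_real ((norm (p x))\<^sup>2)"
  by (metis cinner_self proj_cinner proj_idem)

lemma proj_pythagoras: "projection_op p \<Longrightarrow> (norm x)\<^sup>2 = (norm (p x))\<^sup>2 + (norm (x - p x))\<^sup>2"
  using pythagoras[of "p x" "x - p x"] by (simp add: proj_cinner cinner_diff_right proj_simps proj_idem)

lemma proj_norm_le: "projection_op p \<Longrightarrow> norm (p x) \<le> norm x"
  by (rule power2_le_imp_le) (use proj_pythagoras[of p x] in auto)

lemma proj_eq_if_norm: "projection_op p \<Longrightarrow> norm x \<le> norm (p x) \<Longrightarrow> p x = x"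
  using proj_pythagoras[of p x] proj_norm_le[of p x] by simp

lemma proj_range: "projection_op p \<Longrightarrow> range p = {h. p h = h}"
  using proj_idem by (auto simp: image_iff) metis+

lemma proj_perp: "projection_op p \<Longrightarrow> projection_op (perp p)"
  by (rule projectionI) (auto simp: bounded_clinear_sub bounded_clinear_id proj_clinear proj_simps proj_idem
      cinner_diff_left cinner_diff_right proj_cinner)

lemma proj_perp_apply: "projection_op p \<Longrightarrow> p (x - p x) = 0"
  by (simp add: proj_simps proj_idem)

lemma proj_zero: "projection_op (\<lambda>h. 0)" and proj_id: "projection_op (\<lambda>h. h)"
  by (rule projectionI; simp add: bounded_clinear_0 bounded_clinear_id)+

lemma proj_closed: assumes "projection_op p" shows "closed (range p)"
proof -
  have "closed {h. p h = h}"
    using assms by (intro closed_Collect_eq bounded_clinear_continuous proj_clinear continuous_on_id)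
  then show ?thesis using assms by (simp add: proj_range)
qed

lemma proj_commute_prod:
  assumes p: "projection_op p" and q: "projection_op q" and c: "\<And>h. p (q h) = q (p h)"
  shows "projection_op (p \<circ> q)"
proof (rule projectionI)
  show "bounded_clinear (p \<circ> q)" using p q by (simp add: bounded_clinear_comp proj_clinear)
  show "(p \<circ> q) ((p \<circ> q) x) = (p \<circ> q) x" for x by (simp add: c proj_idem p q)
  show "cinner ((p \<circ> q) x) y = cinner x ((p \<circ> q) y)" for x y
    by (simp add: proj_cinner[OF p] proj_cinner[OF q] c)
qed

lemma proj_eqI: assumes p: "projection_op p" and q: "projection_op q" and n: "\<And>h. norm (p h) = norm (q h)"
  shows "p = q"
  by (rule clinear_eq_if_form) (use p q n in \<open>auto simp: proj_clinear proj_cinner_self\<close>)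

text \<open>This is the adjoint of the relation \<open>q p = p\<close>; the pair of relations is how
  the order of projections is used in calculations.\<close>

lemma proj_le_commute: assumes p: "projection_op p" and q: "projection_op q" and c: "\<And>h. q (p h) = p h"
  shows "p (q h) = p h"
proof (rule cinner_ext)
  fix z show "cinner (p (q h)) z = cinner (p h) z" by (simp add: proj_cinner[OF p] proj_cinner[OF q] c)
qed

lemma proj_diff: assumes p: "projection_op p" and q: "projection_op q" and c: "\<And>h. q (p h) = p h"
  shows "projection_op (\<lambda>h. q h - p h)"
  by (rule projectionI) (use p q c proj_le_commute[OF p q c] in
      \<open>simp_all add: bounded_clinear_sub proj_clinear proj_simps proj_idem cinner_simps proj_cinner\<close>)

lemma proj_sum: assumes p: "projection_op p" and q: "projection_op q" and c: "\<And>h. q (p h) = 0"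
  shows "projection_op (\<lambda>h. q h + p h)"
proof -
  have c': "p (q h) = 0" for h
    by (rule cinner_ext) (simp add: proj_cinner[OF p] proj_cinner[OF q] c)
  show ?thesis
  by (rule projectionI) (use p q c c' in
      \<open>simp_all add: bounded_clinear_plus proj_clinear proj_simps proj_idem cinner_simps proj_cinner\<close>)
qed

lemma nonneg_Reals_iff: "z \<in> \<real>\<^sub>\<ge>\<^sub>0 \<longleftrightarrow> 0 \<le> Re z \<and> Im z = 0" for z :: complex
  by (simp add: complex_nonneg_Reals_iff)

lemma op_le_selfadj: "selfadj S \<Longrightarrow> selfadj T \<Longrightarrow> op_le S T \<longleftrightarrow> (\<forall>x. Re (cinner (S x) x) \<le> Re (cinner (T x) x))"
  by (auto simp: op_le_def positive_op_def nonneg_Reals_iff cinner_diff_left selfadj_Im)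

lemma op_le_proj: assumes p: "projection_op p" and q: "projection_op q"
  shows "op_le p q \<longleftrightarrow> (\<forall>h. q (p h) = p h)"
proof
  assume "op_le p q"
  then have le: "(norm (p x))\<^sup>2 \<le> (norm (q x))\<^sup>2" for x
    using p q by (simp add: op_le_selfadj proj_selfadj proj_norm_sq)
  show "\<forall>h. q (p h) = p h"
  proof
    fix h show "q (p h) = p h"
      using le[of "p h"] by (intro proj_eq_if_norm[OF q]) (simp add: proj_idem[OF p] power2_le_iff_abs_le)
  qed
next
  assume c: "\<forall>h. q (p h) = p h"
  have "norm (p x) \<le> norm (q x)" for x
    using proj_norm_le[OF p, of "q x"] proj_le_commute[OF p q] c by simp
  then show "op_le p q" using p q by (simp add: op_le_selfadj proj_selfadj flip: proj_norm_sq)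
qed

section \<open>Orthogonal projections onto closed subspaces\<close>

definition orth_proj :: "'a::complex_hilbert_space set \<Rightarrow> 'a \<Rightarrow> 'a" where
  "orth_proj S h = (THE a. a \<in> S \<and> (\<forall>b\<in>S. cinner (h - a) b = 0))"

context
  fixes S :: "'a::complex_hilbert_space set"
  assumes S: "csubspace S" "closed S"
begin

lemma orth_proj_unique:
  assumes "a \<in> S" "\<And>b. b \<in> S \<Longrightarrow> cinner (h - a) b = 0"
  shows "orth_proj S h = a"
  unfolding orth_proj_def
proof (rule the_equality)
  fix a' assume a': "a' \<in> S \<and> (\<forall>b\<in>S. cinner (h - a') b = 0)"
  then have "a - a' \<in> S" using assms S csubspace_diff by blast
  then have "cinner (h - a') (a - a') = 0" "cinner (h - a) (a - a') = 0" using a' assms by auto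
  then have "cinner (a - a') (a - a') = 0" by (simp add: cinner_diff_left)
  then show "a' = a" by (simp add: cinner_self)
qed (use assms in auto)

lemma orth_proj_in: "orth_proj S h \<in> S"
  and orth_proj_orth: "b \<in> S \<Longrightarrow> cinner (h - orth_proj S h) b = 0"
  using orthogonal_decomposition[OF S, of h] orth_proj_unique by metis+

lemma orth_proj_fix: "h \<in> S \<Longrightarrow> orth_proj S h = h"
  by (rule orth_proj_unique) auto

lemma orth_proj_projection: "projection_op (orth_proj S)"
proof (rule projectionI)
  have add: "orth_proj S (x + y) = orth_proj S x + orth_proj S y" for x y
  proof (rule orth_proj_unique)
    fix b assume b: "b \<in> S"
    show "cinner (x + y - (orth_proj S x + orth_proj S y)) b = 0"
      using orth_proj_orth[OF b, of x] orth_proj_orth[OF b, of y] by (simp add: cinner_add_left cinner_diff_left)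
  qed (use orth_proj_in S csubspace_add in blast)
  have sc: "orth_proj S (c *\<^sub>C x) = c *\<^sub>C orth_proj S x" for c x
    by (rule orth_proj_unique)
      (use csubspace_scaleC[OF S(1) orth_proj_in] orth_proj_orth in
        \<open>auto simp: cinner_scaleC_left simp flip: scaleC_diff_right\<close>)
  have "cinner (x - orth_proj S x) (orth_proj S x) = 0" for x by (rule orth_proj_orth[OF orth_proj_in])
  then have "(norm x)\<^sup>2 = (norm (orth_proj S x))\<^sup>2 + (norm (x - orth_proj S x))\<^sup>2" for x
    using pythagoras[of "x - orth_proj S x" "orth_proj S x"] by simp
  then have "norm (orth_proj S x) \<le> 1 * norm x" for x
    using power2_le_imp_le[of "norm (orth_proj S x)" "norm x"] by (metis le_add_same_cancel1 mult_1 norm_ge_zero zero_le_power2)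
  with add sc show "bounded_clinear (orth_proj S)" by (rule bounded_clinearI)
  show "orth_proj S (orth_proj S x) = orth_proj S x" for x by (rule orth_proj_fix[OF orth_proj_in])
  fix x y
  have "cinner (x - orth_proj S x) (orth_proj S y) = 0" "cinner (y - orth_proj S y) (orth_proj S x) = 0"
    by (rule orth_proj_orth[OF orth_proj_in])+
  then have "cinner x (orth_proj S y) = cinner (orth_proj S x) (orth_proj S y)"
    "cinner (orth_proj S x) y = cinner (orth_proj S x) (orth_proj S y)"
    by (auto simp: cinner_diff_left) (metis cinner_commute)
  then show "cinner (orth_proj S x) y = cinner x (orth_proj S y)" by simp
qed

lemma orth_proj_eq_iff: "orth_proj S h = h \<longleftrightarrow> h \<in> S"
  using orth_proj_in orth_proj_fix by metis

text \<open>Invariance under \<open>T\<close> alone would keep only the subspace in place;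
  invariance under the adjoint keeps its orthogonal complement in place too, and both together give
  commutation.\<close>

lemma orth_proj_commute:
  assumes T: "bounded_clinear T" and inv: "\<And>h. h \<in> S \<Longrightarrow> T h \<in> S" "\<And>h. h \<in> S \<Longrightarrow> badjoint T h \<in> S"
  shows "orth_proj S (T h) = T (orth_proj S h)"
proof (rule orth_proj_unique)
  show "T (orth_proj S h) \<in> S" using inv orth_proj_in by blast
  fix b assume "b \<in> S"
  then have "cinner (h - orth_proj S h) (badjoint T b) = 0" using inv orth_proj_orth by blast
  then show "cinner (T h - T (orth_proj S h)) b = 0"
    by (metis T bounded_clinear_diff cinner_badjoint)
qed

end

lemma csubspace_dense_iff:
  assumes S: "csubspace S"
  shows "closure S = UNIV \<longleftrightarrow> (\<forall>h. (\<forall>b\<in>S. cinner h b = 0) \<longrightarrow> h = 0)"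
proof
  assume d: "closure S = UNIV"
  show "\<forall>h. (\<forall>b\<in>S. cinner h b = 0) \<longrightarrow> h = 0"
  proof (intro allI impI)
    fix h assume h: "\<forall>b\<in>S. cinner h b = 0"
    obtain f where f: "\<And>n. f n \<in> S" "f \<longlonglongrightarrow> h" using d closure_sequential by (metis UNIV_I)
    have "(\<lambda>n. cinner h (f n)) \<longlonglongrightarrow> cinner h h" by (intro tendsto_cinner tendsto_const f)
    then have "cinner h h = 0" using h f LIMSEQ_unique[OF _ tendsto_const] by auto
    then show "h = 0" by (simp add: cinner_self)
  qed
next
  assume *: "\<forall>h. (\<forall>b\<in>S. cinner h b = 0) \<longrightarrow> h = 0"
  have C: "csubspace (closure S)" "closed (closure S)" using S csubspace_closure by auto
  have "h - orth_proj (closure S) h = 0" for h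
    using * orth_proj_orth[OF C] closure_subset by blast
  then show "closure S = UNIV" using orth_proj_in[OF C] by (metis UNIV_eq_I eq_iff_diff_eq_0)
qed

section \<open>Increasing sequences of projections\<close>

lemma proj_incr_commute:
  assumes p: "\<And>n::nat. projection_op (p n)" and inc: "\<And>n h. p (Suc n) (p n h) = p n h" and mn: "m \<le> n"
  shows "p n (p m h) = p m h" "p m (p n h) = p m h"
proof -
  show *: "p n (p m h) = p m h" for h
    using mn
  proof (induction n rule: dec_induct)
    case base show ?case by (rule proj_idem[OF p])
  next
    case (step n) then show ?case using inc[of n "p m h"] by simp
  qed
  show "p m (p n h) = p m h" by (rule proj_le_commute[OF p p *])
qed

text \<open>Made for sequences in which Pythagoras turns a squared distance into a difference of
  squared norms: increasing projections, and the preimages under \<open>S\<close> in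
  \<open>PF_domain\<close>.\<close>

lemma cauchy_if_monotone_sq:
  fixes f :: "nat \<Rightarrow> 'a::real_normed_vector" and a :: "nat \<Rightarrow> real"
  assumes "\<And>m n. m \<le> n \<Longrightarrow> (norm (f n - f m))\<^sup>2 \<le> \<bar>a n - a m\<bar>" and "convergent a"
  shows "Cauchy f"
proof (rule metric_CauchyI)
  fix e :: real assume e: "0 < e"
  have "Cauchy a" using assms(2) Cauchy_convergent_iff by blast
  then obtain M where M: "\<And>m n. M \<le> m \<Longrightarrow> M \<le> n \<Longrightarrow> \<bar>a m - a n\<bar> < e\<^sup>2"
    using e metric_CauchyD[of a "e\<^sup>2"] by (auto simp: dist_real_def)
  have "norm (f n - f m) < e" if "M \<le> m" "m \<le> n" for m n
    using assms(1)[of m n] M[of n m] that e by (intro power2_less_imp_less[of _ e]) auto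
  then have "dist (f m) (f n) < e" if "M \<le> m" "M \<le> n" for m n
    using that by (metis dist_commute dist_norm linear)
  then show "\<exists>M. \<forall>m\<ge>M. \<forall>n\<ge>M. dist (f m) (f n) < e" by blast
qed

lemma pointwise_limit_clinear:
  assumes T: "\<And>n::nat. bounded_clinear (T n)" and K: "\<And>n x. norm (T n x) \<le> K * norm x"
    and lim: "\<And>x. (\<lambda>n. T n x) \<longlonglongrightarrow> L x"
  shows "bounded_clinear L" "norm (L x) \<le> K * norm x"
proof -
  show n: "norm (L x) \<le> K * norm x" for x
    by (rule LIMSEQ_le_const2[OF tendsto_norm[OF lim]]) (use K in auto)
  show "bounded_clinear L"
  proof (rule bounded_clinearI[OF _ _ n])
    fix x y
    have "(\<lambda>n. T n x + T n y) \<longlonglongrightarrow> L x + L y" by (intro tendsto_intros lim)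
    then show "L (x + y) = L x + L y"
      using LIMSEQ_unique[OF lim[of "x + y"]] by (simp add: bounded_clinear_add[OF T])
    fix c
    have "(\<lambda>n. c *\<^sub>C T n x) \<longlonglongrightarrow> c *\<^sub>C L x" by (intro tendsto_scaleC lim)
    then show "L (c *\<^sub>C x) = c *\<^sub>C L x"
      using LIMSEQ_unique[OF lim[of "c *\<^sub>C x"]] by (simp add: bounded_clinear_scaleC[OF T])
  qed
qed

lemma proj_limit_proj:
  assumes p: "\<And>n::nat. projection_op (p n)" and lim: "\<And>h. (\<lambda>n. p n h) \<longlonglongrightarrow> q h"
  shows "projection_op q"
proof (rule projectionI)
  show "bounded_clinear q"
    by (rule pointwise_limit_clinear(1)[OF _ _ lim, where K = 1]) (use p proj_clinear proj_norm_le in auto)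
  have sa: "cinner (q x) y = cinner x (q y)" for x y
  proof -
    have "(\<lambda>n. cinner (p n x) y) \<longlonglongrightarrow> cinner (q x) y" by (intro tendsto_cinner lim tendsto_const)
    moreover have "(\<lambda>n. cinner x (p n y)) \<longlonglongrightarrow> cinner x (q y)" by (intro tendsto_cinner lim tendsto_const)
    ultimately show ?thesis using LIMSEQ_unique by (simp add: proj_cinner[OF p])
  qed
  show "cinner (q x) y = cinner x (q y)" for x y by (rule sa)
  show "q (q x) = q x" for x
  proof (rule cinner_ext)
    fix z
    have "(\<lambda>n. cinner (p n x) (p n z)) \<longlonglongrightarrow> cinner (q x) (q z)" by (intro tendsto_cinner lim)
    moreover have "cinner (p n x) (p n z) = cinner (p n x) z" for n by (metis p proj_cinner proj_idem)
    moreover have "(\<lambda>n. cinner (p n x) z) \<longlonglongrightarrow> cinner (q x) z" by (intro tendsto_cinner lim tendsto_const)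
    ultimately have "cinner (q x) (q z) = cinner (q x) z" using LIMSEQ_unique by auto
    then show "cinner (q (q x)) z = cinner (q x) z" by (simp add: sa)
  qed
qed

text \<open>The squared norms of \<open>p n h\<close> increase and are bounded by that of
  \<open>h\<close>, so \<open>cauchy_if_monotone_sq\<close> gives pointwise convergence.\<close>

lemma proj_incr_limit:
  assumes p: "\<And>n::nat. projection_op (p n)" and inc: "\<And>n h. p (Suc n) (p n h) = p n h"
  shows "\<exists>q. projection_op q \<and> (\<forall>h. (\<lambda>n. p n h) \<longlonglongrightarrow> q h) \<and> (\<forall>n h. q (p n h) = p n h)"
proof -
  note pc = proj_incr_commute[where p = p, OF p inc]
  have diff: "(norm (p n h - p m h))\<^sup>2 = (norm (p n h))\<^sup>2 - (norm (p m h))\<^sup>2" if "m \<le> n" for m n h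
  proof -
    have "(norm (p n h))\<^sup>2 = (norm (p m (p n h)))\<^sup>2 + (norm (p n h - p m (p n h)))\<^sup>2"
      by (rule proj_pythagoras[OF p])
    then show ?thesis using pc(2)[OF that] by simp
  qed
  have "convergent (\<lambda>n. p n h)" for h
  proof -
    have "incseq (\<lambda>n. (norm (p n h))\<^sup>2)"
    proof (rule incseq_SucI)
      fix n show "(norm (p n h))\<^sup>2 \<le> (norm (p (Suc n) h))\<^sup>2"
        using diff[of n "Suc n" h] zero_le_power2[of "norm (p (Suc n) h - p n h)"] by linarith
    qed
    moreover have "(norm (p n h))\<^sup>2 \<le> (norm h)\<^sup>2" for n using proj_norm_le[OF p, of n h] by (simp add: power_mono)
    ultimately obtain L where "(\<lambda>n. (norm (p n h))\<^sup>2) \<longlonglongrightarrow> L"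
      using incseq_convergent by blast
    then have "convergent (\<lambda>n. (norm (p n h))\<^sup>2)" by (auto simp: convergent_def)
    then have "Cauchy (\<lambda>n. p n h)" by (rule cauchy_if_monotone_sq[rotated]) (simp add: diff)
    then show ?thesis by (rule Cauchy_convergent)
  qed
  then obtain q where lim: "\<And>h. (\<lambda>n. p n h) \<longlonglongrightarrow> q h" unfolding convergent_def by metis
  have "q (p m h) = p m h" for m h
  proof -
    have "(\<lambda>n. p n (p m h)) \<longlonglongrightarrow> p m h"
      by (rule tendsto_eventually) (use pc(1) in \<open>auto simp: eventually_sequentially\<close>)
    then show ?thesis using lim LIMSEQ_unique by blast
  qed
  then show ?thesis using proj_limit_proj[OF p lim] lim by blast
qed

section \<open>Positive operators and square roots\<close>

text \<open>Unlike \<open>positive_op\<close>, this carries boundedness and self-adjointness with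
  it.\<close>

definition pos_op :: "('h::complex_hilbert_space \<Rightarrow> 'h) \<Rightarrow> bool" where
  "pos_op T \<longleftrightarrow> selfadj T \<and> (\<forall>x. 0 \<le> Re (cinner (T x) x))"

lemma pos_op_selfadj: "pos_op T \<Longrightarrow> selfadj T"
  and pos_op_clinear: "pos_op T \<Longrightarrow> bounded_clinear T"
  and pos_op_nonneg: "pos_op T \<Longrightarrow> 0 \<le> Re (cinner (T x) x)"
  by (auto simp: pos_op_def selfadj_def)

lemma pos_op_positive: "pos_op T \<Longrightarrow> positive_op T"
  by (auto simp: positive_op_def nonneg_Reals_iff pos_op_nonneg selfadj_Im pos_op_selfadj)

lemma proj_pos: "projection_op p \<Longrightarrow> pos_op p"
  by (simp add: pos_op_def proj_selfadj flip: proj_norm_sq)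

lemma selfadj_plus: "selfadj S \<Longrightarrow> selfadj T \<Longrightarrow> selfadj (\<lambda>h. S h + T h)"
  and selfadj_minus: "selfadj S \<Longrightarrow> selfadj T \<Longrightarrow> selfadj (\<lambda>h. S h - T h)"
  and selfadj_scale: "selfadj S \<Longrightarrow> selfadj (\<lambda>h. r *\<^sub>R S h)"
  and selfadj_id: "selfadj (\<lambda>h. h)" and selfadj_0: "selfadj (\<lambda>h. 0)"
  by (simp_all add: selfadj_def bounded_clinear_plus bounded_clinear_sub bounded_clinear_scale_real bounded_clinear_id
      bounded_clinear_0 cinner_simps)

lemma selfadj_comp: "selfadj S \<Longrightarrow> selfadj T \<Longrightarrow> (\<And>h. S (T h) = T (S h)) \<Longrightarrow> selfadj (\<lambda>h. S (T h))"
  by (simp add: selfadj_def bounded_clinear_compose)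

lemma selfadj_sq_pos: "selfadj T \<Longrightarrow> pos_op (\<lambda>h. T (T h))"
  by (simp add: pos_op_def selfadj_comp) (simp add: selfadjD cinner_self)

text \<open>Nonnegativity of the form at \<open>x - T x / K\<close> gives the bound. It replaces an
  argument through the square root of \<open>T\<close>, which does not exist yet.\<close>

lemma pos_norm_sq_le:
  assumes T: "pos_op T" and K: "0 < K" "\<And>x. norm (T x) \<le> K * norm x"
  shows "(norm (T x))\<^sup>2 \<le> K * Re (cinner (T x) x)"
proof -
  define t where "t = 1 / K"
  let ?y = "x - t *\<^sub>R T x"
  have sa: "cinner (T a) b = cinner a (T b)" for a b using T by (simp add: pos_op_def selfadjD)
  note lin = bounded_clinear_simps[OF pos_op_clinear[OF T]]
  have "0 \<le> Re (cinner (T ?y) ?y)" by (rule pos_op_nonneg[OF T])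
  also have "\<dots> = Re (cinner (T x) x) - 2 * t * (norm (T x))\<^sup>2 + t\<^sup>2 * Re (cinner (T (T x)) (T x))"
    by (simp add: lin cinner_diff_left cinner_diff_right cinner_scaleR_left cinner_scaleR_right cinner_self_Re
        sa[of "T x" x] power2_eq_square algebra_simps)
  also have "\<dots> \<le> Re (cinner (T x) x) - 2 * t * (norm (T x))\<^sup>2 + t\<^sup>2 * (K * (norm (T x))\<^sup>2)"
  proof -
    have "Re (cinner (T (T x)) (T x)) \<le> norm (T (T x)) * norm (T x)"
      using cauchy_schwarz complex_Re_le_cmod order_trans by blast
    also have "\<dots> \<le> K * norm (T x) * norm (T x)" by (intro mult_right_mono K) simp
    finally have "Re (cinner (T (T x)) (T x)) \<le> K * (norm (T x))\<^sup>2" by (simp add: power2_eq_square mult.assoc)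
    then show ?thesis by (intro add_left_mono mult_left_mono) auto
  qed
  also have "\<dots> = Re (cinner (T x) x) - 1 / K * (norm (T x))\<^sup>2"
    using K by (simp add: field_simps power2_eq_square t_def)
  finally show ?thesis using K by (simp add: field_simps)
qed

lemma pos_zero_iff: assumes T: "pos_op T" shows "T x = 0 \<longleftrightarrow> Re (cinner (T x) x) = 0"
proof -
  obtain K where "0 < K" "\<And>x. norm (T x) \<le> K * norm x" using bounded_clinear_bound[OF pos_op_clinear[OF T]] by blast
  from pos_norm_sq_le[OF T this, of x] show ?thesis by auto
qed

text \<open>With \<open>Q = 1 - B\<close> and a root written as \<open>1 - L\<close>, the equation
  becomes \<open>L = (B + L L) / 2\<close>, solved by iteration from zero. The iterates are
  polynomials in \<open>B\<close>, so whatever commutes with \<open>Q\<close> commutes with the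
  root; this clause stands in for a functional calculus.\<close>

lemma sqrt_exists_contraction:
  assumes Q: "pos_op Q" and Q1: "\<And>x. norm (Q x) \<le> norm x"
  shows "\<exists>S. pos_op S \<and> (\<forall>h. S (S h) = Q h) \<and>
    (\<forall>K. bounded_clinear K \<longrightarrow> (\<forall>h. K (Q h) = Q (K h)) \<longrightarrow> (\<forall>h. K (S h) = S (K h)))"
proof -
  define B where "B = (\<lambda>h. h - Q h)"
  have sB: "selfadj B" unfolding B_def by (intro selfadj_minus selfadj_id pos_op_selfadj[OF Q])
  have B1: "norm (B x) \<le> norm x" for x
  proof (rule power2_le_imp_le)
    have "(norm (Q x))\<^sup>2 \<le> Re (cinner (Q x) x)" using pos_norm_sq_le[OF Q, of 1 x] Q1 by simp
    then show "(norm (B x))\<^sup>2 \<le> (norm x)\<^sup>2"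
      using pos_op_nonneg[OF Q, of x] Re_cinner_commute[of x "Q x"] by (simp add: B_def norm_diff_sq)
  qed simp
  define Z where "Z = rec_nat (\<lambda>h. 0) (\<lambda>n Zn h. (1/2) *\<^sub>R (B h + Zn (Zn h)))"
  have Z0: "Z 0 = (\<lambda>h. 0)" and ZS: "\<And>n. Z (Suc n) = (\<lambda>h. (1/2) *\<^sub>R (B h + Z n (Z n h)))" by (simp_all add: Z_def)
  \<comment> \<open>The scalar iteration with \<open>B = 1\<close>. It majorizes the norms of the
    iterates and of their increments, so the convergence of one bounded increasing real sequence
    carries over to the operators.\<close>
  define z where "z = rec_nat 0 (\<lambda>n zn. (1/2) * (1 + zn * zn) :: real)"
  have z0: "z 0 = 0" and zS: "\<And>n. z (Suc n) = (1/2) * (1 + z n * z n)" by (simp_all add: z_def)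
  have z: "0 \<le> z n \<and> z n \<le> 1" for n
    by (induction n) (auto simp: z0 zS mult_le_one)
  have lZ: "selfadj (Z n)" for n
  proof (induction n)
    case (Suc n)
    show ?case unfolding ZS by (rule selfadj_scale, rule selfadj_plus, rule sB, rule selfadj_comp, rule Suc, rule Suc, rule refl)
  qed (simp add: Z0 selfadj_0)
  note lin = bounded_clinear_simps[OF selfadj_clinear[OF lZ]]
  have comm: "K (Z n h) = Z n (K h)" if K: "bounded_clinear K" "\<And>h. K (B h) = B (K h)" for K n h
    by (induction n arbitrary: h) (simp_all add: Z0 ZS bounded_clinear_simps[OF K(1)] K(2))
  have cZ: "Z m (Z n h) = Z n (Z m h)" for m n h
    by (rule comm) (auto simp: selfadj_clinear[OF lZ] intro!: comm[symmetric] selfadj_clinear[OF sB])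
  have Zn: "norm (Z n x) \<le> z n * norm x" for n x
  proof (induction n arbitrary: x)
    case (Suc n)
    have "norm (Z n (Z n x)) \<le> z n * (z n * norm x)"
      using Suc[of "Z n x"] mult_left_mono[OF Suc[of x], of "z n"] z[of n] by linarith
    moreover have "norm (Z (Suc n) x) = (1/2) * norm (B x + Z n (Z n x))" by (simp add: ZS)
    ultimately show ?case using norm_triangle_ineq[of "B x" "Z n (Z n x)"] B1[of x] by (simp add: zS algebra_simps)
  qed (simp add: Z0 z0)
  have step: "norm (Z (Suc n) x - Z n x) \<le> (z (Suc n) - z n) * norm x" for n x
  proof (induction n arbitrary: x)
    case 0 then show ?case using B1[of x] by (simp add: Z0 ZS z0 zS)
  next
    case (Suc n)
    let ?d = "Z (Suc n) x - Z n x"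
    have "Z (Suc (Suc n)) x - Z (Suc n) x = (1/2) *\<^sub>R (Z (Suc n) (Z (Suc n) x) - Z n (Z n x))"
      by (simp add: ZS[of "Suc n"] ZS[of n] scaleR_diff_right[symmetric])
    also have "Z (Suc n) (Z (Suc n) x) - Z n (Z n x) = Z (Suc n) ?d + Z n ?d"
      by (simp add: lin cZ[of n "Suc n"])
    finally have "norm (Z (Suc (Suc n)) x - Z (Suc n) x) \<le> (1/2) * (norm (Z (Suc n) ?d) + norm (Z n ?d))"
      using norm_triangle_ineq[of "Z (Suc n) ?d" "Z n ?d"] by simp
    also have "\<dots> \<le> (1/2) * (z (Suc n) * norm ?d + z n * norm ?d)"
      using Zn[of "Suc n" ?d] Zn[of n ?d] by simp
    also have "\<dots> \<le> (1/2) * (z (Suc n) + z n) * ((z (Suc n) - z n) * norm x)"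
      using mult_left_mono[OF Suc[of x], of "(1/2) * (z (Suc n) + z n)"] z[of n] z[of "Suc n"] by (simp add: algebra_simps)
    also have "\<dots> = (z (Suc (Suc n)) - z (Suc n)) * norm x"
      by (simp add: zS[of "Suc n"] zS[of n] field_simps)
    finally show ?case .
  qed
  have diff: "norm (Z n x - Z m x) \<le> (z n - z m) * norm x" if "m \<le> n" for m n x
    using that
  proof (induction n rule: dec_induct)
    case (step n)
    have "norm (Z (Suc n) x - Z m x) \<le> norm (Z (Suc n) x - Z n x) + norm (Z n x - Z m x)"
      by (metis (no_types) add_diff_cancel_left' diff_add_cancel diff_diff_eq2 norm_triangle_ineq add.commute diff_add_eq)
    then show ?case using step \<open>\<And>n x. norm (Z (Suc n) x - Z n x) \<le> (z (Suc n) - z n) * norm x\<close>[of n x]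
      by (simp add: algebra_simps)
  qed simp
  have inc: "incseq z"
  proof (rule incseq_SucI)
    fix n have "0 \<le> (1 - z n) * (1 - z n)" by simp
    then show "z n \<le> z (Suc n)" by (simp add: zS algebra_simps)
  qed
  then obtain l where "z \<longlonglongrightarrow> l" using incseq_convergent[of z 1] z by blast
  then have "convergent z" by (auto simp: convergent_def)
  then have "Cauchy z" by (simp add: Cauchy_convergent_iff)
  have "convergent (\<lambda>n. Z n x)" for x
  proof (rule Cauchy_convergent, rule metric_CauchyI)
    fix e :: real assume e: "0 < e"
    then have "0 < e / (1 + norm x)" by (simp add: add_pos_nonneg)
    from metric_CauchyD[OF \<open>Cauchy z\<close> this] obtain M where
      M: "\<And>m n. M \<le> m \<Longrightarrow> M \<le> n \<Longrightarrow> \<bar>z m - z n\<bar> < e / (1 + norm x)" by (auto simp: dist_real_def)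
    have "norm (Z n x - Z m x) < e" if "M \<le> m" "m \<le> n" for m n
    proof -
      have "norm (Z n x - Z m x) \<le> \<bar>z n - z m\<bar> * (1 + norm x)"
        using diff[OF that(2), of x] by (smt (verit) abs_ge_self mult_mono norm_ge_zero)
      also have "\<dots> < e" using M[of n m] that by (simp add: pos_less_divide_eq add_pos_nonneg)
      finally show ?thesis .
    qed
    then have "dist (Z m x) (Z n x) < e" if "M \<le> m" "M \<le> n" for m n
      using that by (metis dist_commute dist_norm linear)
    then show "\<exists>M. \<forall>m\<ge>M. \<forall>n\<ge>M. dist (Z m x) (Z n x) < e" by blast
  qed
  then obtain L where lim: "\<And>x. (\<lambda>n. Z n x) \<longlonglongrightarrow> L x" unfolding convergent_def by metis
  have Zn1: "norm (Z n x) \<le> 1 * norm x" for n x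
    using Zn[of n x] z[of n] mult_right_mono[of "z n" 1 "norm x"] by simp
  note L = pointwise_limit_clinear[OF selfadj_clinear[OF lZ] Zn1 lim]
  have sL: "cinner (L x) y = cinner x (L y)" for x y
  proof -
    have "(\<lambda>n. cinner (Z n x) y) \<longlonglongrightarrow> cinner (L x) y" by (intro tendsto_cinner lim tendsto_const)
    moreover have "(\<lambda>n. cinner x (Z n y)) \<longlonglongrightarrow> cinner x (L y)" by (intro tendsto_cinner lim tendsto_const)
    ultimately show ?thesis using LIMSEQ_unique by (simp add: selfadjD[OF lZ])
  qed
  have LL: "L x = (1/2) *\<^sub>R (B x + L (L x))" for x
  proof -
    have "(\<lambda>n. Z n (Z n x - L x)) \<longlonglongrightarrow> 0"
    proof (rule Lim_null_comparison)
      show "eventually (\<lambda>n. norm (Z n (Z n x - L x)) \<le> norm (Z n x - L x)) sequentially"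
        using Zn1 by simp
      show "(\<lambda>n. norm (Z n x - L x)) \<longlonglongrightarrow> 0" using lim by (simp add: tendsto_norm_zero LIM_zero)
    qed
    from tendsto_add[OF this lim[of "L x"]] have "(\<lambda>n. Z n (Z n x)) \<longlonglongrightarrow> L (L x)" by (simp add: lin)
    then have "(\<lambda>n. Z (Suc n) x) \<longlonglongrightarrow> (1/2) *\<^sub>R (B x + L (L x))"
      unfolding ZS by (intro tendsto_intros)
    then show ?thesis using LIMSEQ_unique LIMSEQ_Suc[OF lim[of x]] by blast
  qed
  let ?S = "\<lambda>h. h - L h"
  have "selfadj ?S" by (intro selfadj_minus selfadj_id) (simp add: selfadj_def L sL)
  moreover have "0 \<le> Re (cinner (?S x) x)" for x
  proof -
    have "Re (cinner (L x) x) \<le> norm (L x) * norm x"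
      using cauchy_schwarz complex_Re_le_cmod order_trans by blast
    also have "\<dots> \<le> norm x * norm x" using L(2)[of x] by (simp add: mult_right_mono)
    finally show ?thesis by (simp add: cinner_diff_left cinner_self power2_eq_square)
  qed
  moreover have "?S (?S h) = Q h" for h
  proof -
    have "L (L h) = 2 *\<^sub>R L h - B h" using LL[of h] by (metis add_diff_cancel_left' divide_self_if one_neq_zero scaleR_one scaleR_scaleR times_divide_eq_right mult_1_right zero_neq_numeral)
    then show ?thesis by (simp add: bounded_clinear_diff[OF L(1)] B_def scaleR_2)
  qed
  moreover have "K (?S h) = ?S (K h)" if K: "bounded_clinear K" "\<forall>h. K (Q h) = Q (K h)" for K h
  proof -
    have "K (B h) = B (K h)" for h using K by (simp add: B_def bounded_clinear_diff)
    then have "(\<lambda>n. K (Z n h)) \<longlonglongrightarrow> L (K h)" using comm[OF K(1)] lim[of "K h"] by simp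
    then have "K (L h) = L (K h)" using bounded_clinear_tendsto[OF K(1) lim] LIMSEQ_unique by blast
    then show ?thesis by (simp add: bounded_clinear_diff[OF K(1)])
  qed
  ultimately show ?thesis unfolding pos_op_def by (intro exI[of _ ?S] conjI allI impI) simp_all
qed

lemma sqrt_exists:
  assumes Q: "pos_op Q"
  shows "\<exists>S. pos_op S \<and> (\<forall>h. S (S h) = Q h) \<and>
    (\<forall>K. bounded_clinear K \<longrightarrow> (\<forall>h. K (Q h) = Q (K h)) \<longrightarrow> (\<forall>h. K (S h) = S (K h)))"
proof -
  obtain c where c: "0 < c" "\<And>x. norm (Q x) \<le> c * norm x" using bounded_clinear_bound[OF pos_op_clinear[OF Q]] by blast
  let ?Q = "\<lambda>h. (1/c) *\<^sub>R Q h"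
  have "pos_op ?Q" using Q c by (auto simp: pos_op_def selfadj_scale cinner_scaleR_left)
  moreover have "norm (?Q x) \<le> norm x" for x using c by (simp add: field_simps)
  ultimately obtain S where S: "pos_op S" "\<And>h. S (S h) = ?Q h"
    "\<And>K h. bounded_clinear K \<Longrightarrow> (\<forall>h. K (?Q h) = ?Q (K h)) \<Longrightarrow> K (S h) = S (K h)"
    using sqrt_exists_contraction[of ?Q] by blast
  let ?S = "\<lambda>h. sqrt c *\<^sub>R S h"
  have "pos_op ?S" using S(1) c by (auto simp: pos_op_def selfadj_scale cinner_scaleR_left)
  moreover have "?S (?S h) = Q h" for h
    using c S(2) by (simp add: bounded_clinear_scaleR[OF pos_op_clinear[OF S(1)]])
  moreover have "K (?S h) = ?S (K h)" if "bounded_clinear K" "\<forall>h. K (Q h) = Q (K h)" for K h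
    using S(3)[OF that(1)] that by (simp add: bounded_clinear_scaleR)
  ultimately show ?thesis by blast
qed

definition sqrt_op :: "('h::complex_hilbert_space \<Rightarrow> 'h) \<Rightarrow> 'h \<Rightarrow> 'h" where
  "sqrt_op Q = (SOME S. pos_op S \<and> (\<forall>h. S (S h) = Q h) \<and>
    (\<forall>K. bounded_clinear K \<longrightarrow> (\<forall>h. K (Q h) = Q (K h)) \<longrightarrow> (\<forall>h. K (S h) = S (K h))))"

lemma sqrt_op: assumes "pos_op Q"
  shows "pos_op (sqrt_op Q)" "sqrt_op Q (sqrt_op Q h) = Q h"
    "bounded_clinear K \<Longrightarrow> (\<And>h. K (Q h) = Q (K h)) \<Longrightarrow> K (sqrt_op Q h) = sqrt_op Q (K h)"
  using someI_ex[OF sqrt_exists[OF assms]] unfolding sqrt_op_def by blast+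

text \<open>The form of the product at \<open>x\<close> is the form of \<open>P\<close> at the image
  of \<open>x\<close> under the root of \<open>Q\<close>; that root commutes with \<open>P\<close>
  because \<open>Q\<close> does.\<close>

lemma pos_comp: assumes P: "pos_op P" and Q: "pos_op Q" and c: "\<And>h. P (Q h) = Q (P h)"
  shows "pos_op (\<lambda>h. P (Q h))"
  unfolding pos_op_def
proof (intro conjI allI)
  show "selfadj (\<lambda>h. P (Q h))" using P Q c by (auto intro: selfadj_comp pos_op_selfadj)
  fix x
  have "P (sqrt_op Q h) = sqrt_op Q (P h)" for h using sqrt_op(3)[OF Q pos_op_clinear[OF P]] c by blast
  then have "cinner (P (Q x)) x = cinner (P (sqrt_op Q x)) (sqrt_op Q x)"
    by (metis Q selfadjD pos_op_selfadj sqrt_op(1,2))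
  then show "0 \<le> Re (cinner (P (Q x)) x)" using pos_op_nonneg[OF P] by simp
qed

text \<open>For \<open>y = S x - R x\<close> commutation gives
  \<open>S y + R y = S (S x) - R (R x) = 0\<close>. Two nonnegative forms at \<open>y\<close> with
  sum zero both vanish, so \<open>S y = R y = 0\<close> and \<open>y\<close> is orthogonal to
  itself.\<close>

lemma sqrt_op_unique: assumes S: "pos_op S" and sq: "\<And>h. S (S h) = Q h" and Q: "pos_op Q"
  shows "S = sqrt_op Q"
proof
  fix x
  let ?R = "sqrt_op Q"
  note R = sqrt_op[OF Q]
  note linS = bounded_clinear_simps[OF pos_op_clinear[OF S]] and linR = bounded_clinear_simps[OF pos_op_clinear[OF R(1)]]
  have c: "S (?R h) = ?R (S h)" for h by (rule R(3)[OF pos_op_clinear[OF S]]) (metis sq)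
  let ?y = "S x - ?R x"
  have "S ?y + ?R ?y = 0" by (simp add: linS linR c sq R(2))
  then have "Re (cinner (S ?y) ?y) + Re (cinner (?R ?y) ?y) = 0"
    by (metis cinner_add_left cinner_zero_left plus_complex.sel(1) zero_complex.sel(1))
  then have "Re (cinner (S ?y) ?y) = 0" "Re (cinner (?R ?y) ?y) = 0"
    using pos_op_nonneg[OF S, of ?y] pos_op_nonneg[OF R(1), of ?y] by linarith+
  then have "S ?y = 0" "?R ?y = 0" using pos_zero_iff S R(1) by blast+
  then have "cinner ?y ?y = 0"
    by (metis (no_types, lifting) S R(1) cinner_diff_left cinner_zero_right diff_self pos_op_selfadj selfadjD)
  then show "S x = ?R x" by (simp add: cinner_self)
qed

text \<open>Let \<open>A\<close> be the root of \<open>T T\<close>; \<open>F\<close> projects onto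
  the kernel of \<open>A + T\<close>. There \<open>T = - A\<close>, and since
  \<open>(A + T) (A - T) = 0\<close> the operator equals \<open>A\<close> on the complement. The
  kernel of \<open>T\<close> goes to \<open>F\<close>, which is why the second sign is
  strict.\<close>

lemma spectral_projection_exists:
  assumes T: "selfadj T"
  shows "\<exists>F. projection_op F \<and> (\<forall>K. bounded_clinear K \<longrightarrow> (\<forall>h. K (T h) = T (K h)) \<longrightarrow> (\<forall>h. K (F h) = F (K h))) \<and>
    (\<forall>h. F h = h \<longrightarrow> Re (cinner (T h) h) \<le> 0) \<and> (\<forall>h. F h = 0 \<longrightarrow> h \<noteq> 0 \<longrightarrow> 0 < Re (cinner (T h) h))"
proof -
  define A where "A = sqrt_op (\<lambda>h. T (T h))"
  note A = sqrt_op[OF selfadj_sq_pos[OF T], folded A_def]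
  note lT = bounded_clinear_simps[OF selfadj_clinear[OF T]] and lA = bounded_clinear_simps[OF pos_op_clinear[OF A(1)]]
  have cA: "K (A h) = A (K h)" if "bounded_clinear K" "\<And>h. K (T h) = T (K h)" for K h
    using A(3)[OF that(1)] that(2) by metis
  have AT: "T (A h) = A (T h)" for h by (rule cA) (use T selfadj_clinear in auto)
  define S where "S = {h. A h + T h = 0}"
  have S: "csubspace S"
  proof -
    have "A (x + y) + T (x + y) = (A x + T x) + (A y + T y)" for x y by (simp add: lA lT)
    moreover have "A (c *\<^sub>C x) + T (c *\<^sub>C x) = c *\<^sub>C (A x + T x)" for c x by (simp add: lA lT scaleC_add_right)
    ultimately show ?thesis by (simp add: S_def csubspace_def lA(4) lT(4))
  qed
  have S': "closed S" unfolding S_def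
    by (intro closed_Collect_eq continuous_intros bounded_clinear_continuous selfadj_clinear[OF T] pos_op_clinear[OF A(1)])
  let ?F = "orth_proj S"
  have comm: "K (?F h) = ?F (K h)" if K: "bounded_clinear K" "\<And>h. K (T h) = T (K h)" for K h
  proof -
    have K': "badjoint K (T h) = T (badjoint K h)" for h
      by (rule cinner_ext) (simp add: cinner_badjoint'[OF K(1)] selfadjD[OF T] K(2))
    have inv: "L h \<in> S" if "bounded_clinear L" "\<And>h. L (T h) = T (L h)" "h \<in> S" for L h
    proof -
      have "A (L h) + T (L h) = L (A h) + L (T h)" using cA[OF that(1,2)] that(2) by simp
      also have "\<dots> = L (A h + T h)" by (rule bounded_clinear_add[OF that(1), symmetric])
      also have "\<dots> = 0" using that(3) by (simp add: S_def bounded_clinear_zero[OF that(1)])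
      finally show ?thesis by (simp add: S_def)
    qed
    show ?thesis
      by (rule orth_proj_commute[OF S S' K(1), symmetric])
         (erule inv[OF K], erule inv[OF bounded_clinear_badjoint[OF K(1)] K'])
  qed
  have neg: "Re (cinner (T h) h) \<le> 0" if "?F h = h" for h
  proof -
    have "A h + T h = 0" using that orth_proj_eq_iff[OF S S'] by (simp add: S_def)
    then have "T h = - A h" by (simp add: eq_neg_iff_add_eq_0 add.commute)
    then show ?thesis using pos_op_nonneg[OF A(1)] by (simp add: cinner_minus_left)
  qed
  have pos: "0 < Re (cinner (T h) h)" if "?F h = 0" "h \<noteq> 0" for h
  proof -
    have cl: "bounded_clinear (\<lambda>h. A h - T h)" by (intro bounded_clinear_sub pos_op_clinear[OF A(1)] selfadj_clinear[OF T])
    have "A h - T h \<in> S" by (simp add: S_def lA lT A(2) AT)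
    then have "A h - T h = ?F (A h - T h)" using orth_proj_eq_iff[OF S S'] by metis
    also have "\<dots> = A (?F h) - T (?F h)" by (rule comm[OF cl, symmetric]) (simp add: lT AT)
    finally have eq: "A h = T h" using that by (simp add: lA lT)
    have "Re (cinner (A h) h) \<noteq> 0"
    proof
      assume "Re (cinner (A h) h) = 0"
      then have "A h = 0" using pos_zero_iff[OF A(1)] by blast
      then have "h \<in> S" using eq by (simp add: S_def)
      then show False using that orth_proj_eq_iff[OF S S'] by metis
    qed
    then show ?thesis using pos_op_nonneg[OF A(1), of h] eq by simp
  qed
  show ?thesis
  proof (intro exI[of _ ?F] conjI allI impI)
    show "projection_op ?F" by (rule orth_proj_projection[OF S S'])
    show "K (?F h) = ?F (K h)" if "bounded_clinear K" "\<forall>h. K (T h) = T (K h)" for K h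
      using comm[OF that(1)] that(2) by blast
    show "Re (cinner (T h) h) \<le> 0" if "?F h = h" for h by (rule neg[OF that])
    show "0 < Re (cinner (T h) h)" if "?F h = 0" "h \<noteq> 0" for h by (rule pos[OF that])
  qed
qed

text \<open>Self-adjointness and injectivity make the range dense; the lower bound lets preimages of
  a convergent sequence converge, so the range is everything.\<close>

lemma selfadj_inverse:
  assumes T: "selfadj T" and c: "0 < c" "\<And>h. c * norm h \<le> norm (T h)"
  shows "\<exists>I. bounded_clinear I \<and> (\<forall>h. T (I h) = h) \<and> (\<forall>h. I (T h) = h)"
proof -
  note lT = bounded_clinear_simps[OF selfadj_clinear[OF T]]
  have inj: "x = y" if "T x = T y" for x y
    using c(2)[of "x - y"] that c(1) by (simp add: lT mult_le_0_iff)
  have sub: "csubspace (range T)"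
    unfolding csubspace_def
  proof (intro conjI ballI allI)
    show "0 \<in> range T" by (metis lT(4) rangeI)
    fix x y c assume "x \<in> range T" "y \<in> range T"
    then obtain a b where ab: "x = T a" "y = T b" by blast
    show "x + y \<in> range T" unfolding ab lT(1)[symmetric] by (rule rangeI)
    show "c *\<^sub>C x \<in> range T" unfolding ab lT(6)[symmetric] by (rule rangeI)
  qed
  have "closure (range T) = UNIV"
    unfolding csubspace_dense_iff[OF sub]
  proof (intro allI impI)
    fix h assume "\<forall>b\<in>range T. cinner h b = 0"
    then have "cinner (T h) (T h) = 0" by (simp add: selfadjD[OF T])
    then have "T h = T 0" by (simp add: lT cinner_self)
    then show "h = 0" by (rule inj)
  qed
  have "\<exists>x. T x = h" for h
  proof -
    have "h \<in> closure (range T)" using \<open>closure (range T) = UNIV\<close> by simp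
    then obtain f where f: "\<And>n. f n \<in> range T" "f \<longlonglongrightarrow> h" unfolding closure_sequential by blast
    then have "\<forall>n. \<exists>x. f n = T x" by blast
    then obtain g where g: "\<And>n. f n = T (g n)" by metis
    have "Cauchy f" by (rule LIMSEQ_imp_Cauchy[OF f(2)])
    have "Cauchy g"
    proof (rule metric_CauchyI)
      fix e :: real assume "0 < e"
      then have "0 < c * e" using c by simp
      from metric_CauchyD[OF \<open>Cauchy f\<close> this] obtain M where M: "\<forall>m\<ge>M. \<forall>n\<ge>M. dist (f m) (f n) < c * e" by blast
      have "dist (g m) (g n) < e" if "M \<le> m" "M \<le> n" for m n
      proof -
        have "c * norm (g m - g n) \<le> norm (f m - f n)" using c(2)[of "g m - g n"] by (simp add: g lT)
        also have "\<dots> < c * e" using M that by (simp add: dist_norm)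
        finally show ?thesis using c(1) by (simp add: dist_norm)
      qed
      then show "\<exists>M. \<forall>m\<ge>M. \<forall>n\<ge>M. dist (g m) (g n) < e" by blast
    qed
    then obtain x where "g \<longlonglongrightarrow> x" unfolding convergent_eq_Cauchy[symmetric] by blast
    then have "(\<lambda>n. T (g n)) \<longlonglongrightarrow> T x" by (rule bounded_clinear_tendsto[OF selfadj_clinear[OF T]])
    then have "f \<longlonglongrightarrow> T x" by (simp flip: g)
    then have "T x = h" using f(2) by (rule LIMSEQ_unique)
    then show ?thesis ..
  qed
  then have "\<forall>h. \<exists>x. T x = h" by blast
  then obtain I where I: "\<And>h. T (I h) = h" by metis
  have "bounded_clinear I"
  proof (rule bounded_clinearI)
    show "I (x + y) = I x + I y" for x y by (rule inj) (simp add: lT I)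
    show "I (a *\<^sub>C x) = a *\<^sub>C I x" for a x by (rule inj) (simp add: lT I)
    show "norm (I x) \<le> (1/c) * norm x" for x using c(2)[of "I x"] c(1) by (simp add: I field_simps)
  qed
  moreover have "I (T h) = h" for h by (rule inj) (rule I)
  ultimately have "bounded_clinear I \<and> (\<forall>h. T (I h) = h) \<and> (\<forall>h. I (T h) = h)" using I by simp
  then show ?thesis by (rule exI[of _ I])
qed

text \<open>\<open>T G + (1 - G)\<close> is bounded below on the whole space by
  \<open>min c 1\<close>, hence invertible; composing its inverse with \<open>G\<close> inverts
  \<open>T\<close> on the range of \<open>G\<close>. The commutation clause later places these
  partial inverses in the algebra.\<close>

lemma selfadj_inverse_on:
  assumes T: "selfadj T" and G: "projection_op G" and TG: "\<And>h. T (G h) = G (T h)"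
    and c: "0 < c" "\<And>h. G h = h \<Longrightarrow> c * norm h \<le> norm (T h)"
  shows "\<exists>I. bounded_clinear I \<and> (\<forall>h. T (I h) = G h) \<and> (\<forall>h. G (I h) = I h) \<and> (\<forall>h. I (T h) = G h) \<and>
     (\<forall>h. norm (I h) \<le> (1/c) * norm h) \<and>
     (\<forall>K. bounded_clinear K \<longrightarrow> (\<forall>h. K (T h) = T (K h)) \<longrightarrow> (\<forall>h. K (G h) = G (K h)) \<longrightarrow> (\<forall>h. K (I h) = I (K h)))"
proof -
  note lT = bounded_clinear_simps[OF selfadj_clinear[OF T]] and lG = proj_simps[OF G]
  let ?T = "\<lambda>h. T (G h) + (h - G h)"
  have sT: "selfadj ?T"
    by (rule selfadj_plus[OF selfadj_comp[OF T proj_selfadj[OF G] TG] proj_selfadj[OF proj_perp[OF G]]])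
  have "min c 1 * norm h \<le> norm (?T h)" for h
  proof (rule power2_le_imp_le)
    have "cinner (T (G h)) (h - G h) = 0"
      by (simp add: TG proj_cinner[OF G] lG proj_idem[OF G])
    then have "(norm (?T h))\<^sup>2 = (norm (T (G h)))\<^sup>2 + (norm (h - G h))\<^sup>2" by (rule pythagoras)
    moreover have "(min c 1)\<^sup>2 * (norm (G h))\<^sup>2 \<le> (norm (T (G h)))\<^sup>2"
    proof -
      have "min c 1 * norm (G h) \<le> c * norm (G h)" by (intro mult_right_mono) auto
      then have "min c 1 * norm (G h) \<le> norm (T (G h))" using c(2)[of "G h"] proj_idem[OF G] by (smt (verit))
      then show ?thesis using c by (simp flip: power_mult_distrib add: power_mono)
    qed
    moreover have "(min c 1)\<^sup>2 * (norm (h - G h))\<^sup>2 \<le> (norm (h - G h))\<^sup>2"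
      using c by (intro mult_left_le_one_le) (auto simp: power_le_one)
    ultimately show "(min c 1 * norm h)\<^sup>2 \<le> (norm (?T h))\<^sup>2"
      using proj_pythagoras[OF G, of h] by (simp add: power_mult_distrib algebra_simps)
  qed simp
  moreover have "0 < min c 1" using c by simp
  ultimately have "\<exists>I. bounded_clinear I \<and> (\<forall>h. ?T (I h) = h) \<and> (\<forall>h. I (?T h) = h)"
    using selfadj_inverse[OF sT, of "min c 1"] by simp
  then obtain I where I: "bounded_clinear I" "\<And>h. ?T (I h) = h" "\<And>h. I (?T h) = h"
    by (elim exE conjE) simp
  note lI = bounded_clinear_simps[OF I(1)]
  have GI: "G (I h) = I (G h)" for h
  proof -
    have "I (?T (G (I h))) = I (G (?T (I h)))" by (simp add: lG TG proj_idem[OF G])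
    then show ?thesis by (simp only: I)
  qed
  let ?J = "\<lambda>h. I (G h)"
  have TJ: "T (?J h) = G h" for h
    using I(2)[of "G h"] GI[of "G h"] by (simp add: proj_idem[OF G])
  have GJ: "G (?J h) = ?J h" for h by (simp add: GI proj_idem[OF G])
  have JT: "?J (T h) = G h" for h
    using I(3)[of "G h"] by (simp add: proj_idem[OF G] TG)
  have "norm (?J h) \<le> (1/c) * norm h" for h
    using c(2)[OF GJ, of h] c(1) proj_norm_le[OF G, of h] by (simp add: TJ field_simps)
  moreover have "K (?J h) = ?J (K h)" if K: "bounded_clinear K" "\<forall>h. K (T h) = T (K h)" "\<forall>h. K (G h) = G (K h)" for K h
  proof -
    have "?J (T (K (?J h))) = G (K (?J h))" by (rule JT)
    moreover have "T (K (?J h)) = G (K h)" using K TJ by metis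
    moreover have "G (K (?J h)) = K (?J h)" using K GJ by metis
    ultimately show ?thesis by (simp add: proj_idem[OF G])
  qed
  ultimately show ?thesis using TJ GJ JT
    by (intro exI[of _ ?J] conjI allI impI bounded_clinear_compose[OF I(1) proj_clinear[OF G]]) simp_all
qed

section \<open>Closed operators and their absolute values\<close>

instantiation prod :: (complex_hilbert_space, complex_hilbert_space) complex_hilbert_space
begin

definition "c *\<^sub>C x = (c *\<^sub>C fst x, c *\<^sub>C snd x)"
definition "cinner x y = cinner (fst x) (fst y) + cinner (snd x) (snd y)"

instance
proof
  fix x y z :: "'a \<times> 'b" and c d :: complex and r :: real
  show "c *\<^sub>C (x + y) = c *\<^sub>C x + c *\<^sub>C y"
    by (simp add: scaleC_prod_def scaleC_add_right)
  show "(c + d) *\<^sub>C x = c *\<^sub>C x + d *\<^sub>C x"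
    by (simp add: scaleC_prod_def scaleC_add_left)
  show "c *\<^sub>C d *\<^sub>C x = (c * d) *\<^sub>C x"
    by (simp add: scaleC_prod_def scaleC_scaleC)
  show "complex_of_real r *\<^sub>C x = r *\<^sub>R x"
    by (simp add: scaleC_prod_def scaleC_of_real scaleR_prod_def)
  show "cinner x y = cnj (cinner y x)"
    by (simp add: cinner_prod_def) (metis cinner_commute)
  show "cinner (x + y) z = cinner x z + cinner y z"
    by (simp add: cinner_prod_def cinner_add_left)
  show "cinner (c *\<^sub>C x) y = c * cinner x y"
    by (simp add: cinner_prod_def scaleC_prod_def cinner_scaleC_left distrib_left)
  show "cinner x x = complex_of_real ((norm x)\<^sup>2)"
    by (simp add: cinner_prod_def cinner_self norm_prod_def)
qed

end

lemma scaleC_Pair: "c *\<^sub>C (a, b) = (c *\<^sub>C a, c *\<^sub>C b)"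
  and cinner_Pair: "cinner (a, b) (a', b') = cinner a a' + cinner b b'"
  by (simp_all add: scaleC_prod_def cinner_prod_def)

lemma norm_Pair_sq: "(norm (a, b))\<^sup>2 = (norm a)\<^sup>2 + (norm b)\<^sup>2"
  for a :: "'a::complex_hilbert_space" and b :: "'b::complex_hilbert_space"
  by (simp add: norm_Pair)

lemma linear_operator_csubspace: "linear_operator A \<Longrightarrow> csubspace A"
  by (auto simp: linear_operator_def csubspace_def zero_prod_def scaleC_Pair)

lemma linear_operatorD:
  assumes "linear_operator A"
  shows linear_operator_single: "(x, y) \<in> A \<Longrightarrow> (x, z) \<in> A \<Longrightarrow> y = z"
    and linear_operator_0: "(0, 0) \<in> A"
    and linear_operator_add: "(x, y) \<in> A \<Longrightarrow> (x', y') \<in> A \<Longrightarrow> (x + x', y + y') \<in> A"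
    and linear_operator_scaleC: "(x, y) \<in> A \<Longrightarrow> (c *\<^sub>C x, c *\<^sub>C y) \<in> A"
    and linear_operator_diff: "(x, y) \<in> A \<Longrightarrow> (x', y') \<in> A \<Longrightarrow> (x - x', y - y') \<in> A"
proof -
  show "(x, y) \<in> A \<Longrightarrow> (x, z) \<in> A \<Longrightarrow> y = z" "(0, 0) \<in> A"
    and ad: "(x, y) \<in> A \<Longrightarrow> (x', y') \<in> A \<Longrightarrow> (x + x', y + y') \<in> A"
    and sc: "(x, y) \<in> A \<Longrightarrow> (c *\<^sub>C x, c *\<^sub>C y) \<in> A" for x y x' y' z c
    using assms unfolding linear_operator_def by (blast dest: single_valuedD)+
  show "(x, y) \<in> A \<Longrightarrow> (x', y') \<in> A \<Longrightarrow> (x - x', y - y') \<in> A"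
    using ad[of x y "- x'" "- y'"] sc[of x' y' "-1"] by (simp add: scaleC_minus_one)
qed

lemma linear_operator_zero_domain: "linear_operator A \<Longrightarrow> (0, b) \<in> A \<Longrightarrow> b = 0"
  using linear_operator_single linear_operator_0 by blast

lemma Domain_csubspace: assumes A: "linear_operator A" shows "csubspace (Domain A)"
  unfolding csubspace_def
proof (intro conjI ballI allI)
  show "0 \<in> Domain A" using linear_operator_0[OF A] by blast
  show "x + y \<in> Domain A" if "x \<in> Domain A" "y \<in> Domain A" for x y
    using that linear_operator_add[OF A] by blast
  show "c *\<^sub>C x \<in> Domain A" if "x \<in> Domain A" for x c
    using that linear_operator_scaleC[OF A] by blast
qed

text \<open>The condition on the adjoint lets \<open>K\<close>, acting on both components, preserve
  the orthogonal complement of the graph as well as the graph.\<close>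

definition reduces :: "('h::complex_hilbert_space \<Rightarrow> 'h) \<Rightarrow> 'h operator \<Rightarrow> bool" where
  "reduces K X \<longleftrightarrow> bounded_clinear K \<and> (\<forall>a b. (a, b) \<in> X \<longrightarrow> (K a, K b) \<in> X \<and> (badjoint K a, badjoint K b) \<in> X)"

text \<open>For a closed densely defined \<open>X\<close>, the first component of the projection onto the graph
  of \<open>X\<close> is \<open>(1 + X*X)\<^sup>-\<^sup>1\<close>, so that all unbounded operators are reached through
  bounded ones.\<close>

definition resolv :: "'h::complex_hilbert_space operator \<Rightarrow> 'h \<Rightarrow> 'h" where
  "resolv X w = fst (orth_proj X (w, 0))"

text \<open>In terms of the absolute value \<open>a\<close> of \<open>X\<close>, \<open>opS\<close>
  is the inverse root of \<open>1 + a a\<close> and \<open>opC\<close> is \<open>a\<close> times it;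
  their squares sum to the identity. \<open>opV\<close> is the bounded product of \<open>X\<close>
  and \<open>opS\<close>.\<close>

definition opS :: "'h::complex_hilbert_space operator \<Rightarrow> 'h \<Rightarrow> 'h" where
  "opS X = sqrt_op (resolv X)"

definition opC :: "'h::complex_hilbert_space operator \<Rightarrow> 'h \<Rightarrow> 'h" where
  "opC X = sqrt_op (perp (resolv X))"

definition opV :: "'h::complex_hilbert_space operator \<Rightarrow> 'h \<Rightarrow> 'h" where
  "opV X h = (THE k. (opS X h, k) \<in> X)"

locale closed_op =
  fixes X :: "'h::complex_hilbert_space operator"
  assumes cdd: "closed_densely_defined X"
begin

lemma lin: "linear_operator X" and cl: "closed X" and dense: "closure (Domain X) = UNIV"
  using cdd by (auto simp: closed_densely_defined_def)

lemma sub: "csubspace X" by (rule linear_operator_csubspace[OF lin])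

abbreviation "R \<equiv> resolv X"
abbreviation "S \<equiv> opS X"
abbreviation "C \<equiv> opC X"
abbreviation "V \<equiv> opV X"
text \<open>The second component of the graph projection: \<open>X\<close> applied to
  \<open>R w\<close>.\<close>

definition "Q w = snd (orth_proj X (w, 0))"

lemma RQ: "orth_proj X (w, 0) = (R w, Q w)" by (simp add: resolv_def Q_def)

lemma RQ_in: "(R w, Q w) \<in> X" using orth_proj_in[OF sub cl, of "(w, 0)"] by (simp add: RQ)

lemma RQ_orth: "(a, b) \<in> X \<Longrightarrow> cinner (w - R w) a = cinner (Q w) b"
  using orth_proj_orth[OF sub cl, of "(a, b)" "(w, 0)"]
  by (simp add: RQ cinner_Pair cinner_minus_left)

lemma RQ_unique: "(a, b) \<in> X \<Longrightarrow> (\<And>x y. (x, y) \<in> X \<Longrightarrow> cinner (w - a) x = cinner b y) \<Longrightarrow> a = R w \<and> b = Q w"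
  using orth_proj_unique[OF sub cl, of "(a, b)" "(w, 0)"] by (auto simp: RQ cinner_Pair cinner_minus_left)

lemma P_proj: "projection_op (orth_proj X)" by (rule orth_proj_projection[OF sub cl])

lemma R_clinear: "bounded_clinear R"
proof (rule bounded_clinearI)
  show "R (x + y) = R x + R y" for x y
    using proj_simps(1)[OF P_proj, of "(x, 0)" "(y, 0)"] by (simp add: RQ)
  show "R (c *\<^sub>C x) = c *\<^sub>C R x" for c x
    using proj_simps(4)[OF P_proj, of c "(x, 0)"] by (simp add: RQ scaleC_Pair)
  show "norm (R x) \<le> 1 * norm x" for x
    using proj_norm_le[OF P_proj, of "(x, 0)"] norm_fst_le[of "R x" "Q x"] by (simp add: RQ)
qed

lemma cinner_R: "cinner (R w) v = cinner (orth_proj X (w, 0)) (v, 0)" by (simp add: RQ cinner_Pair)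

lemma R_selfadj: "selfadj R"
  unfolding selfadj_def
proof (intro conjI allI R_clinear)
  fix x y
  have "cinner (orth_proj X (x, 0)) (y, 0) = cinner (x, 0) (orth_proj X (y, 0))" by (rule proj_cinner[OF P_proj])
  then show "cinner (R x) y = cinner x (R y)" by (simp add: RQ cinner_Pair)
qed

lemma R_form: "Re (cinner (R w) w) = (norm (orth_proj X (w, 0)))\<^sup>2"
  by (simp add: cinner_R proj_norm_sq[OF P_proj])

lemma R_pos: "pos_op R" by (simp add: pos_op_def R_selfadj R_form)

lemma R'_pos: "pos_op (perp R)"
proof -
  have "(norm (orth_proj X (x, 0)))\<^sup>2 \<le> (norm x)\<^sup>2" for x
    using proj_norm_le[OF P_proj, of "(x, 0)"] by (simp add: power_mono)
  then show ?thesis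
    by (simp add: pos_op_def selfadj_minus selfadj_id R_selfadj cinner_diff_left R_form cinner_self_Re)
qed

text \<open>If \<open>R w = 0\<close> then \<open>(w, 0)\<close> is orthogonal to the whole graph,
  so \<open>w\<close> is orthogonal to the dense domain.\<close>

lemma R_inj: assumes "R w = 0" shows "w = 0"
proof -
  have "orth_proj X (w, 0) = 0" using R_form[of w] assms by simp
  then have "Q w = 0" by (simp add: RQ zero_prod_def)
  then have "cinner w a = 0" if "a \<in> Domain X" for a
    using RQ_orth[of a _ w] that assms by auto
  then show ?thesis using dense csubspace_dense_iff[OF Domain_csubspace[OF lin]] by blast
qed

lemma S_pos: "pos_op S" and SS: "S (S h) = R h"
  and C_pos: "pos_op C" and CC: "C (C h) = h - R h"
  using sqrt_op[OF R_pos] sqrt_op[OF R'_pos] by (simp_all add: opS_def opC_def)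

lemma comm_S: "bounded_clinear K \<Longrightarrow> (\<And>h. K (R h) = R (K h)) \<Longrightarrow> K (S h) = S (K h)"
  unfolding opS_def by (rule sqrt_op(3)[OF R_pos])

lemma comm_C: "bounded_clinear K \<Longrightarrow> (\<And>h. K (R h) = R (K h)) \<Longrightarrow> K (C h) = C (K h)"
  unfolding opC_def by (rule sqrt_op(3)[OF R'_pos]) (simp_all add: bounded_clinear_diff)

lemma S_selfadj: "selfadj S" and C_selfadj: "selfadj C" and S_clinear: "bounded_clinear S" and C_clinear: "bounded_clinear C"
  using S_pos C_pos by (auto simp: pos_op_selfadj pos_op_clinear)

lemmas S_lin = bounded_clinear_simps[OF S_clinear] and C_lin = bounded_clinear_simps[OF C_clinear]

lemma SR: "S (R h) = R (S h)" by (simp flip: SS)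

lemma SC: "C (S h) = S (C h)"
  by (rule comm_C[OF S_clinear SR, symmetric])

lemma SS_CC: "S (S h) + C (C h) = h" by (simp add: SS CC)

lemma norm_S_C: "(norm (S h))\<^sup>2 + (norm (C h))\<^sup>2 = (norm h)\<^sup>2"
proof -
  have "cinner (S h) (S h) + cinner (C h) (C h) = cinner (S (S h) + C (C h)) h"
    by (simp add: cinner_add_left selfadjD[OF S_selfadj, of "S h"] selfadjD[OF C_selfadj, of "C h"])
  then have "complex_of_real ((norm (S h))\<^sup>2 + (norm (C h))\<^sup>2) = complex_of_real ((norm h)\<^sup>2)"
    by (simp only: SS_CC cinner_self of_real_add)
  then show ?thesis by (simp only: of_real_eq_iff)
qed

lemma C_norm: "norm (C h) \<le> norm h"
  using norm_S_C[of h] zero_le_power2[of "norm (S h)"]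
  by (intro power2_le_imp_le[OF _ norm_ge_zero]) linarith

lemma S_inj: assumes "S h = 0" shows "h = 0"
  by (rule R_inj) (metis SS assms S_lin(4))

lemma range_S_csubspace: "csubspace (range S)"
  unfolding csubspace_def
proof (intro conjI ballI allI)
  show "0 \<in> range S" by (metis S_lin(4) rangeI)
  fix x y c assume "x \<in> range S" "y \<in> range S"
  then obtain a b where ab: "x = S a" "y = S b" by blast
  show "x + y \<in> range S" unfolding ab S_lin(1)[symmetric] by (rule rangeI)
  show "c *\<^sub>C x \<in> range S" unfolding ab S_lin(6)[symmetric] by (rule rangeI)
qed

lemma range_S_dense: "closure (range S) = UNIV"
  unfolding csubspace_dense_iff[OF range_S_csubspace]
proof (intro allI impI)
  fix h assume "\<forall>b\<in>range S. cinner h b = 0"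
  then have "cinner (S h) (S h) = 0" by (simp add: selfadjD[OF S_selfadj])
  then have "S h = 0" by (simp add: cinner_self)
  then show "h = 0" by (rule S_inj)
qed

lemma S_approx: obtains f where "(\<lambda>n. S (f n)) \<longlonglongrightarrow> h"
proof -
  have "h \<in> closure (range S)" by (simp add: range_S_dense)
  then obtain g where g: "\<forall>n. g n \<in> range S" "g \<longlonglongrightarrow> h" unfolding closure_sequential by blast
  then have "\<forall>n. \<exists>x. g n = S x" by (simp add: image_iff)
  then obtain f where "\<forall>n. g n = S (f n)" by (rule choice[THEN exE])
  then have "g = (\<lambda>n. S (f n))" by (simp add: fun_eq_iff)
  with g(2) show ?thesis by (intro that[of f]) simp
qed

lemma cinner_C_S: "cinner (C h) (S g) = cinner (S h) (C g)"
  using selfadjD[OF C_selfadj, of h "S g"] selfadjD[OF S_selfadj, of h "C g"] by (simp add: SC)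

lemma cinner_CC_S: "cinner (C (C w)) (S g) = cinner (C (S w)) (C g)"
  using cinner_C_S[of "C w" g] by (simp add: SC)

lemma Q_norm: "norm (Q w) = norm (C (S w))"
proof -
  have "cinner (Q w) (Q w) = cinner (w - R w) (R w)" by (rule RQ_orth[OF RQ_in, symmetric])
  also have "\<dots> = cinner (C (C w)) (S (S w))" by (simp add: CC SS)
  also have "\<dots> = cinner (C (S w)) (C (S w))"
    by (rule cinner_CC_S)
  finally have "(norm (Q w))\<^sup>2 = (norm (C (S w)))\<^sup>2" by (simp only: cinner_self of_real_eq_iff)
  then show ?thesis by (simp add: power2_eq_iff_nonneg)
qed

lemma Q_diff: "Q (x - y) = Q x - Q y"
  using proj_simps(2)[OF P_proj, of "(x, 0)" "(y, 0)"] by (simp add: RQ)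

text \<open>For \<open>h = S w\<close> the vector is \<open>Q w\<close>. Since \<open>Q w\<close>
  has the norm of \<open>C (S w)\<close>, the assignment is contractive on the dense range of
  \<open>S\<close>; it extends to every \<open>h\<close>, and closedness keeps the limits in the
  graph.\<close>

lemma V_exists: "\<exists>k. (S h, k) \<in> X \<and> norm k = norm (C h)"
proof -
  obtain f where f: "(\<lambda>n. S (f n)) \<longlonglongrightarrow> h" by (rule S_approx)
  have "Cauchy (\<lambda>n. Q (f n))"
  proof (rule metric_CauchyI)
    fix e :: real assume e: "0 < e"
    obtain M where M: "\<And>m n. M \<le> m \<Longrightarrow> M \<le> n \<Longrightarrow> dist (S (f m)) (S (f n)) < e"
      using metric_CauchyD[OF LIMSEQ_imp_Cauchy[OF f] e] by blast
    have "dist (Q (f m)) (Q (f n)) < e" if "M \<le> m" "M \<le> n" for m n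
    proof -
      have "dist (Q (f m)) (Q (f n)) = norm (C (S (f m - f n)))" by (simp add: dist_norm flip: Q_diff Q_norm)
      also have "\<dots> \<le> norm (S (f m - f n))" by (rule C_norm)
      also have "\<dots> < e" using M[OF that] by (simp add: dist_norm S_lin)
      finally show ?thesis .
    qed
    then show "\<exists>M. \<forall>m\<ge>M. \<forall>n\<ge>M. dist (Q (f m)) (Q (f n)) < e" by blast
  qed
  then obtain k where k: "(\<lambda>n. Q (f n)) \<longlonglongrightarrow> k" unfolding convergent_eq_Cauchy[symmetric] by blast
  have "(\<lambda>n. (S (S (f n)), Q (f n))) \<longlonglongrightarrow> (S h, k)"
    by (intro tendsto_Pair k bounded_clinear_tendsto[OF S_clinear f])
  then have "(S h, k) \<in> X" by (rule closed_sequentially[OF cl, rotated]) (simp add: SS RQ_in)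
  moreover have "(\<lambda>n. norm (Q (f n))) \<longlonglongrightarrow> norm (C h)"
    unfolding Q_norm by (rule tendsto_norm[OF bounded_clinear_tendsto[OF C_clinear f]])
  then have "norm k = norm (C h)" by (rule LIMSEQ_unique[OF tendsto_norm[OF k]])
  ultimately show ?thesis by blast
qed

lemma V_unique: "(S h, k) \<in> X \<Longrightarrow> V h = k"
  unfolding opV_def using linear_operator_single[OF lin] by blast

lemma SV_in: "(S h, V h) \<in> X" and V_norm: "norm (V h) = norm (C h)"
  using V_exists[of h] V_unique by metis+

lemma V_clinear: "bounded_clinear V"
proof (rule bounded_clinearI)
  show "V (x + y) = V x + V y" for x y
    by (rule V_unique) (simp add: S_lin linear_operator_add[OF lin] SV_in)
  show "V (c *\<^sub>C x) = c *\<^sub>C V x" for c x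
    by (rule V_unique) (simp add: S_lin linear_operator_scaleC[OF lin] SV_in)
  show "norm (V x) \<le> 1 * norm x" for x using C_norm[of x] by (simp add: V_norm)
qed

lemmas V_lin = bounded_clinear_simps[OF V_clinear]

lemma isometric_pair: "norm (S h, V h) = norm h"
proof -
  have "(norm (S h, V h))\<^sup>2 = (norm h)\<^sup>2" by (simp add: norm_Pair_sq V_norm norm_S_C)
  then show ?thesis by (simp add: power2_eq_iff_nonneg)
qed

lemma V_S: "V (S w) = Q w"
  by (rule V_unique) (simp add: SS RQ_in)

lemma pair_range_closed:
  assumes W: "bounded_clinear W" and iso: "\<And>h. norm (S h, W h) = norm h"
  shows "closed (range (\<lambda>h. (S h, W h)))"
  unfolding closed_sequential_limits
proof (intro allI impI, elim conjE)
  fix p l assume p: "\<forall>n. p n \<in> range (\<lambda>h. (S h, W h))" and l: "p \<longlonglongrightarrow> l"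
  from p have "\<forall>n. \<exists>g. p n = (S g, W g)" by blast
  then obtain g where g: "\<And>n. p n = (S (g n), W (g n))" by metis
  have "norm (g m - g n) = norm (p m - p n)" for m n
    using iso[of "g m - g n"] by (simp add: g S_lin bounded_clinear_diff[OF W])
  then have "Cauchy g" using LIMSEQ_imp_Cauchy[OF l] by (simp add: Cauchy_def dist_norm)
  then obtain x where x: "g \<longlonglongrightarrow> x" unfolding convergent_eq_Cauchy[symmetric] by blast
  have "(\<lambda>n. (S (g n), W (g n))) \<longlonglongrightarrow> (S x, W x)"
    by (intro tendsto_Pair bounded_clinear_tendsto[OF S_clinear x] bounded_clinear_tendsto[OF W x])
  then have "p \<longlonglongrightarrow> (S x, W x)" by (simp flip: g)
  then have "l = (S x, W x)" by (rule LIMSEQ_unique[OF l])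
  then show "l \<in> range (\<lambda>h. (S h, W h))" by blast
qed

lemma pair_range_csubspace: assumes W: "bounded_clinear W" shows "csubspace (range (\<lambda>h. (S h, W h)))"
  unfolding csubspace_def
proof (intro conjI ballI allI)
  note W_lin = bounded_clinear_simps[OF W]
  have "(0, 0) = (S 0, W 0)" by (simp add: S_lin W_lin)
  then show "0 \<in> range (\<lambda>h. (S h, W h))" unfolding zero_prod_def by blast
  fix x y c assume "x \<in> range (\<lambda>h. (S h, W h))" "y \<in> range (\<lambda>h. (S h, W h))"
  then obtain a b where ab: "x = (S a, W a)" "y = (S b, W b)" by blast
  have "x + y = (S (a + b), W (a + b))" "c *\<^sub>C x = (S (c *\<^sub>C a), W (c *\<^sub>C a))"
    by (simp_all add: ab S_lin W_lin scaleC_Pair)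
  then show "x + y \<in> range (\<lambda>h. (S h, W h))" "c *\<^sub>C x \<in> range (\<lambda>h. (S h, W h))" by blast+
qed

lemma graph_eq: "X = range (\<lambda>h. (S h, V h))"
proof
  show "range (\<lambda>h. (S h, V h)) \<subseteq> X" using SV_in by blast
  show "X \<subseteq> range (\<lambda>h. (S h, V h))"
  proof
    let ?G = "range (\<lambda>h. (S h, V h))"
    have G: "csubspace ?G" "closed ?G"
      by (rule pair_range_csubspace[OF V_clinear], rule pair_range_closed[OF V_clinear isometric_pair])
    fix x assume x: "x \<in> X"
    obtain a b where ab: "x - orth_proj ?G x = (a, b)" by fastforce
    have "?G \<subseteq> X" using SV_in by blast
    then have "orth_proj ?G x \<in> X" using orth_proj_in[OF G, of x] by (rule subsetD)
    from csubspace_diff[OF sub x this] have abX: "(a, b) \<in> X" by (simp only: ab)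
    \<comment> \<open>Orthogonality to the candidate graph is used only at \<open>S w\<close>, where
      the pair is \<open>(R w, Q w)\<close>, the projection of \<open>(w, 0)\<close> onto
      \<open>X\<close>. As \<open>(a, b)\<close> lies in \<open>X\<close>, it is then orthogonal to
      \<open>(w, 0)\<close> itself.\<close>
    have "cinner w a = 0" for w
    proof -
      have "cinner (a, b) (R w, Q w) = 0"
        using orth_proj_orth[OF G rangeI, of x "S w"] by (simp add: ab SS V_S)
      then have "cinner (R w, Q w) (a, b) = 0" by (simp add: cinner_eq_0_commute)
      then have "cinner (R w) a + cinner (Q w) b = 0" by (simp add: cinner_Pair)
      then show ?thesis using RQ_orth[OF abX, of w] by (simp add: cinner_diff_left diff_eq_eq add.commute)
    qed
    from this[of a] have a0: "a = 0" by (simp add: cinner_self)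
    then have "b = 0" using abX linear_operator_zero_domain[OF lin] by simp
    with ab a0 have "x - orth_proj ?G x = 0" by (simp only: zero_prod_def)
    then have "orth_proj ?G x = x" by simp
    then show "x \<in> ?G" by (simp only: orth_proj_eq_iff[OF G])
  qed
qed

lemma in_X: "(a, b) \<in> X \<longleftrightarrow> (\<exists>g. a = S g \<and> b = V g)"
  by (subst graph_eq) auto

lemma Q_clinear: "bounded_clinear Q"
  using bounded_clinear_compose[OF V_clinear S_clinear] by (simp add: V_S)

text \<open>Graph form of the statement that the product of \<open>X\<close> with its adjoint is the
  inverse of \<open>R\<close> minus the identity. An element with components \<open>a\<close> and
  \<open>c\<close> has \<open>a = R (a + c)\<close> by uniqueness of the orthogonal
  decomposition.\<close>

lemma adj_comp: "X O op_adjoint X = range (\<lambda>w. (R w, w - R w))"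
proof (intro equalityI subsetI)
  fix p assume "p \<in> X O op_adjoint X"
  then obtain a b c where abc: "p = (a, c)" "(a, b) \<in> X" "(b, c) \<in> op_adjoint X" by blast
  have "cinner (a + c - a) x = cinner b y" if "(x, y) \<in> X" for x y
  proof -
    have "cinner y b = cinner x c" using abc(3) that by (auto simp: op_adjoint_def)
    then show ?thesis by (metis add_diff_cancel_left' cinner_commute)
  qed
  then have "a = R (a + c)" using RQ_unique[OF abc(2), of "a + c"] by blast
  then have "p = (R (a + c), (a + c) - R (a + c))" using abc(1) by (metis add_diff_cancel_left')
  then show "p \<in> range (\<lambda>w. (R w, w - R w))" by blast
next
  fix p assume "p \<in> range (\<lambda>w. (R w, w - R w))"
  then obtain w where w: "p = (R w, w - R w)" by blast
  have "(Q w, w - R w) \<in> op_adjoint X"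
    unfolding op_adjoint_def using RQ_orth[of _ _ w] by auto (metis cinner_commute)
  then show "p \<in> X O op_adjoint X" using RQ_in[of w] w by blast
qed

text \<open>The pair \<open>(K (R h), K (Q h))\<close> has the properties that characterize the
  graph projection of \<open>(K h, 0)\<close>, where the adjoint of \<open>K\<close> is needed for
  orthogonality. The roots inherit commutation from \<open>R\<close>.\<close>

lemma reduces_comm:
  assumes K: "reduces K X"
  shows "K (R h) = R (K h)" "K (S h) = S (K h)" "K (C h) = C (K h)" "K (V h) = V (K h)"
proof -
  have Kc: "bounded_clinear K" using K by (simp add: reduces_def)
  have KX: "(K a, K b) \<in> X" "(badjoint K a, badjoint K b) \<in> X" if "(a, b) \<in> X" for a b
    using K that by (auto simp: reduces_def)
  note K_lin = bounded_clinear_simps[OF Kc]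
  show RK: "K (R h) = R (K h)" for h
  proof -
    have "K (R h) = R (K h) \<and> K (Q h) = Q (K h)"
    proof (rule RQ_unique)
      show "(K (R h), K (Q h)) \<in> X" by (rule KX(1)[OF RQ_in])
      fix x y assume "(x, y) \<in> X"
      from RQ_orth[OF KX(2)[OF this], of h]
      show "cinner (K h - K (R h)) x = cinner (K (Q h)) y"
        by (simp add: cinner_badjoint[OF Kc] flip: K_lin(2))
    qed
    then show ?thesis ..
  qed
  show SK: "K (S h) = S (K h)" for h by (rule comm_S[OF Kc RK])
  show "K (C h) = C (K h)" by (rule comm_C[OF Kc RK])
  show "K (V h) = V (K h)"
    by (rule V_unique[symmetric]) (use KX(1)[OF SV_in, of h] in \<open>simp add: SK\<close>)
qed

text \<open>The absolute value of \<open>X\<close>: the quotient of \<open>C\<close> by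
  \<open>S\<close>, with the range of \<open>S\<close> as domain. That \<open>op_abs\<close> takes
  this value is shown in \<open>op_abs_eq\<close>.\<close>

definition "A = range (\<lambda>h. (S h, C h))"

lemma in_A: "(a, b) \<in> A \<longleftrightarrow> (\<exists>g. a = S g \<and> b = C g)" by (auto simp: A_def)

lemma in_adjoint_A: "(u, v) \<in> op_adjoint A \<longleftrightarrow> (\<forall>g. cinner (C g) u = cinner (S g) v)"
  by (simp add: op_adjoint_def A_def)

lemma A_adjoint: "op_adjoint A = A"
proof (intro equalityI subsetI)
  fix p assume "p \<in> op_adjoint A"
  moreover obtain u v where "p = (u, v)" by fastforce
  ultimately have uv: "p = (u, v)" "\<And>g. cinner (C g) u = cinner (S g) v" by (simp_all add: in_adjoint_A)
  have eq: "C u = S v"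
    by (rule cinner_ext_right) (use uv(2) in \<open>simp add: selfadjD[OF C_selfadj] selfadjD[OF S_selfadj]\<close>)
  \<comment> \<open>The only possible preimage of \<open>(u, v)\<close>: applying \<open>S\<close>
    and \<open>C\<close> to the two components and adding recovers the parameter, because
    \<open>S S + C C\<close> is the identity.\<close>
  let ?w = "S u + C v"
  have "S ?w = S (S u) + C (C u)" "C ?w = S (S v) + C (C v)" by (simp_all add: S_lin C_lin eq SC)
  then have "u = S ?w" "v = C ?w" by (simp_all add: SS_CC)
  then show "p \<in> A" using uv(1) by (auto simp: in_A)
next
  fix p assume "p \<in> A"
  then obtain g where g: "p = (S g, C g)" by (auto simp: A_def)
  then show "p \<in> op_adjoint A" by (simp add: g in_adjoint_A cinner_C_S)
qed

lemma A_positive_selfadjoint: "positive_selfadjoint A"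
  unfolding positive_selfadjoint_def closed_densely_defined_def
proof (intro conjI A_adjoint)
  have iso: "norm (S h, C h) = norm h" for h using isometric_pair[of h] by (simp add: norm_Pair V_norm)
  have sub: "csubspace A" unfolding A_def by (rule pair_range_csubspace[OF C_clinear])
  show "closed A" unfolding A_def by (rule pair_range_closed[OF C_clinear iso])
  have "Domain A = range S" by (auto simp: Domain_iff in_A)
  then show "closure (Domain A) = UNIV" by (simp add: range_S_dense)
  have "g = g'" if "S g = S g'" for g g' using S_inj[of "g - g'"] that by (simp add: S_lin)
  then have "single_valued A" by (auto simp: single_valued_def in_A)
  then show "linear_operator A"
    using csubspace_0[OF sub] csubspace_add[OF sub, of "(_, _)" "(_, _)"] csubspace_scaleC[OF sub, of "(_, _)"]
    by (simp add: linear_operator_def zero_prod_def scaleC_Pair)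
  have "pos_op (\<lambda>h. S (C h))" by (rule pos_comp[OF S_pos C_pos SC[symmetric]])
  from pos_op_positive[OF this] have "cinner (C g) (S g) \<in> \<real>\<^sub>\<ge>\<^sub>0" for g
    unfolding positive_op_def by (simp add: selfadjD[OF S_selfadj])
  then show "\<forall>(x, y)\<in>A. cinner y x \<in> \<real>\<^sub>\<ge>\<^sub>0" by (auto simp: in_A)
qed

end

lemma positive_selfadjoint_closed_op: "positive_selfadjoint B \<Longrightarrow> closed_op B"
  by (simp add: positive_selfadjoint_def closed_op_def)

text \<open>By \<open>adj_comp\<close> both sides are determined by a resolvent, and the pair
  \<open>(S (S w), C (S w))\<close> shows that the resolvents of \<open>A\<close> and of
  \<open>X\<close> coincide.\<close>

lemma (in closed_op) A_comp: "A O A = X O op_adjoint X"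
proof -
  interpret A: closed_op A by (rule positive_selfadjoint_closed_op[OF A_positive_selfadjoint])
  have "S (S w) = resolv A w \<and> C (S w) = A.Q w" for w
  proof (rule A.RQ_unique)
    show "(S (S w), C (S w)) \<in> A" by (auto simp: in_A)
    fix x y assume "(x, y) \<in> A"
    then obtain g where g: "x = S g" "y = C g" by (auto simp: in_A)
    show "cinner (w - S (S w)) x = cinner (C (S w)) y"
      using cinner_CC_S[of w g] by (simp add: g CC SS)
  qed
  then have "resolv A = R" by (simp add: fun_eq_iff SS)
  then show ?thesis using A.adj_comp adj_comp A_adjoint by simp
qed

text \<open>\<open>B\<close> has the resolvent of \<open>X\<close>, hence the same \<open>S\<close>
  and \<open>C\<close>, and only its \<open>V\<close> remains to be found. The operator
  \<open>B R\<close> is a positive root of \<open>R - R R\<close>, as is \<open>S C\<close>;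
  uniqueness of roots makes the \<open>V\<close> of \<open>B\<close> agree with \<open>C\<close> on
  the dense range of \<open>S\<close>.\<close>

lemma (in closed_op) abs_unique:
  assumes B: "positive_selfadjoint B" and BB: "B O B = X O op_adjoint X"
  shows "B = A"
proof -
  interpret B: closed_op B by (rule positive_selfadjoint_closed_op[OF B])
  have Ba: "op_adjoint B = B" and Bp: "\<And>x y. (x, y) \<in> B \<Longrightarrow> cinner y x \<in> \<real>\<^sub>\<ge>\<^sub>0"
    using B by (auto simp: positive_selfadjoint_def)
  have sym: "cinner y x' = cinner x y'" if "(x, y) \<in> B" "(x', y') \<in> B" for x y x' y'
  proof -
    have "(x', y') \<in> op_adjoint B" using that(2) Ba by simp
    then show ?thesis using that(1) by (auto simp: op_adjoint_def)
  qed
  have "range (\<lambda>w. (resolv B w, w - resolv B w)) = range (\<lambda>w. (R w, w - R w))"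
    using B.adj_comp adj_comp BB Ba by simp
  then have "\<exists>w'. (resolv B w, w - resolv B w) = (R w', w' - R w')" for w by blast
  then have RB: "resolv B = R"
    by (metis (no_types, lifting) Pair_inject ext add_diff_cancel_left' diff_add_cancel add_diff_eq)
  have SB: "opS B = S" and CB: "opC B = C" by (simp_all add: opS_def opC_def RB)
  define T where "T = B.Q"
  have T1: "(R w, T w) \<in> B" for w using B.RQ_in[of w] by (simp add: RB T_def)
  have T2: "(T w, w - R w) \<in> B" for w
  proof -
    have "(R w, w - R w) \<in> B O B" using BB adj_comp by auto
    then obtain b where b: "(R w, b) \<in> B" "(b, w - R w) \<in> B" by blast
    then have "b = T w" using T1 linear_operator_single[OF B.lin] by blast
    then show ?thesis using b by simp
  qed
  have Tc: "bounded_clinear T" unfolding T_def by (rule B.Q_clinear)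
  have TR: "T (T w) = R w - R (R w)" for w
  proof -
    have a: "(T (R w), R w - R (R w)) \<in> B" by (rule T2)
    have b: "(R w - R (R w), T w - T (R w)) \<in> B" by (rule linear_operator_diff[OF B.lin T1 T1])
    from a b have "(T (R w), T w - T (R w)) \<in> B O B" by blast
    then obtain w' where w': "T (R w) = R w'" "T w - T (R w) = w' - R w'" using BB adj_comp by auto
    then have "w' = T w" by (metis diff_add_cancel)
    then have "T (R w) = R (T w)" using w' by simp
    then have "(R (T w), R w - R (R w)) \<in> B" using a by simp
    then show ?thesis using T1[of "T w"] linear_operator_single[OF B.lin] by blast
  qed
  have "pos_op T"
    unfolding pos_op_def selfadj_def
  proof (intro conjI allI Tc)
    fix x y
    have "cinner (T x) (R y) = cinner (R x) (T y)" by (rule sym[OF T1 T1])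
    moreover have "cinner (x - R x) (T y) = cinner (T x) (y - R y)" by (rule sym[OF T2 T2])
    ultimately show "cinner (T x) y = cinner x (T y)" by (simp add: cinner_diff_left cinner_diff_right)
    have "0 \<le> Re (cinner (T x) (R x))" using Bp[OF T1] by (simp add: nonneg_Reals_iff)
    moreover have "0 \<le> Re (cinner (x - R x) (T x))" using Bp[OF T2] by (simp add: nonneg_Reals_iff)
    ultimately show "0 \<le> Re (cinner (T x) x)"
      using Re_cinner_commute[of "x - R x" "T x"] by (simp add: cinner_diff_right)
  qed
  then have T: "T = sqrt_op (\<lambda>w. R w - R (R w))"
    by (rule sqrt_op_unique) (use TR \<open>pos_op T\<close> selfadj_sq_pos[of T] in \<open>auto simp: pos_op_selfadj\<close>)
  have "pos_op (\<lambda>w. S (C w))" by (rule pos_comp[OF S_pos C_pos SC[symmetric]])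
  moreover have "S (C (S (C w))) = R w - R (R w)" for w
    by (simp add: SC) (simp add: CC SS S_lin flip: SC) 
  ultimately have CS: "(\<lambda>w. S (C w)) = sqrt_op (\<lambda>w. R w - R (R w))"
    by (rule sqrt_op_unique) (use TR \<open>pos_op T\<close> selfadj_sq_pos[of T] in \<open>auto simp: pos_op_selfadj\<close>)
  have VC: "opV B = C"
  proof
    fix h
    obtain f where f: "(\<lambda>n. S (f n)) \<longlonglongrightarrow> h" by (rule S_approx)
    have "opV B (S w) = C (S w)" for w
      using B.V_S[of w] T CS by (simp add: SB T_def fun_eq_iff SC)
    then have "(\<lambda>n. C (S (f n))) \<longlonglongrightarrow> opV B h" using bounded_clinear_tendsto[OF B.V_clinear f] by simp
    then show "opV B h = C h" by (rule LIMSEQ_unique[OF _ bounded_clinear_tendsto[OF C_clinear f]])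
  qed
  show "B = A" using B.graph_eq by (simp add: A_def SB VC)
qed

lemma (in closed_op) op_abs_eq: "op_abs X = A"
  unfolding op_abs_def
proof (rule the_equality)
  show "positive_selfadjoint A \<and> A O A = X O op_adjoint X" using A_positive_selfadjoint A_comp by simp
qed (use abs_unique in blast)

section \<open>The spectral measure of the absolute value\<close>

lemma bounded_clinear_sum_arg: "bounded_clinear T \<Longrightarrow> T (\<Sum>i\<in>I. f i) = (\<Sum>i\<in>I. T (f i))"
  by (induction I rule: infinite_finite_induct) (simp_all add: bounded_clinear_zero bounded_clinear_add)

definition spectral_proj :: "('h::complex_hilbert_space \<Rightarrow> 'h) \<Rightarrow> 'h \<Rightarrow> 'h" where
  "spectral_proj T = (SOME F. projection_op F \<and>
    (\<forall>K. bounded_clinear K \<longrightarrow> (\<forall>h. K (T h) = T (K h)) \<longrightarrow> (\<forall>h. K (F h) = F (K h))) \<and>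
    (\<forall>h. F h = h \<longrightarrow> Re (cinner (T h) h) \<le> 0) \<and> (\<forall>h. F h = 0 \<longrightarrow> h \<noteq> 0 \<longrightarrow> 0 < Re (cinner (T h) h)))"

lemma spectral_proj:
  assumes "selfadj T"
  shows "projection_op (spectral_proj T)"
    and "bounded_clinear K \<Longrightarrow> (\<And>h. K (T h) = T (K h)) \<Longrightarrow> K (spectral_proj T h) = spectral_proj T (K h)"
    and "spectral_proj T h = h \<Longrightarrow> Re (cinner (T h) h) \<le> 0"
    and "spectral_proj T h = 0 \<Longrightarrow> h \<noteq> 0 \<Longrightarrow> 0 < Re (cinner (T h) h)"
  using someI_ex[OF spectral_projection_exists[OF assms], folded spectral_proj_def] by simp_all

text \<open>\<open>C - s S\<close> is the absolute value minus \<open>s\<close>, multiplied by the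
  positive injective \<open>S\<close>. Its nonpositive part therefore sits on the spectral subspace
  of the absolute value for levels at most \<open>s\<close>.\<close>

definition opF :: "'h::complex_hilbert_space operator \<Rightarrow> real \<Rightarrow> 'h \<Rightarrow> 'h" where
  "opF X s = spectral_proj (\<lambda>h. opC X h - s *\<^sub>R opS X h)"

context closed_op
begin

abbreviation "F \<equiv> opF X"

lemma CsS_selfadj: "selfadj (\<lambda>h. C h - s *\<^sub>R S h)"
  by (rule selfadj_minus[OF C_selfadj selfadj_scale[OF S_selfadj]])

lemma F_proj: "projection_op (F s)"
  unfolding opF_def by (rule spectral_proj(1)[OF CsS_selfadj])

lemmas F_lin = proj_simps[OF F_proj] and F_idem = proj_idem[OF F_proj]

lemma F_comm:
  assumes "bounded_clinear K" "\<And>h. K (S h) = S (K h)" "\<And>h. K (C h) = C (K h)"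
  shows "K (F s h) = F s (K h)"
  unfolding opF_def
  by (rule spectral_proj(2)[OF CsS_selfadj assms(1)]) (simp add: assms bounded_clinear_simps[OF assms(1)])

lemma F_le: "F s h = h \<Longrightarrow> Re (cinner (C h) h) \<le> s * Re (cinner (S h) h)"
  using spectral_proj(3)[OF CsS_selfadj, of s h] by (simp add: opF_def cinner_diff_left cinner_scaleR_left)

lemma F_gt: "F s h = 0 \<Longrightarrow> h \<noteq> 0 \<Longrightarrow> s * Re (cinner (S h) h) < Re (cinner (C h) h)"
  using spectral_proj(4)[OF CsS_selfadj, of s h] by (simp add: opF_def cinner_diff_left cinner_scaleR_left)

lemma F_S: "S (F s h) = F s (S h)" by (rule F_comm[OF S_clinear refl SC[symmetric]])
lemma F_C: "C (F s h) = F s (C h)" by (rule F_comm[OF C_clinear SC refl])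
lemma F_F: "F t (F s h) = F s (F t h)" by (rule F_comm[OF proj_clinear[OF F_proj] F_S[symmetric] F_C[symmetric]])

lemma S_form_pos: assumes "h \<noteq> 0" shows "0 < Re (cinner (S h) h)"
  using pos_zero_iff[OF S_pos, of h] pos_op_nonneg[OF S_pos, of h] S_inj[of h] assms by fastforce

lemma F_mono: assumes "s \<le> t" shows "F t (F s h) = F s h"
proof (rule ccontr)
  let ?g = "F s h - F t (F s h)"
  assume "F t (F s h) \<noteq> F s h"
  then have g0: "?g \<noteq> 0" by simp
  have "F s ?g = ?g" "F t ?g = 0" by (simp_all add: F_lin F_idem F_F[of s t])
  then have "t * Re (cinner (S ?g) ?g) < s * Re (cinner (S ?g) ?g)"
    using F_le[of s ?g] F_gt[of t ?g] g0 by linarith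
  moreover have "s * Re (cinner (S ?g) ?g) \<le> t * Re (cinner (S ?g) ?g)"
    using assms pos_op_nonneg[OF S_pos] by (rule mult_right_mono)
  ultimately show False by simp
qed

lemma F_mono': assumes "s \<le> t" shows "F s (F t h) = F s h"
  using F_mono[OF assms] by (simp add: F_F[of s t])

lemma F_neg: assumes "s < 0" shows "F s h = 0"
proof (rule ccontr)
  let ?g = "F s h"
  assume "?g \<noteq> 0"
  then have "0 < Re (cinner (S ?g) ?g)" by (rule S_form_pos)
  then have "s * Re (cinner (S ?g) ?g) < 0" using assms by (simp add: mult_neg_pos)
  then show False using F_le[of s ?g] pos_op_nonneg[OF C_pos, of ?g] by (simp add: F_idem)
qed

lemma F_norm_mono: "s \<le> t \<Longrightarrow> norm (F s h) \<le> norm (F t h)"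
  using proj_norm_le[OF F_proj, of s "F t h"] by (simp add: F_mono')

text \<open>A vector fixed by every \<open>F (s + 1 / (n + 1))\<close> and killed by
  \<open>F s\<close> would satisfy the form inequality with constant \<open>s\<close> in the limit,
  against the strict inequality of \<open>F_gt\<close>. Right continuity is thus due to the kernel
  being assigned to the lower part.\<close>

lemma F_tendsto_right: "(\<lambda>n. F (s + inverse (real (Suc n))) h) \<longlonglongrightarrow> F s h"
proof -
  define t where "t n = s + inverse (real (Suc n))" for n
  have t: "t m \<le> t n" if "n \<le> m" for m n using that by (simp add: t_def le_imp_inverse_le)
  have st: "s \<le> t n" for n by (simp add: t_def)
  have "\<exists>q. projection_op q \<and> (\<forall>h. (\<lambda>n. perp (F (t n)) h) \<longlonglongrightarrow> q h) \<and> (\<forall>n h. q (perp (F (t n)) h) = perp (F (t n)) h)"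
  proof (rule proj_incr_limit[where p = "\<lambda>n. perp (F (t n))"])
    show "projection_op (perp (F (t n)))" for n by (rule proj_perp[OF F_proj])
    show "perp (F (t (Suc n))) (perp (F (t n)) h) = perp (F (t n)) h" for n h
      by (simp add: F_lin F_mono'[OF t[OF le_SucI[OF order_refl]]])
  qed
  then obtain q where q: "\<And>h. (\<lambda>n. perp (F (t n)) h) \<longlonglongrightarrow> q h" by blast
  let ?g = "h - q h - F s h"
  have lim: "(\<lambda>n. F (t n) h) \<longlonglongrightarrow> h - q h" using tendsto_diff[OF tendsto_const q, of h h] by simp
  have Fg: "F (t n) ?g = ?g" for n
  proof -
    have "(\<lambda>m. F (t n) (F (t m) h)) \<longlonglongrightarrow> F (t n) (h - q h)"
      by (rule bounded_clinear_tendsto[OF proj_clinear[OF F_proj] lim])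
    moreover have "eventually (\<lambda>m. F (t n) (F (t m) h) = F (t m) h) sequentially"
      using eventually_ge_at_top[of n] by eventually_elim (rule F_mono[OF t])
    ultimately have "(\<lambda>m. F (t m) h) \<longlonglongrightarrow> F (t n) (h - q h)" by (simp add: tendsto_cong)
    then have "F (t n) (h - q h) = h - q h" by (rule LIMSEQ_unique[OF _ lim])
    moreover have "F (t n) (F s h) = F s h" by (rule F_mono[OF st])
    ultimately show ?thesis by (simp only: F_lin)
  qed
  have Fsg: "F s ?g = 0"
  proof -
    have "(\<lambda>m. F s (F (t m) h)) \<longlonglongrightarrow> F s (h - q h)"
      by (rule bounded_clinear_tendsto[OF proj_clinear[OF F_proj] lim])
    moreover have "F s (F (t m) h) = F s h" for m by (rule F_mono'[OF st])
    ultimately have "F s (h - q h) = F s h" by (simp add: LIMSEQ_const_iff)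
    then show ?thesis by (simp only: F_lin F_idem) simp
  qed
  have "?g = 0"
  proof (rule ccontr)
    assume "?g \<noteq> 0"
    then have gt: "s * Re (cinner (S ?g) ?g) < Re (cinner (C ?g) ?g)" by (rule F_gt[OF Fsg])
    have "(\<lambda>n. t n * Re (cinner (S ?g) ?g)) \<longlonglongrightarrow> (s + 0) * Re (cinner (S ?g) ?g)"
      unfolding t_def by (intro tendsto_intros LIMSEQ_inverse_real_of_nat)
    then have "Re (cinner (C ?g) ?g) \<le> (s + 0) * Re (cinner (S ?g) ?g)"
      by (rule LIMSEQ_le_const) (use F_le[OF Fg] in blast)
    with gt show False by simp
  qed
  then show ?thesis using lim by (simp add: t_def)
qed

lemma F_tendsto_top: "(\<lambda>n. F (real n) h) \<longlonglongrightarrow> h"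
proof -
  have "\<exists>q. projection_op q \<and> (\<forall>h. (\<lambda>n. F (real n) h) \<longlonglongrightarrow> q h) \<and> (\<forall>n h. q (F (real n) h) = F (real n) h)"
    by (rule proj_incr_limit[where p = "\<lambda>n. F (real n)"]) (simp_all add: F_proj F_mono)
  then obtain q where q: "\<And>h. (\<lambda>n. F (real n) h) \<longlonglongrightarrow> q h" by blast
  let ?g = "h - q h"
  have Fg: "F (real n) ?g = 0" for n
  proof -
    have "(\<lambda>m. F (real n) (F (real m) h)) \<longlonglongrightarrow> F (real n) (q h)"
      by (rule bounded_clinear_tendsto[OF proj_clinear[OF F_proj] q])
    moreover have "eventually (\<lambda>m. F (real n) (F (real m) h) = F (real n) h) sequentially"
      using eventually_ge_at_top[of n] by eventually_elim (rule F_mono', simp)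
    ultimately have "(\<lambda>m. F (real n) h) \<longlonglongrightarrow> F (real n) (q h)" by (simp add: tendsto_cong)
    then show ?thesis by (simp add: LIMSEQ_const_iff F_lin)
  qed
  have "?g = 0"
  proof (rule ccontr)
    assume g: "?g \<noteq> 0"
    then have pos: "0 < Re (cinner (S ?g) ?g)" by (rule S_form_pos)
    obtain n where "Re (cinner (C ?g) ?g) < real n * Re (cinner (S ?g) ?g)"
      using ex_less_of_nat_mult[OF pos] by blast
    then show False using F_gt[OF Fg g, of n] by simp
  qed
  then show ?thesis using q[of h] by simp
qed

text \<open>\<open>F_le\<close> compares \<open>C\<close> and \<open>S\<close> at one vector,
  whereas estimates for the absolute value at \<open>S g\<close> involve products of two such
  operators. Applying \<open>F_le\<close> at the roots of \<open>S\<close> and of \<open>C\<close>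
  evaluated at \<open>g\<close> supplies the missing factor.\<close>

lemma F_S_form:
  assumes "F b g = g" shows "Re (cinner (C g) (S g)) \<le> b * (norm (S g))\<^sup>2"
    and F_C_form: "(norm (C g))\<^sup>2 \<le> b * Re (cinner (C g) (S g))"
proof -
  have sS: "K (sqrt_op S h) = sqrt_op S (K h)" if "bounded_clinear K" "\<And>h. K (S h) = S (K h)" for K h
    by (rule sqrt_op(3)[OF S_pos that])
  have sC: "K (sqrt_op C h) = sqrt_op C (K h)" if "bounded_clinear K" "\<And>h. K (C h) = C (K h)" for K h
    by (rule sqrt_op(3)[OF C_pos that])
  have sSsa: "selfadj (sqrt_op S)" and sCsa: "selfadj (sqrt_op C)"
    by (rule pos_op_selfadj[OF sqrt_op(1)[OF S_pos]], rule pos_op_selfadj[OF sqrt_op(1)[OF C_pos]])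
  have form: "cinner (K (sqrt_op S g)) (sqrt_op S g) = cinner (K g) (S g)"
    if "bounded_clinear K" "\<And>h. K (S h) = S (K h)" for K
    using sS[OF that, of g] selfadjD[OF sSsa, of "K g" "sqrt_op S g"] by (simp add: sqrt_op(2)[OF S_pos])
  have form': "cinner (K (sqrt_op C g)) (sqrt_op C g) = cinner (K g) (C g)"
    if "bounded_clinear K" "\<And>h. K (C h) = C (K h)" for K
    using sC[OF that, of g] selfadjD[OF sCsa, of "K g" "sqrt_op C g"] by (simp add: sqrt_op(2)[OF C_pos])
  have "F b (sqrt_op S g) = sqrt_op S g"
    using sS[OF proj_clinear[OF F_proj] F_S[symmetric], of b g] assms by simp
  from F_le[OF this] show "Re (cinner (C g) (S g)) \<le> b * (norm (S g))\<^sup>2"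
    by (simp add: form[OF C_clinear SC] form[OF S_clinear refl] cinner_self_Re)
  have "F b (sqrt_op C g) = sqrt_op C g"
    using sC[OF proj_clinear[OF F_proj] F_C[symmetric], of b g] assms by simp
  from F_le[OF this] show "(norm (C g))\<^sup>2 \<le> b * Re (cinner (C g) (S g))"
    using Re_cinner_commute[of "S g" "C g"]
    by (simp add: form'[OF C_clinear refl] form'[OF S_clinear SC[symmetric]] cinner_self_Re)
qed

lemma F_S_form_strict:
  assumes "F a g = 0" "g \<noteq> 0" shows "a * (norm (S g))\<^sup>2 < Re (cinner (C g) (S g))"
    and F_C_form_strict: "a * Re (cinner (C g) (S g)) \<le> (norm (C g))\<^sup>2"
proof -
  have sS: "K (sqrt_op S h) = sqrt_op S (K h)" if "bounded_clinear K" "\<And>h. K (S h) = S (K h)" for K h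
    by (rule sqrt_op(3)[OF S_pos that])
  have sC: "K (sqrt_op C h) = sqrt_op C (K h)" if "bounded_clinear K" "\<And>h. K (C h) = C (K h)" for K h
    by (rule sqrt_op(3)[OF C_pos that])
  have sSsa: "selfadj (sqrt_op S)" and sCsa: "selfadj (sqrt_op C)"
    by (rule pos_op_selfadj[OF sqrt_op(1)[OF S_pos]], rule pos_op_selfadj[OF sqrt_op(1)[OF C_pos]])
  have form: "cinner (K (sqrt_op S g)) (sqrt_op S g) = cinner (K g) (S g)"
    if "bounded_clinear K" "\<And>h. K (S h) = S (K h)" for K
    using sS[OF that, of g] selfadjD[OF sSsa, of "K g" "sqrt_op S g"] by (simp add: sqrt_op(2)[OF S_pos])
  have form': "cinner (K (sqrt_op C g)) (sqrt_op C g) = cinner (K g) (C g)"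
    if "bounded_clinear K" "\<And>h. K (C h) = C (K h)" for K
    using sC[OF that, of g] selfadjD[OF sCsa, of "K g" "sqrt_op C g"] by (simp add: sqrt_op(2)[OF C_pos])
  have 1: "F a (sqrt_op S g) = 0"
    using sS[OF proj_clinear[OF F_proj] F_S[symmetric], of a g] assms
    by (simp add: bounded_clinear_zero[OF selfadj_clinear[OF sSsa]])
  have 2: "sqrt_op S g \<noteq> 0"
  proof
    assume "sqrt_op S g = 0"
    then have "S g = 0" using sqrt_op(2)[OF S_pos, of g] bounded_clinear_zero[OF selfadj_clinear[OF sSsa]] by metis
    then show False using S_inj assms(2) by blast
  qed
  from F_gt[OF 1 2] show "a * (norm (S g))\<^sup>2 < Re (cinner (C g) (S g))"
    by (simp add: form[OF C_clinear SC] form[OF S_clinear refl] cinner_self_Re)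
  have 3: "F a (sqrt_op C g) = 0"
    using sC[OF proj_clinear[OF F_proj] F_C[symmetric], of a g] assms
    by (simp add: bounded_clinear_zero[OF selfadj_clinear[OF sCsa]])
  have "a * Re (cinner (S (sqrt_op C g)) (sqrt_op C g)) \<le> Re (cinner (C (sqrt_op C g)) (sqrt_op C g))"
    using F_gt[OF 3] by (cases "sqrt_op C g = 0") (simp_all add: less_imp_le)
  then show "a * Re (cinner (C g) (S g)) \<le> (norm (C g))\<^sup>2"
    using Re_cinner_commute[of "S g" "C g"]
    by (simp add: form'[OF C_clinear refl] form'[OF S_clinear SC[symmetric]] cinner_self_Re)
qed

lemma F_C_upper: assumes "F b g = g" "0 \<le> b" shows "norm (C g) \<le> b * norm (S g)"
proof (rule power2_le_imp_le)
  have "b * Re (cinner (C g) (S g)) \<le> b * (b * (norm (S g))\<^sup>2)"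
    using F_S_form(1)[OF assms(1)] assms(2) by (rule mult_left_mono)
  then show "(norm (C g))\<^sup>2 \<le> (b * norm (S g))\<^sup>2"
    using F_C_form[OF assms(1)] by (simp add: power2_eq_square mult_ac)
  show "0 \<le> b * norm (S g)" using assms by simp
qed

lemma F_C_lower: assumes "F a g = 0" "0 \<le> a" "g \<noteq> 0" shows "a * norm (S g) < norm (C g)"
proof (cases "a = 0")
  case True
  have "C g \<noteq> 0" using F_gt[OF assms(1,3)] True by auto
  then show ?thesis using True by simp
next
  case False
  have "a * (a * (norm (S g))\<^sup>2) < a * Re (cinner (C g) (S g))"
    using F_S_form_strict(1)[OF assms(1,3)] False assms(2) by simp
  then have "(a * norm (S g))\<^sup>2 < (norm (C g))\<^sup>2"
    using F_C_form_strict[OF assms(1,3)] by (simp add: power2_eq_square mult_ac)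
  then show ?thesis by (rule power2_less_imp_less) simp
qed

section \<open>The projection-valued measure generated by the spectral projections\<close>

definition "mF h = interval_measure (\<lambda>s. (norm (F s h))\<^sup>2)"

lemma mF_Ioc: assumes "a \<le> b" shows "emeasure (mF h) {a<..b} = ennreal ((norm (F b h))\<^sup>2 - (norm (F a h))\<^sup>2)"
  unfolding mF_def
proof (rule emeasure_interval_measure_Ioc[OF assms])
  let ?f = "\<lambda>s. (norm (F s h))\<^sup>2"
  have mono: "?f x \<le> ?f y" if "x \<le> y" for x y
    using F_norm_mono[OF that] by (simp add: power_mono)
  then show "?f x \<le> ?f y" if "x \<le> y" for x y using that .
  have "\<exists>d>0. ?f (c + d) - ?f c < e" if e: "0 < e" for c e
  proof -
    have "(\<lambda>n. ?f (c + inverse (real (Suc n)))) \<longlonglongrightarrow> ?f c"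
      by (intro tendsto_intros F_tendsto_right)
    then have "eventually (\<lambda>n. ?f (c + inverse (real (Suc n))) < ?f c + e) sequentially"
      by (rule order_tendstoD(2)) (use e in simp)
    then obtain n where "?f (c + inverse (real (Suc n))) < ?f c + e"
      by (auto simp: eventually_sequentially)
    then show ?thesis
      by (intro exI[of _ "inverse (real (Suc n))"]) simp
  qed
  then show "continuous (at_right c) ?f" for c
    using continuous_at_right_real_increasing[of ?f c] mono by blast
qed

lemma mF_sets [simp]: "sets (mF h) = sets borel" "space (mF h) = UNIV" by (simp_all add: mF_def)

lemma mF_atMost: "emeasure (mF h) {..b} = ennreal ((norm (F b h))\<^sup>2)"
proof -
  let ?A = "\<lambda>n. {- \<bar>b\<bar> - 1 - real n<..b}"
  have U: "(\<Union>n. ?A n) = {..b}"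
  proof (intro equalityI subsetI)
    fix x assume "x \<in> {..b}"
    obtain n where "- \<bar>b\<bar> - 1 - x < real n" using reals_Archimedean2 by blast
    then show "x \<in> (\<Union>n. ?A n)" using \<open>x \<in> {..b}\<close> by (intro UN_I[of n]) auto
  qed auto
  have "(\<lambda>n. emeasure (mF h) (?A n)) \<longlonglongrightarrow> emeasure (mF h) (\<Union>n. ?A n)"
    by (rule Lim_emeasure_incseq) (auto intro!: incseq_SucI)
  moreover have "emeasure (mF h) (?A n) = ennreal ((norm (F b h))\<^sup>2)" for n
    by (subst mF_Ioc) (auto simp: F_neg)
  ultimately show ?thesis by (simp add: U LIMSEQ_const_iff)
qed

lemma mF_UNIV: "emeasure (mF h) UNIV = ennreal ((norm h)\<^sup>2)"
proof -
  have U: "(\<Union>n. {..real n}) = UNIV" using reals_Archimedean2 less_imp_le by fastforce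
  have "(\<lambda>n. emeasure (mF h) {..real n}) \<longlonglongrightarrow> emeasure (mF h) (\<Union>n. {..real n})"
    by (rule Lim_emeasure_incseq) (auto intro!: incseq_SucI)
  moreover have "(\<lambda>n. ennreal ((norm (F (real n) h))\<^sup>2)) \<longlonglongrightarrow> ennreal ((norm h)\<^sup>2)"
    by (intro tendsto_ennrealI tendsto_intros F_tendsto_top)
  ultimately show ?thesis unfolding U mF_atMost by (rule LIMSEQ_unique)
qed

text \<open>At the vector \<open>p h\<close> the set \<open>B\<close> already carries the total
  mass, so nothing is left for the disjoint set \<open>D\<close>.\<close>

lemma mF_orthogonal:
  assumes p: "projection_op p" "\<And>h. emeasure (mF h) B = ennreal ((norm (p h))\<^sup>2)"
    and q: "projection_op q" "\<And>h. emeasure (mF h) D = ennreal ((norm (q h))\<^sup>2)"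
    and BD: "B \<inter> D = {}" "B \<in> sets borel" "D \<in> sets borel"
  shows "q (p h) = 0"
proof -
  have "ennreal ((norm (p (p h)))\<^sup>2) + ennreal ((norm (q (p h)))\<^sup>2) = emeasure (mF (p h)) (B \<union> D)"
    using BD by (subst plus_emeasure[symmetric]) (auto simp: p(2) q(2))
  also have "\<dots> \<le> emeasure (mF (p h)) UNIV" by (rule emeasure_mono) auto
  also have "\<dots> = ennreal ((norm (p h))\<^sup>2)" by (rule mF_UNIV)
  finally have "(norm (p h))\<^sup>2 + (norm (q (p h)))\<^sup>2 \<le> (norm (p h))\<^sup>2"
    by (simp add: proj_idem[OF p(1)] flip: ennreal_plus)
  then show ?thesis by simp
qed

lemma mF_union:
  assumes p: "\<And>i. projection_op (p i)" "\<And>i h. emeasure (mF h) (B i) = ennreal ((norm (p i h))\<^sup>2)"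
    and B: "disjoint_family B" "\<And>i. B i \<in> sets borel"
  shows "\<exists>q. projection_op q \<and> (\<forall>h. (\<lambda>i. p i h) sums q h) \<and>
    (\<forall>h. emeasure (mF h) (\<Union>i. B i) = ennreal ((norm (q h))\<^sup>2))"
proof -
  have orth: "p i (p j h) = 0" if "i \<noteq> j" for i j h
    using that B
    by (intro mF_orthogonal[OF p(1)[of j] p(2)[where i = j] p(1)[of i] p(2)[where i = i]]) (auto simp: disjoint_family_on_def)
  let ?s = "\<lambda>n h. \<Sum>i<n. p i h"
  have s0: "?s n (p n h) = 0" for n h by (simp add: orth)
  have ps: "projection_op (?s n)" for n
  proof (induction n)
    case 0 then show ?case by (simp add: proj_zero)
  next
    case (Suc n)
    then show ?case using proj_sum[OF p(1)[of n] Suc s0] by simp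
  qed
  have ns: "ennreal ((norm (?s n h))\<^sup>2) = emeasure (mF h) (\<Union>i<n. B i)" for n h
  proof -
    have "(norm (?s n h))\<^sup>2 = (\<Sum>i<n. (norm (p i h))\<^sup>2)"
    proof (induction n)
      case (Suc n)
      have "cinner (?s n h) (p n h) = 0" by (subst proj_cinner[OF ps]) (simp add: s0)
      then show ?case using Suc by (simp add: pythagoras)
    qed simp
    then have "ennreal ((norm (?s n h))\<^sup>2) = (\<Sum>i<n. emeasure (mF h) (B i))" by (simp add: p(2) sum_ennreal)
    also have "\<dots> = emeasure (mF h) (\<Union>i<n. B i)"
      using B by (intro sum_emeasure) (auto simp: disjoint_family_on_def)
    finally show ?thesis .
  qed
  have "\<exists>q. projection_op q \<and> (\<forall>h. (\<lambda>n. ?s n h) \<longlonglongrightarrow> q h) \<and> (\<forall>n h. q (?s n h) = ?s n h)"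
  proof (rule proj_incr_limit[where p = ?s, OF ps])
    fix n h
    have "p n (?s n h) = 0" by (simp add: bounded_clinear_sum_arg[OF proj_clinear[OF p(1)]] orth)
    then show "?s (Suc n) (?s n h) = ?s n h" using proj_idem[OF ps[of n], of h] by simp
  qed
  then obtain q where q: "projection_op q" "\<And>h. (\<lambda>n. ?s n h) \<longlonglongrightarrow> q h" by blast
  have "emeasure (mF h) (\<Union>i. B i) = ennreal ((norm (q h))\<^sup>2)" for h
  proof -
    have "(\<lambda>n. emeasure (mF h) (\<Union>i<n. B i)) \<longlonglongrightarrow> emeasure (mF h) (\<Union>n. \<Union>i<n. B i)"
      using B by (intro Lim_emeasure_incseq) (force intro!: incseq_SucI)+
    moreover have "(\<Union>n. \<Union>i<n. B i) = (\<Union>i. B i)" by auto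
    moreover have "(\<lambda>n. ennreal ((norm (?s n h))\<^sup>2)) \<longlonglongrightarrow> ennreal ((norm (q h))\<^sup>2)"
      by (intro tendsto_ennrealI tendsto_power tendsto_norm q)
    ultimately show ?thesis unfolding ns by (metis LIMSEQ_unique)
  qed
  then show ?thesis using q by (auto simp: sums_def)
qed

text \<open>The sets whose scalar measures are squared norms of one projection include the
  half-lines and are closed under complements and disjoint unions. Half-lines are stable under
  intersection, so the Dynkin argument reaches every Borel set.\<close>

lemma mF_proj_exists:
  assumes "B \<in> sets borel"
  shows "\<exists>p. projection_op p \<and> (\<forall>h. emeasure (mF h) B = ennreal ((norm (p h))\<^sup>2))"
proof -
  have I: "Int_stable (range (\<lambda>a::real. {..a}))"
  proof (rule Int_stableI, clarify)
    fix a b :: real show "{..a} \<inter> {..b} \<in> range atMost" by (rule image_eqI[of _ _ "min a b"]) auto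
  qed
  have borel: "sets (borel :: real measure) = sigma_sets UNIV (range (\<lambda>a. {..a}))"
    unfolding borel_eq_atMost by (rule sets_measure_of) simp
  have Bs: "B \<in> sigma_sets UNIV (range (\<lambda>a::real. {..a}))" using assms borel by simp
  show ?thesis
  proof (rule sigma_sets_induct_disjoint[OF I _ Bs])
    fix A :: "real set" assume "A \<in> range (\<lambda>a::real. {..a})"
    then obtain a where "A = {..a}" by blast
    then show "\<exists>p. projection_op p \<and> (\<forall>h. emeasure (mF h) A = ennreal ((norm (p h))\<^sup>2))"
      by (intro exI[of _ "F a"]) (simp add: F_proj mF_atMost)
  next
    show "\<exists>p. projection_op p \<and> (\<forall>h. emeasure (mF h) {} = ennreal ((norm (p h))\<^sup>2))"
      by (rule exI[of _ "\<lambda>h. 0"]) (simp add: proj_zero)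
  next
    fix A assume A: "A \<in> sigma_sets UNIV (range (\<lambda>a::real. {..a}))"
      and "\<exists>p. projection_op p \<and> (\<forall>h. emeasure (mF h) A = ennreal ((norm (p h))\<^sup>2))"
    then obtain p where p: "projection_op p" "\<And>h. emeasure (mF h) A = ennreal ((norm (p h))\<^sup>2)" by blast
    have A': "A \<in> sets borel" using A borel by simp
    have "emeasure (mF h) (UNIV - A) = ennreal ((norm (h - p h))\<^sup>2)" for h
    proof -
      have "emeasure (mF h) (UNIV - A) = emeasure (mF h) UNIV - emeasure (mF h) A"
        using p(2)[of h] A' by (intro emeasure_Diff) simp_all
      also have "\<dots> = ennreal ((norm h)\<^sup>2 - (norm (p h))\<^sup>2)" by (simp add: mF_UNIV p(2) ennreal_minus)
      finally show ?thesis using proj_pythagoras[OF p(1), of h] by simp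
    qed
    then show "\<exists>p. projection_op p \<and> (\<forall>h. emeasure (mF h) (UNIV - A) = ennreal ((norm (p h))\<^sup>2))"
      using proj_perp[OF p(1)] by (intro exI[of _ "perp p"]) simp
  next
    fix A :: "nat \<Rightarrow> real set" assume A: "disjoint_family A" "range A \<subseteq> sigma_sets UNIV (range (\<lambda>a::real. {..a}))"
      and "\<And>i. \<exists>p. projection_op p \<and> (\<forall>h. emeasure (mF h) (A i) = ennreal ((norm (p h))\<^sup>2))"
    then obtain p where p: "\<And>i. projection_op (p i)" "\<And>i h. emeasure (mF h) (A i) = ennreal ((norm (p i h))\<^sup>2)" by metis
    have "A i \<in> sets borel" for i using A(2) borel by auto
    from mF_union[OF p A(1) this] show "\<exists>p. projection_op p \<and> (\<forall>h. emeasure (mF h) (\<Union>i. A i) = ennreal ((norm (p h))\<^sup>2))"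
      by blast
  qed simp
qed

definition "PF B = (SOME p. projection_op p \<and> (\<forall>h. emeasure (mF h) B = ennreal ((norm (p h))\<^sup>2)))"

lemma PF: assumes "B \<in> sets borel"
  shows PF_proj: "projection_op (PF B)" and PF_measure: "emeasure (mF h) B = ennreal ((norm (PF B h))\<^sup>2)"
  using someI_ex[OF mF_proj_exists[OF assms], folded PF_def] by simp_all

lemma PF_unique:
  assumes B: "B \<in> sets borel" and p: "projection_op p" "\<And>h. emeasure (mF h) B = ennreal ((norm (p h))\<^sup>2)"
  shows "PF B = p"
proof (rule proj_eqI[OF PF_proj[OF B] p(1)])
  fix h
  have "ennreal ((norm (PF B h))\<^sup>2) = ennreal ((norm (p h))\<^sup>2)" by (simp flip: PF_measure[OF B] p(2))
  then show "norm (PF B h) = norm (p h)" by (simp add: power2_eq_iff_nonneg)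
qed

lemma PF_atMost: "PF {..b} = F b" by (rule PF_unique) (simp_all add: F_proj mF_atMost)

lemma PF_disjoint: "B \<in> sets borel \<Longrightarrow> D \<in> sets borel \<Longrightarrow> B \<inter> D = {} \<Longrightarrow> PF D (PF B h) = 0"
  by (rule mF_orthogonal[OF PF_proj PF_measure PF_proj PF_measure])

lemma PF_Un: assumes B: "B \<in> sets borel" "D \<in> sets borel" "B \<inter> D = {}"
  shows "PF (B \<union> D) h = PF B h + PF D h"
proof -
  have z: "PF B (PF D h) = 0" for h using B by (intro PF_disjoint) auto
  have "PF (B \<union> D) = (\<lambda>h. PF B h + PF D h)"
  proof (rule PF_unique)
    show "projection_op (\<lambda>h. PF B h + PF D h)" by (rule proj_sum[OF PF_proj[OF B(2)] PF_proj[OF B(1)] z])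
    fix h
    have "cinner (PF B h) (PF D h) = 0" by (subst proj_cinner[OF PF_proj[OF B(1)]]) (simp add: z)
    then show "emeasure (mF h) (B \<union> D) = ennreal ((norm (PF B h + PF D h))\<^sup>2)"
      using B by (subst plus_emeasure[symmetric]) (simp_all add: pythagoras PF_measure)
  qed (use B in auto)
  then show ?thesis by simp
qed

text \<open>Multiplicativity is reduced to additivity: split both sets along the intersection and
  let the disjoint pieces annihilate each other.\<close>

lemma PF_Int: assumes B: "B \<in> sets borel" "D \<in> sets borel"
  shows "PF (B \<inter> D) h = PF B (PF D h)"
proof -
  have "B \<inter> D \<union> (D - B) = D" "B \<inter> D \<union> (B - D) = B" by auto
  then have 1: "PF D h = PF (B \<inter> D) h + PF (D - B) h" and 2: "PF B h = PF (B \<inter> D) h + PF (B - D) h" for h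
    using PF_Un[of "B \<inter> D" "D - B" h] PF_Un[of "B \<inter> D" "B - D" h] B by auto
  have "PF B (PF (D - B) h) = 0" "PF (B - D) (PF (B \<inter> D) h) = 0" using B by (auto intro!: PF_disjoint)
  then show ?thesis
    using B by (simp add: 1[of h] proj_simps[OF PF_proj[OF B(1)]]) (simp add: 2 proj_idem[OF PF_proj])
qed

lemma PF_Ioc: assumes "a \<le> b" shows "PF {a<..b} h = F b h - F a h"
proof -
  have eq: "{..b} = {..a} \<union> {a<..b}" using assms by auto
  have "PF {..b} h = PF {..a} h + PF {a<..b} h" by (subst eq, rule PF_Un) auto
  then show ?thesis by (simp add: PF_atMost)
qed

lemma PF_pvm: "projection_valued_measure PF"
  unfolding projection_valued_measure_def
proof (intro conjI ballI allI impI)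
  show "PF UNIV = id"
    by (rule PF_unique) (simp_all add: mF_UNIV proj_id id_def)
  fix B :: "nat \<Rightarrow> real set" and h assume "range B \<subseteq> sets borel \<and> disjoint_family B"
  then have B: "\<And>i. B i \<in> sets borel" "disjoint_family B" by auto
  from mF_union[of "\<lambda>i. PF (B i)" B, OF PF_proj[OF B(1)] PF_measure[OF B(1)] B(2) B(1)]
  obtain q where q: "projection_op q" "\<And>h. (\<lambda>i. PF (B i) h) sums q h"
    "\<And>h. emeasure (mF h) (\<Union>i. B i) = ennreal ((norm (q h))\<^sup>2)" by blast
  have "PF (\<Union>i. B i) = q" using B by (intro PF_unique q) auto
  then show "(\<lambda>n. PF (B n) h) sums PF (\<Union>n. B n) h" using q(2) by simp
next
  fix B D :: "real set" assume "B \<in> sets borel" "D \<in> sets borel"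
  then show "PF (B \<inter> D) = PF B \<circ> PF D" by (simp add: fun_eq_iff PF_Int)
qed (rule PF_proj)

end

section \<open>Scalar measures of an arbitrary projection-valued measure\<close>

lemma sets_scalar_measure [simp]: "sets (scalar_measure P h) = sets borel"
  and space_scalar_measure [simp]: "space (scalar_measure P h) = UNIV"
  by (simp_all add: scalar_measure_def sets.sigma_sets_eq[of borel, simplified])

context
  fixes P :: "real set \<Rightarrow> 'h::complex_hilbert_space \<Rightarrow> 'h"
  assumes P: "projection_valued_measure P"
begin

lemma pvm_proj: "B \<in> sets borel \<Longrightarrow> projection_op (P B)"
  and pvm_UNIV: "P UNIV h = h"
  and pvm_Int: "B \<in> sets borel \<Longrightarrow> D \<in> sets borel \<Longrightarrow> P (B \<inter> D) h = P B (P D h)"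
  and pvm_sums: "(\<And>n::nat. F n \<in> sets borel) \<Longrightarrow> disjoint_family F \<Longrightarrow> (\<lambda>n. P (F n) h) sums P (\<Union>n. F n) h"
  using P by (simp_all add: projection_valued_measure_def image_subset_iff)

lemma pvm_empty: "P {} h = 0"
proof -
  have "(\<lambda>n. P {} h) sums P {} h" using pvm_sums[of "\<lambda>n. {}" h] by (simp add: disjoint_family_on_def)
  then have "(\<lambda>n::nat. P {} h) \<longlonglongrightarrow> 0" by (rule summable_LIMSEQ_zero[OF sums_summable])
  then show ?thesis by (simp add: LIMSEQ_const_iff)
qed

lemma pvm_compl: assumes B: "B \<in> sets borel" shows "P (- B) h = h - P B h"
proof -
  let ?F = "\<lambda>n::nat. if n = 0 then B else if n = 1 then - B else {}"
  have "(\<lambda>n. P (?F n) h) sums P (\<Union>n. ?F n) h"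
    by (rule pvm_sums) (use B in \<open>auto simp: disjoint_family_on_def\<close>)
  moreover have "(\<Union>n. ?F n) = UNIV" by auto
  moreover have "(\<lambda>n. P (?F n) h) sums (\<Sum>n\<in>{0,1}. P (?F n) h)"
    by (rule sums_finite) (auto simp: pvm_empty)
  ultimately have "h = P B h + P (- B) h" using sums_unique2 by (fastforce simp: pvm_UNIV)
  then show ?thesis by (simp add: algebra_simps)
qed

lemma pvm_norm_sums:
  assumes "\<And>n::nat. F n \<in> sets borel" "disjoint_family F"
  shows "(\<lambda>n. (norm (P (F n) h))\<^sup>2) sums (norm (P (\<Union>n. F n) h))\<^sup>2"
proof -
  have "(\<lambda>n. Re (cinner (P (F n) h) h)) sums Re (cinner (P (\<Union>n. F n) h) h)"
    by (intro bounded_linear.sums[OF bounded_linear_Re]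
        bounded_linear.sums[OF bounded_bilinear.bounded_linear_left[OF bounded_bilinear_cinner]] pvm_sums assms)
  then show ?thesis using assms by (simp add: proj_norm_sq pvm_proj)
qed

lemma emeasure_scalar_measure:
  assumes "B \<in> sets borel" shows "emeasure (scalar_measure P h) B = ennreal ((norm (P B h))\<^sup>2)"
proof -
  have "emeasure (scalar_measure P h) B = ennreal (Re (cinner (P B h) h))"
    unfolding scalar_measure_def
  proof (rule emeasure_measure_of_sigma)
    show "sigma_algebra UNIV (sets (borel :: real measure))" using sets.sigma_algebra_axioms[of borel] by simp
    show "positive (sets borel) (\<lambda>B. ennreal (Re (cinner (P B h) h)))" by (simp add: positive_def pvm_empty)
    show "countably_additive (sets borel) (\<lambda>B. ennreal (Re (cinner (P B h) h)))"
    proof (rule countably_additiveI)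
      fix F :: "nat \<Rightarrow> real set" assume F: "range F \<subseteq> sets borel" "disjoint_family F" "(\<Union>n. F n) \<in> sets borel"
      then have "F n \<in> sets borel" for n by auto
      then have "Re (cinner (P (F n) h) h) = (norm (P (F n) h))\<^sup>2" for n by (simp add: proj_norm_sq pvm_proj)
      moreover have "Re (cinner (P (\<Union>n. F n) h) h) = (norm (P (\<Union>n. F n) h))\<^sup>2"
        using F(3) by (simp add: proj_norm_sq pvm_proj)
      ultimately show "(\<Sum>n. ennreal (Re (cinner (P (F n) h) h))) = ennreal (Re (cinner (P (\<Union>n. F n) h) h))"
        by (simp only:) (rule suminf_ennreal_eq[OF _ pvm_norm_sums[OF \<open>\<And>n. F n \<in> sets borel\<close> F(2)]], simp)
    qed
  qed (use assms in auto)
  then show ?thesis using assms by (simp add: proj_norm_sq pvm_proj)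
qed

lemma scalar_measure_eqI:
  "(\<And>B. B \<in> sets borel \<Longrightarrow> norm (P B h) = norm (P B k)) \<Longrightarrow> scalar_measure P h = scalar_measure P k"
  by (rule measure_eqI) (simp_all add: emeasure_scalar_measure)

lemma finite_scalar_measure: "finite_measure (scalar_measure P h)"
  by (rule finite_measureI) (simp add: emeasure_scalar_measure)

lemma nn_integral_scalar_mono:
  assumes "\<And>B. B \<in> sets borel \<Longrightarrow> norm (P B h) \<le> norm (P B k)"
  shows "nn_integral (scalar_measure P h) f \<le> nn_integral (scalar_measure P k) f"
  using assms by (intro nn_integral_mono_measure)
     (auto simp: le_measure emeasure_scalar_measure power_mono)

lemma nn_integral_cells:
  fixes B :: "nat \<Rightarrow> real set"
  assumes B: "\<And>j. B j \<in> sets borel" "disjoint_family B" and all: "P (\<Union>j. B j) h = h" and f: "f \<in> borel_measurable borel"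
  shows "nn_integral (scalar_measure P h) f = (\<Sum>j. \<integral>\<^sup>+ l. f l * indicator (B j) l \<partial>scalar_measure P h)"
proof -
  let ?M = "scalar_measure P h"
  define U where "U = (\<Union>j. B j)"
  have U: "U \<in> sets borel" using B by (auto simp: U_def)
  have "emeasure ?M (- U) = 0" using U all by (simp add: emeasure_scalar_measure pvm_compl[OF U] U_def[symmetric])
  then have "AE l in ?M. l \<in> U" using U by (intro AE_I[of _ _ "- U"]) auto
  moreover have "f l = (\<Sum>j. f l * indicator (B j) l)" if "l \<in> U" for l
  proof -
    obtain i where "l \<in> B i" using \<open>l \<in> U\<close> by (auto simp: U_def)
    from suminf_cmult_indicator[OF B(2) this, of "\<lambda>_. f l"] show ?thesis by simp
  qed
  ultimately have "nn_integral ?M f = (\<integral>\<^sup>+ l. (\<Sum>j. f l * indicator (B j) l) \<partial>?M)"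
    by (intro nn_integral_cong_AE) (auto elim!: eventually_mono)
  also have "\<dots> = (\<Sum>j. \<integral>\<^sup>+ l. f l * indicator (B j) l \<partial>?M)"
  proof (rule nn_integral_suminf)
    fix j
    have "?M = scalar_measure P h" ..
    show "(\<lambda>l. f l * indicator (B j) l) \<in> borel_measurable ?M"
      using f B(1)[of j] by (intro borel_measurable_times_ennreal borel_measurable_indicator)
        (simp_all add: measurable_cong_sets[OF sets_scalar_measure refl])
  qed
  finally show ?thesis .
qed

end

lemma nn_integral_cell_bounds:
  fixes f :: "real \<Rightarrow> ennreal"
  assumes "B \<in> sets M" "\<And>l. l \<in> B \<Longrightarrow> c \<le> f l" "\<And>l. l \<in> B \<Longrightarrow> f l \<le> d"
  shows "c * emeasure M B \<le> (\<integral>\<^sup>+ l. f l * indicator B l \<partial>M)" "(\<integral>\<^sup>+ l. f l * indicator B l \<partial>M) \<le> d * emeasure M B"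
proof -
  have "c * emeasure M B = (\<integral>\<^sup>+ l. c * indicator B l \<partial>M)"
    by (rule nn_integral_cmult_indicator[OF assms(1), symmetric])
  also have "\<dots> \<le> (\<integral>\<^sup>+ l. f l * indicator B l \<partial>M)"
    by (rule nn_integral_mono) (auto simp: indicator_def assms)
  finally show "c * emeasure M B \<le> (\<integral>\<^sup>+ l. f l * indicator B l \<partial>M)" .
  have "(\<integral>\<^sup>+ l. f l * indicator B l \<partial>M) \<le> (\<integral>\<^sup>+ l. d * indicator B l \<partial>M)"
    by (rule nn_integral_mono) (auto simp: indicator_def assms)
  also have "\<dots> = d * emeasure M B" by (rule nn_integral_cmult_indicator[OF assms(1)])
  finally show "(\<integral>\<^sup>+ l. f l * indicator B l \<partial>M) \<le> d * emeasure M B" .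
qed

section \<open>Moments of the spectral measure, computed on cells\<close>

context closed_op
begin

text \<open>Left-open, so that \<open>PF\<close> of a cell is a difference of two values of
  \<open>F\<close>. The cell with index zero ends at zero and so catches the kernel.\<close>

definition "cell e j = {(real j - 1) * e <.. real j * e}"

lemma cell_sets: "cell e j \<in> sets borel" by (simp add: cell_def)

lemma cell_disjoint: assumes "0 < e" shows "disjoint_family (cell e)"
proof -
  have "cell e i \<inter> cell e j = {}" if "i < j" for i j
  proof -
    have "real i * e \<le> (real j - 1) * e" using that assms by (intro mult_right_mono) auto
    then show ?thesis by (auto simp: cell_def)
  qed
  then show ?thesis unfolding disjoint_family_on_def by (metis Int_commute nat_neq_iff)
qed

lemma cell_UN: assumes e: "0 < e" shows "(\<Union>j. cell e j) = {- e<..}"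
proof (intro equalityI subsetI)
  fix x assume x: "x \<in> {- e<..}"
  let ?j = "nat \<lceil>x / e\<rceil>"
  have "- 1 < x / e" using x e by (simp add: field_simps)
  then have "0 \<le> \<lceil>x / e\<rceil>" by linarith
  then have j: "real ?j = of_int \<lceil>x / e\<rceil>" by simp
  have "real ?j - 1 < x / e" "x / e \<le> real ?j" unfolding j by linarith+
  then have "x \<in> cell e ?j" using e by (simp add: cell_def field_simps)
  then show "x \<in> (\<Union>j. cell e j)" by blast
next
  fix x assume "x \<in> (\<Union>j. cell e j)"
  then obtain j where "(real j - 1) * e < x" by (auto simp: cell_def)
  moreover have "- 1 * e \<le> (real j - 1) * e" using e by (intro mult_right_mono) auto
  ultimately show "x \<in> {- e<..}" by simp
qed

lemma PF_cell_UN: assumes e: "0 < e" shows "PF (\<Union>j. cell e j) h = h"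
proof -
  have "PF (- {..- e}) h = h - PF {..- e} h" by (rule pvm_compl[OF PF_pvm]) simp
  moreover have "- {..- e} = {- e<..}" by auto
  ultimately show ?thesis using e by (simp add: cell_UN PF_atMost F_neg)
qed

lemma PF_cell: "0 < e \<Longrightarrow> PF (cell e j) h = F (real j * e) h - F ((real j - 1) * e) h"
  unfolding cell_def by (rule PF_Ioc) simp

lemma PF_cell_S: "0 < e \<Longrightarrow> PF (cell e j) (S h) = S (PF (cell e j) h)"
  and PF_cell_C: "0 < e \<Longrightarrow> PF (cell e j) (C h) = C (PF (cell e j) h)"
  by (simp_all add: PF_cell S_lin C_lin F_S F_C)

lemma F_PF_cell: assumes "0 < e"
  shows "F (real j * e) (PF (cell e j) h) = PF (cell e j) h" "F ((real j - 1) * e) (PF (cell e j) h) = 0"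
proof -
  have le: "(real j - 1) * e \<le> real j * e" using assms by simp
  show "F (real j * e) (PF (cell e j) h) = PF (cell e j) h"
    by (simp only: PF_cell[OF assms] F_lin F_idem F_mono[OF le])
  show "F ((real j - 1) * e) (PF (cell e j) h) = 0"
    by (simp only: PF_cell[OF assms] F_lin F_idem F_mono'[OF le] diff_self)
qed

lemma cell_form:
  assumes e: "0 < e" and g: "g = PF (cell e j) h"
  shows "Re (cinner (C g) (S g)) \<le> real j * e * (norm (S g))\<^sup>2"
    "(real j - 1) * e * (norm (S g))\<^sup>2 \<le> Re (cinner (C g) (S g))"
    "norm (C g) \<le> real j * e * norm (S g)"
    "0 < j \<Longrightarrow> (real j - 1) * e * norm (S g) \<le> norm (C g)"
proof -
  have 1: "F (real j * e) g = g" and 2: "F ((real j - 1) * e) g = 0" using F_PF_cell[OF e] g by simp_all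
  show "Re (cinner (C g) (S g)) \<le> real j * e * (norm (S g))\<^sup>2" by (rule F_S_form(1)[OF 1])
  show "norm (C g) \<le> real j * e * norm (S g)" using F_C_upper[OF 1] e by simp
  show "(real j - 1) * e * (norm (S g))\<^sup>2 \<le> Re (cinner (C g) (S g))"
    using F_S_form_strict(1)[OF 2] by (cases "g = 0") (auto simp: S_lin C_lin)
  assume "0 < j"
  then show "(real j - 1) * e * norm (S g) \<le> norm (C g)"
    using F_C_lower[OF 2] e by (cases "g = 0") (auto simp: S_lin C_lin)
qed

lemma cell_form_sums: assumes e: "0 < e"
  shows "(\<lambda>j. Re (cinner (C (PF (cell e j) g)) (S (PF (cell e j) g)))) sums Re (cinner (C g) (S g))"
proof -
  have "(\<lambda>j. Re (cinner (PF (cell e j) (C g)) (S g))) sums Re (cinner (PF (\<Union>j. cell e j) (C g)) (S g))"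
    by (intro bounded_linear.sums[OF bounded_linear_Re]
        bounded_linear.sums[OF bounded_bilinear.bounded_linear_left[OF bounded_bilinear_cinner]]
        pvm_sums[OF PF_pvm] cell_sets cell_disjoint e)
  moreover have "cinner (PF (cell e j) (C g)) (S g) = cinner (C (PF (cell e j) g)) (S (PF (cell e j) g))" for j
  proof -
    have "cinner (PF (cell e j) (C g)) (S g) = cinner (PF (cell e j) (PF (cell e j) (C g))) (S g)"
      by (simp only: proj_idem[OF PF_proj[OF cell_sets]])
    also have "\<dots> = cinner (PF (cell e j) (C g)) (PF (cell e j) (S g))"
      by (rule proj_cinner[OF PF_proj[OF cell_sets]])
    finally show ?thesis by (simp only: PF_cell_S[OF e] PF_cell_C[OF e])
  qed
  ultimately show ?thesis by (simp add: PF_cell_UN[OF e])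
qed

lemma cell_norm_sums: "0 < e \<Longrightarrow> (\<lambda>j. (norm (PF (cell e j) h))\<^sup>2) sums (norm h)\<^sup>2"
  using pvm_norm_sums[OF PF_pvm cell_sets cell_disjoint, of e h] by (simp add: PF_cell_UN)

abbreviation "MF \<equiv> scalar_measure PF"

lemma emeasure_MF_cell: "0 < e \<Longrightarrow> emeasure (MF (S g)) (cell e j) = ennreal ((norm (S (PF (cell e j) g)))\<^sup>2)"
  by (simp add: emeasure_scalar_measure[OF PF_pvm cell_sets] PF_cell_S)

lemma nn_integral_MF_cells:
  "0 < e \<Longrightarrow> f \<in> borel_measurable borel \<Longrightarrow>
    nn_integral (MF h) f = (\<Sum>j. \<integral>\<^sup>+ l. f l * indicator (cell e j) l \<partial>MF h)"
  by (rule nn_integral_cells[OF PF_pvm cell_sets cell_disjoint PF_cell_UN])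

text \<open>On a cell of width \<open>e\<close> the integral and the form differ by at most
  \<open>e\<close> times the mass of the cell. Summed over all cells the error is at most
  \<open>e\<close> times the total mass, and \<open>e\<close> is arbitrary.\<close>

lemma nn_integral_MF: "(\<integral>\<^sup>+ l. ennreal l \<partial>MF (S g)) = ennreal (Re (cinner (C g) (S g)))"
proof (rule antisym)
  define x where "x e j = Re (cinner (C (PF (cell e j) g)) (S (PF (cell e j) g)))" for e j
  define y where "y e j = (norm (S (PF (cell e j) g)))\<^sup>2" for e j
  define I where "I e j = (\<integral>\<^sup>+ l. ennreal l * indicator (cell e j) l \<partial>MF (S g))" for e j
  let ?r = "Re (cinner (C g) (S g))"
  have x_pos: "0 \<le> x e j" for e j
  proof -
    have "pos_op (\<lambda>h. S (C h))" by (rule pos_comp[OF S_pos C_pos SC[symmetric]])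
    then show ?thesis unfolding x_def using pos_op_nonneg selfadjD[OF S_selfadj] by metis
  qed
  have bounds: "I e j \<le> ennreal (x e j + e * y e j)" "ennreal (x e j) \<le> I e j + ennreal (e * y e j)" if e: "0 < e" for e j
  proof -
    have y: "0 \<le> y e j" by (simp add: y_def)
    have x: "x e j \<le> real j * e * y e j" "(real j - 1) * e * y e j \<le> x e j"
      using cell_form(1,2)[OF e refl, of j g] by (simp_all add: x_def y_def)
    have "I e j \<le> ennreal (real j * e) * ennreal (y e j)"
      unfolding I_def y_def emeasure_MF_cell[OF e, symmetric]
      by (rule nn_integral_cell_bounds(2)[where c = 0]) (auto simp: cell_def intro: ennreal_leI)
    also have "\<dots> = ennreal (real j * e * y e j)" using e y by (simp flip: ennreal_mult)
    also have "\<dots> \<le> ennreal (x e j + e * y e j)" using x by (intro ennreal_leI) (simp add: algebra_simps)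
    finally show "I e j \<le> ennreal (x e j + e * y e j)" .
    have I: "ennreal ((real j - 1) * e) * ennreal (y e j) \<le> I e j"
      unfolding I_def y_def emeasure_MF_cell[OF e, symmetric]
      by (rule nn_integral_cell_bounds(1)[where d = top]) (auto simp: cell_def intro: ennreal_leI)
    have "ennreal (x e j) \<le> ennreal ((real j - 1) * e) * ennreal (y e j) + ennreal (e * y e j)"
    proof (cases "j = 0")
      case True
      then have "x e j \<le> 0" using x by simp
      then show ?thesis by (simp add: ennreal_neg)
    next
      case False
      have "ennreal ((real j - 1) * e) * ennreal (y e j) + ennreal (e * y e j) = ennreal ((real j - 1) * e * y e j + e * y e j)"
        using False e y by (simp add: ennreal_mult ennreal_plus)
      then show ?thesis using x by (simp add: algebra_simps ennreal_leI)
    qed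
    also have "\<dots> \<le> I e j + ennreal (e * y e j)" using I by (rule add_right_mono)
    finally show "ennreal (x e j) \<le> I e j + ennreal (e * y e j)" .
  qed
  have xs: "x e sums ?r" if "0 < e" for e unfolding x_def by (rule cell_form_sums[OF that])
  have ys: "(\<lambda>j. e * y e j) sums (e * (norm (S g))\<^sup>2)" if "0 < e" for e
    using cell_norm_sums[OF that, of "S g"] that by (intro sums_mult) (simp add: y_def PF_cell_S)
  have int: "(\<integral>\<^sup>+ l. ennreal l \<partial>MF (S g)) = (\<Sum>j. I e j)" if "0 < e" for e
    unfolding I_def by (rule nn_integral_MF_cells[OF that]) simp
  have y_pos: "0 \<le> e * y e j" if "0 < e" for e j using that by (simp add: y_def)
  have up: "(\<integral>\<^sup>+ l. ennreal l \<partial>MF (S g)) \<le> ennreal ?r + ennreal (e * (norm (S g))\<^sup>2)" if e: "0 < e" for e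
  proof -
    have "(\<Sum>j. I e j) \<le> (\<Sum>j. ennreal (x e j + e * y e j))" by (rule suminf_le) (auto intro: bounds[OF e])
    also have "\<dots> = ennreal (?r + e * (norm (S g))\<^sup>2)"
      by (rule suminf_ennreal_eq) (use x_pos y_pos[OF e] sums_add[OF xs[OF e] ys[OF e]] in \<open>auto intro: add_nonneg_nonneg\<close>)
    also have "\<dots> \<le> ennreal ?r + ennreal (e * (norm (S g))\<^sup>2)"
      using e by (simp add: ennreal_plus_if)
    finally show ?thesis by (simp add: int[OF e])
  qed
  have lo: "ennreal ?r \<le> (\<integral>\<^sup>+ l. ennreal l \<partial>MF (S g)) + ennreal (e * (norm (S g))\<^sup>2)" if e: "0 < e" for e
  proof -
    have "ennreal ?r = (\<Sum>j. ennreal (x e j))" by (rule suminf_ennreal_eq[symmetric]) (use x_pos xs[OF e] in auto)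
    also have "\<dots> \<le> (\<Sum>j. I e j + ennreal (e * y e j))" by (rule suminf_le) (auto intro: bounds[OF e])
    also have "\<dots> = (\<Sum>j. I e j) + (\<Sum>j. ennreal (e * y e j))" by (rule suminf_add[symmetric]) auto
    also have "(\<Sum>j. ennreal (e * y e j)) = ennreal (e * (norm (S g))\<^sup>2)"
      by (rule suminf_ennreal_eq) (use y_pos[OF e] ys[OF e] in auto)
    finally show ?thesis by (simp add: int[OF e])
  qed
  have small: "d / (1 + (norm (S g))\<^sup>2) * (norm (S g))\<^sup>2 \<le> d" "0 < d / (1 + (norm (S g))\<^sup>2)" if "0 < d" for d :: real
    using that by (auto simp: field_simps add_pos_nonneg)
  show "(\<integral>\<^sup>+ l. ennreal l \<partial>MF (S g)) \<le> ennreal ?r"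
  proof (rule ennreal_le_epsilon)
    fix d :: real assume "0 < d"
    from small[OF this] show "(\<integral>\<^sup>+ l. ennreal l \<partial>MF (S g)) \<le> ennreal ?r + ennreal d"
      using up[of "d / (1 + (norm (S g))\<^sup>2)"] by (meson add_left_mono ennreal_leI order_trans)
  qed
  show "ennreal ?r \<le> (\<integral>\<^sup>+ l. ennreal l \<partial>MF (S g))"
  proof (rule ennreal_le_epsilon)
    fix d :: real assume "0 < d"
    from small[OF this] show "ennreal ?r \<le> (\<integral>\<^sup>+ l. ennreal l \<partial>MF (S g)) + ennreal d"
      using lo[of "d / (1 + (norm (S g))\<^sup>2)"] by (meson add_left_mono ennreal_leI order_trans)
  qed
qed

lemma cell_sq_bounds:
  assumes "l \<in> cell 1 j"
  shows "0 < j \<Longrightarrow> (real j - 1)\<^sup>2 \<le> l\<^sup>2" "l\<^sup>2 \<le> (if j = 0 then 1 else (real j)\<^sup>2)"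
proof -
  have l: "real j - 1 < l" "l \<le> real j" using assms by (auto simp: cell_def)
  show "(real j - 1)\<^sup>2 \<le> l\<^sup>2" if "0 < j" using l that by (intro power_mono) auto
  show "l\<^sup>2 \<le> (if j = 0 then 1 else (real j)\<^sup>2)"
  proof (cases "j = 0")
    case True
    then have "\<bar>l\<bar> \<le> 1" using l by auto
    then show ?thesis using True by (simp add: abs_square_le_1)
  next
    case False
    then show ?thesis using l by (auto intro!: power_mono)
  qed
qed

lemma sq_step: "(real j)\<^sup>2 \<le> 2 * (real j - 1)\<^sup>2 + 2"
proof -
  have "0 \<le> (real j - 2)\<^sup>2" by simp
  then show ?thesis by (simp add: power2_eq_square algebra_simps)
qed

abbreviation "moment2 h \<equiv> \<integral>\<^sup>+ l. ennreal (l\<^sup>2) \<partial>MF h"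

text \<open>Only finiteness of the second moment is wanted for the domain, so cells of width one and
  a comparison up to the factor 2 and a multiple of the mass are enough; \<open>sq_step\<close>
  accounts for both.\<close>

lemma nn_integral_MF_sq_le:
  "moment2 (S g) \<le> ennreal (2 * (norm (C g))\<^sup>2 + 2 * (norm (S g))\<^sup>2)"
  and nn_integral_MF_sq_ge:
  "ennreal ((norm (C g))\<^sup>2) \<le> 2 * moment2 (S g) + ennreal (2 * (norm (S g))\<^sup>2)"
proof -
  define x where "x j = (norm (C (PF (cell 1 j) g)))\<^sup>2" for j
  define y where "y j = (norm (S (PF (cell 1 j) g)))\<^sup>2" for j
  define I where "I j = (\<integral>\<^sup>+ l. ennreal (l\<^sup>2) * indicator (cell 1 j) l \<partial>MF (S g))" for j
  have xs: "x sums (norm (C g))\<^sup>2" and ys: "y sums (norm (S g))\<^sup>2"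
    using cell_norm_sums[of 1 "C g"] cell_norm_sums[of 1 "S g"] by (simp_all add: x_def[abs_def] y_def[abs_def] PF_cell_S PF_cell_C)
  have pos: "0 \<le> x j" "0 \<le> y j" for j by (simp_all add: x_def y_def)
  have int: "moment2 (S g) = (\<Sum>j. I j)"
    unfolding I_def by (rule nn_integral_MF_cells) simp_all
  have xle: "x j \<le> (real j)\<^sup>2 * y j" for j
    using power_mono[OF cell_form(3)[of 1 _ j g, OF _ refl], of 2] by (simp add: x_def y_def power_mult_distrib)
  have xge: "(real j - 1)\<^sup>2 * y j \<le> x j" if "0 < j" for j
    using power_mono[OF cell_form(4)[of 1 _ j g, OF _ refl that], of 2] that by (simp add: x_def y_def power_mult_distrib)
  have Ile: "I j \<le> ennreal (2 * x j + 2 * y j)" for j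
  proof -
    have "I j \<le> ennreal (if j = 0 then 1 else (real j)\<^sup>2) * ennreal (y j)"
      unfolding I_def y_def emeasure_MF_cell[OF zero_less_one, symmetric]
      by (rule nn_integral_cell_bounds(2)[where c = 0]) (simp_all add: cell_sets ennreal_leI cell_sq_bounds(2))
    also have "\<dots> = ennreal ((if j = 0 then 1 else (real j)\<^sup>2) * y j)" by (simp add: ennreal_mult pos)
    also have "\<dots> \<le> ennreal (2 * x j + 2 * y j)"
    proof (rule ennreal_leI, cases "j = 0")
      case True
      then show "(if j = 0 then 1 else (real j)\<^sup>2) * y j \<le> 2 * x j + 2 * y j" using pos[of j] by simp
    next
      case False
      have "(real j)\<^sup>2 * y j \<le> (2 * (real j - 1)\<^sup>2 + 2) * y j" by (intro mult_right_mono sq_step pos)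
      then show "(if j = 0 then 1 else (real j)\<^sup>2) * y j \<le> 2 * x j + 2 * y j"
        using xge[of j] False by (simp add: algebra_simps)
    qed
    finally show ?thesis .
  qed
  have "(\<Sum>j. I j) \<le> (\<Sum>j. ennreal (2 * x j + 2 * y j))" by (rule suminf_le) (auto intro: Ile)
  also have "\<dots> = ennreal (2 * (norm (C g))\<^sup>2 + 2 * (norm (S g))\<^sup>2)"
    by (rule suminf_ennreal_eq) (use pos in \<open>auto intro!: sums_add sums_mult xs ys\<close>)
  finally show "moment2 (S g) \<le> ennreal (2 * (norm (C g))\<^sup>2 + 2 * (norm (S g))\<^sup>2)"
    by (simp add: int)
  have Ige: "ennreal (x j) \<le> 2 * I j + ennreal (2 * y j)" for j
  proof (cases "j = 0")
    case True
    then have "x j \<le> 0" using xle[of j] by simp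
    then show ?thesis by (simp add: ennreal_neg)
  next
    case False
    have "ennreal ((real j - 1)\<^sup>2) * ennreal (y j) \<le> I j"
      unfolding I_def y_def emeasure_MF_cell[OF zero_less_one, symmetric]
      by (rule nn_integral_cell_bounds(1)[where d = top]) (use False in \<open>simp_all add: cell_sets ennreal_leI cell_sq_bounds(1)\<close>)
    then have I: "ennreal ((real j - 1)\<^sup>2 * y j) \<le> I j" by (simp add: ennreal_mult pos)
    have "(real j)\<^sup>2 * y j \<le> (2 * (real j - 1)\<^sup>2 + 2) * y j" by (intro mult_right_mono sq_step pos)
    then have "x j \<le> 2 * ((real j - 1)\<^sup>2 * y j) + 2 * y j" using xle[of j] by (simp add: algebra_simps)
    then have "ennreal (x j) \<le> ennreal (2 * ((real j - 1)\<^sup>2 * y j) + 2 * y j)" by (rule ennreal_leI)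
    also have "\<dots> = 2 * ennreal ((real j - 1)\<^sup>2 * y j) + ennreal (2 * y j)"
      using pos by (simp add: ennreal_plus ennreal_mult)
    also have "\<dots> \<le> 2 * I j + ennreal (2 * y j)" by (intro add_right_mono mult_left_mono I) simp
    finally show ?thesis .
  qed
  have "ennreal ((norm (C g))\<^sup>2) = (\<Sum>j. ennreal (x j))" by (rule suminf_ennreal_eq[symmetric]) (use pos xs in auto)
  also have "\<dots> \<le> (\<Sum>j. 2 * I j + ennreal (2 * y j))" by (rule suminf_le) (auto intro: Ige)
  also have "\<dots> = (\<Sum>j. 2 * I j) + (\<Sum>j. ennreal (2 * y j))" by (rule suminf_add[symmetric]) auto
  also have "(\<Sum>j. ennreal (2 * y j)) = ennreal (2 * (norm (S g))\<^sup>2)"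
    by (rule suminf_ennreal_eq) (use pos in \<open>auto intro!: sums_mult ys\<close>)
  also have "(\<Sum>j. 2 * I j) = 2 * (\<Sum>j. I j)" by (rule ennreal_suminf_cmult)
  finally show "ennreal ((norm (C g))\<^sup>2) \<le> 2 * moment2 (S g) + ennreal (2 * (norm (S g))\<^sup>2)"
    by (simp add: int)
qed

lemma MF_nonneg: "AE l in MF h. 0 \<le> l"
proof -
  have "{..- inverse (real (Suc n))} \<in> null_sets (MF h)" for n
    by (simp add: null_sets_def emeasure_scalar_measure[OF PF_pvm] PF_atMost F_neg)
  then have N: "(\<Union>n. {..- inverse (real (Suc n))}) \<in> null_sets (MF h)" by (rule null_sets_UN)
  have "{..<0} \<subseteq> (\<Union>n. {..- inverse (real (Suc n))})"
  proof
    fix x :: real assume "x \<in> {..<0}"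
    then obtain n where "inverse (real (Suc n)) < - x" using reals_Archimedean[of "- x"] by auto
    then show "x \<in> (\<Union>n. {..- inverse (real (Suc n))})" by (intro UN_I[of n]) auto
  qed
  then show ?thesis by (intro AE_I'[OF N]) auto
qed

lemma F_S_lower: assumes s: "0 \<le> s" and g: "F s g = g" shows "1 / (1 + s) * norm g \<le> norm (S g)"
proof -
  have "norm g \<le> norm (S g) + norm (C g)"
  proof (rule power2_le_imp_le)
    show "(norm g)\<^sup>2 \<le> (norm (S g) + norm (C g))\<^sup>2" by (simp add: power2_sum flip: norm_S_C[of g])
  qed simp
  then have "norm g \<le> (1 + s) * norm (S g)" using F_C_upper[OF g s] by (simp add: algebra_simps)
  then show ?thesis using s by (simp add: field_simps)
qed

lemma F_in_range_S: assumes "0 \<le> s" shows "\<exists>g. F s h = S g \<and> F s g = g"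
proof -
  have "0 < 1 / (1 + s)" using assms by simp
  obtain I where "\<forall>h. S (I h) = F s h" "\<forall>h. F s (I h) = I h"
  proof (rule exE[OF selfadj_inverse_on[where T = S and G = "F s", OF S_selfadj F_proj F_S \<open>0 < 1 / (1 + s)\<close>]])
    show "1 / (1 + s) * norm h \<le> norm (S h)" if "F s h = h" for h by (rule F_S_lower[OF assms that])
  qed (elim conjE, rule that; assumption)
  then show ?thesis by (intro exI[of _ "I h"]) simp
qed

lemma PF_commute: "B \<in> sets borel \<Longrightarrow> PF B (F s h) = F s (PF B h)"
  using PF_Int[of B "{..s}" h] PF_Int[of "{..s}" B h] by (simp add: PF_atMost Int_commute)

lemma PF_domain: "Domain A = {h. moment2 h < \<infinity>}"
proof (intro equalityI subsetI)
  fix h assume "h \<in> Domain A"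
  then obtain g where "h = S g" by (auto simp: in_A)
  then have "moment2 h < \<infinity>"
    by (simp only:) (rule le_less_trans[OF nn_integral_MF_sq_le], simp)
  then show "h \<in> {h. moment2 h < \<infinity>}" by simp
next
  fix h assume "h \<in> {h. moment2 h < \<infinity>}"
  then have fin: "moment2 h < \<infinity>" by simp
  obtain K where K: "2 * moment2 h + ennreal (2 * (norm h)\<^sup>2) = ennreal K" "0 \<le> K"
    using fin by (cases "2 * moment2 h + ennreal (2 * (norm h)\<^sup>2)")
      (auto simp: ennreal_mult_eq_top_iff top_unique)
  \<comment> \<open>\<open>S\<close> is invertible on the range of each \<open>F n\<close>, and
    injectivity makes the preimages consistent. The second moment bounds their norms, so they
    converge, and the limit is a preimage of \<open>h\<close>.\<close>
  have "\<forall>n. \<exists>g. F (real n) h = S g \<and> F (real n) g = g" using F_in_range_S by simp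
  then obtain g where g: "\<And>n. F (real n) h = S (g n)" "\<And>n. F (real n) (g n) = g n" by metis
  have gm: "F (real m) (g n) = g m" if "m \<le> n" for m n
  proof -
    have "S (F (real m) (g n)) = F (real m) (F (real n) h)" by (simp only: F_S g(1))
    also have "\<dots> = F (real m) h" by (rule F_mono') (use that in simp)
    also have "\<dots> = S (g m)" by (rule g(1))
    finally have "S (F (real m) (g n) - g m) = 0" by (simp add: S_lin)
    from S_inj[OF this] show ?thesis by simp
  qed
  have diff: "(norm (g n - g m))\<^sup>2 = (norm (g n))\<^sup>2 - (norm (g m))\<^sup>2" if "m \<le> n" for m n
    using proj_pythagoras[OF F_proj, of "g n" "real m"] by (simp add: gm[OF that])
  have bound: "(norm (g n))\<^sup>2 \<le> (norm h)\<^sup>2 + K" for n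
  proof -
    have "moment2 (F (real n) h) \<le> moment2 h"
      by (rule nn_integral_scalar_mono[OF PF_pvm]) (simp add: PF_commute proj_norm_le[OF F_proj])
    moreover have nF: "norm (F (real n) h) \<le> norm h" by (rule proj_norm_le[OF F_proj])
    ultimately have "ennreal ((norm (C (g n)))\<^sup>2) \<le> 2 * moment2 h + ennreal (2 * (norm h)\<^sup>2)"
      using nn_integral_MF_sq_ge[of "g n"]
      by (elim order_trans) (auto intro!: add_mono mult_left_mono ennreal_leI power_mono simp flip: g(1))
    then have "(norm (C (g n)))\<^sup>2 \<le> K" using K by simp
    moreover have "(norm (S (g n)))\<^sup>2 \<le> (norm h)\<^sup>2" using nF by (simp add: power_mono flip: g(1))
    ultimately show ?thesis using norm_S_C[of "g n"] by linarith
  qed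
  have "incseq (\<lambda>n. (norm (g n))\<^sup>2)"
  proof (rule incseq_SucI)
    fix n show "(norm (g n))\<^sup>2 \<le> (norm (g (Suc n)))\<^sup>2"
      using diff[of n "Suc n"] zero_le_power2[of "norm (g (Suc n) - g n)"] by linarith
  qed
  then obtain L where "(\<lambda>n. (norm (g n))\<^sup>2) \<longlonglongrightarrow> L" using incseq_convergent bound by blast
  then have "convergent (\<lambda>n. (norm (g n))\<^sup>2)" by (auto simp: convergent_def)
  then have "Cauchy g" by (rule cauchy_if_monotone_sq[rotated]) (simp add: diff)
  then obtain x where x: "g \<longlonglongrightarrow> x" unfolding convergent_eq_Cauchy[symmetric] by blast
  have "(\<lambda>n. F (real n) h) \<longlonglongrightarrow> S x" unfolding g(1) by (rule bounded_clinear_tendsto[OF S_clinear x])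
  then have "h = S x" by (rule LIMSEQ_unique[OF F_tendsto_top])
  then show "h \<in> Domain A" using in_A by blast
qed

lemma PF_resolution: "spectral_resolution A PF"
  unfolding spectral_resolution_def
proof (intro conjI PF_pvm PF_domain ballI)
  fix p assume "p \<in> A"
  then obtain g where g: "p = (S g, C g)" by (auto simp: A_def)
  have pos: "pos_op (\<lambda>h. S (C h))" by (rule pos_comp[OF S_pos C_pos SC[symmetric]])
  have "cinner (C g) (S g) = cinner (S (C g)) g" by (simp add: selfadjD[OF S_selfadj])
  also have "\<dots> = of_real (Re (cinner (S (C g)) g))" by (rule selfadj_real[OF pos_op_selfadj[OF pos]])
  finally have r: "cinner (C g) (S g) = of_real (Re (cinner (C g) (S g)))" "0 \<le> Re (cinner (C g) (S g))"
    using pos_op_nonneg[OF pos, of g] by (simp_all add: selfadjD[OF S_selfadj])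
  have "(\<integral>l. l \<partial>MF (S g)) = enn2real (\<integral>\<^sup>+ l. ennreal l \<partial>MF (S g))"
    by (rule integral_eq_nn_integral) (simp_all add: MF_nonneg measurable_cong_sets[OF sets_scalar_measure refl])
  also have "\<dots> = Re (cinner (C g) (S g))" using r by (simp add: nn_integral_MF)
  finally show "case p of (h, k) \<Rightarrow> cinner k h = complex_of_real (\<integral>l. l \<partial>MF h)" using r by (simp add: g)
qed


lemma resolv_A: "resolv A = R"
proof -
  interpret A: closed_op A by (rule positive_selfadjoint_closed_op[OF A_positive_selfadjoint])
  have "range (\<lambda>w. (resolv A w, w - resolv A w)) = range (\<lambda>w. (R w, w - R w))"
    using A.adj_comp adj_comp A_comp A_adjoint by simp
  then have "\<exists>w'. (resolv A w, w - resolv A w) = (R w', w' - R w')" for w by blast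
  then show ?thesis
    by (metis (no_types, lifting) Pair_inject ext add_diff_cancel_left' diff_add_cancel add_diff_eq)
qed

section \<open>Uniqueness of the spectral resolution on half-lines\<close>

context
  fixes P assumes res: "spectral_resolution A P"
begin

lemma P_pvm: "projection_valued_measure P"
  and P_domain: "h \<in> Domain A \<longleftrightarrow> (\<integral>\<^sup>+ l. ennreal (l\<^sup>2) \<partial>scalar_measure P h) < \<infinity>"
  and P_form: "(h, k) \<in> A \<Longrightarrow> cinner k h = complex_of_real (\<integral>l. l \<partial>scalar_measure P h)"
  using res by (auto simp: spectral_resolution_def)

lemma P_Domain: assumes B: "B \<in> sets borel" and h: "h \<in> Domain A" shows "P B h \<in> Domain A"
proof -
  have "norm (P D (P B h)) \<le> norm (P D h)" if D: "D \<in> sets borel" for D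
  proof -
    have "P D (P B h) = P B (P D h)"
      using pvm_Int[OF P_pvm D B, of h] pvm_Int[OF P_pvm B D, of h] by (simp add: Int_commute)
    then show ?thesis using proj_norm_le[OF pvm_proj[OF P_pvm B]] by simp
  qed
  from nn_integral_scalar_mono[OF P_pvm this] h show ?thesis
    unfolding P_domain by (rule le_less_trans)
qed

text \<open>A resolution prescribes only quadratic forms. Since \<open>h\<close> and
  \<open>v\<close> lie in complementary ranges, \<open>h + c v\<close> and \<open>h - c v\<close>
  have the same scalar measure and hence the same value of the form; \<open>c = 1\<close> and
  \<open>c = i\<close> together isolate the mixed term.\<close>

lemma P_orthogonal:
  assumes B: "B \<in> sets borel" and hk: "(h, k) \<in> A" "P B h = h" and vw: "(v, w) \<in> A" "P B v = 0"
  shows "cinner k v = 0"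
proof -
  have A: "linear_operator A"
    using A_positive_selfadjoint by (simp add: positive_selfadjoint_def closed_densely_defined_def)
  have same: "norm (P D (h + c *\<^sub>C v)) = norm (P D (h - c *\<^sub>C v))" if D: "D \<in> sets borel" for D c
  proof -
    note lin = proj_simps[OF pvm_proj[OF P_pvm D]]
    have "P D (P B u) = P B (P D u)" for u
      using pvm_Int[OF P_pvm D B, of u] pvm_Int[OF P_pvm B D, of u] by (simp add: Int_commute)
    then have "P B (P D h) = P D h" "P B (P D v) = 0" using hk(2) vw(2) lin(3) by metis+
    then have "cinner (P D h) (P D v) = 0"
      using proj_cinner[OF pvm_proj[OF P_pvm B], of "P D h" "P D v"] by simp
    then have "(norm (P D h + c *\<^sub>C P D v))\<^sup>2 = (norm (P D h - c *\<^sub>C P D v))\<^sup>2"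
      by (simp add: norm_add_sq norm_diff_sq cinner_scaleC_right)
    then show ?thesis by (simp add: lin power2_eq_iff_nonneg)
  qed
  have eq: "cinner (k + c *\<^sub>C w) (h + c *\<^sub>C v) = cinner (k - c *\<^sub>C w) (h - c *\<^sub>C v)" for c
  proof -
    have cs: "(c *\<^sub>C v, c *\<^sub>C w) \<in> A" by (rule linear_operator_scaleC[OF A vw(1)])
    have "scalar_measure P (h + c *\<^sub>C v) = scalar_measure P (h - c *\<^sub>C v)"
      by (rule scalar_measure_eqI[OF P_pvm same])
    then show ?thesis
      using P_form[OF linear_operator_add[OF A hk(1) cs]] P_form[OF linear_operator_diff[OF A hk(1) cs]] by simp
  qed
  have "2 * (cinner k v + cinner w h) = 0"
    using eq[of 1] by (simp add: cinner_add_left cinner_add_right cinner_diff_left cinner_diff_right algebra_simps)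
  then have 1: "cinner k v + cinner w h = 0" unfolding mult_eq_0_iff by simp
  have "2 * (\<i> * cinner w h) = 2 * (\<i> * cinner k v)"
    using eq[of \<i>] by (simp add: cinner_add_left cinner_add_right cinner_diff_left cinner_diff_right
        cinner_scaleC_left cinner_scaleC_right algebra_simps)
  then have "cinner w h = cinner k v" by simp
  with 1 show ?thesis by simp
qed

text \<open>By \<open>P_orthogonal\<close>, tested against the dense domain, \<open>A\<close> maps
  the part of its domain in the range of \<open>P B\<close> back into that range. Using this for
  \<open>B\<close> and for its complement gives commutation.\<close>

lemma P_reduces: assumes B: "B \<in> sets borel" shows "reduces (P B) A"
proof -
  have A: "linear_operator A" and dA: "closure (Domain A) = UNIV"
    using A_positive_selfadjoint by (auto simp: positive_selfadjoint_def closed_densely_defined_def)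
  have inv: "P B k = k" if B: "B \<in> sets borel" and hk: "(h, k) \<in> A" "P B h = h" for B h k
  proof -
    note pB = pvm_proj[OF P_pvm B]
    have "cinner (k - P B k) h' = 0" if h': "h' \<in> Domain A" for h'
    proof -
      obtain w where w: "(h', w) \<in> A" using h' by blast
      obtain w' where w': "(P B h', w') \<in> A" using P_Domain[OF B h'] by blast
      have "cinner k (h' - P B h') = 0"
        by (rule P_orthogonal[OF B hk linear_operator_diff[OF A w w'] proj_perp_apply[OF pB]])
      then show ?thesis by (simp add: cinner_diff_left cinner_diff_right proj_cinner[OF pB])
    qed
    then have "k - P B k = 0" using dA csubspace_dense_iff[OF Domain_csubspace[OF A]] by blast
    then show ?thesis by simp
  qed
  have "(P B h, P B k) \<in> A" if hk: "(h, k) \<in> A" for h k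
  proof -
    note pB = pvm_proj[OF P_pvm B]
    obtain w where w: "(P B h, w) \<in> A" using P_Domain[OF B] hk by blast
    have d: "(h - P B h, k - w) \<in> A" by (rule linear_operator_diff[OF A hk w])
    have "P B w = w" by (rule inv[OF B w proj_idem[OF pB]])
    moreover have "P (- B) (k - w) = k - w"
      by (rule inv[OF _ d]) (use B in \<open>simp_all add: pvm_compl[OF P_pvm B] proj_simps[OF pB] proj_idem[OF pB]\<close>)
    then have "P B (k - w) = 0" by (simp add: pvm_compl[OF P_pvm B])
    ultimately have "P B k = w" by (simp add: proj_simps[OF pB])
    then show ?thesis using w by simp
  qed
  moreover have "badjoint (P B) = P B" using pvm_proj[OF P_pvm B] by (simp add: projection_op_def)
  ultimately show ?thesis using pvm_proj[OF P_pvm B] by (simp add: reduces_def proj_clinear)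
qed

lemma P_comm: assumes "B \<in> sets borel"
  shows "P B (S h) = S (P B h)" "P B (C h) = C (P B h)" "P B (F s h) = F s (P B h)"
proof -
  interpret A: closed_op A by (rule positive_selfadjoint_closed_op[OF A_positive_selfadjoint])
  have RS: "P B (R h) = R (P B h)" for h using A.reduces_comm(1)[OF P_reduces[OF assms]] by (simp add: resolv_A)
  note cl = proj_clinear[OF pvm_proj[OF P_pvm assms]]
  show S: "P B (S h) = S (P B h)" for h by (rule comm_S[OF cl RS])
  show C: "P B (C h) = C (P B h)" for h by (rule comm_C[OF cl RS])
  show "P B (F s h) = F s (P B h)" by (rule F_comm[OF cl S C])
qed

lemma P_integrable: "h \<in> Domain A \<Longrightarrow> integrable (scalar_measure P h) (\<lambda>l. l)"
proof (rule integrableI_bounded)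
  interpret finite_measure "scalar_measure P h" by (rule finite_scalar_measure[OF P_pvm])
  assume "h \<in> Domain A"
  have "ennreal (norm l) \<le> 1 + ennreal (l\<^sup>2)" for l :: real
  proof -
    have "0 \<le> (\<bar>l\<bar> - 1)\<^sup>2" by simp
    then have "\<bar>l\<bar> \<le> 1 + l\<^sup>2" by (simp add: power2_eq_square algebra_simps)
    then have "ennreal (norm l) \<le> ennreal (1 + l\<^sup>2)" unfolding real_norm_def by (rule ennreal_leI)
    also have "\<dots> = ennreal 1 + ennreal (l\<^sup>2)" by (rule ennreal_plus) simp_all
    finally show ?thesis by simp
  qed
  then have "(\<integral>\<^sup>+ l. ennreal (norm l) \<partial>scalar_measure P h) \<le> (\<integral>\<^sup>+ l. 1 + ennreal (l\<^sup>2) \<partial>scalar_measure P h)"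
    by (intro nn_integral_mono)
  also have "\<dots> = emeasure (scalar_measure P h) UNIV + (\<integral>\<^sup>+ l. ennreal (l\<^sup>2) \<partial>scalar_measure P h)"
    by (subst nn_integral_add) (simp_all add: measurable_cong_sets[OF sets_scalar_measure refl])
  also have "\<dots> < \<infinity>"
    using \<open>h \<in> Domain A\<close> by (simp add: P_domain emeasure_scalar_measure[OF P_pvm])
  finally show "(\<integral>\<^sup>+ l. ennreal (norm l) \<partial>scalar_measure P h) < \<infinity>" .
qed (simp add: measurable_cong_sets[OF sets_scalar_measure refl])

lemma P_form_le: assumes "P {..s} g = g" shows "Re (cinner (C g) (S g)) \<le> s * (norm (S g))\<^sup>2"
proof -
  interpret finite_measure "scalar_measure P (S g)" by (rule finite_scalar_measure[OF P_pvm])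
  have SC: "(S g, C g) \<in> A" by (auto simp: in_A)
  have int: "integrable (scalar_measure P (S g)) (\<lambda>l. l)" by (rule P_integrable) (use SC in blast)
  have PS: "P {..s} (S g) = S g" using P_comm(1)[of "{..s}" g] assms by simp
  have "emeasure (scalar_measure P (S g)) (- {..s}) = 0"
    using pvm_compl[OF P_pvm, of "{..s}" "S g"] PS by (subst emeasure_scalar_measure[OF P_pvm]) auto
  then have ae: "AE l in scalar_measure P (S g). l \<le> s" by (intro AE_I[of _ _ "- {..s}"]) auto
  have "(\<integral>l. l \<partial>scalar_measure P (S g)) \<le> (\<integral>l. s \<partial>scalar_measure P (S g))"
    by (rule integral_mono_AE[OF int _ ae]) simp
  also have "\<dots> = s * (norm (S g))\<^sup>2"
    by (simp add: measure_def emeasure_scalar_measure[OF P_pvm] pvm_UNIV[OF P_pvm])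
  finally show ?thesis using P_form[OF SC] by simp
qed

lemma P_form_gt: assumes "P {..s} g = 0" "g \<noteq> 0" shows "s * (norm (S g))\<^sup>2 < Re (cinner (C g) (S g))"
proof -
  let ?M = "scalar_measure P (S g)"
  interpret finite_measure ?M by (rule finite_scalar_measure[OF P_pvm])
  have SC: "(S g, C g) \<in> A" by (auto simp: in_A)
  have int: "integrable ?M (\<lambda>l. l)" by (rule P_integrable) (use SC in blast)
  have PS: "P {..s} (S g) = 0" using P_comm(1)[of "{..s}" g] assms by (simp add: S_lin)
  have "emeasure ?M {..s} = 0" using PS by (subst emeasure_scalar_measure[OF P_pvm]) auto
  then have ae: "AE l in ?M. 0 < l - s" by (intro AE_I[of _ _ "{..s}"]) auto
  have UN: "emeasure ?M UNIV = ennreal ((norm (S g))\<^sup>2)"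
    by (simp add: emeasure_scalar_measure[OF P_pvm] pvm_UNIV[OF P_pvm])
  have int': "integrable ?M (\<lambda>l. l - s)" using int by simp
  have eq: "(\<integral>l. l - s \<partial>?M) = Re (cinner (C g) (S g)) - s * (norm (S g))\<^sup>2"
    using int P_form[OF SC] UN by (simp add: measure_def)
  have "0 \<le> (\<integral>l. l - s \<partial>?M)" using ae by (intro integral_nonneg_AE) (auto elim!: eventually_mono)
  moreover have "(\<integral>l. l - s \<partial>?M) \<noteq> 0"
  proof
    assume "(\<integral>l. l - s \<partial>?M) = 0"
    moreover have "AE l in ?M. 0 \<le> l - s" using ae by eventually_elim simp
    ultimately have "AE l in ?M. l - s = 0"
      using integral_nonneg_eq_0_iff_AE[OF int'] by simp
    with ae have "AE l in ?M. False" by eventually_elim simp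
    then have "emeasure ?M UNIV = 0" using emeasure_eq_0_AE[of "\<lambda>_. True" ?M] by simp
    then show False using UN S_inj[of g] assms(2) by simp
  qed
  ultimately show ?thesis using eq by simp
qed

text \<open>The two projections commute, so a discrepancy would provide a nonzero vector in the
  range of one and the kernel of the other. Its form would be at most \<open>s\<close> times the
  squared norm of \<open>S g\<close> by one inequality and strictly more by another.\<close>

lemma resolution_unique: "P {..s} = F s"
proof
  fix x
  let ?E = "P {..s}"
  have E: "projection_op ?E" by (rule pvm_proj[OF P_pvm]) simp
  note E_lin = proj_simps[OF E]
  have EF: "?E (F s h) = F s (?E h)" for h by (rule P_comm(3)) simp
  have "F s (?E x) = ?E x"
  proof (rule ccontr)
    let ?y = "?E x - F s (?E x)"
    assume "F s (?E x) \<noteq> ?E x"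
    then have y: "?y \<noteq> 0" by simp
    have "?E ?y = ?y" by (simp only: E_lin proj_idem[OF E] EF)
    moreover have "F s ?y = 0" by (simp only: F_lin F_idem diff_self)
    ultimately show False using P_form_le[of s ?y] F_S_form_strict(1)[OF _ y] by fastforce
  qed
  moreover have "?E (F s x) = F s x"
  proof (rule ccontr)
    let ?z = "F s x - ?E (F s x)"
    assume "?E (F s x) \<noteq> F s x"
    then have z: "?z \<noteq> 0" by simp
    have "F s ?z = ?z" by (simp only: F_lin F_idem EF[symmetric])
    moreover have "?E ?z = 0" by (simp only: E_lin proj_idem[OF E] diff_self)
    ultimately show False using P_form_gt[OF _ z, of s] F_S_form(1)[of s ?z] by fastforce
  qed
  ultimately show "?E x = F s x" by (simp add: EF)
qed

end

lemma spectral_measure_resolution: "spectral_resolution A (spectral_measure (op_abs X))"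
  unfolding spectral_measure_def op_abs_eq by (rule someI[of "spectral_resolution A", OF PF_resolution])

text \<open>\<open>spectral_measure\<close> is an unspecified choice; these are its only values that
  enter the singular values, and uniqueness on half-lines pins them down.\<close>

lemma spectral_measure_greaterThan: "spectral_measure (op_abs X) {s<..} = perp (F s)"
proof
  fix h
  have "spectral_measure (op_abs X) (- {..s}) h = h - spectral_measure (op_abs X) {..s} h"
    by (rule pvm_compl[OF P_pvm[OF spectral_measure_resolution]]) simp
  moreover have "- {..s} = {s<..}" by auto
  ultimately show "spectral_measure (op_abs X) {s<..} h = h - F s h"
    by (simp add: resolution_unique[OF spectral_measure_resolution])
qed

end

section \<open>Von Neumann algebras\<close>

lemma unitary_badjoint: assumes "unitary_op u" shows "unitary_op (badjoint u)"
  using assms by (auto simp: unitary_op_def bounded_clinear_badjoint badjoint_badjoint)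

definition projs :: "('h::complex_hilbert_space \<Rightarrow> 'h) set \<Rightarrow> ('h \<Rightarrow> 'h) set" where
  "projs \<M> = {p\<in>\<M>. projection_op p}"

locale vn_algebra =
  fixes \<M> :: "('h::complex_hilbert_space \<Rightarrow> 'h) set"
  assumes vn: "von_neumann_algebra \<M>"
begin

lemma M_clinear: "T \<in> \<M> \<Longrightarrow> bounded_clinear T"
  and M_adj: "T \<in> \<M> \<Longrightarrow> badjoint T \<in> \<M>"
  and bicommutant: "commutant (commutant \<M>) = \<M>"
  using vn by (auto simp: von_neumann_algebra_def)

abbreviation "\<C> \<equiv> commutant \<M>"

lemma C_clinear': "K \<in> \<C> \<Longrightarrow> bounded_clinear K"
  and C_comm: "K \<in> \<C> \<Longrightarrow> T \<in> \<M> \<Longrightarrow> K (T h) = T (K h)"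
  by (auto simp: commutant_def fun_eq_iff)

lemma C_I: "bounded_clinear K \<Longrightarrow> (\<And>T h. T \<in> \<M> \<Longrightarrow> K (T h) = T (K h)) \<Longrightarrow> K \<in> \<C>"
  by (auto simp: commutant_def fun_eq_iff)

lemma M_I: "bounded_clinear T \<Longrightarrow> (\<And>K h. K \<in> \<C> \<Longrightarrow> T (K h) = K (T h)) \<Longrightarrow> T \<in> \<M>"
  by (subst bicommutant[symmetric]) (auto simp: commutant_def[of "commutant \<M>"] fun_eq_iff)

lemma C_adj: assumes K: "K \<in> \<C>" shows "badjoint K \<in> \<C>"
proof (rule C_I[OF bounded_clinear_badjoint[OF C_clinear'[OF K]]])
  fix T h assume T: "T \<in> \<M>"
  show "badjoint K (T h) = T (badjoint K h)"
  proof (rule cinner_ext_right)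
    fix z
    have "cinner z (badjoint K (T h)) = cinner (badjoint T (K z)) h"
      by (simp add: cinner_badjoint'[OF M_clinear[OF T]] cinner_badjoint[OF C_clinear'[OF K]])
    also have "\<dots> = cinner (K (badjoint T z)) h" by (simp add: C_comm[OF K M_adj[OF T]])
    also have "\<dots> = cinner z (T (badjoint K h))"
      by (simp add: cinner_badjoint'[OF M_clinear[OF T]] cinner_badjoint[OF C_clinear'[OF K]])
    finally show "cinner z (badjoint K (T h)) = cinner z (T (badjoint K h))" .
  qed
qed

text \<open>Affiliation is tested only against unitaries, while the bicommutant condition asks for
  all of the commutant. A self-adjoint contraction \<open>T\<close> is the mean of the unitaries
  \<open>T + i W\<close> and \<open>T - i W\<close>, with \<open>W\<close> the root of
  \<open>1 - T T\<close>, and every operator is a combination of two self-adjoint ones.\<close>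

lemma C_unitary_span:
  assumes L: "bounded_clinear L" and u: "\<And>u h. u \<in> \<C> \<Longrightarrow> unitary_op u \<Longrightarrow> L (u h) = u (L h)" and K: "K \<in> \<C>"
  shows "L (K h) = K (L h)"
proof -
  note lL = bounded_clinear_simps[OF L]
  have contr: "L (T h) = T (L h)" if T: "selfadj T" "T \<in> \<C>" and T1: "\<And>x. norm (T x) \<le> norm x" for T h
  proof -
    note lT = bounded_clinear_simps[OF selfadj_clinear[OF T(1)]]
    let ?Q = "\<lambda>h. h - T (T h)"
    have Q: "pos_op ?Q"
      unfolding pos_op_def
    proof (intro conjI allI)
      show "selfadj ?Q" by (rule selfadj_minus[OF selfadj_id selfadj_comp[OF T(1) T(1) refl]])
      fix x show "0 \<le> Re (cinner (?Q x) x)"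
        using power_mono[OF T1[of x], of 2] by (simp add: cinner_diff_left selfadjD[OF T(1), of "T x"] cinner_self_Re)
    qed
    note W = sqrt_op[OF Q]
    let ?W = "sqrt_op ?Q"
    note lW = bounded_clinear_simps[OF pos_op_clinear[OF W(1)]]
    have TW: "T (?W h) = ?W (T h)" for h by (rule W(3)[OF selfadj_clinear[OF T(1)]]) (simp add: lT)
    have uC: "(\<lambda>h. T h + c *\<^sub>C ?W h) \<in> \<C>" for c
    proof (rule C_I)
      show "bounded_clinear (\<lambda>h. T h + c *\<^sub>C ?W h)"
        by (rule bounded_clinear_plus[OF selfadj_clinear[OF T(1)] bounded_clinear_scale[OF pos_op_clinear[OF W(1)]]])
      fix S h assume S: "S \<in> \<M>"
      note lS = bounded_clinear_simps[OF M_clinear[OF S]]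
      have "S (?W h) = ?W (S h)"
        by (rule W(3)[OF M_clinear[OF S]]) (simp add: lS C_comm[OF T(2) S])
      then show "T (S h) + c *\<^sub>C ?W (S h) = S (T h + c *\<^sub>C ?W h)" by (simp add: lS C_comm[OF T(2) S])
    qed
    have adj: "badjoint (\<lambda>h. T h + c *\<^sub>C ?W h) = (\<lambda>h. T h + cnj c *\<^sub>C ?W h)" for c
      by (rule badjoint_unique) (simp add: cinner_add_left cinner_add_right cinner_scaleC_left cinner_scaleC_right
          selfadjD[OF T(1)] selfadjD[OF pos_op_selfadj[OF W(1)]])
    have un: "unitary_op (\<lambda>h. T h + c *\<^sub>C ?W h)" if c: "c * cnj c = 1" "c + cnj c = 0" for c
    proof -
      have c': "c *\<^sub>C v + cnj c *\<^sub>C v = 0" for v :: 'h by (simp add: c flip: scaleC_add_left)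
      have id: "T (T h + c *\<^sub>C ?W h) + d *\<^sub>C ?W (T h + c *\<^sub>C ?W h) = h" if "c + d = 0" "d * c = 1" for c d h
      proof -
        have "T (T h + c *\<^sub>C ?W h) + d *\<^sub>C ?W (T h + c *\<^sub>C ?W h)
          = T (T h) + (c + d) *\<^sub>C ?W (T h) + (d * c) *\<^sub>C ?W (?W h)"
          by (simp add: lT lW TW scaleC_add_right scaleC_add_left scaleC_scaleC add_ac)
        then show ?thesis using that W(2)[of h] by simp
      qed
      have d: "cnj c * c = 1" "cnj c + c = 0" using c by (simp_all add: mult.commute add.commute)
      show ?thesis
        unfolding unitary_op_def adj
        using id[OF c(2) d(1)] id[OF d(2) c(1)] uC[of c] by (auto simp: fun_eq_iff C_clinear')
    qed
    have "T h = (1/2) *\<^sub>C ((T h + \<i> *\<^sub>C ?W h) + (T h + (- \<i>) *\<^sub>C ?W h))" for h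
    proof -
      have "\<i> *\<^sub>C ?W h + (- \<i>) *\<^sub>C ?W h = 0" by (simp flip: scaleC_add_left)
      then have "(T h + \<i> *\<^sub>C ?W h) + (T h + (- \<i>) *\<^sub>C ?W h) = T h + T h" by (simp add: algebra_simps)
      also have "\<dots> = 2 *\<^sub>C T h" using scaleC_add_left[of 1 1 "T h"] by simp
      finally show ?thesis by (simp add: scaleC_scaleC)
    qed
    note split = this
    have "L (T h + \<i> *\<^sub>C ?W h) = T (L h) + \<i> *\<^sub>C ?W (L h)" "L (T h + (- \<i>) *\<^sub>C ?W h) = T (L h) + (- \<i>) *\<^sub>C ?W (L h)"
      by (rule u[OF uC un]; simp)+
    then show ?thesis by (subst split, subst (2) split) (simp only: lL)
  qed
  have sa: "L (T h) = T (L h)" if T: "selfadj T" "T \<in> \<C>" for T h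
  proof -
    note lT = bounded_clinear_simps[OF selfadj_clinear[OF T(1)]]
    obtain c where c: "0 < c" "\<And>x. norm (T x) \<le> c * norm x" using bounded_clinear_bound[OF selfadj_clinear[OF T(1)]] by blast
    have "(\<lambda>h. (1/c) *\<^sub>R T h) \<in> \<C>"
      by (rule C_I) (simp_all add: bounded_clinear_scale_real[OF selfadj_clinear[OF T(1)]] C_comm[OF T(2)]
          bounded_clinear_scaleR[OF M_clinear])
    from contr[OF selfadj_scale[OF T(1)] this, of h] c show ?thesis
      by (simp add: lL field_simps)
  qed
  note lK = bounded_clinear_simps[OF C_clinear'[OF K]]
    and lK' = bounded_clinear_simps[OF bounded_clinear_badjoint[OF C_clinear'[OF K]]]
  let ?A = "\<lambda>h. K h + badjoint K h" and ?B = "\<lambda>h. \<i> *\<^sub>C (K h - badjoint K h)"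
  have A: "?A \<in> \<C>" "?B \<in> \<C>"
    by (rule C_I; simp add: bounded_clinear_plus bounded_clinear_sub bounded_clinear_scale C_clinear' K C_adj
        C_comm[OF K] C_comm[OF C_adj[OF K]] bounded_clinear_add[OF M_clinear] bounded_clinear_diff[OF M_clinear]
        bounded_clinear_scaleC[OF M_clinear])+
  have sA: "selfadj ?A" "selfadj ?B"
    unfolding selfadj_def
    by (auto simp: C_clinear'[OF A(1)] C_clinear'[OF A(2)] cinner_simps cinner_badjoint'[OF C_clinear'[OF K]]
        cinner_badjoint[OF C_clinear'[OF K]] algebra_simps)
  have K2: "2 *\<^sub>C K h = ?A h + (- \<i>) *\<^sub>C ?B h" for h
  proof -
    have "2 *\<^sub>C K h = K h + K h" using scaleC_add_left[of 1 1 "K h"] by simp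
    moreover have "(- \<i>) *\<^sub>C ?B h = K h - badjoint K h" by (simp add: scaleC_scaleC)
    ultimately show ?thesis by simp
  qed
  have "2 *\<^sub>C L (K h) = L (?A h + (- \<i>) *\<^sub>C ?B h)" by (simp only: K2[symmetric] lL)
  also have "\<dots> = L (?A h) + (- \<i>) *\<^sub>C L (?B h)" by (simp only: lL(1) bounded_clinear_scaleC[OF L, of "- \<i>"])
  also have "\<dots> = ?A (L h) + (- \<i>) *\<^sub>C ?B (L h)" by (simp only: sa[OF sA(1) A(1)] sa[OF sA(2) A(2)])
  also have "\<dots> = 2 *\<^sub>C K (L h)" by (rule K2[symmetric])
  finally have "(1/2) *\<^sub>C 2 *\<^sub>C L (K h) = (1/2) *\<^sub>C 2 *\<^sub>C K (L h)" by simp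
  then show ?thesis by (simp add: scaleC_scaleC)
qed

lemma M_unitaryI:
  assumes "bounded_clinear T" "\<And>u h. u \<in> \<C> \<Longrightarrow> unitary_op u \<Longrightarrow> T (u h) = u (T h)"
  shows "T \<in> \<M>"
proof (rule M_I[OF assms(1)])
  show "T (K h) = K (T h)" if "K \<in> \<C>" for K h by (rule C_unitary_span[OF assms that])
qed

lemma M_comp: "S \<in> \<M> \<Longrightarrow> T \<in> \<M> \<Longrightarrow> (\<lambda>h. S (T h)) \<in> \<M>"
  and M_add: "S \<in> \<M> \<Longrightarrow> T \<in> \<M> \<Longrightarrow> (\<lambda>h. S h + T h) \<in> \<M>"
  and M_diff: "S \<in> \<M> \<Longrightarrow> T \<in> \<M> \<Longrightarrow> (\<lambda>h. S h - T h) \<in> \<M>"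
  and M_scaleR: "T \<in> \<M> \<Longrightarrow> (\<lambda>h. r *\<^sub>R T h) \<in> \<M>"
  and M_id: "(\<lambda>h. h) \<in> \<M>" and M_0: "(\<lambda>h. 0) \<in> \<M>"
proof -
  have iff: "T \<in> \<M> \<longleftrightarrow> bounded_clinear T \<and> (\<forall>K\<in>\<C>. \<forall>h. T (K h) = K (T h))" for T
    using M_I[of T] M_clinear[of T] C_comm[of _ T] by auto
  note simps = iff bounded_clinear_compose bounded_clinear_plus bounded_clinear_sub bounded_clinear_scale_real bounded_clinear_id(2)
    bounded_clinear_0 bounded_clinear_simps[OF C_clinear']
  show "S \<in> \<M> \<Longrightarrow> T \<in> \<M> \<Longrightarrow> (\<lambda>h. S (T h)) \<in> \<M>" "S \<in> \<M> \<Longrightarrow> T \<in> \<M> \<Longrightarrow> (\<lambda>h. S h + T h) \<in> \<M>"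
    "S \<in> \<M> \<Longrightarrow> T \<in> \<M> \<Longrightarrow> (\<lambda>h. S h - T h) \<in> \<M>" "T \<in> \<M> \<Longrightarrow> (\<lambda>h. r *\<^sub>R T h) \<in> \<M>" "(\<lambda>h. h) \<in> \<M>" "(\<lambda>h. 0) \<in> \<M>"
    by (simp_all add: simps)
qed

lemma M_limit:
  assumes T: "\<And>n::nat. T n \<in> \<M>" and L: "bounded_clinear L" and lim: "\<And>h. (\<lambda>n. T n h) \<longlonglongrightarrow> L h"
  shows "L \<in> \<M>"
proof (rule M_I[OF L])
  fix K h assume K: "K \<in> \<C>"
  have "(\<lambda>n. K (T n h)) \<longlonglongrightarrow> K (L h)" by (rule bounded_clinear_tendsto[OF C_clinear'[OF K] lim])
  moreover have "K (T n h) = T n (K h)" for n by (rule C_comm[OF K T])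
  ultimately have "(\<lambda>n. T n (K h)) \<longlonglongrightarrow> K (L h)" by simp
  then show "L (K h) = K (L h)" by (rule LIMSEQ_unique[OF lim])
qed

lemma projs_iff: "p \<in> projs \<M> \<longleftrightarrow> p \<in> \<M> \<and> projection_op p" by (simp add: projs_def)

lemma projs_M: "p \<in> projs \<M> \<Longrightarrow> p \<in> \<M>" and projs_proj: "p \<in> projs \<M> \<Longrightarrow> projection_op p"
  by (simp_all add: projs_def)

lemma projs_perp: "p \<in> projs \<M> \<Longrightarrow> perp p \<in> projs \<M>"
  by (simp add: projs_def M_diff M_id proj_perp)

lemma projs_0: "(\<lambda>h. 0) \<in> projs \<M>" and projs_id: "(\<lambda>h. h) \<in> projs \<M>"
  by (simp_all add: projs_def M_0 M_id proj_zero proj_id)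

section \<open>Invariant subspaces, meets and kernel projections\<close>

definition invariant :: "'h set \<Rightarrow> bool" where
  "invariant L \<longleftrightarrow> (\<forall>u\<in>\<C>. unitary_op u \<longrightarrow> (\<forall>h\<in>L. u h \<in> L))"

lemma invariant_orth_proj:
  assumes L: "csubspace L" "closed L" "invariant L"
  shows "orth_proj L \<in> projs \<M>"
  unfolding projs_iff
proof (rule conjI[OF M_unitaryI orth_proj_projection[OF L(1,2)]])
  show "bounded_clinear (orth_proj L)" by (rule proj_clinear[OF orth_proj_projection[OF L(1,2)]])
  fix u h assume u: "u \<in> \<C>" "unitary_op u"
  show "orth_proj L (u h) = u (orth_proj L h)"
    by (rule orth_proj_commute[OF L(1,2) C_clinear'[OF u(1)]])
      (use L(3) u C_adj[OF u(1)] unitary_badjoint[OF u(2)] in \<open>auto simp: invariant_def\<close>)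
qed

lemma invariant_closure: assumes "invariant L" shows "invariant (closure L)"
  unfolding invariant_def
proof (intro ballI impI)
  fix u h assume u: "u \<in> \<C>" "unitary_op u" and "h \<in> closure L"
  then obtain f where f: "\<And>n. f n \<in> L" "f \<longlonglongrightarrow> h" unfolding closure_sequential by blast
  have "(\<lambda>n. u (f n)) \<longlonglongrightarrow> u h" by (rule bounded_clinear_tendsto[OF C_clinear'[OF u(1)] f(2)])
  moreover have "u (f n) \<in> L" for n using assms u f(1) by (auto simp: invariant_def)
  ultimately show "u h \<in> closure L"
    unfolding closure_sequential by (intro exI[of _ "\<lambda>n. u (f n)"]) simp
qed

lemma proj_fix_subspace: "(\<And>p. p \<in> \<A> \<Longrightarrow> projection_op p) \<Longrightarrow> csubspace {h. \<forall>p\<in>\<A>. p h = h}"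
  by (auto simp: csubspace_def proj_simps)

lemma proj_fix_closed: assumes "\<And>p. p \<in> \<A> \<Longrightarrow> projection_op p" shows "closed {h. \<forall>p\<in>\<A>. p h = h}"
proof -
  have "{h. \<forall>p\<in>\<A>. p h = h} = (\<Inter>p\<in>\<A>. range p)" using assms by (auto simp: proj_range)
  then show ?thesis using assms by (simp add: closed_INT proj_closed)
qed

definition meet :: "('h \<Rightarrow> 'h) set \<Rightarrow> 'h \<Rightarrow> 'h" where
  "meet \<A> = orth_proj {h. \<forall>p\<in>\<A>. p h = h}"

lemma meet:
  assumes A: "\<A> \<subseteq> projs \<M>"
  shows meet_projs: "meet \<A> \<in> projs \<M>" and meet_fix: "meet \<A> h = h \<longleftrightarrow> (\<forall>p\<in>\<A>. p h = h)"
    and meet_le: "p \<in> \<A> \<Longrightarrow> p (meet \<A> h) = meet \<A> h" and meet_le': "p \<in> \<A> \<Longrightarrow> meet \<A> (p h) = meet \<A> h"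
proof -
  have pr: "\<And>p. p \<in> \<A> \<Longrightarrow> projection_op p" using A by (auto simp: projs_def)
  note L = proj_fix_subspace[where \<A> = \<A>, OF pr] proj_fix_closed[where \<A> = \<A>, OF pr]
  show "meet \<A> \<in> projs \<M>"
    unfolding meet_def
  proof (rule invariant_orth_proj[OF L])
    show "invariant {h. \<forall>p\<in>\<A>. p h = h}"
      unfolding invariant_def
    proof (intro ballI impI CollectI)
      fix u h p assume u: "u \<in> \<C>" and h: "h \<in> {h. \<forall>p\<in>\<A>. p h = h}" and p: "p \<in> \<A>"
      have "p (u h) = u (p h)" using A p by (intro C_comm[OF u, symmetric]) (auto simp: projs_def)
      moreover have "p h = h" using h p by blast
      ultimately show "p (u h) = u h" by simp
    qed
  qed
  show "meet \<A> h = h \<longleftrightarrow> (\<forall>p\<in>\<A>. p h = h)" unfolding meet_def using orth_proj_eq_iff[OF L] by simp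
  show le: "p (meet \<A> h) = meet \<A> h" if "p \<in> \<A>" for h
    unfolding meet_def using orth_proj_in[OF L, of h] that by simp
  show "meet \<A> (p h) = meet \<A> h" if "p \<in> \<A>"
    by (rule proj_le_commute[OF _ pr[OF that] le[OF that]]) (simp add: meet_def orth_proj_projection[OF L])
qed

definition kproj :: "('h \<Rightarrow> 'h) \<Rightarrow> 'h \<Rightarrow> 'h" where
  "kproj T = orth_proj {h. T h = 0}"

lemma kproj: assumes T: "T \<in> \<M>"
  shows kproj_projs: "kproj T \<in> projs \<M>" and kproj_fix: "kproj T h = h \<longleftrightarrow> T h = 0" and kproj_zero: "T (kproj T h) = 0"
proof -
  note lT = bounded_clinear_simps[OF M_clinear[OF T]]
  have L: "csubspace {h. T h = 0}" by (auto simp: csubspace_def lT)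
  have L': "closed {h. T h = 0}"
    by (intro closed_Collect_eq continuous_on_const bounded_clinear_continuous M_clinear T)
  show "kproj T \<in> projs \<M>"
    unfolding kproj_def
  proof (rule invariant_orth_proj[OF L L'])
    show "invariant {h. T h = 0}"
      using C_comm[OF _ T, symmetric] by (auto simp: invariant_def bounded_clinear_zero[OF C_clinear'])
  qed
  show "kproj T h = h \<longleftrightarrow> T h = 0" unfolding kproj_def using orth_proj_eq_iff[OF L L'] by simp
  show "T (kproj T h) = 0" unfolding kproj_def using orth_proj_in[OF L L', of h] by simp
qed

end

section \<open>Operators affiliated with the algebra\<close>

lemma graph_closed_op: assumes T: "bounded_clinear T" shows "closed_op (graph T)"
proof
  note lT = bounded_clinear_simps[OF T]
  have eq: "graph T = {p. snd p = T (fst p)}" by (auto simp: graph_def)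
  have "closed {p. snd p = T (fst p)}"
    by (intro closed_Collect_eq continuous_intros continuous_on_compose2[OF bounded_clinear_continuous[OF T, of UNIV]]) auto
  moreover have "Domain (graph T) = UNIV" by (auto simp: graph_def)
  ultimately show "closed_densely_defined (graph T)"
    unfolding closed_densely_defined_def linear_operator_def by (auto simp: eq lT single_valued_def)
qed

lemma in_graph: "(a, b) \<in> graph T \<longleftrightarrow> b = T a" by (auto simp: graph_def)

locale affil_op = vn_algebra \<M> + closed_op X
  for \<M> :: "('h::complex_hilbert_space \<Rightarrow> 'h) set" and X :: "'h operator" +
  assumes aff: "affiliated \<M> X"
begin

lemma aff_unitary: assumes "u \<in> \<C>" "unitary_op u" "(a, b) \<in> X" shows "(u a, u b) \<in> X"
proof -
  have "(a, u b) \<in> X O graph u" using assms(3) by (auto simp: graph_def)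
  then have "(a, u b) \<in> graph u O X" using aff assms(1,2) by (simp add: affiliated_def)
  then show ?thesis by (auto simp: graph_def)
qed

lemma unitary_reduces: "u \<in> \<C> \<Longrightarrow> unitary_op u \<Longrightarrow> reduces u X"
  by (simp add: reduces_def C_clinear' aff_unitary C_adj unitary_badjoint)

lemmas unitary_comm = reduces_comm[OF unitary_reduces]

lemma S_M: "S \<in> \<M>" and C_M: "C \<in> \<M>" and V_M: "V \<in> \<M>"
  by (rule M_unitaryI; simp add: S_clinear C_clinear V_clinear unitary_comm)+

lemma F_projs: "F s \<in> projs \<M>"
  unfolding projs_iff
  by (rule conjI[OF M_unitaryI[OF proj_clinear[OF F_proj] F_comm[symmetric]] F_proj]) (simp_all add: C_clinear' unitary_comm)

text \<open>The bounded operator is \<open>X (F s)\<close>, obtained as \<open>V\<close> times the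
  inverse of \<open>S\<close> on the range of \<open>F s\<close>. That inverse commutes with the
  unitaries of the commutant, which puts the product in the algebra.\<close>

lemma cut_exists: assumes s: "0 \<le> s"
  shows "\<exists>T\<in>\<M>. \<forall>h. (F s h, T h) \<in> X \<and> norm (T h) \<le> s * norm (F s h)"
proof -
  obtain I where I: "bounded_clinear I" "\<forall>h. S (I h) = F s h" "\<forall>h. F s (I h) = I h"
    "\<forall>K. bounded_clinear K \<longrightarrow> (\<forall>h. K (S h) = S (K h)) \<longrightarrow> (\<forall>h. K (F s h) = F s (K h)) \<longrightarrow> (\<forall>h. K (I h) = I (K h))"
  proof (rule exE[OF selfadj_inverse_on[where T = S and G = "F s" and c = "1 / (1 + s)", OF S_selfadj F_proj F_S]])
    show "0 < 1 / (1 + s)" using s by simp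
    show "1 / (1 + s) * norm h \<le> norm (S h)" if "F s h = h" for h by (rule F_S_lower[OF s that])
  qed (elim conjE, rule that; assumption)
  have "I \<in> \<M>"
  proof (rule M_unitaryI[OF I(1)])
    fix u h assume u: "u \<in> \<C>" "unitary_op u"
    have "u (F s h) = F s (u h)" for h by (rule C_comm[OF u(1) projs_M[OF F_projs]])
    then show "I (u h) = u (I h)" using I(4) u by (simp add: C_clinear' unitary_comm)
  qed
  then have "(\<lambda>h. V (I h)) \<in> \<M>" by (rule M_comp[OF V_M])
  moreover have "(F s h, V (I h)) \<in> X" for h using SV_in[of "I h"] I(2) by simp
  moreover have "norm (V (I h)) \<le> s * norm (F s h)" for h
    using F_C_upper[OF _ s, of "I h"] I(2,3) by (simp add: V_norm)
  ultimately show ?thesis by (intro bexI[of _ "\<lambda>h. V (I h)"]) simp_all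
qed

lemma F_strict: assumes "(h, k) \<in> X" "F s h = 0" "h \<noteq> 0" "0 \<le> s" shows "s * norm h < norm k"
proof -
  obtain g where g: "h = S g" "k = V g" using assms(1) in_X by blast
  have "S (F s g) = 0" using assms(2) by (simp add: g F_S)
  then have "F s g = 0" by (rule S_inj)
  moreover have "g \<noteq> 0" using assms(3) by (auto simp: g S_lin)
  ultimately show ?thesis using F_C_lower[of s g] assms(4) by (simp add: g V_norm)
qed

text \<open>The squared norms add up because \<open>V g\<close> has the norm of \<open>C g\<close>
  and \<open>C\<close> commutes with \<open>F s\<close>.\<close>

lemma F_split: assumes "(h, k) \<in> X"
  shows "\<exists>k1 k2. (F s h, k1) \<in> X \<and> (h - F s h, k2) \<in> X \<and> k = k1 + k2 \<and> (norm k)\<^sup>2 = (norm k1)\<^sup>2 + (norm k2)\<^sup>2"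
proof -
  obtain g where g: "h = S g" "k = V g" using assms(1) in_X by blast
  have "(F s h, V (F s g)) \<in> X" using SV_in[of "F s g"] by (simp add: g F_S)
  moreover have "(h - F s h, V (g - F s g)) \<in> X" using SV_in[of "g - F s g"] by (simp add: g F_S S_lin)
  moreover have "k = V (F s g) + V (g - F s g)" by (simp add: g V_lin)
  moreover have "(norm k)\<^sup>2 = (norm (V (F s g)))\<^sup>2 + (norm (V (g - F s g)))\<^sup>2"
    using proj_pythagoras[OF F_proj, of "C g" s] by (simp add: g V_norm C_lin F_C)
  ultimately show ?thesis by blast
qed

lemma F_0_iff: "F 0 h = h \<longleftrightarrow> (h, 0) \<in> X"
proof
  assume "F 0 h = h"
  then obtain g where g: "h = S g" "F 0 g = g" using F_in_range_S[of 0 h] by auto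
  have "C g = 0" using F_C_upper[OF g(2)] by simp
  then have "V g = 0" using V_norm[of g] by simp
  then show "(h, 0) \<in> X" using SV_in[of g] g by simp
next
  assume X: "(h, 0) \<in> X"
  obtain k1 k2 where k: "(F 0 h, k1) \<in> X" "(h - F 0 h, k2) \<in> X" "0 = k1 + k2" "(norm (0::'h))\<^sup>2 = (norm k1)\<^sup>2 + (norm k2)\<^sup>2"
    using F_split[OF X, of 0] by blast
  then have "k2 = 0" by (simp add: sum_power2_eq_zero_iff)
  moreover have "F 0 (h - F 0 h) = 0" by (simp add: F_lin F_idem)
  ultimately show "F 0 h = h" using F_strict[OF k(2), of 0] by fastforce
qed

text \<open>The polar part of \<open>X\<close> on the spectral subspace above \<open>s\<close>:
  \<open>V\<close> times the inverse of \<open>C\<close> there, isometric because \<open>V g\<close>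
  and \<open>C g\<close> have equal norms. \<open>C\<close> is bounded below on that subspace, so no
  unbounded operator has to be inverted.\<close>

lemma partial_isometry:
  assumes s: "0 < s"
  shows "\<exists>u\<in>\<M>. (\<forall>h. norm (u h) = norm (h - F s h)) \<and> (\<forall>h. \<exists>a. (a, u h) \<in> X) \<and>
    (\<forall>a b. (a, b) \<in> X \<longrightarrow> F s a = 0 \<longrightarrow> (\<exists>w. b = u w))"
proof -
  let ?G = "perp (F s)"
  have G: "projection_op ?G" by (rule proj_perp[OF F_proj])
  have lower: "1 / (1 / s + 1) * norm g \<le> norm (C g)" if "?G g = g" for g
  proof (cases "g = 0")
    case False
    have "F s g = 0" using that by simp
    from F_C_lower[OF this _ False] s have 1: "norm (S g) \<le> (1 / s) * norm (C g)" by (simp add: field_simps)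
    have "norm g \<le> norm (S g) + norm (C g)"
    proof (rule power2_le_imp_le)
      show "(norm g)\<^sup>2 \<le> (norm (S g) + norm (C g))\<^sup>2" by (simp add: power2_sum flip: norm_S_C[of g])
    qed simp
    also have "\<dots> \<le> (1 / s + 1) * norm (C g)" using 1 by (simp add: algebra_simps)
    finally show ?thesis using s by (simp add: field_simps add_pos_pos)
  qed (simp add: C_lin)
  have CG: "C (?G h) = ?G (C h)" for h by (simp add: C_lin F_C)
  obtain I where I: "bounded_clinear I" "\<forall>h. C (I h) = ?G h" "\<forall>h. I (C h) = ?G h"
    "\<forall>K. bounded_clinear K \<longrightarrow> (\<forall>h. K (C h) = C (K h)) \<longrightarrow> (\<forall>h. K (?G h) = ?G (K h)) \<longrightarrow> (\<forall>h. K (I h) = I (K h))"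
  proof (rule exE[OF selfadj_inverse_on[where T = C and G = ?G and c = "1 / (1 / s + 1)", OF C_selfadj G CG]])
    show "0 < 1 / (1 / s + 1)" using s by (simp add: add_pos_pos)
    show "1 / (1 / s + 1) * norm h \<le> norm (C h)" if "?G h = h" for h by (rule lower[OF that])
  qed (elim conjE, rule that; assumption)
  have "I \<in> \<M>"
  proof (rule M_unitaryI[OF I(1)])
    fix u h assume u: "u \<in> \<C>" "unitary_op u"
    have "u (F s h) = F s (u h)" for h by (rule C_comm[OF u(1) projs_M[OF F_projs]])
    then show "I (u h) = u (I h)" using I(4) u by (simp add: C_clinear' unitary_comm bounded_clinear_diff)
  qed
  then have "(\<lambda>h. V (I h)) \<in> \<M>" by (rule M_comp[OF V_M])
  moreover have "norm (V (I h)) = norm (h - F s h)" for h using I(2) by (simp add: V_norm)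
  moreover have "\<exists>a. (a, V (I h)) \<in> X" for h using SV_in by blast
  moreover have "\<exists>w. b = V (I w)" if ab: "(a, b) \<in> X" "F s a = 0" for a b
  proof -
    obtain g where g: "a = S g" "b = V g" using ab(1) in_X by blast
    have "S (F s g) = 0" using ab(2) by (simp add: g F_S)
    then have "F s g = 0" by (rule S_inj)
    then have "I (C g) = g" using I(3) by simp
    then show ?thesis using g(2) by (intro exI[of _ "C g"]) simp
  qed
  ultimately show ?thesis by (intro bexI[of _ "\<lambda>h. V (I h)"]) simp_all
qed

end

lemma (in vn_algebra) graph_affil: assumes T: "T \<in> \<M>" shows "affil_op \<M> (graph T)"
proof -
  interpret closed_op "graph T" by (rule graph_closed_op[OF M_clinear[OF T]])
  have "affiliated \<M> (graph T)"
    unfolding affiliated_def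
  proof (intro ballI impI)
    fix u assume u: "u \<in> \<C>"
    have "(a, b) \<in> graph T O graph u \<longleftrightarrow> b = u (T a)" "(a, b) \<in> graph u O graph T \<longleftrightarrow> b = T (u a)" for a b
      by (auto simp: graph_def)
    then have "p \<in> graph T O graph u \<longleftrightarrow> p \<in> graph u O graph T" for p
      using C_comm[OF u T] by (cases p) simp
    then show "graph T O graph u = graph u O graph T" by (rule set_eqI)
  qed
  then show ?thesis by unfold_locales
qed

section \<open>Traces\<close>

locale traced_algebra = vn_algebra \<M>
  for \<M> :: "('h::complex_hilbert_space \<Rightarrow> 'h) set" +
  fixes \<tau> :: "('h \<Rightarrow> 'h) \<Rightarrow> ennreal"
  assumes tr: "trace_on \<M> \<tau>" and faithful: "faithful_trace \<M> \<tau>" and normal: "normal_trace \<M> \<tau>"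
begin

abbreviation "Cone \<equiv> positive_cone \<M>"

lemma Cone_iff: "T \<in> Cone \<longleftrightarrow> T \<in> \<M> \<and> positive_op T" by (simp add: positive_cone_def)

lemma Cone_form: "T \<in> Cone \<Longrightarrow> 0 \<le> Re (cinner (T x) x)" and Cone_Im: "T \<in> Cone \<Longrightarrow> Im (cinner (T x) x) = 0"
  by (auto simp: Cone_iff positive_op_def nonneg_Reals_iff)

lemma projs_Cone: "p \<in> projs \<M> \<Longrightarrow> p \<in> Cone"
  by (simp add: Cone_iff projs_iff pos_op_positive proj_pos)

lemma tau_add: "S \<in> Cone \<Longrightarrow> T \<in> Cone \<Longrightarrow> \<tau> (\<lambda>h. S h + T h) = \<tau> S + \<tau> T"
  and tau_adj: "T \<in> \<M> \<Longrightarrow> \<tau> (badjoint T \<circ> T) = \<tau> (T \<circ> badjoint T)"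
  and tau_scale: "T \<in> Cone \<Longrightarrow> 0 \<le> r \<Longrightarrow> \<tau> (\<lambda>h. r *\<^sub>R T h) = ennreal r * \<tau> T"
  using tr by (auto simp: trace_on_def)

lemma tau_0: "\<tau> (\<lambda>h. 0) = 0"
  using tau_scale[OF projs_Cone[OF projs_0], of 0] by simp

lemma op_le_Cone: "S \<in> Cone \<Longrightarrow> T \<in> Cone \<Longrightarrow> op_le S T \<longleftrightarrow> (\<forall>x. Re (cinner (S x) x) \<le> Re (cinner (T x) x))"
  by (auto simp: op_le_def positive_op_def nonneg_Reals_iff cinner_diff_left Cone_Im)

lemma tau_mono: assumes S: "S \<in> Cone" and T: "T \<in> Cone" and le: "\<And>x. Re (cinner (S x) x) \<le> Re (cinner (T x) x)"
  shows "\<tau> S \<le> \<tau> T"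
proof -
  have D: "(\<lambda>h. T h - S h) \<in> Cone"
    using S T le by (auto simp: Cone_iff M_diff) (auto simp: positive_op_def nonneg_Reals_iff cinner_diff_left)
  have "\<tau> T = \<tau> (\<lambda>h. S h + (T h - S h))" by simp
  also have "\<dots> = \<tau> S + \<tau> (\<lambda>h. T h - S h)" by (rule tau_add[OF S D])
  finally show ?thesis by simp
qed

text \<open>Normality speaks of least upper bounds in the cone. Convergence of the forms shows that
  any upper bound of all \<open>T n\<close> dominates \<open>L\<close>.\<close>

lemma tau_SUP:
  assumes T: "\<And>n::nat. T n \<in> Cone" and L: "L \<in> Cone"
    and inc: "\<And>n x. Re (cinner (T n x) x) \<le> Re (cinner (T (Suc n) x) x)"
    and lim: "\<And>x. (\<lambda>n. Re (cinner (T n x) x)) \<longlonglongrightarrow> Re (cinner (L x) x)"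
  shows "\<tau> L = (SUP n. \<tau> (T n))"
proof -
  have mono: "Re (cinner (T m x) x) \<le> Re (cinner (T n x) x)" if "m \<le> n" for m n x
    using lift_Suc_mono_le[of "\<lambda>n. Re (cinner (T n x) x)", OF inc that] .
  have le: "Re (cinner (T n x) x) \<le> Re (cinner (L x) x)" for n x
    by (rule LIMSEQ_le_const[OF lim]) (use mono in blast)
  have lub: "Re (cinner (L x) x) \<le> Re (cinner (U x) x)" if "\<forall>n. op_le (T n) U" "U \<in> Cone" for U x
    by (rule LIMSEQ_le_const2[OF lim]) (use that op_le_Cone[OF T that(2)] in blast)
  have "\<tau> L = (SUP S\<in>range T. \<tau> S)"
  proof (rule normal[unfolded normal_trace_def, rule_format], intro conjI ballI impI)
    fix R S assume "R \<in> range T" "S \<in> range T"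
    then obtain m n where mn: "R = T m" "S = T n" by blast
    show "\<exists>U\<in>range T. op_le R U \<and> op_le S U"
      by (rule bexI[of _ "T (max m n)"]) (simp_all add: mn op_le_Cone T mono)
  qed (use T L le lub in \<open>auto simp: op_le_Cone\<close>)
  then show ?thesis by (simp add: image_comp)
qed

lemma adj_comp_Cone: assumes T: "T \<in> \<M>" shows "badjoint T \<circ> T \<in> Cone"
proof -
  have "(\<lambda>h. badjoint T (T h)) \<in> \<M>" by (rule M_comp[OF M_adj[OF T] T])
  moreover have "cinner (badjoint T (T x)) x = of_real ((norm (T x))\<^sup>2)" for x
    by (simp add: cinner_badjoint'[OF M_clinear[OF T]] cinner_self)
  ultimately show ?thesis by (simp add: Cone_iff positive_op_def o_def nonneg_Reals_iff)
qed

lemma adj_comp_form: "T \<in> \<M> \<Longrightarrow> Re (cinner ((badjoint T \<circ> T) x) x) = (norm (T x))\<^sup>2"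
  by (simp add: cinner_badjoint'[OF M_clinear] cinner_self_Re)

lemma comp_adj_Cone: "T \<in> \<M> \<Longrightarrow> T \<circ> badjoint T \<in> Cone"
  using adj_comp_Cone[OF M_adj[of T]] by (simp add: badjoint_badjoint M_clinear)

lemma comp_adj_form: "T \<in> \<M> \<Longrightarrow> Re (cinner ((T \<circ> badjoint T) x) x) = (norm (badjoint T x))\<^sup>2"
  using adj_comp_form[OF M_adj[of T]] by (simp add: badjoint_badjoint M_clinear)

lemma tau_mono_proj:
  assumes p: "p \<in> projs \<M>" and q: "q \<in> projs \<M>" and le: "\<And>h. q (p h) = p h"
  shows "\<tau> p \<le> \<tau> q"
proof (rule tau_mono[OF projs_Cone[OF p] projs_Cone[OF q]])
  fix x
  have "norm (p x) \<le> norm (q x)"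
    using proj_norm_le[OF projs_proj[OF p], of "q x"] proj_le_commute[OF projs_proj[OF p] projs_proj[OF q] le] by simp
  then show "Re (cinner (p x) x) \<le> Re (cinner (q x) x)"
    using p q by (simp add: projs_proj flip: proj_norm_sq)
qed

lemma tau_zero_proj: "p \<in> projs \<M> \<Longrightarrow> \<tau> p = 0 \<Longrightarrow> p = (\<lambda>h. 0)"
  using faithful projs_Cone by (auto simp: faithful_trace_def)

text \<open>Comparison in the sense of Murray and von Neumann: the adjoint of \<open>u\<close> times
  \<open>u\<close> is \<open>e\<close>, while \<open>u\<close> times its adjoint is dominated by
  \<open>b\<close>, and the trace does not distinguish the two products.\<close>

lemma tau_partial_isometry_le:
  assumes u: "u \<in> \<M>" and e: "e \<in> projs \<M>" and n: "\<And>h. norm (u h) = norm (e h)"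
    and b: "b \<in> projs \<M>" "\<And>h. b (u h) = u h"
  shows "\<tau> e \<le> \<tau> b"
proof -
  have "badjoint u \<circ> u = e"
  proof (rule clinear_eq_if_form)
    show "bounded_clinear (badjoint u \<circ> u)"
      by (rule bounded_clinear_comp[OF bounded_clinear_badjoint[OF M_clinear[OF u]] M_clinear[OF u]])
    show "bounded_clinear e" by (rule M_clinear[OF projs_M[OF e]])
    fix x show "cinner ((badjoint u \<circ> u) x) x = cinner (e x) x"
      by (simp add: cinner_badjoint'[OF M_clinear[OF u]] cinner_self n proj_cinner_self[OF projs_proj[OF e]])
  qed
  then have "\<tau> e = \<tau> (u \<circ> badjoint u)" using tau_adj[OF u] by simp
  also have "\<dots> \<le> \<tau> b"
  proof (rule tau_mono[OF comp_adj_Cone[OF u] projs_Cone[OF b(1)]])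
    fix x
    have u1: "norm (u x) \<le> 1 * norm x" for x using n[of x] proj_norm_le[OF projs_proj[OF e], of x] by simp
    have "badjoint u x = badjoint u (b x)"
      by (rule cinner_ext_right)
        (simp add: b(2) flip: cinner_badjoint[OF M_clinear[OF u]] proj_cinner[OF projs_proj[OF b(1)]])
    then have "norm (badjoint u x) \<le> norm (b x)"
      using badjoint_norm_bound[OF M_clinear[OF u] u1, of "b x"] by simp
    then have "(norm (badjoint u x))\<^sup>2 \<le> (norm (b x))\<^sup>2" by (simp add: power_mono)
    then show "Re (cinner ((u \<circ> badjoint u) x) x) \<le> Re (cinner (b x) x)"
      unfolding comp_adj_form[OF u] by (simp add: proj_norm_sq[OF projs_proj[OF b(1)]])
  qed
  finally show ?thesis .
qed

lemma tau_proj_SUP: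
  assumes p: "\<And>n::nat. p n \<in> projs \<M>" and q: "q \<in> projs \<M>" and inc: "\<And>n h. p (Suc n) (p n h) = p n h"
    and lim: "\<And>h. (\<lambda>n. p n h) \<longlonglongrightarrow> q h"
  shows "\<tau> q = (SUP n. \<tau> (p n))"
proof (rule tau_SUP[OF projs_Cone[OF p] projs_Cone[OF q]])
  fix n x
  have "norm (p n x) \<le> norm (p (Suc n) x)"
    using proj_norm_le[OF projs_proj[OF p], of n "p (Suc n) x"]
      proj_le_commute[OF projs_proj[OF p] projs_proj[OF p] inc] by simp
  then show "Re (cinner (p n x) x) \<le> Re (cinner (p (Suc n) x) x)"
    using p by (simp add: projs_proj flip: proj_norm_sq)
  show "(\<lambda>n. Re (cinner (p n x) x)) \<longlonglongrightarrow> Re (cinner (q x) x)"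
    by (intro tendsto_Re tendsto_cinner lim tendsto_const)
qed

end

locale traced_op = traced_algebra \<M> \<tau> + affil_op \<M> X
  for \<M> :: "('h::complex_hilbert_space \<Rightarrow> 'h) set" and \<tau> and X :: "'h operator"
begin

lemma tau_F_right: "\<tau> (perp (F s)) = (SUP n. \<tau> (perp (F (s + inverse (real (Suc n))))))"
proof (rule tau_proj_SUP)
  fix n h
  have le: "s + inverse (real (Suc (Suc n))) \<le> s + inverse (real (Suc n))" by (simp add: le_imp_inverse_le)
  show "perp (F (s + inverse (real (Suc (Suc n))))) (perp (F (s + inverse (real (Suc n)))) h)
      = perp (F (s + inverse (real (Suc n)))) h"
    by (simp only: F_lin F_mono'[OF le]) simp
  show "(\<lambda>n. perp (F (s + inverse (real (Suc n)))) h) \<longlonglongrightarrow> perp (F s) h"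
    by (intro tendsto_diff tendsto_const F_tendsto_right)
qed (simp_all add: projs_perp F_projs)

text \<open>The left side is the trace of the right support of \<open>X\<close>, the limit of
  \<open>1 - F s\<close> as \<open>s\<close> decreases to zero. Each of these projections is carried
  isometrically into the range of \<open>b\<close>.\<close>

lemma tau_support_le:
  assumes b: "b \<in> projs \<M>" "\<And>a k. (a, k) \<in> X \<Longrightarrow> b k = k"
  shows "\<tau> (perp (F 0)) \<le> \<tau> b"
proof -
  have "\<tau> (perp (F s)) \<le> \<tau> b" if s: "0 < s" for s
  proof -
    obtain u where u: "u \<in> \<M>" "\<forall>h. norm (u h) = norm (h - F s h)" "\<forall>h. \<exists>a. (a, u h) \<in> X"
      using partial_isometry[OF s] by blast
    show ?thesis
      by (rule tau_partial_isometry_le[OF u(1) projs_perp[OF F_projs] _ b(1)]) (use u b(2) in auto)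
  qed
  then show ?thesis unfolding tau_F_right[of 0] by (intro SUP_least) simp
qed

end

context traced_algebra
begin

text \<open>The kernel projection of \<open>T\<close> is \<open>F 0\<close> of its graph, so the
  trace of the right support is bounded by any projection containing the range.\<close>

lemma tau_kproj_le:
  assumes T: "T \<in> \<M>" and b: "b \<in> projs \<M>" "\<And>h. b (T h) = T h"
  shows "\<tau> (perp (kproj T)) \<le> \<tau> b"
proof -
  interpret affil_op \<M> "graph T" by (rule graph_affil[OF T])
  interpret traced_op \<M> \<tau> "graph T" by unfold_locales
  have "kproj T = F 0"
  proof (rule proj_eqI[OF projs_proj[OF kproj_projs[OF T]] F_proj])
    fix h
    have *: "kproj T h = h \<longleftrightarrow> F 0 h = h" for h
      unfolding kproj_fix[OF T] F_0_iff in_graph by (rule eq_commute)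
    have "F 0 (kproj T h) = kproj T h" "kproj T (F 0 h) = F 0 h" for h
      using *[of "kproj T h"] *[of "F 0 h"] by (simp_all add: F_idem proj_idem[OF projs_proj[OF kproj_projs[OF T]]])
    note c = this proj_le_commute[OF projs_proj[OF kproj_projs[OF T]] F_proj this(1)]
    show "norm (kproj T h) = norm (F 0 h)" using c(2)[of h] c(3)[of h] by simp
  qed
  then show ?thesis using tau_support_le[OF b(1)] b(2) by (simp add: in_graph)
qed

lemma tau_range_le:
  assumes T: "T \<in> \<M>" and b: "b \<in> projs \<M>" "\<And>h. T (b h) = T h"
  shows "\<tau> (perp (kproj (badjoint T))) \<le> \<tau> b"
proof (rule tau_kproj_le[OF M_adj[OF T] b(1)])
  fix h show "b (badjoint T h) = badjoint T h"
    by (rule cinner_ext_right)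
      (simp add: b(2) flip: cinner_badjoint[OF M_clinear[OF T]] proj_cinner[OF projs_proj[OF b(1)]])
qed

text \<open>\<open>r\<close> is the kernel projection of \<open>(1 - p) b\<close>; its complement is
  the right support of an operator with range under \<open>1 - p\<close>. This lets small cotrace
  survive multiplication from the right.\<close>

lemma pullback:
  assumes b: "b \<in> \<M>" and p: "p \<in> projs \<M>"
  shows "\<exists>r\<in>projs \<M>. (\<forall>h. r h = h \<longleftrightarrow> p (b h) = b h) \<and> \<tau> (perp r) \<le> \<tau> (perp p)"
proof -
  have T: "(\<lambda>h. perp p (b h)) \<in> \<M>" by (rule M_comp[OF projs_M[OF projs_perp[OF p]] b])
  have "\<tau> (perp (kproj (\<lambda>h. perp p (b h)))) \<le> \<tau> (perp p)"
    by (rule tau_kproj_le[OF T projs_perp[OF p]]) (simp add: proj_simps[OF projs_proj[OF p]] proj_idem[OF projs_proj[OF p]])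
  moreover have "kproj (\<lambda>h. perp p (b h)) h = h \<longleftrightarrow> p (b h) = b h" for h
    using kproj_fix[OF T, of h] by auto
  ultimately show ?thesis using kproj_projs[OF T] by blast
qed

lemma projs_eq_if_fix: assumes p: "p \<in> projs \<M>" and q: "q \<in> projs \<M>" and eq: "\<And>h. p h = h \<longleftrightarrow> q h = h" shows "p = q"
proof (rule proj_eqI[OF projs_proj[OF p] projs_proj[OF q]])
  fix h
  have qp: "q (p h) = p h" for h using eq[of "p h"] by (simp add: proj_idem[OF projs_proj[OF p]])
  have "p (q h) = q h" using eq[of "q h"] by (simp add: proj_idem[OF projs_proj[OF q]])
  then show "norm (p h) = norm (q h)" using proj_le_commute[OF projs_proj[OF p] projs_proj[OF q] qp, of h] by simp
qed

text \<open>A form of Kaplansky's comparison, read off from \<open>pullback\<close> with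
  \<open>b = p\<close>: the projection found there is the complement of \<open>p\<close> minus the
  meet.\<close>

lemma tau_minus_meet:
  assumes p: "p \<in> projs \<M>" and q: "q \<in> projs \<M>"
  shows "(\<lambda>h. p h - meet {p, q} h) \<in> projs \<M>" "\<tau> (\<lambda>h. p h - meet {p, q} h) \<le> \<tau> (perp q)"
proof -
  have pq: "{p, q} \<subseteq> projs \<M>" using p q by simp
  note m = meet_projs[OF pq] and pm = meet_le[OF pq, of p, simplified]
  obtain r where r: "r \<in> projs \<M>" "\<forall>h. r h = h \<longleftrightarrow> q (p h) = p h" "\<tau> (perp r) \<le> \<tau> (perp q)"
    using pullback[OF projs_M[OF p] q] by blast
  have mp: "meet {p, q} (p h) = meet {p, q} h" for h by (rule meet_le'[OF pq]) simp
  show d: "(\<lambda>h. p h - meet {p, q} h) \<in> projs \<M>"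
    using proj_diff[OF projs_proj[OF m] projs_proj[OF p] pm] by (simp add: projs_iff M_diff projs_M[OF p] projs_M[OF m])
  have "r = perp (\<lambda>h. p h - meet {p, q} h)"
  proof (rule projs_eq_if_fix[OF r(1) projs_perp[OF d]])
    fix h
    have "meet {p, q} (p h) = p h \<longleftrightarrow> q (p h) = p h" using meet_fix[OF pq, of "p h"] by (simp add: proj_idem[OF projs_proj[OF p]])
    then show "r h = h \<longleftrightarrow> h - (p h - meet {p, q} h) = h" using r(2) by (auto simp: mp)
  qed
  then have "perp r = (\<lambda>h. p h - meet {p, q} h)" by (simp add: fun_eq_iff)
  then show "\<tau> (\<lambda>h. p h - meet {p, q} h) \<le> \<tau> (perp q)" using r(3) by simp
qed

lemma cotrace_meet2:
  assumes p: "p \<in> projs \<M>" and q: "q \<in> projs \<M>"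
  shows "\<tau> (perp (meet {p, q})) \<le> \<tau> (perp p) + \<tau> (perp q)"
proof -
  note d = tau_minus_meet[OF p q]
  have "\<tau> (perp (meet {p, q})) = \<tau> (\<lambda>h. perp p h + (p h - meet {p, q} h))" by simp
  also have "\<dots> = \<tau> (perp p) + \<tau> (\<lambda>h. p h - meet {p, q} h)"
    by (rule tau_add[OF projs_Cone[OF projs_perp[OF p]] projs_Cone[OF d(1)]])
  also have "\<dots> \<le> \<tau> (perp p) + \<tau> (perp q)" using d(2) by (rule add_left_mono)
  finally show ?thesis .
qed

lemma meet_tendsto:
  fixes p :: "nat \<Rightarrow> 'h \<Rightarrow> 'h"
  assumes p: "\<And>n. p n \<in> projs \<M>" and dec: "\<And>n h. p n (p (Suc n) h) = p (Suc n) h"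
  shows "(\<lambda>n. p n h) \<longlonglongrightarrow> meet (range p) h"
proof -
  have "p (Suc n) (p n h) = p (Suc n) h" for n h by (rule proj_le_commute[OF projs_proj[OF p] projs_proj[OF p] dec])
  then have inc: "perp (p (Suc n)) (perp (p n) h) = perp (p n) h" for n h
    by (simp add: proj_simps[OF projs_proj[OF p]])
  have "\<exists>q. projection_op q \<and> (\<forall>h. (\<lambda>n. perp (p n) h) \<longlonglongrightarrow> q h) \<and> (\<forall>n h. q (perp (p n) h) = perp (p n) h)"
    by (rule proj_incr_limit[where p = "\<lambda>n. perp (p n)", OF projs_proj[OF projs_perp[OF p]] inc])
  then obtain q where q: "projection_op q" "\<And>h. (\<lambda>n. perp (p n) h) \<longlonglongrightarrow> q h" "\<And>n h. q (perp (p n) h) = perp (p n) h"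
    by blast
  have qP: "q \<in> projs \<M>"
    using M_limit[OF projs_M[OF projs_perp[OF p]] proj_clinear[OF q(1)] q(2)] q(1) by (simp add: projs_iff)
  have R: "range p \<subseteq> projs \<M>" using p by auto
  have "perp q = meet (range p)"
  proof (rule projs_eq_if_fix[OF projs_perp[OF qP] meet_projs[OF R]])
    fix h
    have "q h = 0 \<longleftrightarrow> (\<forall>n. p n h = h)"
    proof
      assume "q h = 0"
      have "p n h = h" for n
        using proj_le_commute[OF projs_proj[OF projs_perp[OF p[of n]]] q(1) q(3), of h] \<open>q h = 0\<close>
        by (simp add: proj_simps[OF projs_proj[OF p]])
      then show "\<forall>n. p n h = h" ..
    next
      assume "\<forall>n. p n h = h"
      then show "q h = 0" using q(2)[of h] by (simp add: LIMSEQ_const_iff)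
    qed
    then show "perp q h = h \<longleftrightarrow> meet (range p) h = h" using meet_fix[OF R, of h] by auto
  qed
  then have "h - q h = meet (range p) h" by (rule fun_cong)
  moreover have "(\<lambda>n. h - perp (p n) h) \<longlonglongrightarrow> h - q h" by (intro tendsto_diff tendsto_const q(2))
  ultimately show ?thesis by simp
qed

text \<open>Finite meets are handled by induction on \<open>cotrace_meet2\<close>; their complements
  increase to that of the full meet, so normality passes to the supremum.\<close>

lemma cotrace_meet:
  fixes p :: "nat \<Rightarrow> 'h \<Rightarrow> 'h"
  assumes p: "\<And>n. p n \<in> projs \<M>"
  shows "\<tau> (perp (meet (range p))) \<le> (\<Sum>n. \<tau> (perp (p n)))"
proof -
  define m where "m n = meet (p ` {..<n})" for n
  have sub: "p ` {..<n} \<subseteq> projs \<M>" for n using p by auto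
  have mp: "m n \<in> projs \<M>" for n unfolding m_def by (rule meet_projs[OF sub])
  have mfix: "m n h = h \<longleftrightarrow> (\<forall>i<n. p i h = h)" for n h unfolding m_def using meet_fix[OF sub, of n h] by auto
  have mS: "m (Suc n) = meet {m n, p n}" for n
    by (rule projs_eq_if_fix[OF mp meet_projs]) (use mp p in \<open>auto simp: mfix meet_fix less_Suc_eq\<close>)
  have ct: "\<tau> (perp (m n)) \<le> (\<Sum>i<n. \<tau> (perp (p i)))" for n
  proof (induction n)
    case 0
    have "m 0 = (\<lambda>h. h)" by (rule projs_eq_if_fix[OF mp projs_id]) (simp add: mfix)
    then show ?case by (simp add: tau_0)
  next
    case (Suc n)
    have "\<tau> (perp (m (Suc n))) \<le> \<tau> (perp (m n)) + \<tau> (perp (p n))" unfolding mS by (rule cotrace_meet2[OF mp p])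
    also have "\<dots> \<le> (\<Sum>i<Suc n. \<tau> (perp (p i)))" using Suc by (simp add: add_right_mono)
    finally show ?case .
  qed
  have dec: "m n (m (Suc n) h) = m (Suc n) h" for n h
    unfolding mS[of n] using mp p by (intro meet_le) auto
  have inc: "perp (m (Suc n)) (perp (m n) h) = perp (m n) h" for n h
    using proj_le_commute[OF projs_proj[OF mp] projs_proj[OF mp] dec] by (simp add: proj_simps[OF projs_proj[OF mp]])
  have R: "range p \<subseteq> projs \<M>" "range m \<subseteq> projs \<M>" using p mp by auto
  have "meet (range m) = meet (range p)"
    by (rule projs_eq_if_fix[OF meet_projs[OF R(2)] meet_projs[OF R(1)]]) (auto simp: meet_fix[OF R(1)] meet_fix[OF R(2)] mfix)
  then have "(\<lambda>n. perp (m n) h) \<longlonglongrightarrow> perp (meet (range p)) h" for h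
    using meet_tendsto[where p = m, OF mp dec] by (intro tendsto_diff tendsto_const) simp
  then have "\<tau> (perp (meet (range p))) = (SUP n. \<tau> (perp (m n)))"
    using tau_proj_SUP[where p = "\<lambda>n. perp (m n)", OF projs_perp[OF mp] projs_perp[OF meet_projs[OF R(1)]] inc] by simp
  also have "\<dots> \<le> (\<Sum>n. \<tau> (perp (p n)))"
    by (intro SUP_least order_trans[OF ct] sum_le_suminf) auto
  finally show ?thesis .
qed

text \<open>By invariance the projection onto the closure belongs to the algebra. The trace of its
  complement is below every positive number, hence zero, and faithfulness finishes.\<close>

lemma dense_criterion:
  assumes L: "csubspace L" "invariant L"
    and p: "\<And>e::real. 0 < e \<Longrightarrow> \<exists>p\<in>projs \<M>. range p \<subseteq> L \<and> \<tau> (perp p) \<le> ennreal e"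
  shows "closure L = UNIV"
proof -
  let ?q = "orth_proj (closure L)"
  have C: "csubspace (closure L)" "closed (closure L)" using L(1) csubspace_closure by auto
  have q: "?q \<in> projs \<M>" by (rule invariant_orth_proj[OF C invariant_closure[OF L(2)]])
  have "\<tau> (perp ?q) \<le> 0 + ennreal e" if e: "0 < e" for e
  proof -
    obtain p where p: "p \<in> projs \<M>" "range p \<subseteq> L" "\<tau> (perp p) \<le> ennreal e" using assms(3)[OF e] by blast
    have "?q (p h) = p h" for h
      using p(2) closure_subset[of L] by (intro orth_proj_fix[OF C]) auto
    note pq = proj_le_commute[OF projs_proj[OF p(1)] projs_proj[OF q] this]
    have "\<tau> (perp ?q) \<le> \<tau> (perp p)"
      by (rule tau_mono_proj[OF projs_perp[OF q] projs_perp[OF p(1)]]) (simp add: proj_simps[OF projs_proj[OF p(1)]] pq)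
    then show ?thesis using p(3) by simp
  qed
  then have "\<tau> (perp ?q) \<le> 0" by (rule ennreal_le_epsilon)
  then have "\<tau> (perp ?q) = 0" by simp
  then have z: "perp ?q = (\<lambda>h. 0)" by (rule tau_zero_proj[OF projs_perp[OF q]])
  have "?q h = h" for h using fun_cong[OF z, of h] by simp
  then have "h \<in> closure L" for h using orth_proj_in[OF C, of h] by simp
  then show ?thesis by blast
qed

end

section \<open>Symmetric function spaces\<close>

lemma emeasure_half_line: "B \<subseteq> {0..} \<Longrightarrow> emeasure half_line B = emeasure lebesgue B"
  by (rule emeasure_restrict_space) auto

lemma sets_half_line: "B \<in> sets half_line \<longleftrightarrow> B \<in> sets lebesgue \<and> B \<subseteq> {0..}"
  by (subst sets_restrict_space_iff) auto

lemma measurable_half_lineI: "f \<in> borel_measurable borel \<Longrightarrow> f \<in> borel_measurable half_line"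
  by (intro measurable_restrict_space1 measurable_completion) simp

lemma half_line_preimage:
  assumes "f \<in> borel_measurable half_line" "B \<in> sets borel" shows "{u\<in>{0..}. f u \<in> B} \<in> sets lebesgue"
proof -
  have "f -` B \<inter> space half_line \<in> sets half_line" using assms by (rule measurable_sets)
  moreover have "f -` B \<inter> space half_line = {u\<in>{0..}. f u \<in> B}" by (auto simp: space_restrict_space)
  ultimately show ?thesis by (simp add: sets_half_line)
qed

lemma half_line_measurableI:
  assumes "\<And>B. B \<in> sets borel \<Longrightarrow> {u\<in>{0..}. f u \<in> B} \<in> sets lebesgue" shows "f \<in> borel_measurable half_line"
proof (rule measurableI)
  fix B :: "'a set" assume "B \<in> sets borel"
  moreover have "f -` B \<inter> space half_line = {u\<in>{0..}. f u \<in> B}" by (auto simp: space_restrict_space)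
  ultimately show "f -` B \<inter> space half_line \<in> sets half_line" using assms by (auto simp: sets_half_line)
qed simp

lemma AE_half_line_pos: "(\<And>t. 0 < t \<Longrightarrow> P t) \<Longrightarrow> AE t in half_line. P t"
proof -
  assume P: "\<And>t. 0 < t \<Longrightarrow> P t"
  have "{0::real} \<in> null_sets half_line" by (simp add: null_sets_def sets_half_line emeasure_half_line)
  then show ?thesis by (rule AE_I') (use P in \<open>auto simp: space_restrict_space\<close>, metis less_eq_real_def)
qed

lemma lebesgue_affine_preimage:
  fixes S :: "real set"
  assumes c: "0 < c" and S: "S \<in> sets lebesgue"
  shows "{x. a + c * x \<in> S} \<in> sets lebesgue" "emeasure lebesgue {x. a + c * x \<in> S} = ennreal (1 / c) * emeasure lebesgue S"
proof -
  have "(\<lambda>x::real. a + (\<Sum>j\<in>Basis. (c * (x \<bullet> j)) *\<^sub>R j)) \<in> lebesgue \<rightarrow>\<^sub>M lebesgue"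
    using c by (intro lebesgue_affine_measurable) auto
  from measurable_sets[OF this S] show "{x. a + c * x \<in> S} \<in> sets lebesgue" by (simp add: vimage_def)
  have "{x. a + c * x \<in> S} = (\<lambda>x. (1 / c) *\<^sub>R x + (- a / c)) ` S"
  proof (intro equalityI subsetI)
    fix x assume "x \<in> {x. a + c * x \<in> S}"
    moreover have "x = (1 / c) *\<^sub>R (a + c * x) + (- a / c)" using c by (simp add: field_simps)
    ultimately show "x \<in> (\<lambda>x. (1 / c) *\<^sub>R x + (- a / c)) ` S" by blast
  qed (use c in \<open>auto simp: field_simps\<close>)
  then show "emeasure lebesgue {x. a + c * x \<in> S} = ennreal (1 / c) * emeasure lebesgue S"
    using emeasure_lebesgue_affine[of "1 / c" "- a / c" S] c by simp
qed

text \<open>A copy of \<open>A\<close> with gaps: the part of \<open>A\<close> in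
  \<open>[j, j + 1)\<close> is moved to \<open>[2 j + e, 2 j + e + 1)\<close>. The copies for
  \<open>e = 0\<close> and \<open>e = 1\<close> are disjoint.\<close>

definition interlace_set :: "nat \<Rightarrow> real set \<Rightarrow> real set" where
  "interlace_set e A = {u\<in>{0..}. nat \<lfloor>u\<rfloor> mod 2 = e \<and> u - real (nat \<lfloor>u\<rfloor> div 2 + e) \<in> A}"

lemma interlace_set:
  assumes e: "e < 2" and A: "A \<in> sets lebesgue" "A \<subseteq> {0..}"
  shows "interlace_set e A \<in> sets lebesgue" "emeasure lebesgue (interlace_set e A) = emeasure lebesgue A"
proof -
  let ?B = "\<lambda>j::nat. A \<inter> {real j..<real (Suc j)}"
  let ?D = "\<lambda>j::nat. {u. - real (j + e) + 1 * u \<in> ?B j}"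
  have eq: "interlace_set e A = (\<Union>j. ?D j)"
  proof (intro equalityI subsetI)
    fix u assume u: "u \<in> interlace_set e A"
    let ?n = "nat \<lfloor>u\<rfloor>"
    have n: "real ?n \<le> u" "u < real ?n + 1" using u by (auto simp: interlace_set_def)
    have "?n = 2 * (?n div 2) + e" using u by (auto simp: interlace_set_def)
    then have "real ?n = 2 * real (?n div 2) + real e" by (metis of_nat_add of_nat_mult of_nat_numeral)
    then have "real (?n div 2) \<le> u - real (?n div 2 + e)" "u - real (?n div 2 + e) < real (Suc (?n div 2))"
      using n by simp_all
    moreover have "u - real (?n div 2 + e) \<in> A" using u by (simp add: interlace_set_def)
    moreover have "- real (?n div 2 + e) + 1 * u = u - real (?n div 2 + e)" by simp
    ultimately have "u \<in> ?D (?n div 2)" by (simp only: mem_Collect_eq Int_iff atLeastLessThan_iff conj_absorb simp_thms)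
    then show "u \<in> (\<Union>j. ?D j)" by blast
  next
    fix u assume "u \<in> (\<Union>j. ?D j)"
    then obtain j where j: "u - real (j + e) \<in> A" "real j \<le> u - real (j + e)" "u - real (j + e) < real (Suc j)"
      by (auto simp: algebra_simps)
    have "\<lfloor>u\<rfloor> = int (2 * j + e)" using j by (intro floor_unique) auto
    then have "nat \<lfloor>u\<rfloor> = 2 * j + e" by simp
    then have "nat \<lfloor>u\<rfloor> mod 2 = e" "nat \<lfloor>u\<rfloor> div 2 = j" using e by auto
    then show "u \<in> interlace_set e A" using j by (auto simp: interlace_set_def)
  qed
  have B: "?B j \<in> sets lebesgue" for j using A by auto
  have D: "?D j \<in> sets lebesgue" "emeasure lebesgue (?D j) = emeasure lebesgue (?B j)" for j
    using lebesgue_affine_preimage[of 1 "?B j" "- real (j + e)", OF _ B] by simp_all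
  show "interlace_set e A \<in> sets lebesgue" unfolding eq using D(1) by blast
  have "?D i \<inter> ?D j = {}" if "i < j" for i j using that by auto
  then have disjD: "disjoint_family ?D" unfolding disjoint_family_on_def by (metis Int_commute nat_neq_iff)
  have "?B i \<inter> ?B j = {}" if "i < j" for i j using that by auto
  then have disjB: "disjoint_family ?B" unfolding disjoint_family_on_def by (metis Int_commute nat_neq_iff)
  have "emeasure lebesgue (interlace_set e A) = (\<Sum>j. emeasure lebesgue (?D j))"
    unfolding eq using D(1) disjD by (intro suminf_emeasure[symmetric]) auto
  also have "\<dots> = (\<Sum>j. emeasure lebesgue (?B j))" by (simp only: D(2))
  also have "\<dots> = emeasure lebesgue (\<Union>j. ?B j)" using B disjB by (intro suminf_emeasure) auto
  also have "(\<Union>j. ?B j) = A"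
  proof (intro equalityI subsetI)
    fix v assume v: "v \<in> A"
    then have "0 \<le> v" using A(2) by auto
    then have "real (nat \<lfloor>v\<rfloor>) \<le> v" "v < real (Suc (nat \<lfloor>v\<rfloor>))" by linarith+
    then have "v \<in> ?B (nat \<lfloor>v\<rfloor>)" using v by simp
    then show "v \<in> (\<Union>j. ?B j)" by blast
  qed auto
  finally show "emeasure lebesgue (interlace_set e A) = emeasure lebesgue A" .
qed

definition interlace :: "nat \<Rightarrow> (real \<Rightarrow> real) \<Rightarrow> real \<Rightarrow> real" where
  "interlace e f u = (if nat \<lfloor>u\<rfloor> mod 2 = e then f (u - real (nat \<lfloor>u\<rfloor> div 2 + e)) else 0)"

lemma interlace_nonneg_arg: assumes "0 \<le> u" "nat \<lfloor>u\<rfloor> mod 2 = e" shows "0 \<le> u - real (nat \<lfloor>u\<rfloor> div 2 + e)"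
proof -
  have "n div 2 + n mod 2 \<le> n" for n :: nat by presburger
  then have "nat \<lfloor>u\<rfloor> div 2 + e \<le> nat \<lfloor>u\<rfloor>" using assms(2) by blast
  then have "real (nat \<lfloor>u\<rfloor> div 2 + e) \<le> real (nat \<lfloor>u\<rfloor>)" by (simp only: of_nat_le_iff)
  also have "\<dots> \<le> u" using assms(1) by simp
  finally show ?thesis by simp
qed

lemma interlace_measurable:
  assumes f: "f \<in> borel_measurable half_line" and e: "e < 2"
  shows "interlace e f \<in> borel_measurable half_line"
proof (rule half_line_measurableI)
  fix B :: "real set" assume B: "B \<in> sets borel"
  have 1: "interlace_set e {v\<in>{0..}. f v \<in> B} \<in> sets lebesgue"
    by (rule interlace_set(1)[OF e half_line_preimage[OF f B]]) auto
  have 2: "{0..} - interlace_set e {0..} \<in> sets lebesgue"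
    using interlace_set(1)[OF e, of "{0..}"] by auto
  have "{u\<in>{0..}. interlace e f u \<in> B} = interlace_set e {v\<in>{0..}. f v \<in> B} \<union> (if 0 \<in> B then {0..} - interlace_set e {0..} else {})"
    using interlace_nonneg_arg[of _ e] by (auto simp: interlace_def interlace_set_def)
  then show "{u\<in>{0..}. interlace e f u \<in> B} \<in> sets lebesgue" using 1 2 by auto
qed

lemma interlace_distribution: assumes "0 \<le> s"
  shows "{u\<in>{0..}. s < \<bar>interlace e f u\<bar>} = interlace_set e {v\<in>{0..}. s < \<bar>f v\<bar>}"
  using assms interlace_nonneg_arg[of _ e] by (auto simp: interlace_def interlace_set_def)

lemma half_line_level_set:
  "f \<in> borel_measurable half_line \<Longrightarrow> {v\<in>{0..}. s < \<bar>f v\<bar>} \<in> sets lebesgue" for f :: "real \<Rightarrow> real"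
  using half_line_preimage[of f "{x. s < \<bar>x\<bar>}"] by simp

lemma emeasure_lborel_Ico_eq: "emeasure lborel {a..<b} = ennreal (b - a)" for a b :: real
  by (cases "a \<le> b") (simp_all add: ennreal_neg)

lemma antimono_borel_measurable:
  fixes f :: "real \<Rightarrow> ennreal"
  assumes "\<And>s t. s \<le> t \<Longrightarrow> f t \<le> f s" shows "f \<in> borel_measurable borel"
proof (rule borel_measurableI_greater)
  fix y
  have "is_interval {t. y < f t}"
    unfolding is_interval_1 using assms by (auto intro: less_le_trans)
  then have "{t. y < f t} \<in> sets borel" by (simp add: real_interval_borel_measurable)
  then show "{x\<in>space borel. y < f x} \<in> sets borel" by simp
qed

abbreviation restr :: "real set \<Rightarrow> (real \<Rightarrow> real) \<Rightarrow> real \<Rightarrow> real" where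
  "restr I f \<equiv> (\<lambda>t. indicator I t * f t)"

context symmetric_quasi_banach_function_space
begin

text \<open>Rearrangements depend only on distribution functions, and it is these that can be
  computed for translates, interlaced copies and dilations.\<close>

lemma equimeasurable:
  assumes f: "f \<in> E" and g: "g \<in> borel_measurable half_line"
    and eq: "\<And>s. 0 \<le> s \<Longrightarrow> emeasure lebesgue {u\<in>{0..}. s < \<bar>g u\<bar>} = emeasure lebesgue {u\<in>{0..}. s < \<bar>f u\<bar>}"
  shows "g \<in> E" "N g = N f"
proof -
  have "decreasing_rearrangement g t = decreasing_rearrangement f t" for t
  proof -
    have "emeasure half_line {u\<in>{0..}. s < \<bar>g u\<bar>} = emeasure half_line {u\<in>{0..}. s < \<bar>f u\<bar>}" if "0 \<le> s" for s
      using eq[OF that] by (subst (1 2) emeasure_half_line) auto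
    then show ?thesis unfolding decreasing_rearrangement_def
      by (intro arg_cong[where f = Inf] Collect_cong ex_cong1 conj_cong) simp_all
  qed
  then show "g \<in> E" "N g = N f" using symmetric[OF f g] by simp_all
qed

lemma mono_pos:
  assumes "f \<in> E" "g \<in> borel_measurable half_line" "\<And>t. 0 < t \<Longrightarrow> \<bar>g t\<bar> \<le> \<bar>f t\<bar>"
  shows "g \<in> E" "N g \<le> N f"
  using ideal[OF assms(1,2) AE_half_line_pos[OF assms(3)]] by simp_all

definition "qc = (SOME C. 1 \<le> C \<and> (\<forall>f\<in>E. \<forall>g\<in>E. N (\<lambda>t. f t + g t) \<le> C * (N f + N g)))"

lemma qc: "1 \<le> qc" and qc_triangle: "f \<in> E \<Longrightarrow> g \<in> E \<Longrightarrow> N (\<lambda>t. f t + g t) \<le> qc * (N f + N g)"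
proof -
  obtain C where C: "\<And>f g. f \<in> E \<Longrightarrow> g \<in> E \<Longrightarrow> N (\<lambda>t. f t + g t) \<le> C * (N f + N g)"
    using quasi_triangle by blast
  have "N (\<lambda>t. f t + g t) \<le> max 1 C * (N f + N g)" if "f \<in> E" "g \<in> E" for f g
    using C[OF that] mult_right_mono[of C "max 1 C" "N f + N g"] norm_nonneg that by fastforce
  then have "\<exists>C. 1 \<le> C \<and> (\<forall>f\<in>E. \<forall>g\<in>E. N (\<lambda>t. f t + g t) \<le> C * (N f + N g))"
    by (intro exI[of _ "max 1 C"]) simp
  from someI_ex[OF this, folded qc_def]
  show "1 \<le> qc" "f \<in> E \<Longrightarrow> g \<in> E \<Longrightarrow> N (\<lambda>t. f t + g t) \<le> qc * (N f + N g)" by simp_all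
qed

lemma qc_pos: "0 < qc" using qc by simp

lemma restr_in: assumes f: "f \<in> E" and I: "I \<in> sets borel"
  shows "restr I f \<in> E" "N (restr I f) \<le> N f"
proof -
  have m: "restr I f \<in> borel_measurable half_line"
    by (intro borel_measurable_times[OF measurable_half_lineI measurable[OF f]] borel_measurable_indicator I)
  show "restr I f \<in> E" "N (restr I f) \<le> N f" by (rule mono_pos[OF f m], simp add: indicator_def)+
qed

lemma const_in: assumes "0 \<le> a" shows "(\<lambda>t. c * indicator {a..<b} t) \<in> E"
proof (rule scale, rule simple)
  have S: "{a..<b} \<in> sets half_line" using assms by (auto simp: sets_half_line)
  then show "simple_function half_line (indicator {a..<b} :: real \<Rightarrow> real)" by (rule simple_function_indicator)
  have "{t\<in>{0..}. indicator {a..<b} t \<noteq> (0::real)} = {a..<b}" using assms by (auto simp: indicator_def)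
  then show "emeasure half_line {t\<in>{0..}. indicator {a..<b} t \<noteq> (0::real)} < \<infinity>"
    using S by (simp add: emeasure_half_line sets_half_line emeasure_lborel_Ico_eq)
qed

lemma const_shift: assumes "0 \<le> a" "0 \<le> a'" "b - a = b' - a'"
  shows "N (\<lambda>t. c * indicator {a..<b} t) = N (\<lambda>t. c * indicator {a'..<b'} t)"
proof (rule equimeasurable(2)[OF const_in[OF assms(2)]])
  show "(\<lambda>t. c * indicator {a..<b} t) \<in> borel_measurable half_line" by (rule measurable[OF const_in[OF assms(1)]])
  fix s :: real assume s: "0 \<le> s"
  have "{u\<in>{0..}. s < \<bar>c * indicator {x..<y} u\<bar>} = (if s < \<bar>c\<bar> then {x..<y} else {})" if "0 \<le> x" for x y :: real
    using s that by (auto simp: indicator_def split: if_splits)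
  then show "emeasure lebesgue {u\<in>{0..}. s < \<bar>c * indicator {a..<b} u\<bar>} = emeasure lebesgue {u\<in>{0..}. s < \<bar>c * indicator {a'..<b'} u\<bar>}"
    using assms by (simp add: emeasure_lborel_Ico_eq)
qed

text \<open>The dilated function has twice the distribution function of \<open>f\<close>, as does a
  sum of two disjoint interlaced copies of \<open>f\<close>. It is needed because bounds for a sum
  of operators at \<open>t\<close> use the summands at \<open>t / 2\<close>.\<close>

lemma dilation: assumes f: "f \<in> E"
  shows "(\<lambda>t. f (t / 2)) \<in> E" "N (\<lambda>t. f (t / 2)) \<le> 2 * qc * N f"
proof -
  note fm = measurable[OF f]
  let ?A = "\<lambda>s. {v\<in>{0..}. s < \<bar>f v\<bar>}"
  have A: "?A s \<in> sets lebesgue" "?A s \<subseteq> {0..}" for s using half_line_level_set[OF fm] by auto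
  have il: "interlace e f \<in> E" "N (interlace e f) = N f" if e: "e < 2" for e
    by (rule equimeasurable[OF f interlace_measurable[OF fm e]];
        simp only: interlace_distribution interlace_set(2)[OF e A])+
  let ?g = "\<lambda>t. interlace 0 f t + interlace 1 f t"
  have g: "?g \<in> E" by (rule add[OF il(1) il(1)]) simp_all
  have dist: "emeasure lebesgue {u\<in>{0..}. s < \<bar>?g u\<bar>} = 2 * emeasure lebesgue (?A s)" if s: "0 \<le> s" for s
  proof -
    have "{u\<in>{0..}. s < \<bar>?g u\<bar>} = interlace_set 0 (?A s) \<union> interlace_set 1 (?A s)"
      unfolding interlace_distribution[OF s, symmetric] using s by (auto simp: interlace_def)
    moreover have "interlace_set 0 (?A s) \<inter> interlace_set 1 (?A s) = {}" by (auto simp: interlace_set_def)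
    moreover have "emeasure lebesgue (interlace_set 0 (?A s) \<union> interlace_set 1 (?A s))
      = emeasure lebesgue (interlace_set 0 (?A s)) + emeasure lebesgue (interlace_set 1 (?A s))"
      by (rule plus_emeasure[symmetric, OF interlace_set(1)[OF _ A] interlace_set(1)[OF _ A]]) (use calculation(2) in simp_all)
    ultimately have "emeasure lebesgue {u\<in>{0..}. s < \<bar>?g u\<bar>}
      = emeasure lebesgue (interlace_set 0 (?A s)) + emeasure lebesgue (interlace_set 1 (?A s))" by (simp only:)
    also have "\<dots> = 2 * emeasure lebesgue (?A s)" using interlace_set(2)[OF _ A] by (simp add: mult_2)
    finally show ?thesis .
  qed
  have pre: "{t\<in>{0..}. t / 2 \<in> D} = {x. 0 + (1/2) * x \<in> D}" if "D \<subseteq> {0..}" for D :: "real set" using that by auto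
  have m: "(\<lambda>t. f (t / 2)) \<in> borel_measurable half_line"
  proof (rule half_line_measurableI)
    fix B :: "real set" assume B: "B \<in> sets borel"
    have "{u\<in>{0..}. f (u / 2) \<in> B} = {x. 0 + (1/2) * x \<in> {v\<in>{0..}. f v \<in> B}}" by auto
    then show "{u\<in>{0..}. f (u / 2) \<in> B} \<in> sets lebesgue"
      using lebesgue_affine_preimage(1)[of "1/2" "{v\<in>{0..}. f v \<in> B}" 0] half_line_preimage[OF fm B] by simp
  qed
  have dist2: "emeasure lebesgue {u\<in>{0..}. s < \<bar>f (u / 2)\<bar>} = 2 * emeasure lebesgue (?A s)" for s
  proof -
    have "{u\<in>{0..}. s < \<bar>f (u / 2)\<bar>} = {x. 0 + (1/2) * x \<in> ?A s}" by auto
    then show ?thesis using lebesgue_affine_preimage(2)[of "1/2" "?A s" 0] A by simp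
  qed
  have *: "(\<lambda>t. f (t / 2)) \<in> E" "N (\<lambda>t. f (t / 2)) = N ?g"
    by (rule equimeasurable[OF g m trans[OF dist2 dist[symmetric]]], assumption)+
  show "(\<lambda>t. f (t / 2)) \<in> E" by (rule *)
  have "N ?g \<le> qc * (N (interlace 0 f) + N (interlace 1 f))" by (rule qc_triangle[OF il(1) il(1)]) simp_all
  then show "N (\<lambda>t. f (t / 2)) \<le> 2 * qc * N f" using * il(2) by simp
qed

text \<open>The piece \<open>[0, b - a)\<close> is no longer than \<open>[b - a, b)\<close>, whose
  length is \<open>a\<close>, and the norm of an indicator of an interval depends on its length
  only.\<close>

lemma const_double: assumes "0 \<le> a" "a \<le> b" "b \<le> 2 * a" 
  shows "N (\<lambda>t. c * indicator {0..<b} t) \<le> 2 * qc * N (\<lambda>t. c * indicator {b - a..<b} t)"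
proof -
  have eq: "N (\<lambda>t. c * indicator {b - a..<b} t) = N (\<lambda>t. c * indicator {0..<a} t)"
    using assms by (intro const_shift) auto
  have "N (\<lambda>t. c * indicator {0..<b} t) \<le> N (\<lambda>t. c * indicator {0..<b - a} t + c * indicator {b - a..<b} t)"
    using assms by (intro mono_pos(2)[OF add[OF const_in const_in] measurable[OF const_in]]) (auto simp: indicator_def)
  also have "\<dots> \<le> qc * (N (\<lambda>t. c * indicator {0..<b - a} t) + N (\<lambda>t. c * indicator {b - a..<b} t))"
    using assms by (intro qc_triangle const_in) auto
  also have "N (\<lambda>t. c * indicator {0..<b - a} t) \<le> N (\<lambda>t. c * indicator {0..<a} t)"
    using assms by (intro mono_pos(2)[OF const_in measurable[OF const_in]]) (auto simp: indicator_def)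
  finally show ?thesis using qc_pos by (simp add: eq mult_left_mono)
qed

section \<open>Consequences of order continuity\<close>

lemma order_continuous_seq:
  assumes oc: "order_continuous E N"
    and f: "\<And>n::nat. f n \<in> E" "\<And>n t. 0 < t \<Longrightarrow> f (Suc n) t \<le> f n t" "\<And>n t. 0 < t \<Longrightarrow> 0 \<le> f n t"
    and lim: "\<And>t. 0 < t \<Longrightarrow> (\<lambda>n. f n t) \<longlonglongrightarrow> 0"
    and e: "0 < e"
  shows "\<exists>n0. \<forall>n\<ge>n0. N (f n) < e"
proof -
  have mono: "f n t \<le> f m t" if "m \<le> n" "0 < t" for m n t
    using that(1) by (induction rule: dec_induct) (auto intro: order_trans[OF f(2)[OF that(2)]])
  have "\<exists>g\<in>range f. \<forall>h\<in>range f. (AE t in half_line. h t \<le> g t) \<longrightarrow> N h < e"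
  proof (rule oc[unfolded order_continuous_def, rule_format, OF _ e], intro conjI ballI impI)
    show "range f \<subseteq> E" using f(1) by blast
    show "range f \<noteq> {}" by blast
    fix g assume g: "g \<in> range f"
    then show "AE t in half_line. 0 \<le> g t" using f(3) by (auto intro: AE_half_line_pos)
    fix h assume h: "h \<in> range f"
    obtain m n where mn: "g = f m" "h = f n" using g h by blast
    show "\<exists>k\<in>range f. (AE t in half_line. k t \<le> g t) \<and> (AE t in half_line. k t \<le> h t)"
      by (rule bexI[of _ "f (max m n)"]) (auto simp: mn intro!: AE_half_line_pos mono)
  next
    fix g assume "g \<in> E" and "\<forall>h\<in>range f. AE t in half_line. g t \<le> h t"
    then have "AE t in half_line. \<forall>n. g t \<le> f n t" by (simp add: AE_all_countable)
    moreover have "AE t in half_line. 0 < t \<longrightarrow> (\<lambda>n. f n t) \<longlonglongrightarrow> 0" using lim by simp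
    moreover have "AE t in half_line. 0 < t" by (rule AE_half_line_pos)
    ultimately show "AE t in half_line. g t \<le> 0"
    proof eventually_elim
      case (elim t)
      then show ?case by (intro LIMSEQ_le_const) auto
    qed
  qed
  then obtain n0 where n0: "\<And>n. (AE t in half_line. f n t \<le> f n0 t) \<Longrightarrow> N (f n) < e" by blast
  show ?thesis by (intro exI[of _ n0] allI impI n0 AE_half_line_pos mono)
qed

lemma head_small: assumes oc: "order_continuous E N" and e: "0 < e" and f: "f \<in> E" "\<And>t. 0 < t \<Longrightarrow> 0 \<le> f t"
  shows "\<exists>d>0. \<forall>b\<le>d. N (restr {0..<b} f) < e"
proof -
  obtain n0 where n0: "\<forall>n\<ge>n0. N (restr {0..<inverse (real (Suc n))} f) < e"
  proof (atomize_elim, rule order_continuous_seq[OF oc _ _ _ _ e])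
    show "restr {0..<inverse (real (Suc n))} f \<in> E" for n by (rule restr_in[OF f(1)]) simp
    fix t :: real assume t: "0 < t"
    show "restr {0..<inverse (real (Suc (Suc n)))} f t \<le> restr {0..<inverse (real (Suc n))} f t" for n
    proof -
      have "inverse (real (Suc (Suc n))) \<le> inverse (real (Suc n))" by (rule le_imp_inverse_le) simp_all
      from order.strict_trans2[OF _ this, of t] show ?thesis using f(2)[OF t] t by (intro mult_right_mono) (auto simp del: of_nat_Suc simp: indicator_def)
    qed
    show "0 \<le> restr {0..<inverse (real (Suc n))} f t" for n using f(2)[OF t] by simp
    obtain m where m: "inverse (real (Suc m)) < t" using reals_Archimedean[OF t] by blast
    have "inverse (real (Suc n)) \<le> inverse (real (Suc m))" if "m \<le> n" for n using that by (simp add: le_imp_inverse_le)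
    then have "restr {0..<inverse (real (Suc n))} f t = 0" if "m \<le> n" for n
      using order.strict_trans1[OF _ m, of "inverse (real (Suc n))"] that by (simp add: indicator_def del: of_nat_Suc)
    then show "(\<lambda>n. restr {0..<inverse (real (Suc n))} f t) \<longlonglongrightarrow> 0"
      by (intro tendsto_eventually) (auto simp: eventually_sequentially)
  qed
  have "N (restr {0..<b} f) < e" if "b \<le> inverse (real (Suc n0))" for b
  proof -
    have "N (restr {0..<b} f) \<le> N (restr {0..<inverse (real (Suc n0))} f)"
      using that by (intro mono_pos(2)[OF restr_in(1)[OF f(1)] measurable[OF restr_in(1)[OF f(1)]]]) (auto simp: indicator_def)
    then show ?thesis using n0 by force
  qed
  then show ?thesis by (intro exI[of _ "inverse (real (Suc n0))"]) simp
qed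

lemma const_small: assumes oc: "order_continuous E N" and e: "0 < e" and c: "0 \<le> c"
  shows "\<exists>d>0. \<forall>b\<le>d. N (\<lambda>t. c * indicator {0..<b} t) < e"
proof -
  obtain d where d: "0 < d" "\<forall>b\<le>d. N (restr {0..<b} (\<lambda>t. c * indicator {0..<1} t)) < e"
    using head_small[OF oc e const_in[of 0 c 1]] c by auto
  have "restr {0..<b} (\<lambda>t. c * indicator {0..<1} t) = (\<lambda>t. c * indicator {0..<b} t)" if "b \<le> 1" for b :: real
    using that by (auto simp: fun_eq_iff indicator_def)
  then have "\<forall>b\<le>min d 1. N (\<lambda>t. c * indicator {0..<b} t) < e" using d(2) by (metis min.bounded_iff)
  then show ?thesis using d(1) by (intro exI[of _ "min d 1"]) simp
qed

lemma min_in: assumes f: "f \<in> E" "\<And>t. 0 < t \<Longrightarrow> 0 \<le> f t" and c: "0 \<le> c"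
  shows "(\<lambda>t. min c (f t)) \<in> E" "N (\<lambda>t. min c (f t)) \<le> N f"
proof -
  have m: "(\<lambda>t. min c (f t)) \<in> borel_measurable half_line" using measurable[OF f(1)] by simp
  show "(\<lambda>t. min c (f t)) \<in> E" "N (\<lambda>t. min c (f t)) \<le> N f"
    by (rule mono_pos[OF f(1) m]; use f(2) c in \<open>force simp: abs_if\<close>)+
qed

lemma min_small: assumes oc: "order_continuous E N" and e: "0 < e" and f: "f \<in> E" "\<And>t. 0 < t \<Longrightarrow> 0 \<le> f t"
  shows "\<exists>d>0. \<forall>c. 0 \<le> c \<and> c \<le> d \<longrightarrow> N (\<lambda>t. min c (f t)) < e"
proof -
  obtain n0 where n0: "\<forall>n\<ge>n0. N (\<lambda>t. min (inverse (real (Suc n))) (f t)) < e"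
  proof (atomize_elim, rule order_continuous_seq[OF oc _ _ _ _ e])
    show "(\<lambda>t. min (inverse (real (Suc n))) (f t)) \<in> E" for n by (rule min_in(1)[OF f]) simp_all
    fix t :: real assume t: "0 < t"
    show "min (inverse (real (Suc (Suc n)))) (f t) \<le> min (inverse (real (Suc n))) (f t)" for n
      by (intro min.mono le_imp_inverse_le) simp_all
    show "0 \<le> min (inverse (real (Suc n))) (f t)" for n using f(2)[OF t] by simp
    show "(\<lambda>n. min (inverse (real (Suc n))) (f t)) \<longlonglongrightarrow> 0"
    proof (rule tendsto_sandwich[OF _ _ tendsto_const LIMSEQ_inverse_real_of_nat])
    qed (use f(2)[OF t] in \<open>simp_all add: min_le_iff_disj less_imp_le[OF positive_imp_inverse_positive] del: of_nat_Suc\<close>)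
  qed
  have "N (\<lambda>t. min c (f t)) < e" if c: "0 \<le> c" "c \<le> inverse (real (Suc n0))" for c
  proof -
    have m: "(\<lambda>t. min c (f t)) \<in> borel_measurable half_line" using measurable[OF f(1)] by simp
    have "N (\<lambda>t. min c (f t)) \<le> N (\<lambda>t. min (inverse (real (Suc n0))) (f t))"
      by (rule mono_pos(2)[OF min_in(1)[OF f] m]) (use c f(2) in \<open>force simp: abs_if\<close>)+
    then show ?thesis using n0 by force
  qed
  then show ?thesis by (intro exI[of _ "inverse (real (Suc n0))"]) simp
qed

section \<open>Consequences of the lower estimate\<close>

lemma lower2:
  assumes lo: "lower_estimate_const_1 q E N" and q: "0 < q" and f: "f \<in> E" "g \<in> E" "\<And>t. 0 < t \<Longrightarrow> f t = 0 \<or> g t = 0"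
  shows "N f powr q + N g powr q \<le> N (\<lambda>t. f t + g t) powr q"
proof -
  let ?h = "\<lambda>i::nat. if i = 0 then f else g"
  have 2: "{..<2::nat} = {0, 1}" by auto
  have ae: "AE t in half_line. f t = 0 \<or> g t = 0" "AE t in half_line. g t = 0 \<or> f t = 0"
    by (rule AE_half_line_pos; use f(3) in blast)+
  have "(\<Sum>i<2. N (?h i) powr q) powr (1 / q) \<le> N (\<lambda>t. \<Sum>i<2. ?h i t)"
    by (rule lo[unfolded lower_estimate_const_1_def, rule_format]) (use f ae in auto)
  then have le: "(N f powr q + N g powr q) powr (1 / q) \<le> N (\<lambda>t. f t + g t)" by (simp add: 2)
  have "N f powr q + N g powr q = ((N f powr q + N g powr q) powr (1 / q)) powr q"
    using q by (simp add: powr_powr)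
  also have "\<dots> \<le> N (\<lambda>t. f t + g t) powr q" using le q by (intro powr_mono2) auto
  finally show ?thesis .
qed

text \<open>The indicator of \<open>[0, n)\<close> is a sum of \<open>n\<close> disjoint translates
  of that of \<open>[0, 1)\<close>, all of the same norm.\<close>

lemma const_lower:
  assumes lo: "lower_estimate_const_1 q E N" and q: "0 < q"
  shows "real n powr (1 / q) * N (\<lambda>t. 1 * indicator {0..<1} t) \<le> N (\<lambda>t. 1 * indicator {0..<real n} t)"
proof -
  have sh: "N (\<lambda>t. 1 * indicator {real i..<real i + 1} t) = N (\<lambda>t. 1 * indicator {0..<1} t)" for i
    by (rule const_shift) simp_all
  have "(\<Sum>i<n. N (\<lambda>t. 1 * indicator {real i..<real i + 1} t) powr q) powr (1 / q) \<le> N (\<lambda>t. \<Sum>i<n. 1 * indicator {real i..<real i + 1} t)"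
  proof (rule lo[unfolded lower_estimate_const_1_def, rule_format], intro conjI allI impI const_in)
    fix i j :: nat assume "i \<noteq> j"
    then consider "i < j" | "j < i" by linarith
    then have "{real i..<real i + 1} \<inter> {real j..<real j + 1} = {}" by cases auto
    then show "AE t in half_line. 1 * indicator {real i..<real i + 1} t = (0::real) \<or> 1 * indicator {real j..<real j + 1} t = (0::real)"
      by (intro AE_half_line_pos) (auto simp: indicator_def)
  qed simp
  also have "(\<lambda>t. \<Sum>i<n. 1 * indicator {real i..<real i + 1} t) = (\<lambda>t::real. 1 * indicator {0..<real n} t :: real)"
  proof
    fix t :: real show "(\<Sum>i<n. 1 * indicator {real i..<real i + 1} t) = (1 * indicator {0..<real n} t :: real)"
      by (induction n) (auto simp: indicator_def)
  qed
  finally show ?thesis unfolding sh using q norm_nonneg[OF const_in[of 0 1 1]] by (simp add: powr_mult powr_powr)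
qed

lemma const_1_pos: assumes "0 < b" shows "0 < N (\<lambda>t. 1 * indicator {0..<b} t)"
proof -
  have E: "(\<lambda>t. 1 * indicator {0..<b} t) \<in> E" by (rule const_in) simp
  have "N (\<lambda>t. 1 * indicator {0..<b} t) \<noteq> 0"
  proof
    assume "N (\<lambda>t. 1 * indicator {0..<b} t) = 0"
    then have "AE t in half_line. 1 * indicator {0..<b} t = (0::real)" using norm_eq_0[OF E] by simp
    moreover have "AE t in half_line. 0 \<le> t" by (rule AE_half_line_pos) simp
    ultimately have "AE t in half_line. t \<notin> {0..<b}" by eventually_elim (auto simp: indicator_def)
    from emeasure_eq_0_AE[where P = "\<lambda>t. t \<in> {0..<b}", OF this] have "emeasure half_line {t\<in>{0..}. t \<in> {0..<b}} = 0"
      by (simp add: space_restrict_space)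
    moreover have "{t\<in>{0..}. t \<in> {0..<b}} = {0..<b}" by auto
    moreover have "emeasure half_line {0..<b} = ennreal b"
      by (subst emeasure_half_line) (auto simp: emeasure_lborel_Ico_eq)
    ultimately show False using assms by simp
  qed
  then show ?thesis using norm_nonneg[OF E] by simp
qed

lemma level_bound:
  assumes f: "f \<in> E" "\<And>s t. 0 < s \<Longrightarrow> s \<le> t \<Longrightarrow> f t \<le> f s" "\<And>t. 0 < t \<Longrightarrow> 0 \<le> f t" and b: "0 < b"
  shows "f b * N (\<lambda>t. 1 * indicator {0..<b} t) \<le> N f"
proof -
  have "f b * N (\<lambda>t. 1 * indicator {0..<b} t) = N (\<lambda>t. f b * (1 * indicator {0..<b} t))"
    using norm_scale[OF const_in[of 0 1 b], of "f b"] f(3)[OF b] by simp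
  also have "\<dots> \<le> N f"
    by (rule mono_pos(2)[OF f(1) measurable[OF scale[OF const_in]]]) (use f b in \<open>auto simp: indicator_def\<close>)
  finally show ?thesis .
qed

text \<open>A decreasing \<open>f\<close> is at least \<open>f n\<close> on \<open>[0, n)\<close>,
  whose indicator has norm growing at least like the power \<open>1 / q\<close> of \<open>n\<close>.
  The rank \<open>n0\<close> therefore depends on the bound \<open>B\<close> but not on
  \<open>f\<close>.\<close>

lemma level_small:
  assumes lo: "lower_estimate_const_1 q E N" and q: "0 < q" and e: "0 < e"
  shows "\<exists>n0::nat. \<forall>n\<ge>n0. \<forall>f\<in>E. (\<forall>s t. 0 < s \<longrightarrow> s \<le> t \<longrightarrow> f t \<le> f s) \<longrightarrow> (\<forall>t>0. 0 \<le> f t) \<longrightarrow> N f \<le> B \<longrightarrow> f (real n) \<le> e"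
proof -
  let ?c = "N (\<lambda>t. 1 * indicator {0..<1} t)"
  have c: "0 < ?c" by (rule const_1_pos) simp
  \<comment> \<open>Large enough that \<open>e\<close> times the norm forced by
    \<open>const_lower\<close> exceeds \<open>B\<close>; the maximum with zero admits arbitrary real
    \<open>B\<close>.\<close>
  obtain n1 :: nat where n1: "(max B 0 / (e * ?c)) powr q < real n1" using reals_Archimedean2 by blast
  have "f (real n) \<le> e" if n: "n1 + 1 \<le> n" and f: "f \<in> E" "\<forall>s t. 0 < s \<longrightarrow> s \<le> t \<longrightarrow> f t \<le> f s" "\<forall>t>0. 0 \<le> f t" "N f \<le> B" for n f
  proof (rule ccontr)
    assume "\<not> f (real n) \<le> e"
    then have fe: "e < f (real n)" by simp
    have n0: "0 < real n" using n by simp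
    have "max B 0 / (e * ?c) = ((max B 0 / (e * ?c)) powr q) powr (1 / q)" using q e c by (simp add: powr_powr)
    also have "\<dots> < real n powr (1 / q)" using n1 n q by (intro powr_less_mono2) auto
    finally have "max B 0 < e * (real n powr (1 / q) * ?c)" using e c by (simp add: field_simps)
    also have "\<dots> \<le> e * N (\<lambda>t. 1 * indicator {0..<real n} t)" using const_lower[OF lo q, of n] e by (simp add: mult_left_mono)
    also have "\<dots> \<le> f (real n) * N (\<lambda>t. 1 * indicator {0..<real n} t)"
      using fe const_1_pos[OF n0] by (intro mult_right_mono) auto
    also have "\<dots> \<le> N f" by (rule level_bound) (use f n0 in auto)
    finally show False using f(4) by simp
  qed
  then show ?thesis by (intro exI[of _ "n1 + 1"]) blast
qed

text \<open>On \<open>[0, 2 a)\<close> the flattened function is at most \<open>f (2 a)\<close>, and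
  this constant costs no more than a multiple of \<open>f\<close> on \<open>[a, 2 a)\<close>. The
  head of \<open>f\<close> thus never enters. The constant arises from \<open>qc (2 qc + 1)\<close>,
  rounded up using \<open>1 <= qc\<close>.\<close>

lemma block_bound:
  assumes f: "f \<in> E" "\<And>s t. 0 < s \<Longrightarrow> s \<le> t \<Longrightarrow> f t \<le> f s" "\<And>t. 0 < t \<Longrightarrow> 0 \<le> f t"
    and ab: "0 < a" "2 * a \<le> b"
  shows "N (\<lambda>t. indicator {0..<b} t * min (f (2 * a)) (f t)) \<le> 3 * qc * qc * N (restr {a..<b} f)"
    "(\<lambda>t. indicator {0..<b} t * min (f (2 * a)) (f t)) \<in> E"
proof -
  have f2: "0 \<le> f (2 * a)" using f(3) ab by simp
  let ?h = "\<lambda>t. indicator {0..<b} t * min (f (2 * a)) (f t)"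
  have r: "restr {a..<b} f \<in> E" by (rule restr_in(1)[OF f(1)]) simp
  have c: "(\<lambda>t. f (2 * a) * indicator {0..<2 * a} t) \<in> E" by (rule const_in) simp
  have hm: "?h \<in> borel_measurable half_line"
    by (intro borel_measurable_times[OF measurable_half_lineI measurable[OF min_in(1)[OF f(1,3) f2]]]) auto
  have le: "\<bar>?h t\<bar> \<le> \<bar>f (2 * a) * indicator {0..<2 * a} t + restr {a..<b} f t\<bar>" if "0 < t" for t
    using f(3)[OF that] f2 ab by (auto simp: indicator_def)
  show "?h \<in> E" by (rule mono_pos(1)[OF add[OF c r] hm le])
  have "N ?h \<le> N (\<lambda>t. f (2 * a) * indicator {0..<2 * a} t + restr {a..<b} f t)"
    by (rule mono_pos(2)[OF add[OF c r] hm le])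
  also have "\<dots> \<le> qc * (N (\<lambda>t. f (2 * a) * indicator {0..<2 * a} t) + N (restr {a..<b} f))"
    by (rule qc_triangle[OF c r])
  also have "N (\<lambda>t. f (2 * a) * indicator {0..<2 * a} t) \<le> 2 * qc * N (\<lambda>t. f (2 * a) * indicator {2 * a - a..<2 * a} t)"
    using ab by (intro const_double) auto
  also have "N (\<lambda>t. f (2 * a) * indicator {2 * a - a..<2 * a} t) \<le> N (restr {a..<b} f)"
    using ab f f2 by (intro mono_pos(2)[OF r measurable[OF const_in]]) (auto simp: indicator_def)
  finally have "N ?h \<le> qc * (2 * qc * N (restr {a..<b} f) + N (restr {a..<b} f))"
    using qc_pos by (simp add: mult_left_mono)
  also have "\<dots> \<le> qc * (2 * qc * N (restr {a..<b} f) + qc * N (restr {a..<b} f))"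
    using qc_pos mult_right_mono[OF qc norm_nonneg[OF r]] by (intro mult_left_mono add_left_mono) auto
  finally show "N ?h \<le> 3 * qc * qc * N (restr {a..<b} f)" by (simp add: algebra_simps)
qed

end

section \<open>Bounds off projections of small trace\<close>

context traced_algebra
begin

lemma projs_idem: "p \<in> projs \<M> \<Longrightarrow> p (p h) = p h"
  and projs_norm: "p \<in> projs \<M> \<Longrightarrow> norm (p h) \<le> norm h"
  and projs_clinear: "p \<in> projs \<M> \<Longrightarrow> bounded_clinear p"
  by (simp_all add: projs_iff proj_idem proj_norm_le proj_clinear)

lemma projs_lin: "p \<in> projs \<M> \<Longrightarrow> p (x + y) = p x + p y" "p \<in> projs \<M> \<Longrightarrow> p (x - y) = p x - p y" "p \<in> projs \<M> \<Longrightarrow> p 0 = 0"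
  by (simp_all add: projs_iff proj_simps)

lemma projs_sub: "p \<in> projs \<M> \<Longrightarrow> q \<in> projs \<M> \<Longrightarrow> (\<And>h. q (p h) = p h) \<Longrightarrow> (\<lambda>h. q h - p h) \<in> projs \<M>"
  by (simp add: projs_iff M_diff proj_diff)

lemma projs_le_commute: "p \<in> projs \<M> \<Longrightarrow> q \<in> projs \<M> \<Longrightarrow> (\<And>h. q (p h) = p h) \<Longrightarrow> p (q h) = p h"
  by (rule proj_le_commute[OF projs_proj projs_proj])

text \<open>For \<open>x\<close> in the algebra and positive \<open>t\<close> this says that the
  generalized singular value of \<open>x\<close> at \<open>t\<close> is at most \<open>s\<close>.
  Keeping the projection as a witness avoids the spectral theory of sums and products.\<close>

definition bdd_off :: "('h \<Rightarrow> 'h) \<Rightarrow> real \<Rightarrow> real \<Rightarrow> bool" where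
  "bdd_off x t s \<longleftrightarrow> (\<exists>p\<in>projs \<M>. \<tau> (perp p) \<le> ennreal t \<and> (\<forall>h. p h = h \<longrightarrow> norm (x h) \<le> s * norm h))"

lemma bdd_offI: "p \<in> projs \<M> \<Longrightarrow> \<tau> (perp p) \<le> ennreal t \<Longrightarrow> (\<And>h. p h = h \<Longrightarrow> norm (x h) \<le> s * norm h) \<Longrightarrow> bdd_off x t s"
  unfolding bdd_off_def by blast

lemma bdd_off_mono: assumes "bdd_off x t s" "t \<le> t'" "s \<le> s'" shows "bdd_off x t' s'"
proof -
  obtain p where p: "p \<in> projs \<M>" "\<tau> (perp p) \<le> ennreal t" "\<forall>h. p h = h \<longrightarrow> norm (x h) \<le> s * norm h"
    using assms(1) unfolding bdd_off_def by blast
  show ?thesis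
  proof (rule bdd_offI[OF p(1)])
    show "\<tau> (perp p) \<le> ennreal t'" using p(2) ennreal_leI[OF assms(2)] by (rule order_trans)
    show "norm (x h) \<le> s' * norm h" if "p h = h" for h
      using p(3) that mult_right_mono[OF assms(3), of "norm h"] by force
  qed
qed

lemma bdd_off_bound: "(\<And>h. norm (x h) \<le> s * norm h) \<Longrightarrow> bdd_off x t s"
  by (rule bdd_offI[OF projs_id]) (simp_all add: tau_0)

lemma bdd_off_add:
  assumes "bdd_off x t s" "bdd_off y t' s'" "0 \<le> t" "0 \<le> t'" shows "bdd_off (\<lambda>h. x h + y h) (t + t') (s + s')"
proof -
  obtain p where p: "p \<in> projs \<M>" "\<tau> (perp p) \<le> ennreal t" "\<forall>h. p h = h \<longrightarrow> norm (x h) \<le> s * norm h"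
    using assms(1) unfolding bdd_off_def by blast
  obtain q where q: "q \<in> projs \<M>" "\<tau> (perp q) \<le> ennreal t'" "\<forall>h. q h = h \<longrightarrow> norm (y h) \<le> s' * norm h"
    using assms(2) unfolding bdd_off_def by blast
  have pq: "{p, q} \<subseteq> projs \<M>" using p q by simp
  show ?thesis
  proof (rule bdd_offI[OF meet_projs[OF pq]])
    show "\<tau> (perp (meet {p, q})) \<le> ennreal (t + t')"
      using cotrace_meet2[OF p(1) q(1)] add_mono[OF p(2) q(2)] assms(3,4) by (simp add: ennreal_plus)
    fix h assume "meet {p, q} h = h"
    then have "p h = h" "q h = h" using meet_fix[OF pq] by simp_all
    then show "norm (x h + y h) \<le> (s + s') * norm h"
      using p(3) q(3) norm_triangle_ineq[of "x h" "y h"] by (force simp: algebra_simps)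
  qed
qed

lemma bdd_off_left:
  assumes "bdd_off x t s" "\<And>h. norm (a h) \<le> c * norm h" "0 \<le> c" shows "bdd_off (\<lambda>h. a (x h)) t (c * s)"
proof -
  obtain p where p: "p \<in> projs \<M>" "\<tau> (perp p) \<le> ennreal t" "\<forall>h. p h = h \<longrightarrow> norm (x h) \<le> s * norm h"
    using assms(1) unfolding bdd_off_def by blast
  show ?thesis
  proof (rule bdd_offI[OF p(1,2)])
    fix h assume "p h = h"
    then have "c * norm (x h) \<le> c * (s * norm h)" using p(3) assms(3) by (simp add: mult_left_mono)
    then show "norm (a (x h)) \<le> c * s * norm h" using assms(2)[of "x h"] by (simp add: mult.assoc)
  qed
qed

lemma bdd_off_right:
  assumes "bdd_off x t s" "b \<in> \<M>" "\<And>h. norm (b h) \<le> c * norm h" "0 \<le> s" shows "bdd_off (\<lambda>h. x (b h)) t (s * c)"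
proof -
  obtain p where p: "p \<in> projs \<M>" "\<tau> (perp p) \<le> ennreal t" "\<forall>h. p h = h \<longrightarrow> norm (x h) \<le> s * norm h"
    using assms(1) unfolding bdd_off_def by blast
  obtain r where r: "r \<in> projs \<M>" "\<forall>h. r h = h \<longleftrightarrow> p (b h) = b h" "\<tau> (perp r) \<le> \<tau> (perp p)"
    using pullback[OF assms(2) p(1)] by blast
  show ?thesis
  proof (rule bdd_offI[OF r(1) order_trans[OF r(3) p(2)]])
    fix h assume "r h = h"
    then have "norm (x (b h)) \<le> s * norm (b h)" using p(3) r(2) by simp
    also have "\<dots> \<le> s * (c * norm h)" using assms(3,4) by (rule mult_left_mono)
    finally show "norm (x (b h)) \<le> s * c * norm h" by (simp add: mult.assoc)
  qed
qed

text \<open>Take the vectors whose image under the adjoint lies in the range of \<open>p\<close>. At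
  such \<open>h\<close> the squared norm of the adjoint image is an inner product of
  \<open>x (badjoint x h)\<close> with \<open>h\<close>, to which the bound for \<open>x\<close>
  applies.\<close>

lemma bdd_off_adj: assumes "bdd_off x t s" "x \<in> \<M>" "0 \<le> s" shows "bdd_off (badjoint x) t s"
proof -
  obtain p where p: "p \<in> projs \<M>" "\<tau> (perp p) \<le> ennreal t" "\<forall>h. p h = h \<longrightarrow> norm (x h) \<le> s * norm h"
    using assms(1) unfolding bdd_off_def by blast
  obtain r where r: "r \<in> projs \<M>" "\<forall>h. r h = h \<longleftrightarrow> p (badjoint x h) = badjoint x h" "\<tau> (perp r) \<le> \<tau> (perp p)"
    using pullback[OF M_adj[OF assms(2)] p(1)] by blast
  show ?thesis
  proof (rule bdd_offI[OF r(1) order_trans[OF r(3) p(2)]])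
    fix h assume "r h = h"
    then have le: "norm (x (badjoint x h)) \<le> s * norm (badjoint x h)" using p(3) r(2) by simp
    have "norm (badjoint x h) * norm (badjoint x h) = cmod (cinner (badjoint x h) (badjoint x h))"
      by (simp add: cinner_self power2_eq_square norm_mult)
    also have "\<dots> = cmod (cinner (x (badjoint x h)) h)"
      by (simp only: cinner_badjoint[OF M_clinear[OF assms(2)]])
    also have "\<dots> \<le> norm (x (badjoint x h)) * norm h" by (rule cauchy_schwarz)
    also have "\<dots> \<le> norm (badjoint x h) * (s * norm h)" using mult_right_mono[OF le, of "norm h"] by (simp add: mult_ac)
    finally show "norm (badjoint x h) \<le> s * norm h" using assms(3) by (cases "badjoint x h = 0") simp_all
  qed
qed

lemma bdd_off_rank:
  assumes q: "q \<in> projs \<M>" "\<tau> q \<le> ennreal t" and z: "\<And>h. z (perp q h) = 0" shows "bdd_off z t 0"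
proof (rule bdd_offI[OF projs_perp[OF q(1)]])
  show "\<tau> (\<lambda>h. h - perp q h) \<le> ennreal t" using q(2) by simp
  fix h assume "perp q h = h"
  then show "norm (z h) \<le> 0 * norm h" using z[of h] by simp
qed

text \<open>The operator vanishes on its own kernel projection, whose cotrace is at most the trace
  of a projection containing the range.\<close>

lemma bdd_off_rank_left:
  assumes q: "q \<in> projs \<M>" "\<tau> q \<le> ennreal t" and z: "z \<in> \<M>" "\<And>h. q (z h) = z h" shows "bdd_off z t 0"
proof (rule bdd_offI[OF kproj_projs[OF z(1)] order_trans[OF tau_kproj_le[OF z(1) q(1) z(2)] q(2)]])
  fix h assume "kproj z h = h"
  then show "norm (z h) \<le> 0 * norm h" using kproj_fix[OF z(1)] by simp
qed

text \<open>The squared Hilbert-Schmidt norm with respect to the trace, possibly infinite.\<close>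

definition sq_trace :: "('h \<Rightarrow> 'h) \<Rightarrow> ennreal" where
  "sq_trace z = \<tau> (badjoint z \<circ> z)"

lemma sq_trace_mono:
  "y \<in> \<M> \<Longrightarrow> z \<in> \<M> \<Longrightarrow> (\<And>h. norm (y h) \<le> norm (z h)) \<Longrightarrow> sq_trace y \<le> sq_trace z"
  unfolding sq_trace_def by (rule tau_mono) (simp_all add: adj_comp_Cone adj_comp_form del: comp_apply)

lemma sq_trace_adj: assumes "z \<in> \<M>" shows "sq_trace (badjoint z) = sq_trace z"
  using tau_adj[OF assms] by (simp add: sq_trace_def badjoint_badjoint M_clinear assms)

lemma sq_trace_add_le:
  assumes M: "x \<in> \<M>" "y \<in> \<M>" "z \<in> \<M>" and le: "\<And>h. (norm (x h))\<^sup>2 + (norm (y h))\<^sup>2 \<le> (norm (z h))\<^sup>2"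
  shows "sq_trace x + sq_trace y \<le> sq_trace z"
proof -
  have C: "(\<lambda>h. (badjoint x \<circ> x) h + (badjoint y \<circ> y) h) \<in> Cone"
    using adj_comp_Cone[OF M(1)] adj_comp_Cone[OF M(2)]
    by (auto simp: Cone_iff M_add positive_op_def nonneg_Reals_iff cinner_add_left simp del: comp_apply)
  have "\<tau> (\<lambda>h. (badjoint x \<circ> x) h + (badjoint y \<circ> y) h) \<le> \<tau> (badjoint z \<circ> z)"
    using le by (intro tau_mono C adj_comp_Cone M)
      (simp add: cinner_add_left adj_comp_form[OF M(1)] adj_comp_form[OF M(2)] adj_comp_form[OF M(3)] del: comp_apply)
  then show ?thesis unfolding sq_trace_def tau_add[OF adj_comp_Cone[OF M(1)] adj_comp_Cone[OF M(2)]] .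
qed

lemma sq_trace_proj: assumes "p \<in> projs \<M>" shows "sq_trace p = \<tau> p"
  using assms by (simp add: sq_trace_def projs_iff projection_op_def)

lemma sq_trace_scale: assumes z: "z \<in> \<M>" and r: "0 \<le> r" shows "sq_trace (\<lambda>h. r *\<^sub>R z h) = ennreal (r\<^sup>2) * sq_trace z"
proof -
  have "badjoint (\<lambda>h. r *\<^sub>R z h) = (\<lambda>h. r *\<^sub>R badjoint z h)"
    by (rule badjoint_unique) (simp add: cinner_scaleR_left cinner_scaleR_right cinner_badjoint[OF M_clinear[OF z]])
  then have "badjoint (\<lambda>h. r *\<^sub>R z h) \<circ> (\<lambda>h. r *\<^sub>R z h) = (\<lambda>h. (r\<^sup>2) *\<^sub>R (badjoint z \<circ> z) h)"
    by (simp add: o_def fun_eq_iff bounded_clinear_scaleR[OF M_clinear[OF M_adj[OF z]]] power2_eq_square)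
  then show ?thesis using tau_scale[OF adj_comp_Cone[OF z], of "r\<^sup>2"] by (simp add: sq_trace_def)
qed

text \<open>Chebyshev's inequality: above the level \<open>s\<close> the operator dominates
  \<open>s\<close> times the spectral projection, so the trace of that projection is at most
  \<open>sq_trace z\<close> divided by the square of \<open>s\<close>.\<close>

lemma bdd_off_sq_trace:
  assumes z: "z \<in> \<M>" and le: "sq_trace z \<le> ennreal (t * s\<^sup>2)" and s: "0 < s" and t: "0 \<le> t"
  shows "bdd_off z t s"
proof -
  interpret affil_op \<M> "graph z" by (rule graph_affil[OF z])
  have low: "s * norm (h - F s h) \<le> norm (z h)" for h
  proof -
    have "(h, z h) \<in> graph z" by (simp add: in_graph)
    from F_split[OF this, of s] obtain k1 k2 where k0: "(F s h, k1) \<in> graph z \<and> (h - F s h, k2) \<in> graph z \<and>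
        z h = k1 + k2 \<and> (norm (z h))\<^sup>2 = (norm k1)\<^sup>2 + (norm k2)\<^sup>2"
      by (elim exE) (rule that)
    note k = k0[THEN conjunct2, THEN conjunct1] k0[THEN conjunct2, THEN conjunct2, THEN conjunct2]
    have "s * norm (h - F s h) \<le> norm k2"
    proof (cases "h - F s h = 0")
      case False
      have "F s (h - F s h) = 0" by (simp add: F_lin F_idem)
      from F_strict[OF k(1) this False] s show ?thesis by simp
    qed simp
    also have "norm k2 \<le> norm (z h)" by (rule power2_le_imp_le) (use k(2) in simp_all)
    finally show ?thesis .
  qed
  have pM: "perp (F s) \<in> projs \<M>" by (rule projs_perp[OF F_projs])
  have "ennreal (s\<^sup>2) * \<tau> (perp (F s)) = sq_trace (\<lambda>h. s *\<^sub>R perp (F s) h)"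
    using sq_trace_scale[OF projs_M[OF pM], of s] s sq_trace_proj[OF pM] by simp
  also have "\<dots> \<le> sq_trace z" using low s by (intro sq_trace_mono M_scaleR projs_M[OF pM] z) simp
  also have "\<dots> \<le> ennreal (s\<^sup>2 * t)" using le by (simp add: mult.commute)
  finally have "ennreal (1 / s\<^sup>2) * (ennreal (s\<^sup>2) * \<tau> (perp (F s))) \<le> ennreal (1 / s\<^sup>2) * ennreal (s\<^sup>2 * t)"
    by (rule mult_left_mono) simp
  moreover have "ennreal (1 / s\<^sup>2) * (ennreal (s\<^sup>2) * \<tau> (perp (F s))) = \<tau> (perp (F s))"
    using s by (simp add: mult.assoc[symmetric] ennreal_mult[symmetric])
  moreover have "ennreal (1 / s\<^sup>2) * ennreal (s\<^sup>2 * t) = ennreal t"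
    using s t by (simp add: ennreal_mult[symmetric])
  ultimately have tau: "\<tau> (perp (F s)) \<le> ennreal t" by simp
  obtain T where T: "\<forall>h. (F s h, T h) \<in> graph z \<and> norm (T h) \<le> s * norm (F s h)" using cut_exists[of s] s by auto
  show ?thesis
  proof (rule bdd_offI[OF F_projs tau])
    fix h assume h: "F s h = h"
    then show "norm (z h) \<le> s * norm h"
      using T[rule_format, THEN conjunct1, of h] T[rule_format, THEN conjunct2, of h] by (simp add: in_graph)
  qed
qed

section \<open>Projections decreasing to zero against a projection of finite trace\<close>

lemma decreasing_to_zero_tendsto:
  assumes d: "decreasing_to_zero \<M> d"
  shows "d n \<in> projs \<M>" "d n (d (Suc n) h) = d (Suc n) h" "(\<lambda>n. d n h) \<longlonglongrightarrow> 0"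
proof -
  have P: "d n \<in> projs \<M>" for n using d by (simp add: decreasing_to_zero_def projs_iff)
  have le: "d n (d (Suc n) h) = d (Suc n) h" for n h
    using d op_le_proj[OF projs_proj[OF P] projs_proj[OF P]] by (simp add: decreasing_to_zero_def)
  show "d n \<in> projs \<M>" "d n (d (Suc n) h) = d (Suc n) h" by (rule P, rule le)
  have R: "range d \<subseteq> projs \<M>" using P by auto
  have "op_le (meet (range d)) (d n)" for n
    unfolding op_le_proj[OF projs_proj[OF meet_projs[OF R]] projs_proj[OF P]] using meet_le[OF R] by blast
  then have "meet (range d) = (\<lambda>h. 0)" using d meet_projs[OF R] unfolding decreasing_to_zero_def projs_iff by blast
  then show "(\<lambda>n. d n h) \<longlonglongrightarrow> 0" using meet_tendsto[where p = d, OF P le, of h] by simp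
qed

text \<open>By normality the squared trace norms of \<open>(1 - d m) c\<close> increase to the trace
  of \<open>c\<close>. As this is finite, Pythagoras leaves an arbitrarily small remainder for
  \<open>d m c\<close>.\<close>

lemma sq_trace_decreasing_to_zero:
  assumes d: "decreasing_to_zero \<M> d" and c: "c \<in> projs \<M>" "\<tau> c < \<infinity>" and e: "0 < e"
  shows "\<exists>m0. \<forall>m\<ge>m0. sq_trace (\<lambda>h. d m (c h)) \<le> ennreal e"
proof -
  note dP = decreasing_to_zero_tendsto(1)[OF d] and dS = decreasing_to_zero_tendsto(2)[OF d]
  let ?A = "\<lambda>m h. perp (d m) (c h)" and ?B = "\<lambda>m h. d m (c h)"
  have A: "?A m \<in> \<M>" and B: "?B m \<in> \<M>" for m
    by (rule M_comp[OF projs_M[OF projs_perp[OF dP]] projs_M[OF c(1)]], rule M_comp[OF projs_M[OF dP] projs_M[OF c(1)]])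
  have inc: "norm (?A m h) \<le> norm (?A (Suc m) h)" for m h
  proof -
    have "?A m h = perp (d m) (?A (Suc m) h)" by (simp add: projs_lin[OF dP] dS)
    then show ?thesis using projs_norm[OF projs_perp[OF dP]] by (simp only:)
  qed
  have form: "(norm (c h))\<^sup>2 = Re (cinner (c h) h)" for h by (rule proj_norm_sq[OF projs_proj[OF c(1)]])
  have "\<tau> c = (SUP m. sq_trace (?A m))"
    unfolding sq_trace_def
  proof (rule tau_SUP[OF adj_comp_Cone[OF A] projs_Cone[OF c(1)]])
    show "Re (cinner ((badjoint (?A m) \<circ> ?A m) h) h) \<le> Re (cinner ((badjoint (?A (Suc m)) \<circ> ?A (Suc m)) h) h)" for m h
      unfolding adj_comp_form[OF A] using inc by (simp add: power_mono)
    fix h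
    have "(\<lambda>m. (norm (?A m h))\<^sup>2) \<longlonglongrightarrow> (norm (c h - 0))\<^sup>2"
      by (intro tendsto_power tendsto_norm tendsto_diff tendsto_const decreasing_to_zero_tendsto(3)[OF d])
    then show "(\<lambda>m. Re (cinner ((badjoint (?A m) \<circ> ?A m) h) h)) \<longlonglongrightarrow> Re (cinner (c h) h)"
      unfolding adj_comp_form[OF A] by (simp add: form)
  qed
  moreover obtain T where T: "\<tau> c = ennreal T" "0 \<le> T" using c(2) by (cases "\<tau> c") auto
  have sum: "sq_trace (?A m) + sq_trace (?B m) \<le> \<tau> c" for m
    unfolding sq_trace_proj[OF c(1), symmetric]
    by (intro sq_trace_add_le A B projs_M[OF c(1)]) (use proj_pythagoras[OF projs_proj[OF dP], of "c _" m] in simp)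
  have "\<exists>m0. ennreal (T - e) < sq_trace (?A m0) \<or> T \<le> e"
  proof (cases "T \<le> e")
    case False
    then have "ennreal (T - e) < (SUP m. sq_trace (?A m))" using calculation T e by (simp add: ennreal_less_iff flip: calculation)
    then show ?thesis by (simp add: less_SUP_iff)
  qed simp
  then obtain m0 where m0: "ennreal (T - e) < sq_trace (?A m0) \<or> T \<le> e" by blast
  have "sq_trace (?B m) \<le> ennreal e" if "m0 \<le> m" for m
  proof (cases "T \<le> e")
    case True
    have "sq_trace (?B m) \<le> \<tau> c" using sum[of m] by (rule order_trans[rotated]) simp
    then show ?thesis using True T ennreal_leI[OF True] by (simp add: order_trans)
  next
    case False
    have "sq_trace (?A m0) \<le> sq_trace (?A m)"
      by (intro sq_trace_mono A lift_Suc_mono_le[where f = "\<lambda>m. norm (?A m _)", OF inc that])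
    then have "ennreal (T - e) + sq_trace (?B m) \<le> sq_trace (?A m) + sq_trace (?B m)"
      using m0 False by (intro add_right_mono) auto
    also have "\<dots> \<le> ennreal (T - e) + ennreal e" using sum[of m] T False e by (simp add: ennreal_plus[symmetric] del: ennreal_plus)
    finally show ?thesis by (simp add: ennreal_add_left_cancel_le)
  qed
  then show ?thesis by blast
qed

lemma bdd_off_decreasing_to_zero:
  assumes d: "decreasing_to_zero \<M> d" and c: "c \<in> projs \<M>" "\<tau> c < \<infinity>" and s: "0 < s" and t: "0 < t"
  shows "\<exists>m0. \<forall>m\<ge>m0. bdd_off (\<lambda>h. d m (c h)) t s \<and> bdd_off (\<lambda>h. c (d m h)) t s"
proof -
  note dP = decreasing_to_zero_tendsto(1)[OF d]
  have M: "(\<lambda>h. d m (c h)) \<in> \<M>" for m by (rule M_comp[OF projs_M[OF dP] projs_M[OF c(1)]])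
  have adj: "badjoint (\<lambda>h. d m (c h)) = (\<lambda>h. c (d m h))" for m
    by (rule badjoint_unique) (simp add: proj_cinner[OF projs_proj[OF dP]] proj_cinner[OF projs_proj[OF c(1)]])
  obtain m0 where m0: "\<forall>m\<ge>m0. sq_trace (\<lambda>h. d m (c h)) \<le> ennreal (t * s\<^sup>2)"
    using sq_trace_decreasing_to_zero[OF d c, of "t * s\<^sup>2"] s t by auto
  have "bdd_off (\<lambda>h. d m (c h)) t s \<and> bdd_off (\<lambda>h. c (d m h)) t s" if "m0 \<le> m" for m
    using bdd_off_sq_trace[OF M _ s, of m t] bdd_off_adj[OF _ M, of m t s] m0 that s t by (simp add: adj)
  then show ?thesis by blast
qed

end

section \<open>Smallness in the noncommutative quasi-norm\<close>

abbreviation eventually_nat (binder "EV " 10) where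
  "eventually_nat P \<equiv> eventually P sequentially"

locale traced_function_space =
  traced_algebra \<M> \<tau> + symmetric_quasi_banach_function_space E N
  for \<M> :: "('h::complex_hilbert_space \<Rightarrow> 'h) set" and \<tau> and E and N +
  assumes oc: "order_continuous E N"
begin

definition lev :: "real \<Rightarrow> real \<Rightarrow> real" where
  "lev c b = N (\<lambda>t. c * indicator {0..<b} t)"

lemma lev_scale: "0 \<le> c \<Longrightarrow> lev (c * c') b = c * lev c' b"
  using norm_scale[OF const_in[of 0 c' b], of c] by (simp add: lev_def mult.assoc)

lemma lev_nonneg: "0 \<le> lev c b"
  unfolding lev_def by (rule norm_nonneg[OF const_in]) simp

lemma lev_small: assumes "0 < e" "0 \<le> c" shows "\<exists>d>0. \<forall>b\<le>d. lev c b < e"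
  unfolding lev_def by (rule const_small[OF oc assms])

lemma lev_small': assumes "0 < e" "0 \<le> c" shows "\<exists>s>0. lev (s * c) b \<le> e"
proof (intro exI conjI)
  have p: "0 < c * lev 1 b + 1" using assms(2) lev_nonneg[of 1 b] by (simp add: add_nonneg_pos)
  then show "0 < e / (c * lev 1 b + 1)" using assms(1) by simp
  have "lev (e / (c * lev 1 b + 1) * c) b = e * (c * lev 1 b / (c * lev 1 b + 1))"
    using lev_scale[of "e / (c * lev 1 b + 1) * c" 1 b] p assms by simp
  also have "\<dots> \<le> e * 1" using p assms(1) by (intro mult_left_mono) simp_all
  finally show "lev (e / (c * lev 1 b + 1) * c) b \<le> e" by simp
qed

text \<open>For bounded operators this takes the place of \<open>nc_norm\<close>: a dominating
  function in \<open>E\<close> passes through products and sums without any singular value being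
  recomputed.\<close>

definition small :: "('h \<Rightarrow> 'h) \<Rightarrow> real \<Rightarrow> bool" where
  "small x e \<longleftrightarrow> (\<exists>G\<in>E. (\<forall>t>0. 0 \<le> G t) \<and> N G \<le> e \<and> (\<forall>t>0. bdd_off x t (G t)))"

lemma smallI: "G \<in> E \<Longrightarrow> N G \<le> e \<Longrightarrow> (\<And>t. 0 < t \<Longrightarrow> 0 \<le> G t) \<Longrightarrow> (\<And>t. 0 < t \<Longrightarrow> bdd_off x t (G t)) \<Longrightarrow> small x e"
  unfolding small_def by blast

text \<open>A factor \<open>2 * qc\<close> comes from the dilation by two and another
  \<open>qc\<close> from adding the dilated functions.\<close>

definition K :: real where "K = 2 * qc * qc"

lemma K_ge: "1 \<le> K"
proof -
  have "1 * 1 \<le> qc * qc" using qc by (intro mult_mono) auto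
  then show ?thesis by (simp add: K_def)
qed

lemma N_dilated_sum:
  assumes "G \<in> E" "G' \<in> E"
  shows "(\<lambda>t. G (t / 2) + G' (t / 2)) \<in> E" "N (\<lambda>t. G (t / 2) + G' (t / 2)) \<le> K * (N G + N G')"
proof -
  note d = dilation[OF assms(1)] dilation[OF assms(2)]
  show "(\<lambda>t. G (t / 2) + G' (t / 2)) \<in> E" by (rule add[OF d(1,3)])
  have "N (\<lambda>t. G (t / 2) + G' (t / 2)) \<le> qc * (2 * qc * N G + 2 * qc * N G')"
    by (rule order_trans[OF qc_triangle[OF d(1,3)] mult_left_mono[OF add_mono[OF d(2,4)]]]) (use qc_pos in simp)
  then show "N (\<lambda>t. G (t / 2) + G' (t / 2)) \<le> K * (N G + N G')" by (simp add: K_def algebra_simps)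
qed

lemma small_mono: "small x e \<Longrightarrow> e \<le> e' \<Longrightarrow> small x e'"
  unfolding small_def by (meson order_trans)

lemma small_add: assumes "small x e" "small y e'" shows "small (\<lambda>h. x h + y h) (K * (e + e'))"
proof -
  obtain G where G: "G \<in> E" "N G \<le> e" "\<And>t. 0 < t \<Longrightarrow> 0 \<le> G t" "\<And>t. 0 < t \<Longrightarrow> bdd_off x t (G t)"
    using assms(1) unfolding small_def by blast
  obtain G' where G': "G' \<in> E" "N G' \<le> e'" "\<And>t. 0 < t \<Longrightarrow> 0 \<le> G' t" "\<And>t. 0 < t \<Longrightarrow> bdd_off y t (G' t)"
    using assms(2) unfolding small_def by blast
  show ?thesis
  proof (rule smallI[OF N_dilated_sum(1)[OF G(1) G'(1)]])
    show "N (\<lambda>t. G (t / 2) + G' (t / 2)) \<le> K * (e + e')"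
      using N_dilated_sum(2)[OF G(1) G'(1)] mult_left_mono[OF add_mono[OF G(2) G'(2)], of K] K_ge by linarith
    fix t :: real assume t: "0 < t"
    show "0 \<le> G (t / 2) + G' (t / 2)" using G(3) G'(3) t by simp
    show "bdd_off (\<lambda>h. x h + y h) t (G (t / 2) + G' (t / 2))"
      using bdd_off_add[OF G(4) G'(4), of "t / 2" "t / 2"] t by simp
  qed
qed

lemma small_transfer: "small x e \<Longrightarrow> (\<And>t s. 0 \<le> s \<Longrightarrow> bdd_off x t s \<Longrightarrow> bdd_off y t s) \<Longrightarrow> small y e"
  unfolding small_def by blast

lemma small_left: "small x e \<Longrightarrow> (\<And>h. norm (a h) \<le> norm h) \<Longrightarrow> small (\<lambda>h. a (x h)) e"
  using bdd_off_left[of x _ _ a 1] by (elim small_transfer) simp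

lemma small_right: "small x e \<Longrightarrow> b \<in> \<M> \<Longrightarrow> (\<And>h. norm (b h) \<le> norm h) \<Longrightarrow> small (\<lambda>h. x (b h)) e"
  using bdd_off_right[of x _ _ b 1] by (elim small_transfer) simp

text \<open>The dominating function is a step function: the operator bound \<open>c\<close> on
  \<open>[0, d)\<close>, then \<open>s\<close> as far as the rank bound \<open>T\<close>, and
  nothing beyond.\<close>

lemma small_levels:
  assumes "\<And>h. norm (z h) \<le> c * norm h" "bdd_off z d s" "bdd_off z T 0" "0 \<le> c" "0 \<le> s"
  shows "small z (qc * (lev c d + lev s T))"
proof (rule smallI[OF add[OF const_in const_in]])
  show "N (\<lambda>t. c * indicator {0..<d} t + s * indicator {0..<T} t) \<le> qc * (lev c d + lev s T)"
    unfolding lev_def by (rule qc_triangle[OF const_in const_in]) simp_all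
  fix t :: real assume t: "0 < t"
  show "0 \<le> c * indicator {0..<d} t + s * indicator {0..<T} t" using assms(4,5) by simp
  consider "t < d" | "d \<le> t" "t < T" | "d \<le> t" "T \<le> t" by linarith
  then show "bdd_off z t (c * indicator {0..<d} t + s * indicator {0..<T} t)"
  proof cases
    case 1
    then show ?thesis using bdd_off_mono[OF bdd_off_bound[OF assms(1)], of t t "c * indicator {0..<d} t + s * indicator {0..<T} t"] assms(5) t
      by simp
  next
    case 2
    then show ?thesis using bdd_off_mono[OF assms(2), of t s] t by simp
  next
    case 3
    then show ?thesis using bdd_off_mono[OF assms(3), of t 0] t by simp
  qed
qed simp_all

text \<open>The threshold depends on \<open>y\<close> only through \<open>B\<close>: it is the
  products of \<open>d m\<close> and \<open>c\<close> that become small, and \<open>y\<close> merely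
  scales the bounds. This uniformity is what later makes a single threshold serve a whole
  sequence.\<close>

lemma small_decreasing_to_zero:
  assumes d: "decreasing_to_zero \<M> d" and c: "c \<in> projs \<M>" "\<tau> c < \<infinity>" and e: "0 < e" and B: "0 \<le> B"
  shows "\<exists>m0. \<forall>m\<ge>m0. \<forall>y. (\<forall>h. norm (y h) \<le> B * norm h) \<longrightarrow>
    small (\<lambda>h. y (c (d m h))) e \<and> (y \<in> \<M> \<longrightarrow> small (\<lambda>h. d m (c (y h))) e)"
proof -
  note dP = decreasing_to_zero_tendsto(1)[OF d]
  let ?T = "enn2real (\<tau> c)"
  have T: "\<tau> c \<le> ennreal ?T" using c(2) by (simp add: less_top)
  have e': "0 < e / (2 * qc)" using e qc_pos by simp
  \<comment> \<open>On an interval this short even the trivial bound \<open>B\<close> has small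
    norm; the level \<open>s\<close> below takes care of the remaining length, which the trace of
    \<open>c\<close> limits.\<close>
  obtain t where t: "0 < t" "\<forall>b\<le>t. lev B b < e / (2 * qc)" using lev_small[OF e' B] by blast
  obtain s where s: "0 < s" "lev (s * B) ?T \<le> e / (2 * qc)" using lev_small'[OF e' B] by blast
  obtain m0 where m0: "\<forall>m\<ge>m0. bdd_off (\<lambda>h. d m (c h)) t s \<and> bdd_off (\<lambda>h. c (d m h)) t s"
    using bdd_off_decreasing_to_zero[OF d c s(1) t(1)] by blast
  have "qc * (lev B t + lev (s * B) ?T) \<le> qc * (e / (2 * qc) + e / (2 * qc))"
    using s(2) t(2) qc_pos by (intro mult_left_mono add_mono) (auto intro: less_imp_le)
  then have le: "qc * (lev B t + lev (s * B) ?T) \<le> e" using qc_pos by simp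
  have M: "(\<lambda>h. d m (c h)) \<in> \<M>" for m by (rule M_comp[OF projs_M[OF dP] projs_M[OF c(1)]])
  have adj: "badjoint (\<lambda>h. d m (c h)) = (\<lambda>h. c (d m h))" for m
    by (rule badjoint_unique) (simp add: proj_cinner[OF projs_proj[OF dP]] proj_cinner[OF projs_proj[OF c(1)]])
  have r: "bdd_off (\<lambda>h. d m (c h)) ?T 0" for m
    by (rule bdd_off_rank[OF c(1) T]) (simp add: projs_lin[OF c(1)] projs_idem[OF c(1)] projs_lin[OF dP])
  have r': "bdd_off (\<lambda>h. c (d m h)) ?T 0" for m using bdd_off_adj[OF r M, of m] by (simp add: adj)
  have nc: "norm (d m (c h)) \<le> norm h" "norm (c (d m h)) \<le> norm h" for m h
    using order_trans[OF projs_norm[OF dP] projs_norm[OF c(1)]] order_trans[OF projs_norm[OF c(1)] projs_norm[OF dP]] by blast+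
  have "small (\<lambda>h. y (c (d m h))) e \<and> (y \<in> \<M> \<longrightarrow> small (\<lambda>h. d m (c (y h))) e)"
    if m: "m0 \<le> m" and y: "\<forall>h. norm (y h) \<le> B * norm h" for m y
  proof (intro conjI impI)
    show "small (\<lambda>h. y (c (d m h))) e"
    proof (rule small_mono[OF small_levels le])
      show "norm (y (c (d m h))) \<le> B * norm h" for h
        using y[rule_format, of "c (d m h)"] mult_left_mono[OF nc(2) B, of m h] by linarith
      show "bdd_off (\<lambda>h. y (c (d m h))) t (s * B)"
        using bdd_off_left[of "\<lambda>h. c (d m h)" t s y B] m0 m y B by (simp add: mult.commute)
      show "bdd_off (\<lambda>h. y (c (d m h))) ?T 0" using bdd_off_left[OF r', of y B m] y B by simp
    qed (use B s in simp_all)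
    assume yM: "y \<in> \<M>"
    show "small (\<lambda>h. d m (c (y h))) e"
    proof (rule small_mono[OF small_levels le])
      show "norm (d m (c (y h))) \<le> B * norm h" for h
        using y[rule_format, of h] nc(1)[of m "y h"] by linarith
      show "bdd_off (\<lambda>h. d m (c (y h))) t (s * B)"
        using bdd_off_right[of "\<lambda>h. d m (c h)" t s y B] m0 m y yM s by simp
      show "bdd_off (\<lambda>h. d m (c (y h))) ?T 0" using bdd_off_right[OF r yM, of B m] y by simp
    qed (use B s in simp_all)
  qed
  then show ?thesis by blast
qed

text \<open>The index \<open>k\<close> is a cut-off that is chosen first; then \<open>Z k i m\<close> is small for large \<open>i\<close> and \<open>m\<close>.\<close>

definition vanish :: "(nat \<Rightarrow> nat \<Rightarrow> nat \<Rightarrow> 'h \<Rightarrow> 'h) \<Rightarrow> bool" where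
  "vanish Z \<longleftrightarrow> (\<forall>e>0. EV k. EV j. \<forall>i\<ge>j. \<forall>m\<ge>j. small (Z k i m) e)"

lemma vanish_mono:
  assumes "vanish Z" and le: "EV k. EV j. \<forall>i\<ge>j. \<forall>m\<ge>j. \<forall>e. small (Z k i m) e \<longrightarrow> small (Z' k i m) e"
  shows "vanish Z'"
  unfolding vanish_def
proof (intro allI impI)
  fix e :: real assume "0 < e"
  then have "EV k. EV j. \<forall>i\<ge>j. \<forall>m\<ge>j. small (Z k i m) e"
    using assms(1) by (simp add: vanish_def)
  then show "EV k. EV j. \<forall>i\<ge>j. \<forall>m\<ge>j. small (Z' k i m) e"
    using le
  proof eventually_elim
    case (elim k)
    from elim(1) elim(2) show ?case by eventually_elim blast
  qed
qed

lemma vanish_add: assumes "vanish Y" "vanish Z" shows "vanish (\<lambda>k i m h. Y k i m h + Z k i m h)"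
  unfolding vanish_def
proof (intro allI impI)
  fix e :: real assume e: "0 < e"
  then have e': "0 < e / (2 * K)" using K_ge by simp
  have "EV k. EV j. \<forall>i\<ge>j. \<forall>m\<ge>j. small (Y k i m) (e / (2 * K))"
    "EV k. EV j. \<forall>i\<ge>j. \<forall>m\<ge>j. small (Z k i m) (e / (2 * K))"
    using assms e' by (simp_all add: vanish_def)
  then show "EV k. EV j. \<forall>i\<ge>j. \<forall>m\<ge>j. small (\<lambda>h. Y k i m h + Z k i m h) e"
  proof eventually_elim
    case (elim k)
    have "K * (e / (2 * K) + e / (2 * K)) = e" using K_ge by simp
    then have "small (\<lambda>h. y h + z h) e" if "small y (e / (2 * K))" "small z (e / (2 * K))" for y z
      using small_add[OF that] by simp
    note * = this
    from elim(1) elim(2) show ?case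
    proof eventually_elim
      case (elim j)
      then show ?case by (intro allI impI * ) blast+
    qed
  qed
qed

lemma vanish_left: "vanish Z \<Longrightarrow> (\<And>k i m h. norm (a k i m h) \<le> norm h) \<Longrightarrow> vanish (\<lambda>k i m h. a k i m (Z k i m h))"
  by (erule vanish_mono) (simp add: small_left)

lemma vanish_right: "vanish Z \<Longrightarrow> (\<And>k i m. b k i m \<in> \<M>) \<Longrightarrow> (\<And>k i m h. norm (b k i m h) \<le> norm h)
    \<Longrightarrow> vanish (\<lambda>k i m h. Z k i m (b k i m h))"
  by (erule vanish_mono) (simp add: small_right)

lemma vanish_const: "vanish (\<lambda>k. Z) \<Longrightarrow> 0 < e \<Longrightarrow> \<exists>j. \<forall>i\<ge>j. \<forall>m\<ge>j. small (Z i m) e"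
  by (force simp: vanish_def eventually_sequentially)

text \<open>The data left of a measurable operator with singular value function \<open>g\<close> after truncation:
  \<open>P t\<close> is the spectral projection of the absolute value for \<open>[0, g t]\<close>.\<close>

definition tame :: "('h \<Rightarrow> 'h) \<Rightarrow> (real \<Rightarrow> real) \<Rightarrow> (real \<Rightarrow> 'h \<Rightarrow> 'h) \<Rightarrow> bool" where
  "tame x g P \<longleftrightarrow> x \<in> \<M> \<and> g \<in> E \<and> (\<forall>s t. 0 < s \<longrightarrow> s \<le> t \<longrightarrow> g t \<le> g s) \<and> (\<forall>t>0. 0 \<le> g t) \<and>
     (\<forall>t>0. P t \<in> projs \<M> \<and> \<tau> (perp (P t)) \<le> ennreal t \<and> (\<forall>h. norm (x (P t h)) \<le> g t * norm (P t h))) \<and>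
     (\<forall>s t h. 0 < s \<longrightarrow> s \<le> t \<longrightarrow> P s (P t h) = P t h)"

lemma tame_M: "tame x g P \<Longrightarrow> x \<in> \<M>"
  and tame_E: "tame x g P \<Longrightarrow> g \<in> E"
  and tame_antimono: "tame x g P \<Longrightarrow> 0 < s \<Longrightarrow> s \<le> t \<Longrightarrow> g t \<le> g s"
  and tame_nonneg: "tame x g P \<Longrightarrow> 0 < t \<Longrightarrow> 0 \<le> g t"
  and tame_projs: "tame x g P \<Longrightarrow> 0 < t \<Longrightarrow> P t \<in> projs \<M>"
  and tame_tau: "tame x g P \<Longrightarrow> 0 < t \<Longrightarrow> \<tau> (perp (P t)) \<le> ennreal t"
  and tame_norm: "tame x g P \<Longrightarrow> 0 < t \<Longrightarrow> norm (x (P t h)) \<le> g t * norm (P t h)"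
  and tame_P: "tame x g P \<Longrightarrow> 0 < s \<Longrightarrow> s \<le> t \<Longrightarrow> P s (P t h) = P t h"
  by (simp_all add: tame_def)

lemma tame_norm': assumes x: "tame x g P" "0 < t" shows "norm (x (P t h)) \<le> g t * norm h"
  using tame_norm[OF x, of h] mult_left_mono[OF projs_norm[OF tame_projs[OF x], of h] tame_nonneg[OF x]] by linarith

lemma tame_le: assumes "tame x g P" "0 < a" "a \<le> t" "P t h = h" shows "P a h = h"
  using tame_P[OF assms(1-3), of h] assms(4) by simp

lemma tame_bdd_off: assumes x: "tame x g P" "0 < t" shows "bdd_off x t (g t)"
  by (rule bdd_offI[OF tame_projs[OF x] tame_tau[OF x]]) (metis tame_norm[OF x])

text \<open>The doubled argument is dictated by \<open>block_bound\<close>: bounding the operator by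
  \<open>g (2 * a)\<close> near zero is affordable because \<open>g\<close> is at least as large on
  \<open>[a, 2 a)\<close>, inside the window.\<close>

lemma tame_mid: assumes x: "tame x g P" and a: "0 < a" "2 * a \<le> b"
  shows "small (\<lambda>h. x (P (2 * a) h - P b h)) (3 * qc * qc * N (restr {a..<b} g))"
proof -
  have a2: "0 < 2 * a" and b: "0 < b" using a by simp_all
  note g = tame_E[OF x] tame_antimono[OF x] tame_nonneg[OF x]
  show ?thesis
  proof (rule smallI[where G = "\<lambda>t. indicator {0..<b} t * min (g (2 * a)) (g t)"])
    show "(\<lambda>t. indicator {0..<b} t * min (g (2 * a)) (g t)) \<in> E"
      "N (\<lambda>t. indicator {0..<b} t * min (g (2 * a)) (g t)) \<le> 3 * qc * qc * N (restr {a..<b} g)"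
      by (rule block_bound[OF g a], assumption+)+
    fix t :: real assume t: "0 < t"
    show "0 \<le> indicator {0..<b} t * min (g (2 * a)) (g t)" using g(3)[OF t] g(3)[OF a2] by simp
    have eq: "P (2 * a) h - P b h = P (2 * a) (h - P b h)" for h
      by (simp add: projs_lin[OF tame_projs[OF x a2]] tame_P[OF x a2 a(2)])
    have nb: "norm (h - P b h) \<le> norm h" for h by (rule projs_norm[OF projs_perp[OF tame_projs[OF x b]]])
    have 1: "norm (x (P (2 * a) h - P b h)) \<le> g (2 * a) * norm h" for h
      unfolding eq using tame_norm'[OF x a2] mult_left_mono[OF nb g(3)[OF a2], of h] by (rule order_trans)
    show "bdd_off (\<lambda>h. x (P (2 * a) h - P b h)) t (indicator {0..<b} t * min (g (2 * a)) (g t))"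
    proof (rule bdd_offI[OF tame_projs[OF x t] tame_tau[OF x t]])
      fix h assume h: "P t h = h"
      show "norm (x (P (2 * a) h - P b h)) \<le> indicator {0..<b} t * min (g (2 * a)) (g t) * norm h"
      proof (cases "b \<le> t")
        case True
        have "P (2 * a) h = h" "P b h = h"
          by (rule tame_le[OF x a2 order_trans[OF a(2) True] h], rule tame_le[OF x b True h])
        then show ?thesis using True bounded_clinear_zero[OF M_clinear[OF tame_M[OF x]]] by simp
      next
        case tb: False
        show ?thesis
        proof (cases "t \<le> 2 * a")
          case True
          then show ?thesis using 1[of h] g(2)[OF t True] tb t by simp
        next
          case False
          have "P (2 * a) h = h" using tame_le[OF x a2 _ h] False by simp
          moreover have "P t (h - P b h) = h - P b h" using tb by (simp add: projs_lin[OF tame_projs[OF x t]] h tame_P[OF x t])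
          ultimately have "norm (x (P (2 * a) h - P b h)) \<le> g t * norm (h - P b h)"
            using tame_norm[OF x t, of "h - P b h"] by simp
          also have "\<dots> \<le> g t * norm h" using nb g(3)[OF t] by (rule mult_left_mono)
          finally show ?thesis using False tb t g(2)[OF a2, of t] by simp
        qed
      qed
    qed
  qed
qed

lemma tame_low: assumes x: "tame x g P" and b: "0 < b"
  shows "small (\<lambda>h. x (P b h)) (N (\<lambda>t. min (g b) (g t)))"
proof (rule smallI[where G = "\<lambda>t. min (g b) (g t)"])
  show "(\<lambda>t. min (g b) (g t)) \<in> E" by (rule min_in(1)[OF tame_E[OF x] tame_nonneg[OF x] tame_nonneg[OF x b]])
  fix t :: real assume t: "0 < t"
  show "0 \<le> min (g b) (g t)" using tame_nonneg[OF x] b t by simp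
  show "bdd_off (\<lambda>h. x (P b h)) t (min (g b) (g t))"
  proof (rule bdd_offI[OF tame_projs[OF x t] tame_tau[OF x t]])
    fix h assume h: "P t h = h"
    show "norm (x (P b h)) \<le> min (g b) (g t) * norm h"
    proof (cases "t \<le> b")
      case True
      then show ?thesis using tame_norm'[OF x b, of h] tame_antimono[OF x t True] by simp
    next
      case False
      then have "P b h = h" using tame_le[OF x b _ h] by simp
      then show ?thesis using tame_norm'[OF x t, of h] h tame_antimono[OF x b, of t] False by simp
    qed
  qed
qed simp

end

section \<open>Tame sequences\<close>

text \<open>Along a diagonal subsequence every \<open>a j k\<close> converges to some
  \<open>L j k\<close>, which decreases in \<open>k\<close> to a limit \<open>l\<close>. Thinning
  out so that errors at position \<open>i\<close> are below \<open>1 / (i + 1)\<close> keeps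
  \<open>a j i\<close> at position \<open>i\<close> above \<open>l\<close> up to that error,
  although the cut-off moves with \<open>i\<close>. The loss is then at most
  \<open>L j k - l\<close> plus errors.\<close>

lemma diagonal_antimono_array:
  fixes a :: "nat \<Rightarrow> nat \<Rightarrow> nat \<Rightarrow> real"
  assumes dec: "\<And>j k n. a j (Suc k) n \<le> a j k n" and nn: "\<And>j k n. 0 \<le> a j k n" and bd: "\<And>j k n. a j k n \<le> b j"
  shows "\<exists>r. strict_mono r \<and> (\<forall>j. \<forall>e>0. EV k. EV i. a j k (r i) - a j i (r i) \<le> e)"
proof -
  define P where "P m s \<longleftrightarrow> convergent (\<lambda>i. case_prod a (prod_decode m) (s i))" for m s
  interpret subseqs P
  proof
    fix m and s :: "nat \<Rightarrow> nat" assume "strict_mono s"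
    obtain j k where jk: "prod_decode m = (j, k)" by (cases "prod_decode m")
    have "\<bar>a j k (s i)\<bar> \<le> b j" for i using nn[of j k "s i"] bd[of j k "s i"] by simp
    then have "bounded (range (\<lambda>i. a j k (s i)))" by (intro boundedI[of _ "b j"]) auto
    from bounded_imp_convergent_subsequence[OF this]
    obtain l r where "strict_mono r" "((\<lambda>i. a j k (s i)) \<circ> r) \<longlonglongrightarrow> l" by blast
    then show "\<exists>r. strict_mono r \<and> P m (s \<circ> r)"
      by (intro exI[of _ r]) (auto simp: P_def jk convergent_def o_def)
  qed
  have stable: "P n (s \<circ> r)" if "strict_mono r" "P n s" for r s n
    using convergent_subseq_convergent[OF that(2)[unfolded P_def] that(1)] by (simp add: P_def o_def)
  have "convergent (\<lambda>i. a j k (diagseq i))" for j k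
  proof -
    have "P (prod_encode (j, k)) (diagseq \<circ> ((+) (Suc (prod_encode (j, k)))))" by (rule diagseq_holds[OF stable])
    then have "convergent (\<lambda>i. a j k (diagseq (i + Suc (prod_encode (j, k)))))" by (simp add: P_def o_def add.commute)
    then show ?thesis by (rule convergent_ignore_initial_segment[THEN iffD1])
  qed
  then have "\<forall>j k. \<exists>l. (\<lambda>i. a j k (diagseq i)) \<longlonglongrightarrow> l" by (simp add: convergent_def)
  then obtain L where L: "\<And>j k. (\<lambda>i. a j k (diagseq i)) \<longlonglongrightarrow> L j k" by metis
  have "EV i. \<forall>j\<le>m. \<forall>k\<le>m. \<bar>a j k (diagseq i) - L j k\<bar> < 1 / real (Suc m)" for m
  proof -
    have "EV i. \<bar>a j k (diagseq i) - L j k\<bar> < 1 / real (Suc m)" for j k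
      using tendstoD[OF L, of "1 / real (Suc m)" j k] by (simp add: dist_real_def)
    then have "EV i. \<forall>j\<in>{..m}. \<forall>k\<in>{..m}. \<bar>a j k (diagseq i) - L j k\<bar> < 1 / real (Suc m)"
      by (intro eventually_ball_finite ballI) simp_all
    then show ?thesis by (rule eventually_mono) simp
  qed
  then have "\<forall>m. \<exists>f. \<forall>i\<ge>f. \<forall>j\<le>m. \<forall>k\<le>m. \<bar>a j k (diagseq i) - L j k\<bar> < 1 / real (Suc m)"
    unfolding eventually_sequentially by blast
  then obtain f where f: "\<And>m i j k. f m \<le> i \<Longrightarrow> j \<le> m \<Longrightarrow> k \<le> m \<Longrightarrow> \<bar>a j k (diagseq i) - L j k\<bar> < 1 / real (Suc m)"
    by metis
  \<comment> \<open>Partial sums make the index strictly increasing while keeping it above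
    \<open>f m\<close>.\<close>
  define s where "s m = (\<Sum>j\<le>m. f j + 1)" for m
  have s: "strict_mono s" unfolding strict_mono_Suc_iff by (simp add: s_def)
  have sf: "f m \<le> s m" for m using member_le_sum[of m "{..m}" "\<lambda>j. f j + 1"] by (simp add: s_def)
  have close: "\<bar>a j k (diagseq (s i)) - L j k\<bar> < 1 / real (Suc i)" if "j \<le> i" "k \<le> i" for i j k
    using f[OF sf that] .
  have Ldec: "L j (Suc k) \<le> L j k" for j k by (rule LIMSEQ_le[OF L L]) (use dec in auto)
  have Lnn: "0 \<le> L j k" for j k by (rule LIMSEQ_le_const[OF L]) (use nn in auto)
  have "EV k. EV i. a j k (diagseq (s i)) - a j i (diagseq (s i)) \<le> e" if e: "0 < e" for j e
  proof -
    have dj: "decseq (L j)" using Ldec by (rule decseq_SucI)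
    have bj: "bdd_below (range (L j))" using Lnn by (intro bdd_belowI[of _ 0]) auto
    obtain l where l: "L j \<longlonglongrightarrow> l" "\<And>i. l \<le> L j i"
      using decseq_convergent[OF dj, of 0] Lnn by metis
    have "EV k. L j k < l + e / 2" using order_tendstoD(2)[OF l(1), of "l + e / 2"] e by simp
    then show ?thesis
    proof eventually_elim
      case (elim k)
      obtain i0 where i0: "2 / real (Suc i0) < e / 2"
        using reals_Archimedean[of "e / 4"] e by (auto simp: field_simps)
      have "a j k (diagseq (s i)) - a j i (diagseq (s i)) \<le> e" if i: "max i0 (max j k) \<le> i" for i
      proof -
        have "1 / real (Suc i) \<le> 1 / real (Suc i0)" using i by (simp add: frac_le)
        then show ?thesis using close[of j i k] close[of j i i] l(2)[of i] elim i0 i by (simp add: abs_less_iff)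
      qed
      then show ?case unfolding eventually_sequentially by blast
    qed
  qed
  moreover have "strict_mono (diagseq \<circ> s)" using subseq_diagseq s by (rule strict_mono_o)
  ultimately show ?thesis by (intro exI[of _ "diagseq \<circ> s"]) (simp add: o_def)
qed

locale lower_estimate_space = traced_function_space \<M> \<tau> E N
  for \<M> :: "('h::complex_hilbert_space \<Rightarrow> 'h) set" and \<tau> and E and N +
  fixes q :: real
  assumes q: "0 < q" and lo: "lower_estimate_const_1 q E N"
begin

lemma power_half_small: assumes "0 < d" shows "EV k. (1/2::real) ^ k < d"
  using LIMSEQ_power_zero[of "1/2 :: real"] assms by (intro order_tendstoD(2)) simp_all

text \<open>The level \<open>g n\<close> tends to zero by the lower estimate, and truncating one
  fixed function at a small level is small by order continuity.\<close>

lemma tail_vanishes: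
  assumes x: "tame x g P" and e: "0 < e" shows "\<exists>n0. \<forall>n\<ge>n0. N (\<lambda>t. min (g (real n)) (g t)) < e"
proof -
  obtain d where d: "0 < d" "\<forall>c. 0 \<le> c \<and> c \<le> d \<longrightarrow> N (\<lambda>t. min c (g t)) < e"
    using min_small[OF oc e tame_E[OF x] tame_nonneg[OF x]] by blast
  obtain n0 where n0: "\<forall>n\<ge>n0. \<forall>f\<in>E. (\<forall>s t. 0 < s \<longrightarrow> s \<le> t \<longrightarrow> f t \<le> f s) \<longrightarrow> (\<forall>t>0. 0 \<le> f t) \<longrightarrow> N f \<le> N g \<longrightarrow> f (real n) \<le> d"
    using level_small[OF lo q d(1)] by blast
  have "N (\<lambda>t. min (g (real n)) (g t)) < e" if "n0 + 1 \<le> n" for n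
    using n0[rule_format, of n g] that tame_E[OF x] tame_antimono[OF x] tame_nonneg[OF x, of "real n"] tame_nonneg[OF x] d(2) by simp
  then show ?thesis by blast
qed

text \<open>Split at a large \<open>b\<close>: on the range of \<open>P b\<close> the operator is
  small by \<open>tail_vanishes\<close>, and the complement of \<open>P b\<close> has finite trace,
  where \<open>small_decreasing_to_zero\<close> applies.\<close>

lemma tame_decreasing_to_zero:
  assumes x: "tame x g P" and d: "decreasing_to_zero \<M> d" and e: "0 < e"
  shows "\<exists>m0. \<forall>m\<ge>m0. small (\<lambda>h. x (d m h)) e"
proof -
  note dP = decreasing_to_zero_tendsto(1)[OF d]
  have e2: "0 < e / (2 * K)" "K * (e / (2 * K) + e / (2 * K)) = e" using e K_ge by simp_all
  obtain n0 where n0: "\<forall>n\<ge>n0. N (\<lambda>t. min (g (real n)) (g t)) < e / (2 * K)" using tail_vanishes[OF x e2(1)] by blast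
  define b where "b = real (Suc n0)"
  have b: "0 < b" "N (\<lambda>t. min (g b) (g t)) \<le> e / (2 * K)" using n0[rule_format, of "Suc n0"] by (simp_all add: b_def)
  note c = projs_perp[OF tame_projs[OF x b(1)]]
  have fin: "\<tau> (perp (P b)) < \<infinity>" using le_less_trans[OF tame_tau[OF x b(1)] ennreal_less_top] by simp
  obtain B where B: "0 < B" "\<And>h. norm (x h) \<le> B * norm h" using bounded_clinear_bound[OF M_clinear[OF tame_M[OF x]]] by blast
  from small_decreasing_to_zero[OF d c fin e2(1) less_imp_le[OF B(1)]]
  obtain m0 where m0: "\<forall>m\<ge>m0. small (\<lambda>h. x (perp (P b) (d m h))) (e / (2 * K))" using B(2) by blast
  have "small (\<lambda>h. x (d m h)) e" if "m0 \<le> m" for m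
  proof -
    have "small (\<lambda>h. x (P b (d m h))) (e / (2 * K))"
      by (rule small_right[OF small_mono[OF tame_low[OF x b(1)] b(2)] projs_M[OF dP] projs_norm[OF dP]])
    from small_add[OF this m0[rule_format, OF that]] show ?thesis
      by (simp only: e2(2) bounded_clinear_add[OF M_clinear[OF tame_M[OF x]], symmetric] add_diff_cancel_left' diff_add_cancel add_diff_eq)
  qed
  then show ?thesis by blast
qed

end

text \<open>The head is small up to twice \<open>\<delta> n\<close> because later error projections
  have trace up to \<open>\<rho> i + \<delta> (n i)\<close>, where the selection keeps
  \<open>\<rho> i\<close> at most \<open>\<delta> (n i)\<close>.\<close>

locale tame_sequence = lower_estimate_space \<M> \<tau> E N q
  for \<M> :: "('h::complex_hilbert_space \<Rightarrow> 'h) set" and \<tau> and E and N and q +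
  fixes x :: "nat \<Rightarrow> 'h \<Rightarrow> 'h" and g :: "nat \<Rightarrow> real \<Rightarrow> real" and P :: "nat \<Rightarrow> real \<Rightarrow> 'h \<Rightarrow> 'h" and \<delta> :: "nat \<Rightarrow> real" and B :: real
  assumes T: "tame (x n) (g n) (P n)" and bd: "N (g n) \<le> B"
    and delta: "0 < \<delta> n" "N (restr {0..<2 * \<delta> n} (g n)) \<le> 1 / real (Suc n)"
begin

lemma B_nonneg: "0 \<le> B" using norm_nonneg[OF tame_E[OF T]] bd by (rule order_trans)

lemma uniform_decay: assumes "0 < e" shows "\<exists>k0. \<forall>k\<ge>k0. \<forall>n. g n (real k) \<le> e"
proof -
  obtain n0 where n0: "\<forall>n\<ge>n0. \<forall>f\<in>E. (\<forall>s t. 0 < s \<longrightarrow> s \<le> t \<longrightarrow> f t \<le> f s) \<longrightarrow> (\<forall>t>0. 0 \<le> f t) \<longrightarrow> N f \<le> B \<longrightarrow> f (real n) \<le> e"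
    using level_small[OF lo q assms] by blast
  then show ?thesis using tame_E[OF T] tame_antimono[OF T] tame_nonneg[OF T] bd by blast
qed

definition lvl :: "nat \<Rightarrow> real" where "lvl k = B / N (\<lambda>t. 1 * indicator {0..<(1/2) ^ k} t)"

lemma g_lvl: "g n ((1/2) ^ k) \<le> lvl k"
proof -
  have p: "0 < (1/2::real) ^ k" by simp
  have "g n ((1/2) ^ k) * N (\<lambda>t. 1 * indicator {0..<(1/2) ^ k} t) \<le> N (g n)"
    by (rule level_bound[OF tame_E[OF T] tame_antimono[OF T] tame_nonneg[OF T] p])
  then show ?thesis using bd[of n] const_1_pos[OF p] by (simp add: lvl_def field_simps)
qed

lemma lvl_nonneg: "0 \<le> lvl k"
  using tame_nonneg[OF T, of "(1/2) ^ k"] g_lvl[of _ k] by (meson order_trans zero_less_power half_gt_zero zero_less_one)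

text \<open>Between the levels \<open>g n ((1/2) ^ k)\<close> and \<open>g n (2 * 2 ^ k)\<close> the operators are bounded
  and supported on projections of finite trace, uniformly in \<open>n\<close>.\<close>

definition mid :: "nat \<Rightarrow> nat \<Rightarrow> 'h \<Rightarrow> 'h" where
  "mid k n h = x n (P n ((1/2) ^ k) h - P n (2 * 2 ^ k) h)"

lemma dyadic: "0 < (1/2::real) ^ k" "(1/2::real) ^ k \<le> 2 * 2 ^ k" "0 < (2 * 2 ^ k :: real)"
proof -
  have "(1/2::real) ^ k \<le> 1" by (rule power_le_one) simp_all
  also have "(1::real) \<le> 2 * 2 ^ k" using one_le_power[of "2::real" k] by linarith
  finally show "(1/2::real) ^ k \<le> 2 * 2 ^ k" .
qed simp_all

lemma mid: "mid k n \<in> \<M>" "norm (mid k n h) \<le> lvl k * norm (perp (P n (2 * 2 ^ k)) h)"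
  "norm (mid k n h) \<le> lvl k * norm h" "bdd_off (mid k n) (2 * 2 ^ k) 0"
proof -
  note p = tame_projs[OF T dyadic(1)] tame_projs[OF T dyadic(3)]
  show "mid k n \<in> \<M>" unfolding mid_def
    by (rule M_comp[OF tame_M[OF T] M_diff[OF projs_M[OF p(1)] projs_M[OF p(2)]]])
  have eq: "P n ((1/2) ^ k) h - P n (2 * 2 ^ k) h = P n ((1/2) ^ k) (perp (P n (2 * 2 ^ k)) h)" for h
    by (simp add: projs_lin[OF p(1)] tame_P[OF T dyadic(1,2)])
  show 1: "norm (mid k n h) \<le> lvl k * norm (perp (P n (2 * 2 ^ k)) h)" for h
    unfolding mid_def eq
    using tame_norm'[OF T dyadic(1)] mult_right_mono[OF g_lvl norm_ge_zero] by (rule order_trans)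
  show "norm (mid k n h) \<le> lvl k * norm h"
    using 1[of h] mult_left_mono[OF projs_norm[OF projs_perp[OF p(2)]] lvl_nonneg] by (rule order_trans)
  show "bdd_off (mid k n) (2 * 2 ^ k) 0"
  proof (rule bdd_offI[OF p(2) tame_tau[OF T dyadic(3)]])
    fix h assume "P n (2 * 2 ^ k) h = h"
    then show "norm (mid k n h) \<le> 0 * norm h" using 1[of h] by simp
  qed
qed

lemma mid_sq_trace: "sq_trace (mid k n) \<le> ennreal ((lvl k)\<^sup>2 * (2 * 2 ^ k))"
proof -
  have pM: "perp (P n (2 * 2 ^ k)) \<in> projs \<M>" by (rule projs_perp[OF tame_projs[OF T dyadic(3)]])
  have "sq_trace (mid k n) \<le> sq_trace (\<lambda>h. lvl k *\<^sub>R perp (P n (2 * 2 ^ k)) h)"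
    by (rule sq_trace_mono[OF mid(1) M_scaleR[OF projs_M[OF pM]]]) (use mid(2) lvl_nonneg in simp)
  also have "\<dots> = ennreal ((lvl k)\<^sup>2) * \<tau> (perp (P n (2 * 2 ^ k)))"
    using sq_trace_scale[OF projs_M[OF pM] lvl_nonneg] sq_trace_proj[OF pM] by simp
  also have "\<dots> \<le> ennreal ((lvl k)\<^sup>2) * ennreal (2 * 2 ^ k)" by (rule mult_left_mono[OF tame_tau[OF T dyadic(3)]]) simp
  finally show ?thesis by (simp add: ennreal_mult)
qed

text \<open>Complements of the left and right supports of \<open>x n (1 - P n t)\<close>.\<close>

definition v :: "nat \<Rightarrow> real \<Rightarrow> 'h \<Rightarrow> 'h" where
  "v n t = meet {P n t, kproj (badjoint (\<lambda>h. x n (perp (P n t) h)))}"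

lemma v: assumes t: "0 < t"
  shows "v n t \<in> projs \<M>" "P n t (v n t h) = v n t h" "v n t (x n h) = v n t (x n (P n t h))"
    "\<tau> (perp (v n t)) \<le> ennreal (2 * t)"
proof -
  let ?y = "\<lambda>h. x n (perp (P n t) h)"
  note p = tame_projs[OF T t]
  have y: "?y \<in> \<M>" by (rule M_comp[OF tame_M[OF T] projs_M[OF projs_perp[OF p]]])
  let ?k = "kproj (badjoint ?y)"
  note k = kproj_projs[OF M_adj[OF y]]
  have S: "{P n t, ?k} \<subseteq> projs \<M>" using p k by simp
  show vP: "v n t \<in> projs \<M>" unfolding v_def by (rule meet_projs[OF S])
  show "P n t (v n t h) = v n t h" unfolding v_def by (rule meet_le[OF S]) simp
  have "?k (?y h) = 0" for h
  proof (rule cinner_ext)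
    fix z
    have "cinner (?k (?y h)) z = cinner (?y h) (?k z)" by (rule proj_cinner[OF projs_proj[OF k]])
    also have "\<dots> = cinner h (badjoint ?y (?k z))" by (rule cinner_badjoint[OF M_clinear[OF y]])
    finally show "cinner (?k (?y h)) z = cinner 0 z" by (simp add: kproj_zero[OF M_adj[OF y]])
  qed
  moreover have "v n t (?k w) = v n t w" for w unfolding v_def by (rule meet_le'[OF S]) simp
  ultimately have "v n t (?y h) = 0" by (metis projs_lin(3)[OF vP])
  then show "v n t (x n h) = v n t (x n (P n t h))"
    by (simp add: bounded_clinear_simps[OF M_clinear[OF tame_M[OF T]]] projs_lin[OF vP])
  have "\<tau> (perp ?k) \<le> \<tau> (perp (P n t))"
    by (rule tau_range_le[OF y projs_perp[OF p]]) (simp add: projs_lin[OF p] projs_idem[OF p])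
  then have "\<tau> (perp (v n t)) \<le> \<tau> (perp (P n t)) + \<tau> (perp (P n t))"
    using cotrace_meet2[OF p k] unfolding v_def by (meson add_left_mono order_trans)
  also have "\<dots> \<le> ennreal t + ennreal t" using tame_tau[OF T t] by (intro add_mono)
  finally show "\<tau> (perp (v n t)) \<le> ennreal (2 * t)" using t by (simp add: ennreal_plus[symmetric] del: ennreal_plus)
qed

text \<open>The projections \<open>b k\<close> decrease, and every \<open>v n (real (Suc j))\<close> is eventually above them; so
  \<open>x n (b k)\<close> and \<open>b k (x n)\<close> become small as \<open>k\<close> grows, while the complements have finite trace.\<close>

definition b :: "nat \<Rightarrow> 'h \<Rightarrow> 'h" where
  "b k = meet ((\<lambda>m. v (fst (prod_decode m)) (real (Suc (snd (prod_decode m))))) ` {..k})"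

lemma b_sub: "(\<lambda>m. v (fst (prod_decode m)) (real (Suc (snd (prod_decode m))))) ` {..k} \<subseteq> projs \<M>"
  using v(1) by auto

lemma b_projs: "b k \<in> projs \<M>" unfolding b_def by (rule meet_projs[OF b_sub])

lemma b_le: assumes "prod_encode (n, j) \<le> k"
  shows "v n (real (Suc j)) (b k h) = b k h" "b k (v n (real (Suc j)) h) = b k h"
proof -
  have "v n (real (Suc j)) \<in> (\<lambda>m. v (fst (prod_decode m)) (real (Suc (snd (prod_decode m))))) ` {..k}"
    using assms by (intro image_eqI[of _ _ "prod_encode (n, j)"]) simp_all
  then show "v n (real (Suc j)) (b k h) = b k h" "b k (v n (real (Suc j)) h) = b k h"
    unfolding b_def by (rule meet_le[OF b_sub], rule meet_le'[OF b_sub])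
qed

lemma b_antimono: assumes "k \<le> k'" shows "b k (b k' h) = b k' h"
proof -
  have "b k' (b k' h) = b k' h" by (rule projs_idem[OF b_projs])
  then show ?thesis using assms unfolding b_def meet_fix[OF b_sub] by auto
qed

lemma b_antimono': "k \<le> k' \<Longrightarrow> b k' (b k h) = b k' h"
  by (rule projs_le_commute[OF b_projs b_projs b_antimono])

lemma b_cotrace: "\<tau> (perp (b k)) < \<infinity>"
proof -
  \<comment> \<open>Padding with the identity turns the finite meet into a countable one, so that
    \<open>cotrace_meet\<close> applies; the padding adds no cotrace.\<close>
  define p where "p m = (if m \<le> k then v (fst (prod_decode m)) (real (Suc (snd (prod_decode m)))) else (\<lambda>h. h))" for m
  have p: "p m \<in> projs \<M>" for m using v(1) projs_id by (simp add: p_def)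
  have R: "range p \<subseteq> projs \<M>" by (rule image_subsetI) (rule p)
  have "b k h = h \<longleftrightarrow> (\<forall>m\<le>k. p m h = h)" for h unfolding b_def meet_fix[OF b_sub] by (auto simp: p_def)
  then have "b k = meet (range p)"
    by (intro projs_eq_if_fix b_projs meet_projs[OF R]) (simp add: meet_fix[OF R], simp add: p_def)
  then have "\<tau> (perp (b k)) \<le> (\<Sum>m. \<tau> (perp (p m)))" using cotrace_meet[of p, OF p] by simp
  also have "\<dots> = (\<Sum>m\<le>k. \<tau> (perp (p m)))" by (rule suminf_finite) (simp_all add: p_def tau_0)
  also have "\<dots> < \<infinity>" using le_less_trans[OF v(4) ennreal_less_top] by (simp add: p_def)
  finally show ?thesis .
qed

definition c :: "nat \<Rightarrow> 'h \<Rightarrow> 'h" where "c k = perp (b k)"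

lemma c: "c k \<in> projs \<M>" "\<tau> (c k) < \<infinity>" "\<tau> (c k) = ennreal (enn2real (\<tau> (c k)))"
  "k \<le> k' \<Longrightarrow> c k' (c k h) = c k h" "k \<le> k' \<Longrightarrow> c k (c k' h) = c k h"
  unfolding c_def using b_cotrace[of k]
  by (simp_all add: projs_perp b_projs projs_lin[OF b_projs] b_antimono b_antimono' less_top)

end

section \<open>The subsequence and the projections\<close>

context traced_function_space
begin

lemma vanishI: assumes "\<And>e. 0 < e \<Longrightarrow> EV k. EV i. small (Z k i) e"
  shows "vanish (\<lambda>k i m. Z k i)"
  unfolding vanish_def
proof (intro allI impI)
  fix e :: real assume "0 < e"
  from assms[OF this] show "EV k. EV j. \<forall>i\<ge>j. \<forall>m\<ge>j. small (Z k i) e"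
  proof eventually_elim
    case (elim k)
    from eventually_all_ge_at_top[OF this] show ?case by eventually_elim simp
  qed
qed

lemma small_finite_rank:
  assumes "\<And>h. norm (z h) \<le> s * norm h" "bdd_off z t 0" "0 \<le> s" shows "small z (qc * lev s t)"
proof -
  have "lev 0 t = 0" using lev_scale[of 0 0 t] by simp
  then show ?thesis using small_levels[OF assms(1,2,2,3)] by simp
qed

text \<open>Both products vanish off a projection of cotrace at most \<open>t\<close>, so only the
  part of \<open>g\<close> before \<open>t\<close> is needed to dominate them.\<close>

lemma tame_rank:
  assumes x: "tame x g P" and p: "p \<in> projs \<M>" "\<tau> p \<le> ennreal t"
  shows "small (\<lambda>h. p (x h)) (N (restr {0..<t} g))" "small (\<lambda>h. x (p h)) (N (restr {0..<t} g))"
proof -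
  have M: "(\<lambda>h. p (x h)) \<in> \<M>" by (rule M_comp[OF projs_M[OF p(1)] tame_M[OF x]])
  have 0: "bdd_off (\<lambda>h. p (x h)) t 0" by (rule bdd_off_rank_left[OF p M]) (simp add: projs_idem[OF p(1)])
  have 2: "bdd_off (\<lambda>h. x (p h)) t 0"
    by (rule bdd_off_rank[OF p])
      (simp add: projs_lin[OF p(1)] projs_idem[OF p(1)] bounded_clinear_zero[OF M_clinear[OF tame_M[OF x]]])
  have 1: "bdd_off (\<lambda>h. p (x h)) u (g u)" "bdd_off (\<lambda>h. x (p h)) u (g u)" if "0 < u" for u
    using bdd_off_left[OF tame_bdd_off[OF x that], of p 1] bdd_off_right[OF tame_bdd_off[OF x that] projs_M[OF p(1)], of 1]
      projs_norm[OF p(1)] tame_nonneg[OF x that] by simp_all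
  have "bdd_off y u (indicator {0..<t} u * g u)" if "bdd_off y t 0" "bdd_off y u (g u)" "0 < u" for y u
    using bdd_off_mono[OF that(1), of u 0] that(2,3) by (cases "u < t") simp_all
  note ind = this
  show "small (\<lambda>h. p (x h)) (N (restr {0..<t} g))" "small (\<lambda>h. x (p h)) (N (restr {0..<t} g))"
    by (rule smallI[OF restr_in(1)[OF tame_E[OF x]] order_refl]; simp add: ind 0 1 2 tame_nonneg[OF x])+
qed

end

context tame_sequence
begin

text \<open>The \<open>b k\<close> decrease, so the squared trace norm of the part between
  \<open>b k\<close> and \<open>b k'\<close> is paid for by the decrease of the squared norm. All
  quantities are bounded by \<open>s\<close>, which makes the passage to real numbers
  faithful.\<close>

lemma sq_trace_b:
  assumes y: "y \<in> \<M>" "sq_trace y \<le> ennreal s" "0 \<le> s" and k: "k \<le> k'"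
  shows "enn2real (sq_trace (\<lambda>h. b k (y h))) \<le> s"
    "enn2real (sq_trace (\<lambda>h. b k' (y h))) \<le> enn2real (sq_trace (\<lambda>h. b k (y h)))"
    "sq_trace (\<lambda>h. b k (y h) - b k' (y h)) \<le> ennreal (enn2real (sq_trace (\<lambda>h. b k (y h))) - enn2real (sq_trace (\<lambda>h. b k' (y h))))"
proof -
  have M: "(\<lambda>h. b k (y h)) \<in> \<M>" "(\<lambda>h. b k' (y h)) \<in> \<M>"
    by (rule M_comp[OF projs_M[OF b_projs] y(1)])+
  have "sq_trace (\<lambda>h. b k (y h)) \<le> sq_trace y"
    by (rule sq_trace_mono[OF M(1) y(1)]) (rule projs_norm[OF b_projs])
  then have le: "sq_trace (\<lambda>h. b k (y h)) \<le> ennreal s" using y(2) by (rule order_trans)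
  then show "enn2real (sq_trace (\<lambda>h. b k (y h))) \<le> s" using y(3) by (intro enn2real_leI)
  have "(norm (b k (y h) - b k' (y h)))\<^sup>2 + (norm (b k' (y h)))\<^sup>2 \<le> (norm (b k (y h)))\<^sup>2" for h
    using proj_pythagoras[OF projs_proj[OF b_projs], of "b k (y h)" k'] by (simp add: b_antimono'[OF k])
  then have sum: "sq_trace (\<lambda>h. b k (y h) - b k' (y h)) + sq_trace (\<lambda>h. b k' (y h)) \<le> sq_trace (\<lambda>h. b k (y h))"
    by (intro sq_trace_add_le M M_diff)
  have fin: "sq_trace (\<lambda>h. b k (y h)) < \<infinity>" using le by (rule le_less_trans) simp
  have fin': "sq_trace (\<lambda>h. b k' (y h)) < \<infinity>" "sq_trace (\<lambda>h. b k (y h) - b k' (y h)) < \<infinity>"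
    by (rule le_less_trans[OF order_trans[OF _ sum] fin], simp)+
  obtain p where p: "sq_trace (\<lambda>h. b k (y h)) = ennreal p" "0 \<le> p" using fin by (cases "sq_trace (\<lambda>h. b k (y h))") auto
  obtain r where r: "sq_trace (\<lambda>h. b k' (y h)) = ennreal r" "0 \<le> r" using fin' by (cases "sq_trace (\<lambda>h. b k' (y h))") auto
  obtain u where u: "sq_trace (\<lambda>h. b k (y h) - b k' (y h)) = ennreal u" "0 \<le> u"
    using fin' by (cases "sq_trace (\<lambda>h. b k (y h) - b k' (y h))") auto
  have "u + r \<le> p" using sum p r u by (simp add: ennreal_plus[symmetric] del: ennreal_plus)
  then show "enn2real (sq_trace (\<lambda>h. b k' (y h))) \<le> enn2real (sq_trace (\<lambda>h. b k (y h)))"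
    "sq_trace (\<lambda>h. b k (y h) - b k' (y h)) \<le> ennreal (enn2real (sq_trace (\<lambda>h. b k (y h))) - enn2real (sq_trace (\<lambda>h. b k' (y h))))"
    using p r u by (auto intro: ennreal_leI)
qed

definition out :: "nat \<Rightarrow> real set" where "out k = {0..<(1/2) ^ k} \<union> {2 ^ k..}"

lemma restr_g: "I \<in> sets borel \<Longrightarrow> restr I (g n) \<in> E" "I \<in> sets borel \<Longrightarrow> N (restr I (g n)) \<le> B"
  using restr_in[OF tame_E[OF T]] bd order_trans by blast+

abbreviation win :: "nat \<Rightarrow> nat \<Rightarrow> real set" where
  "win k k' \<equiv> {(1/2) ^ k'..<(1/2) ^ k} \<union> {2 ^ k..<2 ^ k'}"

text \<open>The window and \<open>out k'\<close> are disjoint with union \<open>out k\<close>, so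
  the two-term lower estimate applies.\<close>

lemma N_out:
  assumes k: "k \<le> k'"
  shows "N (restr (win k k') (g n)) powr q + N (restr (out k') (g n)) powr q
    \<le> N (restr (out k) (g n)) powr q"
proof -
  let ?W = "win k k'"
  have o: "(1/2::real) ^ k' \<le> (1/2) ^ k" "(1/2::real) ^ k \<le> 1" "(1::real) \<le> 2 ^ k" "(2::real) ^ k \<le> 2 ^ k'" "(0::real) < (1/2) ^ k'"
    using k by (simp_all add: power_decreasing power_le_one)
  have "indicator ({a'..<a} \<union> {d..<d'}) t + indicator ({0..<a'} \<union> {d'..}) t = (indicator ({0..<a} \<union> {d..}) t :: real)"
    "indicator ({a'..<a} \<union> {d..<d'}) t = (0::real) \<or> indicator ({0..<a'} \<union> {d'..}) t = (0::real)"
    if "0 < a'" "a' \<le> a" "a \<le> d" "d \<le> d'" for a a' d d' t :: real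
    using that by (auto simp: indicator_def)
  note ind = this[OF o(5,1) order_trans[OF o(2,3)] o(4)]
  have "N (restr ?W (g n)) powr q + N (restr (out k') (g n)) powr q \<le> N (\<lambda>t. restr ?W (g n) t + restr (out k') (g n) t) powr q"
    by (rule lower2[OF lo q restr_g(1) restr_g(1)]) (use ind(2) in \<open>auto simp: out_def\<close>)
  also have "(\<lambda>t. restr ?W (g n) t + restr (out k') (g n) t) = restr (out k) (g n)"
    unfolding out_def by (simp add: ind(1) flip: distrib_right)
  finally show ?thesis .
qed

text \<open>The bounded quantity, decreasing in \<open>k\<close>, for the diagonal argument: the
  \<open>q\<close>-th power is superadditive by the lower estimate and the squared trace norms by
  Pythagoras. The term with the adjoint controls projections multiplied from the right.\<close>

definition arr :: "nat \<Rightarrow> nat \<Rightarrow> nat \<Rightarrow> real" where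
  "arr j k n = N (restr (out k) (g n)) powr q + enn2real (sq_trace (\<lambda>h. b k (mid j n h)))
    + enn2real (sq_trace (\<lambda>h. b k (badjoint (mid j n) h)))"

lemma mid_adj_sq_trace: "sq_trace (badjoint (mid j n)) \<le> ennreal ((lvl j)\<^sup>2 * (2 * 2 ^ j))"
  using mid_sq_trace by (simp add: sq_trace_adj[OF mid(1)])

lemma arr_diff:
  assumes k: "k \<le> k'"
  shows "N (restr (win k k') (g n)) powr q \<le> arr j k n - arr j k' n"
    "sq_trace (\<lambda>h. b k (mid j n h) - b k' (mid j n h)) \<le> ennreal (arr j k n - arr j k' n)"
    "sq_trace (\<lambda>h. b k (badjoint (mid j n) h) - b k' (badjoint (mid j n) h)) \<le> ennreal (arr j k n - arr j k' n)"
    "0 \<le> arr j k n" "arr j k n \<le> B powr q + 2 * ((lvl j)\<^sup>2 * (2 * 2 ^ j))" "arr j k' n \<le> arr j k n"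
proof -
  have nn: "0 \<le> (lvl j)\<^sup>2 * (2 * 2 ^ j)" by simp
  note 1 = sq_trace_b[OF mid(1) mid_sq_trace nn k, of n] and 2 = sq_trace_b[OF M_adj[OF mid(1)] mid_adj_sq_trace nn k, of n]
  note 3 = N_out[OF k, of n]
  have p: "0 \<le> N (restr (win k k') (g n)) powr q" by simp
  show "N (restr (win k k') (g n)) powr q \<le> arr j k n - arr j k' n"
    "arr j k' n \<le> arr j k n"
    unfolding arr_def using 1(2) 2(2) 3 p by linarith+
  show "sq_trace (\<lambda>h. b k (mid j n h) - b k' (mid j n h)) \<le> ennreal (arr j k n - arr j k' n)"
    by (rule order_trans[OF 1(3) ennreal_leI]) (unfold arr_def, use 2(2) 3 p in linarith)
  show "sq_trace (\<lambda>h. b k (badjoint (mid j n) h) - b k' (badjoint (mid j n) h)) \<le> ennreal (arr j k n - arr j k' n)"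
    by (rule order_trans[OF 2(3) ennreal_leI]) (unfold arr_def, use 1(2) 3 p in linarith)
  show "0 \<le> arr j k n" by (simp add: arr_def)
  have "N (restr (out k) (g n)) powr q \<le> B powr q"
    using q by (intro powr_mono2 norm_nonneg restr_g) (auto simp: out_def)
  then show "arr j k n \<le> B powr q + 2 * ((lvl j)\<^sup>2 * (2 * 2 ^ j))"
    unfolding arr_def using 1(1) 2(1) by linarith
qed

lemma extend:
  assumes e: "0 < e" and d: "0 < d" and L: "0 \<le> L"
  shows "\<exists>k\<ge>k0. g (r k) (2 ^ k) * L \<le> e \<and> (1/2::real) ^ k \<le> d"
proof -
  have "0 < e / (L + 1)" using e L by simp
  then obtain k1 where k1: "\<forall>k\<ge>k1. \<forall>n. g n (real k) \<le> e / (L + 1)" using uniform_decay by blast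
  obtain k2 where k2: "\<forall>k\<ge>k2. (1/2::real) ^ k < d" using power_half_small[OF d] unfolding eventually_sequentially by blast
  let ?k = "max k0 (max k1 k2)"
  \<comment> \<open>\<open>uniform_decay\<close> is stated for integer arguments; the power of two
    is one of them and lies beyond \<open>k1\<close>.\<close>
  have "?k < 2 ^ ?k" by simp
  then have "k1 \<le> 2 ^ ?k" by linarith
  with k1 have "g (r ?k) (real (2 ^ ?k)) \<le> e / (L + 1)" by blast
  then have "g (r ?k) (2 ^ ?k) * L \<le> e / (L + 1) * L" using L by (intro mult_right_mono) simp_all
  also have "\<dots> \<le> e" using e L by (simp add: field_simps)
  finally have 1: "g (r ?k) (2 ^ ?k) * L \<le> e" .
  moreover have "(1/2) ^ ?k \<le> d" by (rule less_imp_le[OF k2[rule_format]]) simp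
  ultimately show ?thesis using 1 by (intro exI[of _ ?k]) simp
qed

end

text \<open>\<open>kp'\<close> indexes the projections \<open>c\<close> and \<open>kp\<close> the
  truncation levels. They differ because \<open>low\<close> asks the level at
  \<open>2 ^ kp i\<close> to beat the already fixed trace of \<open>c (kp' i)\<close>.
  \<open>tail\<close> puts \<open>b (kp' (Suc i))\<close> below one of the projections
  \<open>v\<close> of the current operator, where little is left of it, and \<open>rho\<close> makes
  the cotraces of all later supports summable.\<close>

locale selected_sequence = tame_sequence \<M> \<tau> E N q x g P \<delta> B
  for \<M> :: "('h::complex_hilbert_space \<Rightarrow> 'h) set" and \<tau> and E and N and q and x g P \<delta> B +
  fixes n kp kp' :: "nat \<Rightarrow> nat" and \<rho> :: "nat \<Rightarrow> real"
  assumes mono: "strict_mono kp" "strict_mono kp'" and le: "kp' i \<le> kp i"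
    and diag: "0 < e \<Longrightarrow> EV k. EV i. arr j k (n i) - arr j (kp i) (n i) \<le> e"
    and low: "g (n i) (2 ^ kp i) * lev 1 (enn2real (\<tau> (c (kp' i)))) \<le> 1 / real (Suc i)"
    and tail: "\<exists>j. prod_encode (n i, j) \<le> kp' (Suc i) \<and> N (\<lambda>t. min (g (n i) (real (Suc j))) (g (n i) t)) \<le> 1 / real (Suc i)"
    and rho: "0 < \<rho> i" "\<rho> (Suc i) \<le> \<rho> i / 2" "16 * (1/2) ^ kp (Suc i) \<le> \<rho> i" "N (restr {0..<\<rho> i + \<delta> (n i)} (g (n i))) \<le> 1 / real (Suc i)"

lemma (in tame_sequence) selection_exists:
  "\<exists>n kp kp' \<rho>. strict_mono n \<and> selected_sequence \<M> \<tau> E N q x g P \<delta> B n kp kp' \<rho>"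
proof -
  have "\<exists>r. strict_mono r \<and> (\<forall>j. \<forall>e>0. EV k. EV i. arr j k (r i) - arr j i (r i) \<le> e)"
    by (rule diagonal_antimono_array[where a = arr, OF arr_diff(6) arr_diff(4) arr_diff(5)]) auto
  then obtain r where r: "strict_mono r"
    "\<And>j e. 0 < e \<Longrightarrow> EV k. EV i. arr j k (r i) - arr j i (r i) \<le> e" by blast
  \<comment> \<open>A state \<open>(a, k, s)\<close> holds the values of \<open>kp'\<close>,
    \<open>kp\<close> and \<open>\<rho>\<close>. The operator chosen is \<open>r k\<close>, so that
    its index is tied to its cut-off, as the diagonal estimate requires.\<close>
  let ?P = "\<lambda>m (a, k, s). a \<le> k \<and> g (r k) (2 ^ k) * lev 1 (enn2real (\<tau> (c a))) \<le> 1 / real (Suc m) \<and> 0 < s \<and> s \<le> \<delta> (r k)"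
  let ?Q = "\<lambda>m (a, k, s) (a', k', s'). a < a' \<and> (\<exists>j. prod_encode (r k, j) \<le> a' \<and> N (\<lambda>t. min (g (r k) (real (Suc j))) (g (r k) t)) \<le> 1 / real (Suc m))
    \<and> k < k' \<and> 16 * (1/2) ^ k' \<le> s \<and> s' \<le> s / 2"
  have "\<exists>f. \<forall>m. ?P m (f m) \<and> ?Q m (f m) (f (Suc m))"
  proof (rule dependent_nat_choice)
    obtain k where "g (r k) (2 ^ k) * lev 1 (enn2real (\<tau> (c 0))) \<le> 1 / real (Suc 0)"
      using extend[of 1 1 "lev 1 (enn2real (\<tau> (c 0)))" 0 r] lev_nonneg by auto
    then show "\<exists>z. ?P 0 z" by (intro exI[of _ "(0, k, \<delta> (r k))"]) (simp add: delta)
  next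
    fix z m assume z: "?P m z"
    obtain a k s where aks: "z = (a, k, s)" by (cases z)
    have s: "0 < s" using z by (simp add: aks)
    have e: "0 < 1 / real (Suc m)" "0 < 1 / real (Suc (Suc m))" by simp_all
    obtain j0 where j0: "\<forall>j\<ge>j0. N (\<lambda>t. min (g (r k) (real j)) (g (r k) t)) < 1 / real (Suc m)" using tail_vanishes[OF T e(1)] by blast
    have j: "N (\<lambda>t. min (g (r k) (real (Suc j0))) (g (r k) t)) \<le> 1 / real (Suc m)" using j0[rule_format, of "Suc j0"] by simp
    define a' where "a' = max (Suc a) (prod_encode (r k, j0))"
    have "0 < s / 16" using s by simp
    from extend[OF e(2) this lev_nonneg, of "max a' (Suc k)" r 1 "enn2real (\<tau> (c a'))"]
    obtain k' where k: "max a' (Suc k) \<le> k'" "g (r k') (2 ^ k') * lev 1 (enn2real (\<tau> (c a'))) \<le> 1 / real (Suc (Suc m))"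
      "(1/2) ^ k' \<le> s / 16" by blast
    define s' where "s' = min (s / 2) (\<delta> (r k'))"
    have "?P (Suc m) (a', k', s')" using k s delta(1) by (simp add: s'_def)
    moreover have "?Q m z (a', k', s')"
      unfolding aks prod.case using k j s by (intro conjI exI[of _ j0]) (auto simp: a'_def s'_def)
    ultimately show "\<exists>z'. ?P (Suc m) z' \<and> ?Q m z z'" by (intro exI[of _ "(a', k', s')"] conjI)
  qed
  then obtain f where f0: "\<forall>m. ?P m (f m) \<and> ?Q m (f m) (f (Suc m))" by (rule exE)
  note f = f0[rule_format, THEN conjunct1] f0[rule_format, THEN conjunct2]
  define kp' where "kp' m = fst (f m)" for m
  define kp where "kp m = fst (snd (f m))" for m
  define \<rho> where "\<rho> m = snd (snd (f m))" for m
  have fm: "f m = (kp' m, kp m, \<rho> m)" for m by (simp add: kp'_def kp_def \<rho>_def)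
  note f1 = f(1)[unfolded fm prod.case] and f2 = f(2)[unfolded fm prod.case]
  have mono: "strict_mono kp" "strict_mono kp'" using f2 by (simp_all add: strict_mono_Suc_iff)
  have rk: "strict_mono (\<lambda>i. r (kp i))" using strict_mono_o[OF r(1) mono(1)] by (simp add: o_def)
  have head: "N (restr {0..<\<rho> i + \<delta> (r (kp i))} (g (r (kp i)))) \<le> 1 / real (Suc i)" for i
  proof -
    have "\<rho> i \<le> \<delta> (r (kp i))" using f1 by blast
    then have "N (restr {0..<\<rho> i + \<delta> (r (kp i))} (g (r (kp i)))) \<le> N (restr {0..<2 * \<delta> (r (kp i))} (g (r (kp i))))"
      by (intro mono_pos(2) restr_g measurable[OF restr_g(1)]) (auto simp: indicator_def)
    also have "\<dots> \<le> 1 / real (Suc (r (kp i)))" by (rule delta(2))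
    also have "\<dots> \<le> 1 / real (Suc i)" using strict_mono_imp_increasing[OF rk, of i] by (intro divide_left_mono) simp_all
    finally show ?thesis .
  qed
  have "selected_sequence \<M> \<tau> E N q x g P \<delta> B (\<lambda>i. r (kp i)) kp kp' \<rho>"
  proof (unfold_locales, rule mono(1), rule mono(2))
    fix e :: real and j assume "0 < e"
    from r(2)[OF this, of j]
    show "EV k. EV i. arr j k (r (kp i)) - arr j (kp i) (r (kp i)) \<le> e"
    proof eventually_elim
      case (elim k)
      \<comment> \<open>The diagonal estimate couples the operator \<open>r i\<close> with the
        cut-off \<open>i\<close>; passing to \<open>kp i\<close> replaces both at once.\<close>
      show ?case by (rule eventually_compose_filterlim[OF elim filterlim_subseq[OF mono(1)]])
    qed
  qed (use f1 f2 head in blast)+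
  with rk show ?thesis by blast
qed

section \<open>The equi-integrable part\<close>

context selected_sequence
begin

abbreviation "X i \<equiv> x (n i)"
abbreviation "Q i \<equiv> P (n i)"

text \<open>The projections \<open>c (kp' i)\<close> increase, and \<open>f i\<close> is the part of \<open>c (kp' i)\<close> on which both \<open>X i\<close> and
  its adjoint are truncated at level \<open>g (n i) (2 * (1/2) ^ kp i)\<close>. The interval between \<open>f i\<close> and the next \<open>c\<close>
  carries the concentrating part of \<open>X i\<close>; cutting it down by \<open>w i\<close> makes \<open>e i \<le> f l\<close> for \<open>l > i\<close>, hence
  the \<open>e i\<close> orthogonal.\<close>

definition "vi i = v (n i) (2 * (1/2) ^ kp i)"
definition "f i = meet {c (kp' i), vi i}"
definition "w' i = meet (range (\<lambda>m. vi (Suc i + m)))"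
definition "w i = meet {w' i, Q i (\<delta> (n i))}"
definition "d i = (\<lambda>h. c (kp' (Suc i)) h - f i h)"
definition "e i = meet {d i, w i}"
definition "th i = (\<lambda>h. d i h - e i h)"

text \<open>Together with \<open>mid\<close> these are the four slices of \<open>X i\<close> below
  its top level. \<open>mid\<close> lies between two levels fixed by \<open>k\<close>;
  \<open>hi\<close> and \<open>lo\<close> reach from there to levels moving with \<open>i\<close>,
  and \<open>far\<close> lies below all of them.\<close>

definition "hi k i h = X i (Q i (2 * (1/2) ^ kp i) h - Q i ((1/2) ^ k) h)"
definition "lo k i h = X i (Q i (2 * 2 ^ k) h - Q i (2 ^ kp i) h)"
definition "far i h = X i (Q i (2 ^ kp i) h)"

lemma kp_ge: "i \<le> kp i" "i \<le> kp' i" using mono by (simp_all add: strict_mono_imp_increasing)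

lemma s1: "0 < 2 * (1/2::real) ^ kp i" by simp

lemma vi: "vi i \<in> projs \<M>" "Q i (2 * (1/2) ^ kp i) (vi i h) = vi i h" "vi i (X i h) = vi i (X i (Q i (2 * (1/2) ^ kp i) h))"
  "\<tau> (perp (vi i)) \<le> ennreal (4 * (1/2) ^ kp i)"
  using v[OF s1, of "n i"] unfolding vi_def by simp_all

lemma f_sub: "{c (kp' i), vi i} \<subseteq> projs \<M>" using c(1) vi(1) by simp

lemma f: "f i \<in> projs \<M>" "c (kp' i) (f i h) = f i h" "vi i (f i h) = f i h" "f i (vi i h) = f i h"
  "(\<lambda>h. c (kp' i) h - f i h) \<in> projs \<M>" "\<tau> (\<lambda>h. c (kp' i) h - f i h) \<le> ennreal (4 * (1/2) ^ kp i)"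
  "\<tau> (f i) \<le> ennreal (enn2real (\<tau> (c (kp' i))))"
proof -
  show F: "f i \<in> projs \<M>" unfolding f_def by (rule meet_projs[OF f_sub])
  show cf: "c (kp' i) (f i h) = f i h" and "vi i (f i h) = f i h" for h
    unfolding f_def by (rule meet_le[OF f_sub], simp)+
  show "f i (vi i h) = f i h" unfolding f_def by (rule meet_le'[OF f_sub]) simp
  note m = tau_minus_meet[OF c(1) vi(1), of "kp' i" i, folded f_def]
  show "(\<lambda>h. c (kp' i) h - f i h) \<in> projs \<M>" "\<tau> (\<lambda>h. c (kp' i) h - f i h) \<le> ennreal (4 * (1/2) ^ kp i)"
    using m vi(4)[of i] by (blast intro: order_trans)+
  show "\<tau> (f i) \<le> ennreal (enn2real (\<tau> (c (kp' i))))"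
    unfolding c(3)[symmetric] by (rule tau_mono_proj[OF F c(1) cf])
qed

lemma w_sub: "range (\<lambda>m. vi (Suc i + m)) \<subseteq> projs \<M>" using vi(1) by auto

lemma rho_decay: "\<rho> (i + m) \<le> \<rho> i * (1/2) ^ m"
proof (induction m)
  case (Suc m)
  then show ?case using rho(2)[of "i + m"] by simp
qed simp

text \<open>The constant 16 in \<open>rho\<close> makes the cotrace of the factor
  \<open>vi (Suc (i + m))\<close> at most a quarter of \<open>\<rho> (i + m)\<close>. As
  \<open>\<rho>\<close> at least halves at each step, a geometric series bounds the total.\<close>

lemma w': "w' i \<in> projs \<M>" "i < l \<Longrightarrow> vi l (w' i h) = w' i h" "\<tau> (perp (w' i)) \<le> ennreal (\<rho> i)"
proof -
  show "w' i \<in> projs \<M>" unfolding w'_def by (rule meet_projs[OF w_sub])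
  show "vi l (w' i h) = w' i h" if "i < l"
    unfolding w'_def by (rule meet_le[OF w_sub]) (use that in \<open>auto intro: image_eqI[of _ _ "l - Suc i"]\<close>)
  have "\<tau> (perp (w' i)) \<le> (\<Sum>m. \<tau> (perp (vi (Suc i + m))))" unfolding w'_def by (rule cotrace_meet) (rule vi(1))
  also have "\<dots> \<le> (\<Sum>m. ennreal (\<rho> i * (1/2) ^ Suc m))"
  proof (rule suminf_le)
    fix m
    have "0 \<le> (1/2::real) ^ kp (Suc (i + m))" by simp
    then have "8 * (1/2) ^ kp (Suc (i + m)) \<le> \<rho> i * (1/2) ^ m"
      using rho(3)[of "i + m"] rho_decay[of i m] by linarith
    then have "4 * (1/2) ^ kp (Suc i + m) \<le> \<rho> i * (1/2) ^ m * (1/2)" by simp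
    then show "\<tau> (perp (vi (Suc i + m))) \<le> ennreal (\<rho> i * (1/2) ^ Suc m)"
      by (intro order_trans[OF vi(4)] ennreal_leI) (simp add: mult_ac)
  qed auto
  also have "\<dots> = ennreal (\<Sum>m. \<rho> i * (1/2) ^ Suc m)"
    using sums_mult[OF power_half_series, of "\<rho> i"] rho(1)[of i]
    by (intro suminf_ennreal2) (auto intro: sums_summable)
  also have "(\<Sum>m. \<rho> i * (1/2) ^ Suc m) = \<rho> i"
    using sums_mult[OF power_half_series, of "\<rho> i"] by (simp add: sums_iff)
  finally show "\<tau> (perp (w' i)) \<le> ennreal (\<rho> i)" .
qed

lemma w: "w i \<in> projs \<M>" "w' i (w i h) = w i h" "Q i (\<delta> (n i)) (w i h) = w i h" "\<tau> (perp (w i)) \<le> ennreal (\<rho> i + \<delta> (n i))"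
proof -
  note dP = tame_projs[OF T delta(1), of "n i" "n i"] and dt = tame_tau[OF T delta(1), of "n i" "n i"]
  have S: "{w' i, Q i (\<delta> (n i))} \<subseteq> projs \<M>" using w'(1) dP by simp
  show "w i \<in> projs \<M>" unfolding w_def by (rule meet_projs[OF S])
  show "w' i (w i h) = w i h" "Q i (\<delta> (n i)) (w i h) = w i h" unfolding w_def by (rule meet_le[OF S], simp)+
  have "\<tau> (perp (w i)) \<le> \<tau> (perp (w' i)) + \<tau> (perp (Q i (\<delta> (n i))))" unfolding w_def by (rule cotrace_meet2[OF w'(1) dP])
  also have "\<dots> \<le> ennreal (\<rho> i) + ennreal (\<delta> (n i))" by (rule add_mono[OF w'(3) dt])
  finally show "\<tau> (perp (w i)) \<le> ennreal (\<rho> i + \<delta> (n i))"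
    using rho(1)[of i] delta(1)[of "n i"] by (simp add: ennreal_plus)
qed

lemma d: "d i \<in> projs \<M>" "c (kp' (Suc i)) (d i h) = d i h" "d i (f i h) = 0"
proof -
  have le: "kp' i \<le> kp' (Suc i)" using mono(2) by (simp add: strict_mono_leD)
  have cf: "c (kp' (Suc i)) (f i h) = f i h" for h using c(4)[OF le, of "f i h"] by (simp add: f(2))
  show "d i \<in> projs \<M>" unfolding d_def by (rule projs_sub[OF f(1) c(1) cf])
  show "c (kp' (Suc i)) (d i h) = d i h" by (simp add: d_def projs_lin[OF c(1)] projs_idem[OF c(1)] cf)
  show "d i (f i h) = 0" by (simp add: d_def cf projs_idem[OF f(1)])
qed

lemma e_sub: "{d i, w i} \<subseteq> projs \<M>" using d(1) w(1) by simp

lemma e: "e i \<in> projs \<M>" "d i (e i h) = e i h" "e i (d i h) = e i h" "w i (e i h) = e i h"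
  unfolding e_def by (rule meet_projs[OF e_sub], rule meet_le[OF e_sub], simp, rule meet_le'[OF e_sub], simp, rule meet_le[OF e_sub], simp)

lemma th: "th i \<in> projs \<M>" "\<tau> (th i) \<le> ennreal (\<rho> i + \<delta> (n i))"
  using tau_minus_meet[OF d(1) w(1), of i i, folded e_def] w(4)[of i] unfolding th_def by (blast intro: order_trans)+

text \<open>The complement of \<open>f i\<close> splits into the next \<open>b\<close>, a discarded
  projection of small trace, and \<open>e i\<close>. Products of \<open>X i\<close> with the first
  two are small, so only the corner at \<open>e i\<close> can persist.\<close>

lemma perp_f: "perp (f i) h = b (kp' (Suc i)) h + th i h + e i h"
  by (simp add: th_def d_def c_def)

lemma e_below: "Q i (\<delta> (n i)) (e i h) = e i h"
  using w(3)[of i "e i h"] by (simp add: e(4))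

lemma e_tau: "\<tau> (e i) < \<infinity>"
proof -
  have "c (kp' (Suc i)) (e i h) = e i h" for h using d(2)[of i "e i h"] by (simp add: e(2))
  from tau_mono_proj[OF e(1) c(1) this] show ?thesis using c(2) by (rule le_less_trans)
qed

text \<open>For \<open>i < l\<close> the projection \<open>e i\<close> is below
  \<open>c (kp' l)\<close> by monotonicity and below \<open>vi l\<close> through
  \<open>w' i\<close>, hence below their meet \<open>f l\<close>. But \<open>e l\<close> is below
  \<open>d l\<close>, which annihilates \<open>f l\<close>.\<close>

lemma e_orth: assumes "i \<noteq> l" shows "e i (e l h) = 0"
proof -
  have *: "e l (e i h) = 0" if "i < l" for i l h
  proof -
    have "kp' (Suc i) \<le> kp' l" using mono(2) that by (simp add: strict_mono_leD)
    from c(4)[OF this, of "e i h"] have "c (kp' l) (e i h) = e i h" using d(2)[of i "e i h"] by (simp add: e(2))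
    moreover have "w' i (e i h) = e i h" using w(2)[of i "e i h"] by (simp only: e(4))
    then have "vi l (e i h) = e i h" using w'(2)[OF that, of "e i h"] by (simp only:)
    ultimately have "f l (e i h) = e i h" unfolding f_def meet_fix[OF f_sub] by simp
    then have "e l (e i h) = e l (d l (f l (e i h)))" by (simp add: e(3))
    then show ?thesis by (simp add: d(3) projs_lin[OF e(1)])
  qed
  show ?thesis
  proof (cases "i < l")
    case True
    show ?thesis
    proof (rule cinner_ext)
      fix z
      have "cinner (e i (e l h)) z = cinner h (e l (e i z))"
        by (simp add: proj_cinner[OF projs_proj[OF e(1)]])
      then show "cinner (e i (e l h)) z = cinner 0 z" by (simp add: *[OF True])
    qed
  next
    case False
    then show ?thesis using * assms by simp
  qed
qed

lemma win_small:
  assumes s: "0 < s"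
  shows "EV k. EV i.
    N (restr {(1/2) ^ kp i..<(1/2) ^ k} (g (n i))) \<le> s \<and> N (restr {2 ^ k..<2 ^ kp i} (g (n i))) \<le> s \<and> Suc k \<le> kp i"
proof -
  have "0 < s powr q" using s by simp
  \<comment> \<open>The window term of \<open>arr\<close> does not depend on \<open>j\<close>, so
    any value serves.\<close>
  from diag[OF this, of 0] show ?thesis
  proof eventually_elim
    case (elim k)
    from elim eventually_ge_at_top[of "Suc k"] show ?case
    proof eventually_elim
      case (elim i)
      then have k: "Suc k \<le> kp i" "k \<le> kp i" using kp_ge(1)[of i] by simp_all
      let ?W = "win k (kp i)"
      have "N (restr ?W (g (n i))) powr q \<le> s powr q" using arr_diff(1)[OF k(2), of "n i" 0] elim by simp
      then have W: "N (restr ?W (g (n i))) \<le> s" using powr_less_mono2[OF q, of s] s by (metis less_imp_le not_le)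
      have "N (restr I (g (n i))) \<le> N (restr ?W (g (n i)))" if "I \<subseteq> ?W" "I \<in> sets borel" for I
        using that by (intro mono_pos(2) restr_g measurable[OF restr_g(1)]) (auto simp: indicator_def)
      then show ?case using W k(1) by (meson Un_upper1 Un_upper2 atLeastLessThan_borel order_trans)
    qed
  qed
qed

lemma win_vanish: "vanish (\<lambda>k i m. hi k i)" (is ?A) "vanish (\<lambda>k i m. lo k i)" (is ?B)
proof -
  have q3: "0 < 3 * qc * qc" using qc_pos by simp
  have *: "EV k. EV i.
      small (hi k i) s \<and> small (lo k i) s" if s: "0 < s" for s
  proof -
    have "0 < s / (3 * qc * qc)" using s q3 by simp
    from win_small[OF this] show ?thesis
    proof eventually_elim
      case (elim k)
      then show ?case
      proof eventually_elim
        case (elim i)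
        \<comment> \<open>\<open>Suc k <= kp i\<close> is exactly what the doubled left endpoints of
          both windows require.\<close>
        have le: "2 * (1/2) ^ kp i \<le> (1/2::real) ^ k" "2 * 2 ^ k \<le> (2::real) ^ kp i"
          using elim power_decreasing[of "Suc k" "kp i" "1/2::real"] power_increasing[of "Suc k" "kp i" "2::real"] by simp_all
        have "3 * qc * qc * t \<le> s" if "t \<le> s / (3 * qc * qc)" for t
          using that q3 by (simp add: pos_le_divide_eq mult.commute)
        then show ?case
          unfolding hi_def[abs_def] lo_def[abs_def]
          using small_mono[OF tame_mid[OF T _ le(1)]] small_mono[OF tame_mid[OF T _ le(2)]] elim by simp
      qed
    qed
  qed
  show ?A by (rule vanishI) (use * in \<open>fastforce elim: eventually_mono\<close>)
  show ?B by (rule vanishI) (use * in \<open>fastforce elim: eventually_mono\<close>)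
qed

text \<open>\<open>f i\<close> has trace at most that of \<open>c (kp' i)\<close>, and
  \<open>far i\<close> has norm at most the level at \<open>2 ^ kp i\<close>; the selection in
  \<open>low\<close> makes that level small relative to this trace.\<close>

lemma low_vanish: "vanish (\<lambda>k i m h. f i (far i h))" (is ?A)
  "vanish (\<lambda>k i m h. far i (f i h))" (is ?B)
proof -
  have sm: "small (\<lambda>h. f i (far i h)) (qc * (1 / real (Suc i))) \<and>
      small (\<lambda>h. far i (f i h)) (qc * (1 / real (Suc i)))" for i
  proof -
    let ?s = "g (n i) (2 ^ kp i)" and ?t = "enn2real (\<tau> (c (kp' i)))"
    have p: "0 < (2::real) ^ kp i" by simp
    note s = tame_nonneg[OF T p, of "n i"] and x = tame_norm'[OF T p, of "n i", folded far_def]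
    have le: "qc * lev ?s ?t \<le> qc * (1 / real (Suc i))"
      using low[of i] lev_scale[OF s, of 1 ?t] qc_pos by (intro mult_left_mono) simp_all
    have XM: "far i \<in> \<M>" unfolding far_def[abs_def] by (rule M_comp[OF tame_M[OF T] projs_M[OF tame_projs[OF T p]]])
    have "small (\<lambda>h. f i (far i h)) (qc * lev ?s ?t)"
    proof (rule small_finite_rank[OF _ _ s])
      show "norm (f i (far i h)) \<le> ?s * norm h" for h using projs_norm[OF f(1)] x by (rule order_trans)
      show "bdd_off (\<lambda>h. f i (far i h)) ?t 0"
        by (rule bdd_off_rank_left[OF f(1,7) M_comp[OF projs_M[OF f(1)] XM]]) (rule projs_idem[OF f(1)])
    qed
    moreover have "small (\<lambda>h. far i (f i h)) (qc * lev ?s ?t)"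
    proof (rule small_finite_rank[OF _ _ s])
      show "norm (far i (f i h)) \<le> ?s * norm h" for h
        using x mult_left_mono[OF projs_norm[OF f(1)] s] by (rule order_trans)
      show "bdd_off (\<lambda>h. far i (f i h)) ?t 0"
        by (rule bdd_off_rank[OF f(1,7)])
          (simp add: far_def projs_lin[OF f(1)] projs_idem[OF f(1)] projs_lin[OF tame_projs[OF T p]] bounded_clinear_zero[OF M_clinear[OF tame_M[OF T]]])
    qed
    ultimately show ?thesis using small_mono le by blast
  qed
  have ev: "EV i. qc * (1 / real (Suc i)) \<le> s" if "0 < s" for s
  proof -
    have "(\<lambda>i. qc * (1 / real (Suc i))) \<longlonglongrightarrow> qc * 0" by (intro tendsto_mult tendsto_const LIMSEQ_Suc[OF lim_1_over_n])
    from order_tendstoD(2)[OF this, of s] that show ?thesis by (auto elim: eventually_mono)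
  qed
  show ?A by (rule vanishI, rule always_eventually, rule allI) (use ev sm small_mono in \<open>fast elim: eventually_mono\<close>)
  show ?B by (rule vanishI, rule always_eventually, rule allI) (use ev sm small_mono in \<open>fast elim: eventually_mono\<close>)
qed

text \<open>A loss of at most \<open>t\<close> times the square of \<open>s\<close> in
  \<open>arr\<close> bounds squared trace norms on both sides, and Chebyshev's inequality brings the
  singular values below \<open>s\<close> from \<open>t\<close> on. With the common bound
  \<open>lvl j\<close> and the common rank bound, \<open>small_levels\<close> applies;
  \<open>k\<close> depends on \<open>j\<close> only.\<close>

lemma mid_cut:
  "\<exists>k. EV i. small (\<lambda>h. c (kp' i) (mid j (n i) h) - c k (mid j (n i) h)) (1 / real (Suc j)) \<and>
     small (\<lambda>h. mid j (n i) (c (kp' i) h - c k h)) (1 / real (Suc j))"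
proof -
  let ?a = "1 / real (Suc j) / (2 * qc)"
  have a: "0 < ?a" using qc_pos by simp
  obtain t where t: "0 < t" "\<forall>b\<le>t. lev (lvl j) b < ?a" using lev_small[OF a lvl_nonneg] by blast
  obtain s where s: "0 < s" "lev (s * 1) (2 * 2 ^ j) \<le> ?a" using lev_small'[OF a, of 1] by auto
  have "qc * (lev (lvl j) t + lev s (2 * 2 ^ j)) \<le> qc * (?a + ?a)"
    using t s qc_pos by (intro mult_left_mono add_mono) (auto intro: less_imp_le)
  also have "qc * (u / (2 * qc) + u / (2 * qc)) = u" for u using qc_pos by (simp add: field_simps)
  finally have lq: "qc * (lev (lvl j) t + lev s (2 * 2 ^ j)) \<le> 1 / real (Suc j)" .
  have "0 < t * s\<^sup>2" using t s by simp
  from diag[OF this, of j] obtain k where k: "EV i. arr j k (n i) - arr j (kp i) (n i) \<le> t * s\<^sup>2"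
    unfolding eventually_sequentially by blast
  from k eventually_ge_at_top[of k] have "EV i. small (\<lambda>h. c (kp' i) (mid j (n i) h) - c k (mid j (n i) h)) (1 / real (Suc j)) \<and>
     small (\<lambda>h. mid j (n i) (c (kp' i) h - c k h)) (1 / real (Suc j))"
  proof eventually_elim
    case (elim i)
    have k': "k \<le> kp' i" using elim(2) kp_ge(2)[of i] by simp
    let ?y = "mid j (n i)" and ?p = "\<lambda>h. b k h - b (kp' i) h"
    have eq: "c (kp' i) h - c k h = ?p h" for h by (simp add: c_def)
    have p: "?p \<in> projs \<M>" by (rule projs_sub[OF b_projs b_projs b_antimono[OF k']])
    have yM: "?y \<in> \<M>" by (rule mid(1))
    have M: "(\<lambda>h. ?p (?y h)) \<in> \<M>" "(\<lambda>h. ?p (badjoint ?y h)) \<in> \<M>" "(\<lambda>h. ?y (?p h)) \<in> \<M>"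
      by (rule M_comp[OF projs_M[OF p] yM], rule M_comp[OF projs_M[OF p] M_adj[OF yM]], rule M_comp[OF yM projs_M[OF p]])
    have adj: "badjoint (\<lambda>h. ?p (badjoint ?y h)) = (\<lambda>h. ?y (?p h))"
      by (rule badjoint_unique) (simp only: proj_cinner[OF projs_proj[OF p]] cinner_badjoint'[OF M_clinear[OF yM]])
    \<comment> \<open>\<open>diag\<close> concerns the cut-off \<open>kp i\<close>, the projection
      has index \<open>kp' i\<close>; as \<open>arr\<close> decreases in the cut-off, the smaller
      index loses no more.\<close>
    have "arr j k (n i) - arr j (kp' i) (n i) \<le> t * s\<^sup>2" using elim(1) arr_diff(6)[OF le, of j i "n i"] by linarith
    then have sq: "sq_trace (\<lambda>h. ?p (?y h)) \<le> ennreal (t * s\<^sup>2)" "sq_trace (\<lambda>h. ?p (badjoint ?y h)) \<le> ennreal (t * s\<^sup>2)"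
      using arr_diff(2,3)[OF k', of j "n i"] by (auto intro: order_trans ennreal_leI)
    have t0: "0 \<le> t" and s0: "0 \<le> s" using t s by simp_all
    have bs: "bdd_off (\<lambda>h. ?p (?y h)) t s" "bdd_off (\<lambda>h. ?y (?p h)) t s"
      using bdd_off_sq_trace[OF M(1) sq(1) s(1) t0] bdd_off_adj[OF bdd_off_sq_trace[OF M(2) sq(2) s(1) t0] M(2) s0] adj by simp_all
    have "small (\<lambda>h. ?p (?y h)) (qc * (lev (lvl j) t + lev s (2 * 2 ^ j)))"
    proof (rule small_levels[OF _ bs(1) _ lvl_nonneg s0])
      show "norm (?p (?y h)) \<le> lvl j * norm h" for h using projs_norm[OF p] mid(3) by (rule order_trans)
      show "bdd_off (\<lambda>h. ?p (?y h)) (2 * 2 ^ j) 0"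
        using bdd_off_left[OF mid(4)[of j "n i"], of ?p 1] projs_norm[OF p] by simp
    qed
    moreover have "small (\<lambda>h. ?y (?p h)) (qc * (lev (lvl j) t + lev s (2 * 2 ^ j)))"
    proof (rule small_levels[OF _ bs(2) _ lvl_nonneg s0])
      show "norm (?y (?p h)) \<le> lvl j * norm h" for h
        using mid(3) mult_left_mono[OF projs_norm[OF p] lvl_nonneg] by (rule order_trans)
      show "bdd_off (\<lambda>h. ?y (?p h)) (2 * 2 ^ j) 0"
        using bdd_off_right[OF mid(4)[of j "n i"] projs_M[OF p], of 1] projs_norm[OF p] by simp
    qed
    ultimately show ?case unfolding eq using small_mono[OF _ lq] by blast
  qed
  then show ?thesis by blast
qed

definition cutoff :: "nat \<Rightarrow> nat" where
  "cutoff j = (SOME k. EV i. small (\<lambda>h. c (kp' i) (mid j (n i) h) - c k (mid j (n i) h)) (1 / real (Suc j)) \<and>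
     small (\<lambda>h. mid j (n i) (c (kp' i) h - c k h)) (1 / real (Suc j)))"

lemma cut_vanish: "vanish (\<lambda>k i m h. c (kp' i) (mid k (n i) h) - c (cutoff k) (mid k (n i) h))" (is ?A)
  "vanish (\<lambda>k i m h. mid k (n i) (c (kp' i) h - c (cutoff k) h))" (is ?B)
proof -
  note cut = someI_ex[OF mid_cut, folded cutoff_def]
  have ev: "EV k. 1 / real (Suc k) \<le> s" if "0 < s" for s
    using order_tendstoD(2)[OF LIMSEQ_Suc[OF lim_1_over_n], of s] that by (auto elim: eventually_mono)
  have *: "EV k. EV i. small (\<lambda>h. c (kp' i) (mid k (n i) h) - c (cutoff k) (mid k (n i) h)) s \<and>
     small (\<lambda>h. mid k (n i) (c (kp' i) h - c (cutoff k) h)) s" if "0 < s" for s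
    using ev[OF that]
  proof eventually_elim
    case (elim k)
    from cut[of k] show ?case by eventually_elim (use elim small_mono in blast)
  qed
  show ?A by (rule vanishI) (use * in \<open>fastforce elim: eventually_mono\<close>)
  show ?B by (rule vanishI) (use * in \<open>fastforce elim: eventually_mono\<close>)
qed

text \<open>For fixed \<open>k\<close> the operators \<open>mid k\<close> share a bound, while the
  trace of \<open>c (kp' i) - f i\<close> is at most \<open>4 * (1/2) ^ kp i\<close> and tends to
  zero.\<close>

lemma corner_vanish: "vanish (\<lambda>k i m h. c (kp' i) (mid k (n i) h) - f i (mid k (n i) h))" (is ?A)
  "vanish (\<lambda>k i m h. mid k (n i) (c (kp' i) h - f i h))" (is ?B)
proof -
  have *: "EV i. small (\<lambda>h. c (kp' i) (mid k (n i) h) - f i (mid k (n i) h)) s \<and>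
     small (\<lambda>h. mid k (n i) (c (kp' i) h - f i h)) s" if s: "0 < s" for s k
  proof -
    have "0 < s / qc" using s qc_pos by simp
    then obtain t where t: "0 < t" "\<forall>b\<le>t. lev (lvl k) b < s / qc" using lev_small[OF _ lvl_nonneg] by blast
    have "0 < t / 4" using t by simp
    from power_half_small[OF this] obtain i0 where i0: "\<forall>i\<ge>i0. (1/2) ^ i < t / 4" unfolding eventually_sequentially by blast
    show ?thesis
      using eventually_ge_at_top[of i0]
    proof eventually_elim
      case (elim i)
      let ?y = "mid k (n i)" and ?p = "\<lambda>h. c (kp' i) h - f i h" and ?t = "4 * (1/2) ^ kp i"
      have "i0 \<le> kp i" using elim kp_ge(1)[of i] by simp
      then have "?t \<le> t" using i0[rule_format, of "kp i"] by linarith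
      then have "lev (lvl k) ?t < s / qc" using t by blast
      then have le: "qc * lev (lvl k) ?t \<le> s" using qc_pos by (simp add: field_simps)
      note p = f(5)[of i] and tp = f(6)[of i]
      have M: "(\<lambda>h. ?p (?y h)) \<in> \<M>" by (rule M_comp[OF projs_M[OF p] mid(1)])
      have "small (\<lambda>h. ?p (?y h)) (qc * lev (lvl k) ?t)"
      proof (rule small_finite_rank[OF _ _ lvl_nonneg])
        show "norm (?p (?y h)) \<le> lvl k * norm h" for h using projs_norm[OF p] mid(3) by (rule order_trans)
        show "bdd_off (\<lambda>h. ?p (?y h)) ?t 0" by (rule bdd_off_rank_left[OF p tp M]) (rule projs_idem[OF p])
      qed
      moreover have "small (\<lambda>h. ?y (?p h)) (qc * lev (lvl k) ?t)"
      proof (rule small_finite_rank[OF _ _ lvl_nonneg])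
        show "norm (?y (?p h)) \<le> lvl k * norm h" for h
          using mid(3) mult_left_mono[OF projs_norm[OF p] lvl_nonneg] by (rule order_trans)
        have "?p (perp ?p h) = 0" for h using projs_lin(2)[OF p, of h "?p h"] projs_idem[OF p, of h] by simp
        then show "bdd_off (\<lambda>h. ?y (?p h)) ?t 0"
          by (intro bdd_off_rank[OF p tp]) (simp only: bounded_clinear_zero[OF M_clinear[OF mid(1)]])
      qed
      ultimately show ?case using small_mono[OF _ le] by blast
    qed
  qed
  show ?A by (rule vanishI, rule always_eventually, rule allI) (use * in \<open>fastforce elim: eventually_mono\<close>)
  show ?B by (rule vanishI, rule always_eventually, rule allI) (use * in \<open>fastforce elim: eventually_mono\<close>)
qed

lemma inv_Suc_vanish: assumes "\<And>i. small (Z i) (1 / real (Suc i))" shows "vanish (\<lambda>k i m. Z i)"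
proof (rule vanishI, rule always_eventually, rule allI)
  fix s :: real assume "0 < s"
  then have "EV i. 1 / real (Suc i) < s"
    using order_tendstoD(2)[OF LIMSEQ_Suc[OF lim_1_over_n], of s] by simp
  then show "EV i. small (Z i) s" by eventually_elim (rule small_mono[OF assms less_imp_le])
qed

text \<open>\<open>b (kp' (Suc i))\<close> lies below a projection \<open>v\<close> off which the
  large part of \<open>X i\<close> is supported on both sides, so only its tail survives. For
  \<open>th i\<close> the trace is small enough that only the head of the singular value function
  counts.\<close>

lemma tail_vanish: "vanish (\<lambda>k i m h. b (kp' (Suc i)) (X i h))" "vanish (\<lambda>k i m h. X i (b (kp' (Suc i)) h))"
  "vanish (\<lambda>k i m h. th i (X i h))" "vanish (\<lambda>k i m h. X i (th i h))"
proof -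
  have *: "small (\<lambda>h. b (kp' (Suc i)) (X i h)) (1 / real (Suc i)) \<and> small (\<lambda>h. X i (b (kp' (Suc i)) h)) (1 / real (Suc i))" for i
  proof -
    obtain j where j: "prod_encode (n i, j) \<le> kp' (Suc i)" "N (\<lambda>t. min (g (n i) (real (Suc j))) (g (n i) t)) \<le> 1 / real (Suc i)"
      using tail by blast
    have p: "0 < real (Suc j)" by simp
    note le = b_le[OF j(1)] and vv = v[OF p, of "n i"]
    have "b (kp' (Suc i)) (X i h) = b (kp' (Suc i)) (X i (Q i (real (Suc j)) h))" for h
      using le(2)[of "X i h"] le(2)[of "X i (Q i (real (Suc j)) h)"] vv(3)[of h] by metis
    moreover have "Q i (real (Suc j)) (b (kp' (Suc i)) h) = b (kp' (Suc i)) h" for h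
      using le(1)[of h] vv(2)[of "b (kp' (Suc i)) h"] by metis
    ultimately show ?thesis
      using small_left[OF tame_low[OF T p], of "b (kp' (Suc i))" "n i"]
        small_right[OF tame_low[OF T p] projs_M[OF b_projs], of "kp' (Suc i)" "n i"] projs_norm[OF b_projs] small_mono[OF _ j(2)] by simp
  qed
  show "vanish (\<lambda>k i m h. b (kp' (Suc i)) (X i h))" "vanish (\<lambda>k i m h. X i (b (kp' (Suc i)) h))"
    by (rule inv_Suc_vanish, use * in blast)+
  show "vanish (\<lambda>k i m h. th i (X i h))" "vanish (\<lambda>k i m h. X i (th i h))"
    by (rule inv_Suc_vanish; rule small_mono[OF tame_rank(1)[OF T th] rho(4)] small_mono[OF tame_rank(2)[OF T th] rho(4)])+
qed

end

context selected_sequence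
begin

section \<open>Compressions by a sequence of projections decreasing to zero\<close>

context
  fixes D :: "nat \<Rightarrow> 'h \<Rightarrow> 'h"
  assumes D: "decreasing_to_zero \<M> D"
begin

lemma D_projs: "D m \<in> projs \<M>" by (rule decreasing_to_zero_tendsto(1)[OF D])

lemma D_M: "D m \<in> \<M>" and D_norm: "norm (D m h) \<le> norm h"
  using D_projs[of m] by (simp_all add: projs_M projs_norm)

lemma vanish_comp:
  assumes "vanish Z" "\<And>k i m. r k i m \<in> projs \<M>" shows "vanish (\<lambda>k i m h. Z k i m (r k i m (D m h)))"
proof (rule vanish_right[OF assms(1)])
  show "(\<lambda>h. r k i m (D m h)) \<in> \<M>" for k i m by (rule M_comp[OF projs_M[OF assms(2)] D_M])
  show "norm (r k i m (D m h)) \<le> norm h" for k i m h by (rule order_trans[OF projs_norm[OF assms(2)] D_norm])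
qed

lemma vanish_cong: "vanish Z \<Longrightarrow> (\<And>k i m h. Z' k i m h = Z k i m h) \<Longrightarrow> vanish Z'"
proof -
  assume "vanish Z" "\<And>k i m h. Z' k i m h = Z k i m h"
  moreover from this(2) have "Z' = Z" by (intro ext)
  ultimately show "vanish Z'" by simp
qed

lemma vanish_neg: "vanish Z \<Longrightarrow> vanish (\<lambda>k i m h. - Z k i m h)"
  by (erule vanish_left) simp

lemma vanish_weaken:
  assumes "\<And>k s. 0 < s \<Longrightarrow> \<exists>m0. \<forall>m\<ge>m0. \<forall>i. small (Z k i m) s" shows "vanish Z"
  unfolding vanish_def
proof (intro allI impI, rule always_eventually, rule allI)
  fix s :: real and k assume "0 < s"
  from assms[OF this, of k] obtain m0 where "\<forall>m\<ge>m0. \<forall>i. small (Z k i m) s" by blast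
  then show "EV j. \<forall>i\<ge>j. \<forall>m\<ge>j. small (Z k i m) s"
    unfolding eventually_sequentially by (intro exI[of _ m0]) auto
qed

text \<open>Once \<open>k\<close> is fixed, \<open>c (cutoff k)\<close> is one projection of finite
  trace and the operators \<open>mid k\<close> share a bound, so a single threshold for
  \<open>m\<close> works for all \<open>i\<close>.\<close>

lemma mid_vanish: "vanish (\<lambda>k i m h. D m (c (cutoff k) (mid k (n i) h)))"
  "vanish (\<lambda>k i m h. mid k (n i) (c (cutoff k) (D m h)))"
proof -
  have *: "\<exists>m0. \<forall>m\<ge>m0. \<forall>i. small (\<lambda>h. mid k (n i) (c (cutoff k) (D m h))) s \<and> small (\<lambda>h. D m (c (cutoff k) (mid k (n i) h))) s"
    if "0 < s" for k s
    using small_decreasing_to_zero[OF D c(1,2) that lvl_nonneg[of k], of "cutoff k"] mid(1,3) by blast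
  show "vanish (\<lambda>k i m h. D m (c (cutoff k) (mid k (n i) h)))"
    by (rule vanish_weaken) (use * in blast)
  show "vanish (\<lambda>k i m h. mid k (n i) (c (cutoff k) (D m h)))"
    by (rule vanish_weaken) (use * in blast)
qed

lemma X_lin: "X i (h + k) = X i h + X i k" "X i (h - k) = X i h - X i k" "X i 0 = 0"
  by (simp_all add: bounded_clinear_simps[OF M_clinear[OF tame_M[OF T]]])

lemma Q_slices: "X i (Q i (2 * (1/2) ^ kp i) h) = hi k i h + mid k (n i) h + lo k i h + far i h"
  by (simp add: mid_def hi_def lo_def far_def X_lin)

lemma mid_lin: "mid k (n i) (u - h) = mid k (n i) u - mid k (n i) h"
  by (simp add: bounded_clinear_simps[OF M_clinear[OF mid(1)]])

text \<open>\<open>f i\<close> absorbs \<open>vi i\<close>, so \<open>X i\<close> may be replaced by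
  its part below the top level and cut into slices. The slice \<open>mid\<close> is compared with
  the fixed projection \<open>c (cutoff k)\<close> through \<open>c (kp' i)\<close>; only there is
  \<open>D m\<close> needed for smallness.\<close>

lemma left_vanish: "vanish (\<lambda>k i m h. D m (f i (X i (D m h))))"
proof -
  note F = projs_lin[OF f(1)]
  let ?Z = "\<lambda>k i h. f i (hi k i h) + f i (lo k i h) + f i (far i h) + (c (kp' i) (mid k (n i) h) - c (cutoff k) (mid k (n i) h))
    + - (c (kp' i) (mid k (n i) h) - f i (mid k (n i) h))"
  note fl = vanish_left[where a = "\<lambda>k i m. f i", OF _ projs_norm[OF f(1)]]
  have "vanish (\<lambda>k i m. ?Z k i)"
    by (rule vanish_add[OF vanish_add[OF vanish_add[OF vanish_add[OF fl[OF win_vanish(1)] fl[OF win_vanish(2)]] low_vanish(1)]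
        cut_vanish(1)] vanish_neg[OF corner_vanish(1)]])
  from vanish_left[where a = "\<lambda>k i m. D m", OF vanish_comp[OF this projs_id] D_norm]
  have "vanish (\<lambda>k i m h. D m (?Z k i (D m h)))" .
  moreover have "vanish (\<lambda>k i m h. D m (c (cutoff k) (mid k (n i) (D m h))))" by (rule vanish_comp[OF mid_vanish(1) projs_id])
  moreover have "D m (f i (X i u)) = D m (?Z k i u) + D m (c (cutoff k) (mid k (n i) u))" for k i m u
  proof -
    have "f i (X i u) = f i (X i (Q i (2 * (1/2) ^ kp i) u))"
      using f(4)[of i "X i u"] f(4)[of i "X i (Q i (2 * (1/2) ^ kp i) u)"] vi(3)[of i u] by metis
    also have "\<dots> = ?Z k i u + c (cutoff k) (mid k (n i) u)" unfolding Q_slices[of i u k] F by simp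
    finally show ?thesis by (simp only: projs_lin(1)[OF D_projs])
  qed
  ultimately show ?thesis by (rule vanish_cong[OF vanish_add])
qed

lemma right_vanish: "vanish (\<lambda>k i m h. X i (f i (D m h)))"
proof -
  let ?Z = "\<lambda>k i h. (mid k (n i) (c (kp' i) h - c (cutoff k) h)) + - (mid k (n i) (c (kp' i) h - f i h)) + far i (f i h)"
  have Z: "vanish (\<lambda>k i m. ?Z k i)"
    by (rule vanish_add[OF vanish_add[OF cut_vanish(2) vanish_neg[OF corner_vanish(2)]] low_vanish(2)])
  have "vanish (\<lambda>k i m h. ?Z k i (D m h) + hi k i (f i (D m h)) + lo k i (f i (D m h)) + mid k (n i) (c (cutoff k) (D m h)))"
    by (rule vanish_add[OF vanish_add[OF vanish_add[OF vanish_comp[OF Z projs_id] vanish_comp[OF win_vanish(1) f(1)]]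
        vanish_comp[OF win_vanish(2) f(1)]] mid_vanish(2)])
  moreover have "X i (f i u) = ?Z k i u + hi k i (f i u) + lo k i (f i u) + mid k (n i) (c (cutoff k) u)" for k i u
  proof -
    have "Q i (2 * (1/2) ^ kp i) (f i u) = f i u" using vi(2)[of i "f i u"] by (simp add: f(3))
    then show ?thesis using Q_slices[of i "f i u" k] by (simp add: mid_lin)
  qed
  ultimately show ?thesis by (rule vanish_cong)
qed

lemma remainder_vanish: "vanish (\<lambda>k i m h. D m (X i (D m h) - e i (X i (e i (D m h)))))"
proof -
  note pf = projs_perp[OF f(1)]
  let ?Z = "\<lambda>i h. b (kp' (Suc i)) (X i (perp (f i) h)) + th i (X i (perp (f i) h)) + e i (X i (b (kp' (Suc i)) h)) + e i (X i (th i h))"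
  have 1: "vanish (\<lambda>k i m h. b (kp' (Suc i)) (X i (perp (f i) (D m h))))" "vanish (\<lambda>k i m h. th i (X i (perp (f i) (D m h))))"
    using vanish_comp[OF tail_vanish(1) pf] vanish_comp[OF tail_vanish(3) pf] .
  have 2: "vanish (\<lambda>k i m h. e i (X i (b (kp' (Suc i)) (D m h))))" "vanish (\<lambda>k i m h. e i (X i (th i (D m h))))"
    using vanish_left[where a = "\<lambda>k i m. e i", OF vanish_comp[OF tail_vanish(2) projs_id] projs_norm[OF e(1)]]
      vanish_left[where a = "\<lambda>k i m. e i", OF vanish_comp[OF tail_vanish(4) projs_id] projs_norm[OF e(1)]] .
  have "vanish (\<lambda>k i m h. ?Z i (D m h) + perp (f i) (X i (f i (D m h))))"
    by (rule vanish_add[OF vanish_add[OF vanish_add[OF vanish_add[OF 1] 2(1)] 2(2)] 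
        vanish_left[where a = "\<lambda>k i m. perp (f i)", OF right_vanish projs_norm[OF pf]]])
  from vanish_left[where a = "\<lambda>k i m. D m", OF this D_norm] have "vanish (\<lambda>k i m h. D m (?Z i (D m h) + perp (f i) (X i (f i (D m h)))))" .
  moreover have "D m (X i u - e i (X i (e i u))) = D m (f i (X i u)) + D m (?Z i u + perp (f i) (X i (f i u)))" for i m u
  proof -
    \<comment> \<open>First \<open>f i\<close> is split off on the left, then on the right. The rest
      is expanded by \<open>perp_f\<close> on the left and, in the term beginning with
      \<open>e i\<close>, again on the right; what remains is the corner.\<close>
    have 1: "X i u = f i (X i u) + perp (f i) (X i (f i u)) + perp (f i) (X i (perp (f i) u))"
      by (simp add: X_lin projs_lin[OF f(1)])
    have 2: "e i (X i (perp (f i) u)) = e i (X i (b (kp' (Suc i)) u)) + e i (X i (th i u)) + e i (X i (e i u))"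
      unfolding perp_f by (simp add: X_lin projs_lin[OF e(1)])
    have 3: "perp (f i) y = b (kp' (Suc i)) y + th i y + e i y" for y by (rule perp_f)
    have "a = a1 + a2 + r \<Longrightarrow> r = a3 + a4 + t \<Longrightarrow> t = a5 + a6 + v \<Longrightarrow> a - v = a1 + (a3 + a4 + a5 + a6 + a2)"
      for a a1 a2 a3 a4 a5 a6 r t v :: 'h by simp
    from this[OF 1 3 2] show ?thesis by (simp only: projs_lin(1)[OF D_projs])
  qed
  ultimately show ?thesis by (rule vanish_cong[OF vanish_add[OF left_vanish]])
qed

text \<open>Since \<open>e i\<close> has finite trace, each fixed corner vanishes under compression.
  The threshold depends on \<open>i\<close>; the estimate is used for the finitely many indices that
  the uniform one leaves out.\<close>

lemma corner_small: assumes s: "0 < s" shows "\<exists>m0. \<forall>m\<ge>m0. small (\<lambda>h. D m (e i (X i (e i (D m h))))) s"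
proof -
  obtain K where K: "0 < K" "\<And>h. norm (X i h) \<le> K * norm h" using bounded_clinear_bound[OF M_clinear[OF tame_M[OF T]]] by blast
  have K0: "0 \<le> K" using K by simp
  from small_decreasing_to_zero[OF D e(1) e_tau s K0, of i] obtain m0 where m0:
    "\<And>m y. m0 \<le> m \<Longrightarrow> (\<forall>h. norm (y h) \<le> K * norm h) \<Longrightarrow> small (\<lambda>h. y (e i (D m h))) s" by blast
  have "small (\<lambda>h. D m (e i (X i (e i (D m h))))) s" if "m0 \<le> m" for m
  proof (rule m0[OF that])
    show "\<forall>h. norm (D m (e i (X i h))) \<le> K * norm h"
      using order_trans[OF D_norm order_trans[OF projs_norm[OF e(1)] K(2)]] by blast
  qed
  then show ?thesis by blast
qed

end

end

lemma (in tame_sequence) splitting: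
  "\<exists>r e. strict_mono r \<and> (\<forall>i. e i \<in> projs \<M>) \<and> (\<forall>i h. P (r i) (\<delta> (r i)) (e i h) = e i h) \<and> (\<forall>i l h. i \<noteq> l \<longrightarrow> e i (e l h) = 0) \<and>
    (\<forall>D s. decreasing_to_zero \<M> D \<longrightarrow> 0 < s \<longrightarrow>
      (\<exists>j. \<forall>i\<ge>j. \<forall>m\<ge>j. small (\<lambda>h. D m (x (r i) (D m h) - e i (x (r i) (e i (D m h))))) s) \<and>
      (\<forall>i. \<exists>m0. \<forall>m\<ge>m0. small (\<lambda>h. D m (e i (x (r i) (e i (D m h))))) s))"
proof -
  obtain n kp kp' \<rho> where n: "strict_mono n" and sel: "selected_sequence \<M> \<tau> E N q x g P \<delta> B n kp kp' \<rho>"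
    using selection_exists by blast
  interpret selected_sequence \<M> \<tau> E N q x g P \<delta> B n kp kp' \<rho> by (rule sel)
  show ?thesis
  proof (intro exI[of _ n] exI[of _ e] conjI allI impI n e(1) e_orth e_below)
    fix D :: "nat \<Rightarrow> 'h \<Rightarrow> 'h" and s :: real assume D: "decreasing_to_zero \<M> D" "0 < s"
    show "\<exists>j. \<forall>i\<ge>j. \<forall>m\<ge>j. small (\<lambda>h. D m (X i (D m h) - e i (X i (e i (D m h))))) s"
      by (rule vanish_const[OF remainder_vanish[OF D(1)] D(2)])
    show "\<exists>m0. \<forall>m\<ge>m0. small (\<lambda>h. D m (e i (X i (e i (D m h))))) s" for i by (rule corner_small[OF D])
  qed
qed

section \<open>Generalized singular values\<close>

context traced_op
begin

text \<open>The range of \<open>p\<close> meets that of \<open>1 - F s\<close> only in zero, since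
  \<open>X\<close> exceeds \<open>s\<close> strictly on the latter. Hence \<open>pullback\<close>
  along \<open>1 - F s\<close> returns exactly \<open>F s\<close>.\<close>

lemma tau_F_le:
  assumes p: "p \<in> projs \<M>" and s: "0 \<le> s" and k: "\<And>h. p h = h \<Longrightarrow> \<exists>k. (h, k) \<in> X \<and> norm k \<le> s * norm h"
  shows "\<tau> (perp (F s)) \<le> \<tau> (perp p)"
proof -
  obtain r where r: "r \<in> projs \<M>" "\<forall>h. r h = h \<longleftrightarrow> p (perp (F s) h) = perp (F s) h" "\<tau> (perp r) \<le> \<tau> (perp p)"
    using pullback[OF projs_M[OF projs_perp[OF F_projs]] p] by blast
  have "r = F s"
  proof (rule projs_eq_if_fix[OF r(1) F_projs])
    fix h
    have A: "perp (F s) h = 0" if ph: "p (perp (F s) h) = perp (F s) h"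
    proof (rule ccontr)
      assume ne: "perp (F s) h \<noteq> 0"
      obtain k where k: "(perp (F s) h, k) \<in> X" "norm k \<le> s * norm (perp (F s) h)" using k[OF ph] by blast
      have "F s (perp (F s) h) = 0" by (simp add: F_lin F_idem)
      from F_strict[OF k(1) this ne s] k(2) show False by simp
    qed
    show "r h = h \<longleftrightarrow> F s h = h"
    proof
      assume "r h = h"
      from A[OF r(2)[rule_format, THEN iffD1, OF this]] show "F s h = h" by simp
    next
      assume "F s h = h"
      then have z: "perp (F s) h = 0" by simp
      show "r h = h" by (rule r(2)[rule_format, THEN iffD2]) (simp only: z projs_lin(3)[OF p])
    qed
  qed
  then show ?thesis using r(3) by simp
qed

lemma tau_F_antimono: "s \<le> t \<Longrightarrow> \<tau> (perp (F t)) \<le> \<tau> (perp (F s))"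
  by (rule tau_mono_proj[OF projs_perp[OF F_projs] projs_perp[OF F_projs]]) (simp add: F_lin F_mono')

lemma singular_value_eq: "singular_value \<tau> X t = Inf {ennreal s | s. 0 \<le> s \<and> \<tau> (perp (F s)) \<le> ennreal t}"
  unfolding singular_value_def spectral_measure_greaterThan ..

lemma singular_value_le: "0 \<le> s \<Longrightarrow> \<tau> (perp (F s)) \<le> ennreal t \<Longrightarrow> singular_value \<tau> X t \<le> ennreal s"
  unfolding singular_value_eq by (rule Inf_lower) blast

lemma singular_value_antimono: assumes "s \<le> t" shows "singular_value \<tau> X t \<le> singular_value \<tau> X s"
  unfolding singular_value_eq using order_trans[OF _ ennreal_leI[OF assms]] by (intro Inf_superset_mono) blast

definition mu :: "real \<Rightarrow> real" where "mu t = enn2real (singular_value \<tau> X t)"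

lemma mu_nonneg: "0 \<le> mu t" by (simp add: mu_def)

lemma mu_measurable: "mu \<in> borel_measurable half_line"
proof (rule measurable_half_lineI)
  have "singular_value \<tau> X \<in> borel_measurable borel" by (rule antimono_borel_measurable[OF singular_value_antimono])
  then show "mu \<in> borel_measurable borel" unfolding mu_def by simp
qed

lemma mu_le:
  assumes p: "p \<in> projs \<M>" "\<tau> (perp p) \<le> ennreal t" and s: "0 \<le> s" and k: "\<And>h. p h = h \<Longrightarrow> \<exists>k. (h, k) \<in> X \<and> norm k \<le> s * norm h"
  shows "mu t \<le> s"
proof -
  have "\<tau> (perp (F s)) \<le> ennreal t" using tau_F_le[OF p(1) s k] p(2) by (rule order_trans)
  from singular_value_le[OF s this] show ?thesis unfolding mu_def using s by (intro enn2real_leI)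
qed

end

locale measurable_op = traced_op \<M> \<tau> X for \<M> :: "('h::complex_hilbert_space \<Rightarrow> 'h) set" and \<tau> and X +
  assumes X: "X \<in> measurable_operators \<M> \<tau>"
begin

lemma tau_F_small: assumes e: "0 < e" shows "\<exists>s>0. \<tau> (perp (F s)) \<le> ennreal e"
proof -
  obtain p T where p: "p \<in> projs \<M>" "\<tau> (perp p) < ennreal e" and T: "T \<in> \<M>" "graph p O X = graph T"
    using X e unfolding measurable_operators_def projs_iff by blast
  obtain K where K: "0 < K" "\<And>h. norm (T h) \<le> K * norm h" using bounded_clinear_bound[OF M_clinear[OF T(1)]] by blast
  have "\<exists>k. (h, k) \<in> X \<and> norm k \<le> K * norm h" if "p h = h" for h
  proof -
    have "(h, T h) \<in> graph p O X" by (simp add: T(2) in_graph)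
    then have "(h, T h) \<in> X" using that by (auto simp: in_graph)
    then show ?thesis using K(2) by blast
  qed
  from tau_F_le[OF p(1) less_imp_le[OF K(1)] this] p(2) K(1) show ?thesis by (intro exI[of _ K]) simp
qed

lemma singular_value_finite: assumes t: "0 < t" shows "singular_value \<tau> X t = ennreal (mu t)"
proof -
  obtain s where s: "0 < s" "\<tau> (perp (F s)) \<le> ennreal t" using tau_F_small[OF t] by blast
  have "singular_value \<tau> X t < top" using singular_value_le[OF _ s(2)] s(1) by (simp add: le_less_trans)
  then show ?thesis by (simp add: mu_def less_top)
qed

lemma mu_antimono: assumes "0 < s" "s \<le> t" shows "mu t \<le> mu s"
  using singular_value_antimono[OF assms(2)]
  unfolding singular_value_finite[OF assms(1)] singular_value_finite[OF less_le_trans[OF assms]] ennreal_le_iff[OF mu_nonneg] .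

text \<open>The infimum defining \<open>mu t\<close> is attained, because the trace of
  \<open>1 - F s\<close> is right continuous in \<open>s\<close>.\<close>

lemma tau_F_mu: assumes t: "0 < t" shows "\<tau> (perp (F (mu t))) \<le> ennreal t"
proof (subst tau_F_right, rule SUP_least)
  fix n
  have "ennreal (mu t) < ennreal (mu t + inverse (real (Suc n)))" by (rule ennreal_lessI) (simp_all add: mu_nonneg add_nonneg_pos)
  then have "Inf {ennreal s | s. 0 \<le> s \<and> \<tau> (perp (F s)) \<le> ennreal t} < ennreal (mu t + inverse (real (Suc n)))"
    unfolding singular_value_eq[symmetric] singular_value_finite[OF t] .
  then obtain s where s: "0 \<le> s" "\<tau> (perp (F s)) \<le> ennreal t" "ennreal s < ennreal (mu t + inverse (real (Suc n)))"
    by (auto simp: Inf_less_iff)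
  have "s \<le> mu t + inverse (real (Suc n))" using s(1,3) by (simp add: ennreal_less_iff)
  from tau_F_antimono[OF this] s(2) show "\<tau> (perp (F (mu t + inverse (real (Suc n))))) \<le> ennreal t" by (rule order_trans)
qed

text \<open>The domain of the adjoint contains the kernel of \<open>u\<^sup>*\<close>, where \<open>u\<close> is a partial isometry with
  initial projection \<open>1 - F s\<close> whose range contains that of \<open>X (1 - F s)\<close>.\<close>

lemma adjoint_domain:
  assumes e: "0 < e"
  shows "\<exists>q\<in>projs \<M>. \<tau> (perp q) \<le> ennreal e \<and> (\<forall>h. q h = h \<longrightarrow> (\<exists>z. \<forall>(a, k)\<in>X. cinner k h = cinner a z))"
proof -
  obtain s where s: "0 < s" "\<tau> (perp (F s)) \<le> ennreal e" using tau_F_small[OF e] by blast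
  obtain u where u: "u \<in> \<M>" "\<forall>h. norm (u h) = norm (h - F s h)" "\<forall>a b. (a, b) \<in> X \<longrightarrow> F s a = 0 \<longrightarrow> (\<exists>w. b = u w)"
    using partial_isometry[OF s(1)] by blast
  obtain T where T: "T \<in> \<M>" "\<forall>h. (F s h, T h) \<in> X" using cut_exists[of s] s(1) by auto
  have "u (F s h) = 0" for h using u(2)[rule_format, of "F s h"] by (simp add: F_idem)
  then have "u (perp (F s) h) = u h" for h by (simp add: bounded_clinear_simps[OF M_clinear[OF u(1)]])
  from tau_range_le[where T = u and b = "perp (F s)", OF u(1) projs_perp[OF F_projs] this]
  have tau: "\<tau> (perp (kproj (badjoint u))) \<le> ennreal e" using s(2) by (rule order_trans)
  have "cinner k h = cinner a (badjoint T h)" if h: "badjoint u h = 0" and ak: "(a, k) \<in> X" for h a k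
  proof -
    obtain k1 k2 where k0: "(F s a, k1) \<in> X \<and> (a - F s a, k2) \<in> X \<and> k = k1 + k2 \<and> (norm k)\<^sup>2 = (norm k1)\<^sup>2 + (norm k2)\<^sup>2"
      using F_split[OF ak, of s] by (elim exE) (rule that)
    have "F s (a - F s a) = 0" by (simp add: F_lin F_idem)
    then obtain w where w: "k2 = u w" using u(3) k0 by blast
    have "k1 = T a" by (rule linear_operator_single[OF lin]) (use k0 T(2) in blast)+
    then have "cinner k h = cinner (T a) h + cinner (u w) h" using k0 w by (simp add: cinner_add_left)
    also have "\<dots> = cinner a (badjoint T h)" by (simp add: cinner_badjoint[OF M_clinear[OF T(1)]] cinner_badjoint[OF M_clinear[OF u(1)]] h)
    finally show ?thesis .
  qed
  then have "\<forall>h. kproj (badjoint u) h = h \<longrightarrow> (\<exists>z. \<forall>(a, k)\<in>X. cinner k h = cinner a z)"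
    unfolding kproj_fix[OF M_adj[OF u(1)]] by blast
  then show ?thesis using tau kproj_projs[OF M_adj[OF u(1)]] by blast
qed

end

section \<open>Bounded perturbations and compressions\<close>

lemma csubspace_image:
  assumes S: "csubspace S" and T: "\<And>x y. T (x + y) = T x + T y" "\<And>c x. T (c *\<^sub>C x) = c *\<^sub>C T x"
  shows "csubspace (T ` S)"
  unfolding csubspace_def
proof (intro conjI ballI allI; (elim imageE)?)
  have "T 0 = 0" using T(1)[of 0 0] by simp
  then show "0 \<in> T ` S" using csubspace_0[OF S] by (metis image_eqI)
qed (auto simp: T[symmetric] intro!: imageI csubspace_add[OF S] csubspace_scaleC[OF S])

lemma csubspace_vimage:
  assumes S: "csubspace S" and T: "\<And>x y. T (x + y) = T x + T y" "\<And>c x. T (c *\<^sub>C x) = c *\<^sub>C T x"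
  shows "csubspace (T -` S)"
proof -
  have "T 0 = 0" using T(1)[of 0 0] by simp
  then show ?thesis using S by (simp add: csubspace_def T)
qed

lemma linear_operatorI:
  assumes A: "csubspace A" and z: "\<And>k. (0, k) \<in> A \<Longrightarrow> k = 0" shows "linear_operator A"
  unfolding linear_operator_def
proof (intro conjI allI impI)
  show "single_valued A"
  proof (rule single_valuedI)
    fix a b b' assume "(a, b) \<in> A" "(a, b') \<in> A"
    then have "(a - a, b - b') \<in> A" using csubspace_diff[OF A, of "(a, b)" "(a, b')"] by simp
    then show "b = b'" using z[of "b - b'"] by simp
  qed
  show "(0, 0) \<in> A" using csubspace_0[OF A] by (simp add: zero_prod_def)
  show "(a + a', b + b') \<in> A" if "(a, b) \<in> A \<and> (a', b') \<in> A" for a b a' b'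
    using csubspace_add[OF A, of "(a, b)" "(a', b')"] that by simp
  show "(c *\<^sub>C a, c *\<^sub>C b) \<in> A" if "(a, b) \<in> A" for c a b
    using csubspace_scaleC[OF A that, of c] by (simp add: scaleC_Pair)
qed

text \<open>Subtracting an everywhere defined bounded operator keeps the domain and closedness, so
  no closure has to be taken.\<close>

definition minus_bounded :: "'h::complex_hilbert_space operator \<Rightarrow> ('h \<Rightarrow> 'h) \<Rightarrow> 'h operator" where
  "minus_bounded X z = {(h, k). (h, k + z h) \<in> X}"

lemma in_minus_bounded: "(h, k) \<in> minus_bounded X z \<longleftrightarrow> (h, k + z h) \<in> X"
  by (simp add: minus_bounded_def)

text \<open>Invariance suffices, since the inverse of a unitary in the commutant is again
  one.\<close>

lemma (in vn_algebra) affiliatedI: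
  fixes X :: "'h operator"
  assumes X: "\<And>u a b. u \<in> \<C> \<Longrightarrow> unitary_op u \<Longrightarrow> (a, b) \<in> X \<Longrightarrow> (u a, u b) \<in> X" shows "affiliated \<M> X"
  unfolding affiliated_def
proof (intro ballI impI set_eqI)
  fix u and p :: "'h \<times> 'h" assume u: "u \<in> \<C>" "unitary_op u"
  obtain a b where p: "p = (a, b)" by (cases p)
  have un: "u (badjoint u h) = h" "badjoint u (u h) = h" for h
    using u(2) by (auto simp: unitary_op_def fun_eq_iff)
  have "(a, badjoint u b) \<in> X" if "(u a, b) \<in> X" using X[OF C_adj[OF u(1)] unitary_badjoint[OF u(2)] that] by (simp add: un)
  moreover have "(u a, u (badjoint u b)) \<in> X" if "(a, badjoint u b) \<in> X" using X[OF u that] .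
  ultimately have "(u a, b) \<in> X \<longleftrightarrow> (\<exists>c. (a, c) \<in> X \<and> b = u c)" using X[OF u] un by metis
  then show "p \<in> X O graph u \<longleftrightarrow> p \<in> graph u O X" by (auto simp: p in_graph)
qed

context measurable_op
begin

lemma minus_bounded: assumes z: "z \<in> \<M>" shows "minus_bounded X z \<in> measurable_operators \<M> \<tau>"
proof -
  note lz = bounded_clinear_simps[OF M_clinear[OF z]]
  have "Domain (minus_bounded X z) = Domain X"
  proof (intro equalityI subsetI)
    fix h assume "h \<in> Domain X"
    then obtain k where "(h, k) \<in> X" by blast
    then have "(h, k - z h) \<in> minus_bounded X z" by (simp add: in_minus_bounded)
    then show "h \<in> Domain (minus_bounded X z)" by blast
  qed (auto simp: minus_bounded_def)
  moreover have eq: "minus_bounded X z = (\<lambda>p. (fst p, snd p + z (fst p))) -` X" by (auto simp: minus_bounded_def)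
  have "csubspace (minus_bounded X z)"
    unfolding eq by (rule csubspace_vimage[OF sub]) (auto simp: lz scaleC_prod_def scaleC_add_right add_ac)
  then have "linear_operator (minus_bounded X z)"
    by (rule linear_operatorI) (use linear_operator_zero_domain[OF lin] in \<open>simp add: in_minus_bounded lz\<close>)
  moreover have "closed (minus_bounded X z)"
  proof -
    have "continuous_on UNIV (\<lambda>p. z (fst p))"
      by (rule continuous_on_compose2[OF bounded_clinear_continuous[OF M_clinear[OF z], of UNIV] continuous_on_fst[OF continuous_on_id]]) simp
    then have c: "continuous_on UNIV (\<lambda>p. (fst p, snd p + z (fst p)))"
      by (intro continuous_on_Pair continuous_on_add continuous_on_fst continuous_on_snd continuous_on_id)
    show ?thesis unfolding eq using closed_vimage[OF cl c] by simp
  qed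
  ultimately have 1: "closed_densely_defined (minus_bounded X z)" using dense by (simp add: closed_densely_defined_def)
  have 2: "affiliated \<M> (minus_bounded X z)"
  proof (rule affiliatedI)
    fix u a b assume u: "u \<in> \<C>" "unitary_op u" and "(a, b) \<in> minus_bounded X z"
    then have "(u a, u (b + z a)) \<in> X" using aff_unitary[OF u] by (simp add: in_minus_bounded)
    then show "(u a, u b) \<in> minus_bounded X z"
      by (simp add: in_minus_bounded C_comm[OF u(1) z] bounded_clinear_simps[OF C_clinear'[OF u(1)]])
  qed
  have "\<exists>p\<in>\<M>. projection_op p \<and> range p \<subseteq> Domain (minus_bounded X z) \<and> \<tau> (perp p) < ennreal e \<and> (\<exists>T\<in>\<M>. graph p O minus_bounded X z = graph T)"
    if e: "0 < e" for e
  proof -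
    have "0 < e / 2" using e by simp
    from tau_F_small[OF this] obtain s where s: "0 < s" "\<tau> (perp (F s)) \<le> ennreal (e / 2)" by blast
    have "ennreal (e / 2) < ennreal e" using e by (simp add: ennreal_less_iff)
    with s(2) have tau: "\<tau> (perp (F s)) < ennreal e" by (rule le_less_trans)
    obtain T where T: "T \<in> \<M>" "\<forall>h. (F s h, T h) \<in> X" using cut_exists[of s] s(1) by auto
    have in_X: "(F s h, k) \<in> X \<longleftrightarrow> k = T h" for h k using linear_operator_single[OF lin] T(2) by blast
    have eq: "k + z (F s h) = T h \<longleftrightarrow> k = T h - z (F s h)" for h k by (auto simp: algebra_simps)
    have "graph (F s) O minus_bounded X z = graph (\<lambda>h. T h - z (F s h))"
      unfolding set_eq_iff by (auto simp: in_graph in_minus_bounded in_X eq)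
    moreover have "(\<lambda>h. T h - z (F s h)) \<in> \<M>" by (rule M_diff[OF T(1) M_comp[OF z projs_M[OF F_projs]]])
    moreover have "(F s h, T h - z (F s h)) \<in> minus_bounded X z" for h using T(2) by (simp add: in_minus_bounded)
    then have "range (F s) \<subseteq> Domain (minus_bounded X z)" by blast
    ultimately show ?thesis using tau F_projs[of s] unfolding projs_iff by blast
  qed
  then show ?thesis using 1 2 by (simp add: measurable_operators_def)
qed

end

lemma strong_prod_graph_left: "strong_prod (graph d) Y = closure {(h, d k) | h k. (h, k) \<in> Y}"
proof -
  have "Y O graph d = {(h, d k) | h k. (h, k) \<in> Y}" by (auto simp: graph_def)
  then show ?thesis by (simp add: strong_prod_def)
qed

lemma strong_prod_graph_right: "strong_prod Y (graph d) = closure {(h, k). (d h, k) \<in> Y}"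
proof -
  have "graph d O Y = {(h, k). (d h, k) \<in> Y}" by (auto simp: graph_def)
  then show ?thesis by (simp add: strong_prod_def)
qed

context measurable_op
begin

lemma compress_mem: assumes "(d h, k) \<in> X" shows "(h, d k) \<in> compress d X"
proof -
  let ?A = "{(h, d k) | h k. (h, k) \<in> X}"
  have "(d h, d k) \<in> ?A" using assms by blast
  then have "(d h, d k) \<in> closure ?A" by (rule subsetD[OF closure_subset])
  then have "(h, d k) \<in> {(h, k). (d h, k) \<in> closure ?A}" by simp
  then show ?thesis
    unfolding compress_def strong_prod_graph_right strong_prod_graph_left by (rule subsetD[OF closure_subset])
qed

text \<open>\<open>compress\<close> takes closures, so single-valuedness has to be proved. For a
  dense set of vectors \<open>w\<close> the image \<open>d w\<close> lies in the domain of the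
  adjoint of \<open>X\<close>, and the adjoint identity passes to both closures; a value over zero
  is then orthogonal to a dense set. Both density claims come from
  \<open>dense_criterion\<close>.\<close>

lemma compress_affil: assumes d: "d \<in> projs \<M>" shows "affil_op \<M> (compress d X)"
proof -
  let ?A = "{(h, d k) | h k. (h, k) \<in> X}"
  let ?B = "{(h, k). (d h, k) \<in> closure ?A}"
  have Z: "compress d X = closure ?B" unfolding compress_def strong_prod_graph_right strong_prod_graph_left ..
  note ld = bounded_clinear_simps[OF projs_clinear[OF d]]
  have cd: "continuous_on UNIV d" by (rule bounded_clinear_continuous[OF projs_clinear[OF d]])
  have "?A = (\<lambda>p. (fst p, d (snd p))) ` X" by (force simp: image_iff)
  moreover have "csubspace ((\<lambda>p. (fst p, d (snd p))) ` X)" by (rule csubspace_image[OF sub]) (simp_all add: ld scaleC_prod_def)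
  ultimately have sA: "csubspace ?A" by (simp only:)
  have "?B = (\<lambda>p. (d (fst p), snd p)) -` closure ?A" by auto
  moreover have "csubspace ((\<lambda>p. (d (fst p), snd p)) -` closure ?A)"
    by (rule csubspace_vimage[OF csubspace_closure[OF sA]]) (simp_all add: ld scaleC_prod_def)
  ultimately have sB: "csubspace ?B" by (simp only:)
  have inv: "(u h, u k) \<in> compress d X" if u: "u \<in> \<C>" "unitary_op u" and hk: "(h, k) \<in> compress d X" for u h k
  proof -
    have cu: "continuous_on S (\<lambda>p. (u (fst p), u (snd p)))" for S
      by (intro continuous_on_Pair continuous_on_compose2[OF bounded_clinear_continuous[OF C_clinear'[OF u(1)], of UNIV]]
          continuous_on_fst continuous_on_snd continuous_on_id) simp_all
    have 1: "(\<lambda>p. (u (fst p), u (snd p))) ` closure ?A \<subseteq> closure ?A"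
    proof (rule image_closure_subset[OF cu closed_closure])
      show "(\<lambda>p. (u (fst p), u (snd p))) ` ?A \<subseteq> closure ?A"
      proof (intro image_subsetI subsetD[OF closure_subset])
        fix p assume "p \<in> ?A"
        then obtain h k where hk: "p = (h, d k)" "(h, k) \<in> X" by blast
        have "(u h, u k) \<in> X" by (rule aff_unitary[OF u hk(2)])
        then show "(u (fst p), u (snd p)) \<in> ?A" using C_comm[OF u(1) projs_M[OF d], of k] by (auto simp: hk(1))
      qed
    qed
    have "(\<lambda>p. (u (fst p), u (snd p))) ` closure ?B \<subseteq> closure ?B"
    proof (rule image_closure_subset[OF cu closed_closure], intro image_subsetI subsetD[OF closure_subset])
      fix p assume "p \<in> ?B"
      then have "(d (fst p), snd p) \<in> closure ?A" by auto
      then have "(u (d (fst p)), u (snd p)) \<in> closure ?A" using 1 by auto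
      then show "(u (fst p), u (snd p)) \<in> ?B" using C_comm[OF u(1) projs_M[OF d], of "fst p"] by simp
    qed
    then show ?thesis using hk unfolding Z by auto
  qed
  let ?L = "{w. \<exists>z. \<forall>(a, k)\<in>X. cinner k (d w) = cinner a z}"
  have L: "closure ?L = UNIV"
  proof (rule dense_criterion)
    show "csubspace ?L"
      unfolding csubspace_def
    proof (intro conjI ballI allI)
      show "0 \<in> ?L" by (auto simp: ld intro: exI[of _ 0])
      fix w w' assume "w \<in> ?L" "w' \<in> ?L"
      then obtain z z' where z: "\<forall>(a, k)\<in>X. cinner k (d w) = cinner a z" "\<forall>(a, k)\<in>X. cinner k (d w') = cinner a z'" by blast
      have "cinner k (d (w + w')) = cinner a (z + z')" if "(a, k) \<in> X" for a k
        using bspec[OF z(1) that] bspec[OF z(2) that] by (simp add: ld cinner_add_right)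
      then have "\<forall>(a, k)\<in>X. cinner k (d (w + w')) = cinner a (z + z')" by blast
      then show "w + w' \<in> ?L" by blast
    next
      fix c w assume "w \<in> ?L"
      then obtain z where "\<forall>(a, k)\<in>X. cinner k (d w) = cinner a z" by blast
      then have "\<forall>(a, k)\<in>X. cinner k (d (c *\<^sub>C w)) = cinner a (c *\<^sub>C z)" by (auto simp: ld cinner_scaleC_right)
      then show "c *\<^sub>C w \<in> ?L" by blast
    qed
    show "invariant ?L"
      unfolding invariant_def
    proof (intro ballI impI)
      fix u w assume u: "u \<in> \<C>" "unitary_op u" and "w \<in> ?L"
      then obtain z where z: "\<forall>(a, k)\<in>X. cinner k (d w) = cinner a z" by blast
      note u' = C_adj[OF u(1)] unitary_badjoint[OF u(2)]
      have "cinner k (d (u w)) = cinner a (u z)" if ak: "(a, k) \<in> X" for a k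
      proof -
        have "cinner k (d (u w)) = cinner k (u (d w))" using C_comm[OF u(1) projs_M[OF d], of w] by simp
        also have "\<dots> = cinner (badjoint u k) (d w)" by (simp add: cinner_badjoint'[OF C_clinear'[OF u(1)]])
        also have "\<dots> = cinner (badjoint u a) z" using z aff_unitary[OF u' ak] by blast
        finally show ?thesis by (simp add: cinner_badjoint'[OF C_clinear'[OF u(1)]])
      qed
      then show "u w \<in> ?L" by blast
    qed
    fix e :: real assume "0 < e"
    from adjoint_domain[OF this] obtain q where q: "q \<in> projs \<M>" "\<tau> (perp q) \<le> ennreal e"
      "\<forall>h. q h = h \<longrightarrow> (\<exists>z. \<forall>(a, k)\<in>X. cinner k h = cinner a z)" by blast
    obtain r where r: "r \<in> projs \<M>" "\<forall>h. r h = h \<longleftrightarrow> q (d h) = d h" "\<tau> (perp r) \<le> \<tau> (perp q)"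
      using pullback[OF projs_M[OF d] q(1)] by blast
    have "range r \<subseteq> ?L" using q(3) r(2) projs_idem[OF r(1)] by blast
    then show "\<exists>p\<in>projs \<M>. range p \<subseteq> ?L \<and> \<tau> (perp p) \<le> ennreal e" using r(1) order_trans[OF r(3) q(2)] by blast
  qed
  have adj: "cinner k w = cinner h (d z)" if hk: "(h, k) \<in> compress d X" and z: "\<forall>(a, k)\<in>X. cinner k (d w) = cinner a z" for h k w z
  proof -
    have cl: "closed {p. cinner (snd p) w = cinner (fst p) v}" for v
      by (intro closed_Collect_eq bounded_bilinear.continuous_on[OF bounded_bilinear_cinner] continuous_intros)
    have "?A \<subseteq> {p. cinner (snd p) w = cinner (fst p) z}"
      using z by (auto simp: proj_cinner[OF projs_proj[OF d]])
    then have "closure ?A \<subseteq> {p. cinner (snd p) w = cinner (fst p) z}" by (rule closure_minimal[OF _ cl])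
    then have "?B \<subseteq> {p. cinner (snd p) w = cinner (fst p) (d z)}"
      by (auto simp: proj_cinner[OF projs_proj[OF d], symmetric])
    then have "closure ?B \<subseteq> {p. cinner (snd p) w = cinner (fst p) (d z)}" by (rule closure_minimal[OF _ cl])
    then show ?thesis using hk unfolding Z by auto
  qed
  have zero: "k = 0" if k: "(0, k) \<in> compress d X" for k
  proof -
    have "cinner k w = 0" if "w \<in> ?L" for w using that adj[OF k] by auto
    then have "\<forall>w\<in>?L. cinner k w = 0" by blast
    moreover have "closed {w. cinner k w = 0}" by (intro closed_Collect_eq bounded_bilinear.continuous_on[OF bounded_bilinear_cinner] continuous_intros)
    ultimately have "closure ?L \<subseteq> {w. cinner k w = 0}" by (intro closure_minimal) auto
    then have "cinner k k = 0" using L by blast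
    then show ?thesis by (simp add: cinner_self)
  qed
  have lZ: "linear_operator (compress d X)"
    by (rule linear_operatorI[OF _ zero]) (simp_all add: Z csubspace_closure[OF sB])
  have dZ: "closure (Domain (compress d X)) = UNIV"
  proof (rule dense_criterion[OF Domain_csubspace[OF lZ]])
    show "invariant (Domain (compress d X))" unfolding invariant_def using inv by blast
    fix e :: real assume "0 < e"
    from tau_F_small[OF this] obtain s where s: "0 < s" "\<tau> (perp (F s)) \<le> ennreal e" by blast
    obtain T where T: "\<forall>h. (F s h, T h) \<in> X" using cut_exists[of s] s(1) by auto
    obtain r where r: "r \<in> projs \<M>" "\<forall>h. r h = h \<longleftrightarrow> F s (d h) = d h" "\<tau> (perp r) \<le> \<tau> (perp (F s))"
      using pullback[OF projs_M[OF d] F_projs] by blast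
    have "r h \<in> Domain (compress d X)" for h
    proof -
      have "F s (d (r h)) = d (r h)" using r(2) projs_idem[OF r(1)] by blast
      then have "(d (r h), T (d (r h))) \<in> X" using T by metis
      then show ?thesis using compress_mem by blast
    qed
    then show "\<exists>p\<in>projs \<M>. range p \<subseteq> Domain (compress d X) \<and> \<tau> (perp p) \<le> ennreal e" using r(1) order_trans[OF r(3) s(2)] by blast
  qed
  have "closed (compress d X)" unfolding Z by simp
  then have "closed_op (compress d X)" using lZ dZ by unfold_locales (simp add: closed_densely_defined_def)
  moreover have "affiliated \<M> (compress d X)" by (rule affiliatedI) (rule inv)
  ultimately show ?thesis by (simp add: affil_op_def affil_op_axioms_def vn_algebra_axioms)
qed

end

section \<open>The splitting theorem\<close>

lemma graph_closed_linear: assumes "bounded_clinear T" shows "closed (graph T)"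
  using graph_closed_op[OF assms] by (simp add: closed_op_def closed_densely_defined_def)

lemma compress_graph:
  assumes d: "bounded_clinear d" and T: "bounded_clinear T"
  shows "compress d (graph T) = graph (\<lambda>h. d (T (d h)))"
proof -
  have 1: "{(h, d k) | h k. (h, k) \<in> graph T} = graph (\<lambda>h. d (T h))" by (auto simp: graph_def)
  have 2: "{(h, k). (d h, k) \<in> graph (\<lambda>h. d (T h))} = graph (\<lambda>h. d (T (d h)))" by (auto simp: graph_def)
  show ?thesis
    unfolding compress_def strong_prod_graph_left[of d "graph T"] 1
      closure_closed[OF graph_closed_linear[OF bounded_clinear_compose[OF d T]]]
    unfolding strong_prod_graph_right 2
    by (rule closure_closed[OF graph_closed_linear[OF bounded_clinear_compose[OF d bounded_clinear_compose[OF T d]]]])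
qed

lemma compress_id: assumes "closed X" shows "compress (\<lambda>h. h) X = X"
proof -
  have "{(h, k) | h k. (h, k) \<in> X} = X" "{(h, k). (h, k) \<in> X} = X" by auto
  then show ?thesis
    unfolding compress_def strong_prod_graph_left[of "\<lambda>h. h" X]
    unfolding strong_prod_graph_right by (simp add: closure_closed[OF assms])
qed

lemma graph_measurable: assumes "traced_algebra \<M> \<tau>" "T \<in> \<M>" shows "graph T \<in> measurable_operators \<M> \<tau>"
proof -
  interpret traced_algebra \<M> \<tau> by fact
  interpret affil_op \<M> "graph T" by (rule graph_affil[OF assms(2)])
  have "graph (\<lambda>h. h) O graph T = graph T" by (auto simp: graph_def)
  moreover have "range (\<lambda>h. h) \<subseteq> Domain (graph T)" by (auto simp: graph_def)
  ultimately have "\<exists>p\<in>\<M>. projection_op p \<and> range p \<subseteq> Domain (graph T) \<and> \<tau> (perp p) < ennreal e \<and> (\<exists>S\<in>\<M>. graph p O graph T = graph S)"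
    if "0 < e" for e using projs_id that assms(2) unfolding projs_iff by (intro bexI[of _ "\<lambda>h. h"]) (auto simp: tau_0)
  then show ?thesis using cdd aff by (simp add: measurable_operators_def)
qed

context traced_function_space
begin

lemma singular_value_in:
  assumes Z: "affil_op \<M> Z" and G: "G \<in> E" "\<And>t. 0 < t \<Longrightarrow> 0 \<le> G t"
    and p: "\<And>t. 0 < t \<Longrightarrow> \<exists>p\<in>projs \<M>. \<tau> (perp p) \<le> ennreal t \<and> (\<forall>h. p h = h \<longrightarrow> (\<exists>k. (h, k) \<in> Z \<and> norm k \<le> G t * norm h))"
  shows "(\<lambda>t. enn2real (singular_value \<tau> Z t)) \<in> E" "nc_norm \<tau> N Z \<le> N G"
proof -
  interpret affil_op \<M> Z by (rule Z)
  interpret traced_op \<M> \<tau> Z by unfold_locales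
  have m: "(\<lambda>t. enn2real (singular_value \<tau> Z t)) \<in> borel_measurable half_line"
    using mu_measurable by (simp add: mu_def[abs_def])
  have "\<bar>enn2real (singular_value \<tau> Z t)\<bar> \<le> \<bar>G t\<bar>" if t: "0 < t" for t
  proof -
    obtain p where p: "p \<in> projs \<M>" "\<tau> (perp p) \<le> ennreal t" "\<forall>h. p h = h \<longrightarrow> (\<exists>k. (h, k) \<in> Z \<and> norm k \<le> G t * norm h)"
      using p[OF t] by blast
    have "mu t \<le> G t" by (rule mu_le[OF p(1,2) G(2)[OF t]]) (use p(3) in blast)
    then show ?thesis using G(2)[OF t] by (simp add: mu_def)
  qed
  from mono_pos[OF G(1) m this] show "(\<lambda>t. enn2real (singular_value \<tau> Z t)) \<in> E" "nc_norm \<tau> N Z \<le> N G"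
    by (simp_all add: nc_norm_def)
qed

lemma small_graph: assumes T: "T \<in> \<M>" "small T e"
  shows "graph T \<in> nc_space \<M> \<tau> E" "nc_norm \<tau> N (graph T) \<le> e"
proof -
  obtain G where G: "G \<in> E" "N G \<le> e" "\<And>t. 0 < t \<Longrightarrow> 0 \<le> G t" "\<And>t. 0 < t \<Longrightarrow> bdd_off T t (G t)"
    using assms(2) unfolding small_def by blast
  have "\<exists>p\<in>projs \<M>. \<tau> (perp p) \<le> ennreal t \<and> (\<forall>h. p h = h \<longrightarrow> (\<exists>k. (h, k) \<in> graph T \<and> norm k \<le> G t * norm h))" if "0 < t" for t
    using G(4)[OF that] unfolding bdd_off_def by (simp add: in_graph)
  note * = singular_value_in[OF graph_affil[OF T(1)] G(1,3) this]
  show "graph T \<in> nc_space \<M> \<tau> E"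
    using *(1) graph_measurable[OF traced_algebra_axioms T(1)] by (simp add: nc_space_def)
  show "nc_norm \<tau> N (graph T) \<le> e" using *(2) G(2) by simp
qed

end

locale nc_element = lower_estimate_space \<M> \<tau> E N q
  for \<M> :: "('h::complex_hilbert_space \<Rightarrow> 'h) set" and \<tau> and E and N and q +
  fixes X :: "'h operator"
  assumes nc: "X \<in> nc_space \<M> \<tau> E"
begin

sublocale measurable_op \<M> \<tau> X
proof unfold_locales
  show "X \<in> measurable_operators \<M> \<tau>" using nc by (simp add: nc_space_def)
  then show "closed_densely_defined X" "affiliated \<M> X" by (simp_all add: measurable_operators_def)
qed

lemma mu_E: "mu \<in> E" using nc by (simp add: nc_space_def mu_def[abs_def])

lemma nc_norm_mu: "nc_norm \<tau> N X = N mu" by (simp add: nc_norm_def mu_def[abs_def])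

text \<open>The bounded operator \<open>X (F (mu d))\<close>, that is, \<open>X\<close> without its
  spectral part above the level \<open>mu d\<close>.\<close>

definition trunc :: "real \<Rightarrow> 'h \<Rightarrow> 'h" where
  "trunc d = (SOME T. T \<in> \<M> \<and> (\<forall>h. (F (mu d) h, T h) \<in> X))"

lemma trunc: "trunc d \<in> \<M>" "(F (mu d) h, trunc d h) \<in> X"
proof -
  have "\<exists>T. T \<in> \<M> \<and> (\<forall>h. (F (mu d) h, T h) \<in> X)" using cut_exists[OF mu_nonneg, of d] by blast
  from someI_ex[OF this, folded trunc_def] show "trunc d \<in> \<M>" "(F (mu d) h, trunc d h) \<in> X" by simp_all
qed

lemma trunc_eq: "(F (mu d) h, k) \<in> X \<Longrightarrow> trunc d h = k"
  by (rule linear_operator_single[OF lin trunc(2)])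

lemma trunc_tame: assumes d: "0 < d" shows "tame (trunc d) mu (\<lambda>t. F (mu t))"
  unfolding tame_def
proof (intro conjI allI impI trunc(1) mu_E mu_antimono mu_nonneg F_projs tau_F_mu)
  fix t :: real and h assume t: "0 < t"
  let ?w = "F (mu d) (F (mu t) h)"
  \<comment> \<open>Both orders of \<open>mu t\<close> and \<open>mu d\<close> occur, as
    \<open>t\<close> is arbitrary; in either case the smaller spectral projection is fixed by the
    larger.\<close>
  have w: "F (mu t) ?w = ?w"
    using F_mono[of "mu t" "mu d" h] F_mono[of "mu d" "mu t" "F (mu t) h"] by (cases "mu t \<le> mu d") (simp_all add: F_idem)
  obtain T where T: "\<forall>h. (F (mu t) h, T h) \<in> X \<and> norm (T h) \<le> mu t * norm (F (mu t) h)" using cut_exists[OF mu_nonneg, of t] by blast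
  have "(?w, T ?w) \<in> X" "norm (T ?w) \<le> mu t * norm ?w" using T[rule_format, of ?w] by (simp_all only: w)
  moreover from this(1) have "trunc d (F (mu t) h) = T ?w" by (rule trunc_eq)
  moreover have "mu t * norm ?w \<le> mu t * norm (F (mu t) h)" by (intro mult_left_mono mu_nonneg projs_norm[OF F_projs])
  ultimately show "norm (trunc d (F (mu t) h)) \<le> mu t * norm (F (mu t) h)" by simp
next
  fix s t :: real and h assume "0 < s" "s \<le> t"
  then show "F (mu s) (F (mu t) h) = F (mu t) h" by (rule F_mono[OF mu_antimono])
qed

text \<open>\<open>X - z\<close> is the truncation minus \<open>z\<close>, dominated by hypothesis,
  plus the removed head, dominated by \<open>mu\<close> on \<open>[0, d)\<close>. Evaluating both at
  \<open>t / 2\<close> brings in \<open>K\<close>. This is where unbounded operators re-enter the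
  estimates.\<close>

lemma compress_bound:
  assumes z: "z \<in> \<M>" and p: "p \<in> projs \<M>" and d: "0 < d"
    and e1: "small (\<lambda>h. p (trunc d (p h) - z (p h))) e1" and e2: "N (restr {0..<d} mu) \<le> e2"
  shows "(\<lambda>t. enn2real (singular_value \<tau> (compress p (minus_bounded X z)) t)) \<in> E"
    "nc_norm \<tau> N (compress p (minus_bounded X z)) \<le> K * (e1 + e2)"
proof -
  let ?Y = "minus_bounded X z" and ?x = "\<lambda>h. p (trunc d (p h) - z (p h))"
  obtain G where G: "G \<in> E" "N G \<le> e1" "\<And>t. 0 < t \<Longrightarrow> 0 \<le> G t" "\<And>t. 0 < t \<Longrightarrow> bdd_off ?x t (G t)"
    using e1 unfolding small_def by blast
  have Y: "?Y \<in> measurable_operators \<M> \<tau>" by (rule minus_bounded[OF z])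
  interpret Y: closed_op ?Y using Y by unfold_locales (simp add: measurable_operators_def)
  interpret Y: measurable_op \<M> \<tau> ?Y using Y by unfold_locales (simp_all add: measurable_operators_def)
  have in_Z: "(h, p k) \<in> compress p ?Y" if "(p h, k + z (p h)) \<in> X" for h k
    by (rule Y.compress_mem) (use that in \<open>simp add: in_minus_bounded\<close>)
  let ?R = "restr {0..<d} mu"
  have R: "?R \<in> E" by (rule restr_in(1)[OF mu_E]) simp
  let ?H = "\<lambda>t. G (t / 2) + ?R (t / 2)"
  have H: "?H \<in> E" "N ?H \<le> K * (N G + N ?R)" by (rule N_dilated_sum[OF G(1) R])+
  have "\<exists>r\<in>projs \<M>. \<tau> (perp r) \<le> ennreal t \<and> (\<forall>h. r h = h \<longrightarrow> (\<exists>k. (h, k) \<in> compress p ?Y \<and> norm k \<le> ?H t * norm h))"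
    if t: "0 < t" for t
  proof -
    have t2: "0 < t / 2" using t by simp
    \<comment> \<open>If \<open>t / 2\<close> is at least \<open>d\<close>, vectors below the level
      \<open>mu d\<close> suffice and no head is left; otherwise the level \<open>mu (t / 2)\<close>
      bounds it. The minimum serves both cases with cotrace at most \<open>t / 2\<close>.\<close>
    let ?s = "min (t / 2) d"
    have s: "0 < ?s" using t2 d by simp
    obtain p1 where p1: "p1 \<in> projs \<M>" "\<tau> (perp p1) \<le> ennreal (t / 2)" "\<forall>h. p1 h = h \<longrightarrow> norm (?x h) \<le> G (t / 2) * norm h"
      using G(4)[OF t2] unfolding bdd_off_def by blast
    obtain p2 where p2: "p2 \<in> projs \<M>" "\<forall>h. p2 h = h \<longleftrightarrow> F (mu ?s) (p h) = p h" "\<tau> (perp p2) \<le> \<tau> (perp (F (mu ?s)))"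
      using pullback[OF projs_M[OF p] F_projs] by blast
    have S: "{p1, p2} \<subseteq> projs \<M>" using p1 p2 by simp
    have "\<tau> (perp p2) \<le> ennreal ?s" using p2(3) tau_F_mu[OF s] by (rule order_trans)
    also have "\<dots> \<le> ennreal (t / 2)" by (rule ennreal_leI) simp
    finally have "\<tau> (perp p1) + \<tau> (perp p2) \<le> ennreal (t / 2) + ennreal (t / 2)" using p1(2) by (intro add_mono)
    then have tau: "\<tau> (perp (meet {p1, p2})) \<le> ennreal t"
      using cotrace_meet2[OF p1(1) p2(1)] t by (simp add: ennreal_plus[symmetric] order_trans del: ennreal_plus)
    have "\<exists>k. (h, k) \<in> compress p ?Y \<and> norm k \<le> ?H t * norm h" if "meet {p1, p2} h = h" for h
    proof -
      have h: "norm (?x h) \<le> G (t / 2) * norm h" "F (mu ?s) (p h) = p h"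
        using that p1(3) p2(2) unfolding meet_fix[OF S] by simp_all
      show ?thesis
      proof (cases "d \<le> t / 2")
        case True
        then have "F (mu d) (p h) = p h" using h(2) by (simp add: min_absorb2)
        then have "(p h, (trunc d (p h) - z (p h)) + z (p h)) \<in> X" using trunc(2)[of d "p h"] by simp
        from in_Z[OF this] show ?thesis using h(1) True by (intro exI[of _ "?x h"]) simp
      next
        case False
        then have s: "?s = t / 2" by simp
        obtain T where T: "\<forall>h. (F (mu (t / 2)) h, T h) \<in> X \<and> norm (T h) \<le> mu (t / 2) * norm (F (mu (t / 2)) h)"
          using cut_exists[OF mu_nonneg] by blast
        have Fp: "F (mu (t / 2)) (p h) = p h" using h(2) by (simp only: s)
        let ?k = "T (p h)"
        have k: "(p h, ?k) \<in> X" "norm ?k \<le> mu (t / 2) * norm (p h)" using T[rule_format, of "p h"] by (simp_all only: Fp)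
        obtain k1 k2 where k0: "(F (mu d) (p h), k1) \<in> X \<and> (p h - F (mu d) (p h), k2) \<in> X \<and> ?k = k1 + k2 \<and> (norm ?k)\<^sup>2 = (norm k1)\<^sup>2 + (norm k2)\<^sup>2"
          using F_split[OF k(1), of "mu d"] by (elim exE) (rule that)
        have k1: "k1 = trunc d (p h)" by (rule trunc_eq[OF k0[THEN conjunct1], symmetric])
        have "norm k2 \<le> norm ?k" 
          by (rule power2_le_imp_le) (use k0[THEN conjunct2, THEN conjunct2, THEN conjunct2] in simp_all)
        also have "\<dots> \<le> mu (t / 2) * norm h"
          using k(2) mult_left_mono[OF projs_norm[OF p] mu_nonneg] by (rule order_trans)
        finally have k2: "norm k2 \<le> ?R (t / 2) * norm h" using False t by simp
        have "(p h, (trunc d (p h) - z (p h) + k2) + z (p h)) \<in> X" using k(1) k0 k1 by (simp add: algebra_simps)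
        from in_Z[OF this] have "(h, ?x h + p k2) \<in> compress p ?Y" by (simp add: projs_lin(1)[OF p])
        moreover have "norm (?x h + p k2) \<le> ?H t * norm h"
          using norm_triangle_ineq[of "?x h" "p k2"] h(1) k2 projs_norm[OF p, of k2] unfolding distrib_right by linarith
        ultimately show ?thesis by blast
      qed
    qed
    then show ?thesis using meet_projs[OF S] tau by blast
  qed
  note * = singular_value_in[OF Y.compress_affil[OF p] H(1) _ this]
  have nn: "0 \<le> ?H t" if "0 < t" for t using G(3)[of "t / 2"] that mu_nonneg by simp
  show "(\<lambda>t. enn2real (singular_value \<tau> (compress p ?Y) t)) \<in> E" by (rule *(1)) (use nn in simp_all)
  have "nc_norm \<tau> N (compress p ?Y) \<le> N ?H" by (rule *(2)) (use nn in simp_all)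
  also have "\<dots> \<le> K * (N G + N ?R)" by (rule H(2))
  also have "\<dots> \<le> K * (e1 + e2)" using G(2) e2 K_ge by (intro mult_left_mono add_mono) auto
  finally show "nc_norm \<tau> N (compress p ?Y) \<le> K * (e1 + e2)" .
qed

text \<open>As \<open>p\<close> lies below \<open>F (mu d)\<close>, on its range \<open>X\<close> is
  the bounded truncation and the compression sends every vector to zero; single-valuedness excludes
  other values.\<close>

lemma compress_minus_corner:
  assumes p: "p \<in> projs \<M>" and le: "\<And>h. F (mu d) (p h) = p h"
  shows "compress p (minus_bounded X (\<lambda>h. p (trunc d (p h)))) = graph (\<lambda>h. 0)"
proof -
  let ?z = "\<lambda>h. p (trunc d (p h))"
  have z: "?z \<in> \<M>" by (rule M_comp[OF projs_M[OF p] M_comp[OF trunc(1) projs_M[OF p]]])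
  have Y: "minus_bounded X ?z \<in> measurable_operators \<M> \<tau>" by (rule minus_bounded[OF z])
  interpret Y: closed_op "minus_bounded X ?z" using Y by unfold_locales (simp add: measurable_operators_def)
  interpret Y: measurable_op \<M> \<tau> "minus_bounded X ?z" using Y by unfold_locales (simp_all add: measurable_operators_def)
  interpret Z: affil_op \<M> "compress p (minus_bounded X ?z)" by (rule Y.compress_affil[OF p])
  have "(h, 0) \<in> compress p (minus_bounded X ?z)" for h
  proof -
    have "(p h, trunc d (p h)) \<in> X" using trunc(2)[of d "p h"] by (simp only: le)
    then have "(p h, trunc d (p h) - ?z (p h)) \<in> minus_bounded X ?z" by (simp add: in_minus_bounded)
    then have "(h, p (trunc d (p h) - ?z (p h))) \<in> compress p (minus_bounded X ?z)" by (rule Y.compress_mem)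
    then show ?thesis by (simp add: projs_lin[OF p] projs_idem[OF p])
  qed
  then have "(h, k) \<in> compress p (minus_bounded X ?z) \<longleftrightarrow> k = 0" for h k
    using linear_operator_single[OF Z.lin] by blast
  then show ?thesis by (auto simp: graph_def)
qed

context
  fixes p and d :: real
  assumes p: "p \<in> projs \<M>" and d: "0 < d"
begin

abbreviation corner :: "'h \<Rightarrow> 'h" where "corner \<equiv> \<lambda>h. p (trunc d (p h))"

lemma corner_M: "corner \<in> \<M>"
  by (rule M_comp[OF projs_M[OF p] M_comp[OF trunc(1) projs_M[OF p]]])

lemma small_trunc: "small (trunc d) (N mu)" "small corner (N mu)"
proof -
  show 1: "small (trunc d) (N mu)"
    by (rule smallI[OF mu_E order_refl mu_nonneg]) (rule tame_bdd_off[OF trunc_tame[OF d]])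
  show "small corner (N mu)"
    by (rule small_left[OF small_right[OF 1 projs_M[OF p] projs_norm[OF p]] projs_norm[OF p]])
qed

lemma corner_nc: "graph corner \<in> nc_space \<M> \<tau> E" "nc_norm \<tau> N (graph corner) \<le> N mu"
  by (rule small_graph[OF corner_M small_trunc(2)])+

lemma remainder_nc:
  assumes e: "N (restr {0..<d} mu) \<le> e"
  shows "minus_bounded X corner \<in> nc_space \<M> \<tau> E"
    "nc_norm \<tau> N (minus_bounded X corner) \<le> K * (K * (N mu + N mu) + e)"
proof -
  have Y: "minus_bounded X corner \<in> measurable_operators \<M> \<tau>" by (rule minus_bounded[OF corner_M])
  then have "closed (minus_bounded X corner)" by (simp add: measurable_operators_def closed_densely_defined_def)
  \<comment> \<open>Compression by the identity makes \<open>compress_bound\<close> a statement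
    about the remainder itself.\<close>
  note id = compress_id[OF this]
  have "small (\<lambda>h. trunc d h + - corner h) (K * (N mu + N mu))"
    by (rule small_add[OF small_trunc(1) small_left[OF small_trunc(2)]]) simp
  then have s: "small (\<lambda>h. (\<lambda>h. h) (trunc d ((\<lambda>h. h) h) - corner ((\<lambda>h. h) h))) (K * (N mu + N mu))" by simp
  note * = compress_bound[OF corner_M projs_id d s e, unfolded id]
  show "minus_bounded X corner \<in> nc_space \<M> \<tau> E" using Y *(1) by (simp add: nc_space_def)
  show "nc_norm \<tau> N (minus_bounded X corner) \<le> K * (K * (N mu + N mu) + e)" by (rule *(2))
qed

text \<open>The head beyond the given \<open>d\<close> need not be small compared with
  \<open>e\<close>, so the operator is truncated again at a finer \<open>d'\<close>. The new
  truncation is one fixed tame operator, covered by \<open>tame_decreasing_to_zero\<close>, and the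
  corner is small by hypothesis.\<close>

lemma single_equi_integrable:
  assumes D: "decreasing_to_zero \<M> D" and e: "0 < e"
    and c: "\<And>s. 0 < s \<Longrightarrow> \<exists>m0. \<forall>m\<ge>m0. small (\<lambda>h. D m (p (trunc d (p (D m h))))) s"
  shows "\<exists>m0. \<forall>m\<ge>m0. nc_norm \<tau> N (compress (D m) (minus_bounded X corner)) \<le> e"
proof -
  note DP = decreasing_to_zero_tendsto(1)[OF D]
  define s where "s = e / (2 * K)"
  define s' where "s' = s / (2 * K)"
  have s: "0 < s" "0 < s'" "K * (s + s) = e" "K * (s' + s') = s" using e K_ge by (simp_all add: s_def s'_def)
  obtain d' where d': "0 < d'" "N (restr {0..<d'} mu) \<le> s"
    using head_small[OF oc s(1) mu_E mu_nonneg] less_imp_le order_refl by metis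
  obtain m1 where m1: "\<forall>m\<ge>m1. small (\<lambda>h. trunc d' (D m h)) s'" using tame_decreasing_to_zero[OF trunc_tame[OF d'(1)] D s(2)] by blast
  obtain m2 where m2: "\<forall>m\<ge>m2. small (\<lambda>h. D m (p (trunc d (p (D m h))))) s'" using c[OF s(2)] by blast
  have "nc_norm \<tau> N (compress (D m) (minus_bounded X corner)) \<le> e" if m: "max m1 m2 \<le> m" for m
  proof -
    have 1: "small (\<lambda>h. D m (trunc d' (D m h))) s'" by (rule small_left[OF _ projs_norm[OF DP]]) (use m1 m in simp)
    have 2: "small (\<lambda>h. - D m (p (trunc d (p (D m h))))) s'" by (rule small_left[where a = uminus]) (use m2 m in simp_all)
    have "small (\<lambda>h. D m (trunc d' (D m h) - p (trunc d (p (D m h))))) s"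
      using small_add[OF 1 2, unfolded s(4)] by (simp add: projs_lin(2)[OF DP])
    from compress_bound(2)[OF corner_M DP d'(1) this d'(2)] show ?thesis by (simp only: s(3))
  qed
  then show ?thesis by blast
qed

end

lemma strong_sum_minus_bounded: "strong_sum (minus_bounded X z) (graph z) = X"
proof -
  have "{(h, a + b) | h a b. (h, a) \<in> minus_bounded X z \<and> (h, b) \<in> graph z} = X"
  proof (intro equalityI subsetI)
    fix w assume "w \<in> X"
    moreover obtain h k where "w = (h, k)" by (cases w)
    ultimately have "w = (h, (k - z h) + z h)" "(h, k - z h) \<in> minus_bounded X z" "(h, z h) \<in> graph z"
      by (simp_all add: in_minus_bounded in_graph)
    then show "w \<in> {(h, a + b) | h a b. (h, a) \<in> minus_bounded X z \<and> (h, b) \<in> graph z}" by blast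
  qed (auto simp: in_minus_bounded in_graph)
  then show ?thesis by (simp add: strong_sum_def closure_closed[OF cl])
qed

end

lemma ennreal_tendsto_0I:
  fixes f :: "nat \<Rightarrow> ennreal"
  assumes "\<And>e. 0 < e \<Longrightarrow> \<exists>m0. \<forall>m\<ge>m0. f m \<le> ennreal e" shows "f \<longlonglongrightarrow> 0"
proof (rule order_tendstoI)
  fix a :: ennreal assume a: "0 < a"
  obtain e where e: "0 < e" "ennreal e < a"
  proof (cases a)
    case (real r)
    then show ?thesis using a by (intro that[of "r / 2"]) (simp_all add: ennreal_less_iff)
  qed (use that[of 1] in simp)
  obtain m0 where "\<forall>m\<ge>m0. f m \<le> ennreal e" using assms[OF e(1)] by blast
  then show "\<forall>\<^sub>F m in sequentially. f m < a"
    unfolding eventually_sequentially using e(2) by (blast intro: le_less_trans)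
qed simp

theorem theorem3p7:
  fixes \<M> :: "('h::complex_hilbert_space \<Rightarrow> 'h) set"
    and \<tau> :: "('h \<Rightarrow> 'h) \<Rightarrow> ennreal"
    and E :: "(real \<Rightarrow> real) set"
    and N :: "(real \<Rightarrow> real) \<Rightarrow> real"
    and \<alpha> q :: real
    and x :: "nat \<Rightarrow> 'h operator"
  assumes "von_neumann_algebra \<M>"
    and "trace_on \<M> \<tau>" and "faithful_trace \<M> \<tau>"
    and "normal_trace \<M> \<tau>" and "semifinite_trace \<M> \<tau>"
    and "symmetric_quasi_banach_function_space E N"
    and "order_continuous E N"
    and "0 < \<alpha>" and "\<alpha> \<le> 1" and "convex_const_1 \<alpha> E N"
    and "\<alpha> \<le> q" and "lower_estimate_const_1 q E N"
    and "nc_bounded \<M> \<tau> E N (range x)"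
  shows "\<exists>(r :: nat \<Rightarrow> nat) (\<phi> :: nat \<Rightarrow> 'h operator) (\<zeta> :: nat \<Rightarrow> 'h operator) (e :: nat \<Rightarrow> 'h \<Rightarrow> 'h).
     strict_mono r \<and>
     nc_bounded \<M> \<tau> E N (range \<phi>) \<and> nc_bounded \<M> \<tau> E N (range \<zeta>) \<and>
     (\<forall>k. e k \<in> \<M> \<and> projection_op (e k)) \<and>
     (\<forall>k l. k \<noteq> l \<longrightarrow> e k \<circ> e l = (\<lambda>h. 0)) \<and>
     (\<forall>k. x (r k) = strong_sum (\<phi> k) (\<zeta> k)) \<and>
     equi_integrable \<M> \<tau> E N (range \<phi>) \<and>
     (\<forall>k. compress (e k) (\<phi> k) = graph (\<lambda>h. 0)) \<and>
     (\<forall>k. compress (e k) (\<zeta> k) = \<zeta> k)"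
proof -
  interpret symmetric_quasi_banach_function_space E N by fact
  interpret lower_estimate_space \<M> \<tau> E N q
    by unfold_locales (use assms in simp_all)
  obtain B where nc: "\<And>n. x n \<in> nc_space \<M> \<tau> E" and B: "\<And>n. nc_norm \<tau> N (x n) \<le> B"
    using assms(13) unfolding nc_bounded_def by blast
  have el: "nc_element \<M> \<tau> E N q (x n)" for n by unfold_locales (rule nc)
  define \<mu> where "\<mu> n = traced_op.mu \<tau> (x n)" for n
  define T where "T n = nc_element.trunc \<M> \<tau> (x n)" for n
  have \<mu>: "\<mu> n \<in> E" "0 \<le> \<mu> n t" "N (\<mu> n) \<le> B" for n t
  proof -
    interpret nc_element \<M> \<tau> E N q "x n" by (rule el)
    show "\<mu> n \<in> E" "0 \<le> \<mu> n t" "N (\<mu> n) \<le> B" using mu_E mu_nonneg B[of n] by (simp_all add: \<mu>_def nc_norm_mu)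
  qed
  have "\<exists>d>0. N (restr {0..<2 * d} (\<mu> n)) \<le> 1 / real (Suc n)" for n
  proof -
    obtain d where d: "0 < d" "\<forall>b\<le>d. N (restr {0..<b} (\<mu> n)) < 1 / real (Suc n)"
      using head_small[OF oc _ \<mu>(1,2), of "1 / real (Suc n)" n] by auto
    show ?thesis using d by (intro exI[of _ "d / 2"]) (simp add: less_imp_le)
  qed
  then obtain \<delta> where delta: "\<And>n. 0 < \<delta> n" "\<And>n. N (restr {0..<2 * \<delta> n} (\<mu> n)) \<le> 1 / real (Suc n)" by metis
  have delta': "N (restr {0..<\<delta> n} (\<mu> n)) \<le> 1 / real (Suc n)" for n
  proof -
    have "N (restr {0..<\<delta> n} (\<mu> n)) \<le> N (restr {0..<2 * \<delta> n} (\<mu> n))"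
      using delta(1)[of n] by (intro mono_pos(2) restr_in(1) \<mu> measurable[OF restr_in(1)]) (auto simp: indicator_def)
    then show ?thesis using delta(2) by (rule order_trans)
  qed
  interpret tame_sequence \<M> \<tau> E N q "\<lambda>n. T n (\<delta> n)" \<mu> "\<lambda>n t. opF (x n) (\<mu> n t)" \<delta> B
  proof
    fix n
    interpret nc_element \<M> \<tau> E N q "x n" by (rule el)
    show "tame (T n (\<delta> n)) (\<mu> n) (\<lambda>t. opF (x n) (\<mu> n t))" using trunc_tame[OF delta(1), of n] by (simp add: \<mu>_def T_def)
  qed (use \<mu> delta in simp_all)
  obtain r e where r: "strict_mono r" and e0: "\<forall>i. e i \<in> projs \<M>" "\<forall>i h. opF (x (r i)) (\<mu> (r i) (\<delta> (r i))) (e i h) = e i h"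
    "\<forall>i l h. i \<noteq> l \<longrightarrow> e i (e l h) = 0"
    and small0: "\<forall>D s. decreasing_to_zero \<M> D \<longrightarrow> 0 < s \<longrightarrow>
      (\<exists>j. \<forall>i\<ge>j. \<forall>m\<ge>j. small (\<lambda>h. D m (T (r i) (\<delta> (r i)) (D m h) - e i (T (r i) (\<delta> (r i)) (e i (D m h))))) s) \<and>
      (\<forall>i. \<exists>m0. \<forall>m\<ge>m0. small (\<lambda>h. D m (e i (T (r i) (\<delta> (r i)) (e i (D m h))))) s)"
    using splitting by (elim exE conjE) (rule that)
  note e = e0[rule_format] and tail = small0[rule_format, THEN conjunct1] and single = small0[rule_format, THEN conjunct2, rule_format]
  \<comment> \<open>The corner of the truncated operator is bounded and is also the corner of
    \<open>x (r i)\<close>, because \<open>e i\<close> lies below the truncating projection.\<close>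
  define z where "z i h = e i (T (r i) (\<delta> (r i)) (e i h))" for i h
  define \<phi> where "\<phi> i = minus_bounded (x (r i)) (z i)" for i
  have ri: "i \<le> r i" for i using r by (rule strict_mono_imp_increasing)
  have B0: "0 \<le> B" by (rule B_nonneg)
  have corner: "graph (z i) \<in> nc_space \<M> \<tau> E" "nc_norm \<tau> N (graph (z i)) \<le> B"
    and rem: "\<phi> i \<in> nc_space \<M> \<tau> E" "nc_norm \<tau> N (\<phi> i) \<le> K * (K * (B + B) + 1)"
    and zero: "compress (e i) (\<phi> i) = graph (\<lambda>h. 0)" and sum: "strong_sum (\<phi> i) (graph (z i)) = x (r i)"
    and zM: "z i \<in> \<M>"
    and cb: "\<And>p s s'. p \<in> projs \<M> \<Longrightarrow> small (\<lambda>h. p (T (r i) (\<delta> (r i)) (p h) - z i (p h))) s \<Longrightarrow>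
      nc_norm \<tau> N (compress p (\<phi> i)) \<le> K * (s + 1 / real (Suc (r i)))"
    and sg: "\<And>D s. decreasing_to_zero \<M> D \<Longrightarrow> 0 < s \<Longrightarrow> \<exists>m0. \<forall>m\<ge>m0. nc_norm \<tau> N (compress (D m) (\<phi> i)) \<le> s" for i
  proof -
    interpret nc_element \<M> \<tau> E N q "x (r i)" by (rule el)
    have m: "\<mu> (r i) = traced_op.mu \<tau> (x (r i))" and t: "T (r i) = trunc" by (simp_all add: \<mu>_def T_def)
    have zi: "z i = (\<lambda>h. e i (trunc (\<delta> (r i)) (e i h)))" by (simp add: z_def[abs_def] t)
    note ed = e(1)[of i] delta(1)[of "r i"]
    have N1: "N (restr {0..<\<delta> (r i)} (traced_op.mu \<tau> (x (r i)))) \<le> 1 / real (Suc (r i))" using delta'[of "r i"] by (simp only: m)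
    show "graph (z i) \<in> nc_space \<M> \<tau> E" unfolding zi by (rule corner_nc(1)[OF ed])
    show "nc_norm \<tau> N (graph (z i)) \<le> B" unfolding zi
      by (rule order_trans[OF corner_nc(2)[OF ed]]) (use \<mu>(3)[of "r i"] in \<open>simp only: m\<close>)
    show "\<phi> i \<in> nc_space \<M> \<tau> E" unfolding \<phi>_def zi by (rule remainder_nc(1)[OF ed N1])
    have "K * (K * (N (\<mu> (r i)) + N (\<mu> (r i))) + 1 / real (Suc (r i))) \<le> K * (K * (B + B) + 1)"
      using K_ge \<mu>(3)[of "r i"] by (intro mult_left_mono add_mono) simp_all
    then show "nc_norm \<tau> N (\<phi> i) \<le> K * (K * (B + B) + 1)"
      unfolding \<phi>_def zi using remainder_nc(2)[OF ed N1] by (simp only: m)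
    show "compress (e i) (\<phi> i) = graph (\<lambda>h. 0)" unfolding \<phi>_def zi
      by (rule compress_minus_corner[OF ed(1)]) (use e(2)[of i] in \<open>simp only: m\<close>)
    show "strong_sum (\<phi> i) (graph (z i)) = x (r i)" unfolding \<phi>_def by (rule strong_sum_minus_bounded)
    show zM: "z i \<in> \<M>" unfolding zi by (rule corner_M[OF ed])
    show "nc_norm \<tau> N (compress p (\<phi> i)) \<le> K * (s + 1 / real (Suc (r i)))"
      if "p \<in> projs \<M>" "small (\<lambda>h. p (T (r i) (\<delta> (r i)) (p h) - z i (p h))) s" for p s s'
      unfolding \<phi>_def by (rule compress_bound(2)[OF zM that(1) ed(2) that(2)[unfolded t] N1])
    show "\<exists>m0. \<forall>m\<ge>m0. nc_norm \<tau> N (compress (D m) (\<phi> i)) \<le> s" if "decreasing_to_zero \<M> D" "0 < s" for D s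
      unfolding \<phi>_def zi by (rule single_equi_integrable[OF ed that]) (rule single[OF that(1), of _ i, unfolded t])
  qed
  have bphi: "nc_bounded \<M> \<tau> E N (range \<phi>)" using rem unfolding nc_bounded_def by blast
  have "equi_integrable \<M> \<tau> E N (range \<phi>)"
    unfolding equi_integrable_def
  proof (intro conjI allI impI bphi ennreal_tendsto_0I)
    fix D and s :: real assume D: "decreasing_to_zero \<M> D" and s: "0 < s"
    have s2: "0 < s / (2 * K)" using s K_ge by simp
    obtain j where j: "\<And>i m. j \<le> i \<Longrightarrow> j \<le> m \<Longrightarrow> small (\<lambda>h. D m (T (r i) (\<delta> (r i)) (D m h) - z i (D m h))) (s / (2 * K))"
      using tail[OF D s2] unfolding z_def by blast
    obtain j' where j': "1 / real (Suc j') < s / (2 * K)" using nat_approx_posE[OF s2] .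
    \<comment> \<open>Beyond \<open>max j j'\<close> both the truncated remainder and the head
      removed by truncation are small, uniformly in \<open>i\<close>. The finitely many earlier
      indices are covered one at a time by \<open>sg\<close>.\<close>
    have large: "nc_norm \<tau> N (compress (D m) (\<phi> i)) \<le> s" if "max j j' \<le> i" "j \<le> m" for i m
    proof -
      have "1 / real (Suc (r i)) \<le> 1 / real (Suc j')" using that(1) ri[of i] by (intro divide_left_mono) simp_all
      then have "K * (s / (2 * K) + 1 / real (Suc (r i))) \<le> K * (s / (2 * K) + s / (2 * K))"
        using j' K_ge by (intro mult_left_mono add_left_mono) simp_all
      also have "\<dots> = s" using K_ge by simp
      finally show ?thesis using cb[OF decreasing_to_zero_tendsto(1)[OF D] j, of i m] that by simp
    qed
    have "\<forall>\<^sub>F m in sequentially. \<forall>i\<in>{..<max j j'}. nc_norm \<tau> N (compress (D m) (\<phi> i)) \<le> s"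
      by (intro eventually_ball_finite ballI) (use sg[OF D s] in \<open>simp_all add: eventually_sequentially\<close>)
    then obtain m0 where m0: "\<forall>m\<ge>m0. \<forall>i\<in>{..<max j j'}. nc_norm \<tau> N (compress (D m) (\<phi> i)) \<le> s"
      unfolding eventually_sequentially by blast
    have "nc_norm \<tau> N (compress (D m) (\<phi> i)) \<le> s" if "max m0 j \<le> m" for m i
    proof (cases "i < max j j'")
      case False
      then have "max j j' \<le> i" by (simp only: not_less)
      then show ?thesis by (rule large) (use that in simp)
    qed (use m0 that in simp)
    then have "(SUP y\<in>range \<phi>. ennreal (nc_norm \<tau> N (compress (D m) y))) \<le> ennreal s" if "max m0 j \<le> m" for m
      using that by (intro SUP_least) (auto intro: ennreal_leI)
    then show "\<exists>m0. \<forall>m\<ge>m0. (SUP y\<in>range \<phi>. ennreal (nc_norm \<tau> N (compress (D m) y))) \<le> ennreal s" by blast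
  qed
  moreover have "nc_bounded \<M> \<tau> E N (range (\<lambda>i. graph (z i)))" using corner unfolding nc_bounded_def by blast
  moreover have "compress (e i) (graph (z i)) = graph (z i)" for i
    unfolding compress_graph[OF projs_clinear[OF e(1)] M_clinear[OF zM]] by (simp add: z_def[abs_def] projs_idem[OF e(1)])
  ultimately show ?thesis
    using r bphi e(1,3) zero sum
    by (intro exI[of _ r] exI[of _ \<phi>] exI[of _ "\<lambda>i. graph (z i)"] exI[of _ e]) (simp add: projs_iff o_def)
qed

end
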